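(* For every integer $d = p+1$ with $p$ prime, there is an infinite family of finite $d$-regular graphs $G$ (with number of vertices $n \to \infty$ along the family) such that each $G$ in the family, on $n$ vertices, satisfies: (i) the girth of $G$ is at least $\left(\tfrac{2}{3}-o_n(1)\right)\log_{d-1} n$; (ii) there is a set of vertices $U$ of $G$ with $|U| \le n^{1/3}$ and $|\Gamma(U)| \le \frac{(d+1)|U|}{2}$; (iii) $\max\{\lambda_2(G), -\lambda_n(G)\} \le 2\sqrt{d-1} + O\!\left(\frac{1}{\log_{d-1} n}\right)$.
   Context: The girth of a graph is the length of its shortest cycle. For a set of vertices $U$, $\Gamma(U)$ denotes the set of all vertices adjacent to at least one vertex of $U$ (it may contain vertices of $U$). For a finite graph $G$ on $n$ vertices, $\lambda_1(G)\ge \lambda_2(G) \ge \dots \ge \lambda_n(G)$ are the eigenvalues of its adjacency matrix. The $o_n(1)$ and $O(\cdot)$ terms are as $n\to\infty$ with $d$ fixed. *)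

theory Defs
  imports
    "HOL-Analysis.Analysis"
    "HOL-Library.Landau_Symbols"
    "HOL-Computational_Algebra.Computational_Algebra"
    "Jordan_Normal_Form.Char_Poly"
    "Graph_Theory.Pair_Digraph"
begin

text \<open>
  A finite simple graph is a \<^locale>\<open>pair_graph\<close>: a finite vertex set together with a finite,
  irreflexive, symmetric set of arcs. Each undirected edge is represented by its two arcs, so the
  out-degree of a vertex is its degree in the undirected sense.
\<close>

definition regular_graph :: "nat \<Rightarrow> 'a pair_pre_digraph \<Rightarrow> bool" where
  "regular_graph d G \<longleftrightarrow> pair_graph G \<and> (\<forall>v \<in> pverts G. out_degree (with_proj G) v = d)"

text \<open>
  The library's cycles include the closed walks that traverse one edge back and forth;
  requiring length at least 3 excludes exactly these. The girth of an acyclic graph is infinite.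
\<close>

definition girth :: "'a pair_pre_digraph \<Rightarrow> enat" where
  "girth G = (INF c \<in> {c. pre_digraph.cycle (with_proj G) c \<and> 3 \<le> length c}. enat (length c))"

definition nbhd :: "'a pair_pre_digraph \<Rightarrow> 'a set \<Rightarrow> 'a set" where
  "nbhd G U = {v \<in> pverts G. \<exists>u \<in> U. (u, v) \<in> parcs G}"

text \<open>
  Rows and columns are indexed by the increasing enumeration of the vertices; the eigenvalues
  do not depend on this choice.
\<close>

definition adj_matrix :: "'a::linorder pair_pre_digraph \<Rightarrow> real mat" where
  "adj_matrix G =
     (let vs = sorted_list_of_set (pverts G); n = card (pverts G)
      in mat n n (\<lambda>(i, j). if (vs ! i, vs ! j) \<in> parcs G then 1 else 0))"

text \<open>
  The eigenvalues with (algebraic) multiplicity, in decreasing order. The adjacency matrix of a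
  graph is real symmetric, so all roots of its characteristic polynomial are real and
  \<open>eigenvalue_list G\<close> has length \<open>card (pverts G)\<close>. In \<open>graph_eigenvalue G k\<close> the index
  starts at 1.
\<close>

definition eigenvalue_list :: "'a::linorder pair_pre_digraph \<Rightarrow> real list" where
  "eigenvalue_list G = rev (sorted_list_of_multiset (proots (char_poly (adj_matrix G))))"

definition graph_eigenvalue :: "'a::linorder pair_pre_digraph \<Rightarrow> nat \<Rightarrow> real" where
  "graph_eigenvalue G k = eigenvalue_list G ! (k - 1)"

end

theory Submission
  imports Defs "HOL-Real_Asymp.Real_Asymp" "Jordan_Normal_Form.Spectral_Radius"
begin

text \<open>
  A \<open>d\<close>-regular graph on \<open>{..<N}\<close> is given by \<open>d = p + 1\<close> perfect matchings, one for each colour, and walks by words of colours.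
  A random system of matchings is nearly Ramanujan by the polynomial method: expected counts of closed walks
  are rational functions of \<open>1/N\<close>, so a Markov-type inequality makes the first two terms of their expansion effective
  for test polynomials of polylogarithmic degree. It also has only about \<open>N powr (2/3)\<close> short cycles, and these are sparsely
  distributed. Their edges are switched away against far edges of the same colour, which gives girth \<open>(2/3 - o(1)) log N\<close>.
  Finally the edges near \<open>N powr (1/3)\<close> far apart vertices are rewired so that every neighbour of this set
  has two neighbours in it, following a bipartite \<open>d\<close>-regular graph of girth \<open>(1/3 - o(1)) log N\<close>.
  Both modifications only change the graph near a sparse set \<open>S\<close> around which the new graph is a forest carrying an explicit positive
  function \<open>h\<close> with \<open>A h \<le> 2 sqrt p h\<close>; a partition of unity with slope \<open>1 / log N\<close> then shows that the spectral
  bound deteriorates by \<open>O(1 / log N)\<close> only.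
\<close>

text \<open>The base estimate rests on a cancellation. The expected number of closed
  non-backtracking walks of length \<open>m > 0\<close> has, as \<open>N\<close> grows, the limit
  "number of reduced words of length \<open>m\<close>" up to an error of order
  \<open>m^2 * p^(m/2)\<close>. The number of reduced words is exactly what the eigenvalue
  \<open>p + 1\<close> contributes to the trace, so it drops out, and a polynomial that is tiny on
  \<open>[-2 sqrt p, 2 sqrt p]\<close> has tiny expected trace over the other eigenvalues. The term
  \<open>O(1 / log N)\<close> comes from the width of the transition window of a step polynomial of
  polylogarithmic degree. The exponents are tied together by \<open>p^g\<close> being about
  \<open>N^(2/3)\<close>. The expected number of vertices near which \<open>k\<close> independent
  cycles of length at most \<open>g\<close> meet is about \<open>N^(1 - k/3)\<close>, so
  \<open>k = 4\<close> is the first case that can be excluded: switched edges form clusters of at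
  most three, and all of them are patched at once. Likewise \<open>N^(1/3)\<close> centres at mutual
  distance \<open>(2/3) log N\<close> just fit into the graph, and each edge of the auxiliary graph
  becomes two steps, which doubles its girth \<open>(1/3) log N\<close>.\<close>

abbreviation "psmult == Polynomial.smult"

section \<open>Systems of matchings and localization\<close>

text \<open>Encoded as an involution of all naturals that is the identity off \<open>S\<close>, so
  that walks are plain folds and removing matched pairs stays within the same type.\<close>

definition pmatch :: "nat set => (nat => nat) set" where
  "pmatch S = {f. (\<forall>x. f (f x) = x) & (\<forall>x. f x ~= x \<longleftrightarrow> x \<in> S)}"

definition matchings :: "nat => nat => (nat => nat => nat) => bool" where
  "matchings d N s \<longleftrightarrow> (\<forall>c<d. s c \<in> pmatch {..<N})"

definition walk :: "(nat => nat => nat) => nat => nat list => nat" where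
  "walk s v w = fold s w v"

text \<open>Variational form of the bound \<open>L\<close> on the absolute values of all eigenvalues
  except one copy of \<open>d\<close>. As a statement about a quadratic form it can be transported
  between systems on the same vertices without diagonalizing the modified one.\<close>

definition spectral_bound :: "nat => nat => (nat => nat => nat) => real => bool" where
  "spectral_bound d N s L \<longleftrightarrow> (\<forall>f::nat => real. (\<Sum>v<N. f v) = 0 -->
     \<bar>\<Sum>v<N. \<Sum>c<d. f v * f (s c v)\<bar> \<le> L * (\<Sum>v<N. (f v)^2))"

lemma walk_Nil [simp]: "walk s v [] = v"
  and walk_Cons [simp]: "walk s v (c # w) = walk s (s c v) w"
  and walk_append: "walk s v (w @ w') = walk s (walk s v w) w'"
  by (simp_all add: walk_def)

lemma pmatch_invol: "f \<in> pmatch S ==> f (f x) = x"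
  and pmatch_neq: "f \<in> pmatch S ==> x \<in> S ==> f x ~= x"
  and pmatch_outside: "f \<in> pmatch S ==> x \<notin> S ==> f x = x"
  by (auto simp: pmatch_def)

lemma pmatch_closed: "f \<in> pmatch S ==> f x \<in> S \<longleftrightarrow> x \<in> S"
  by (cases "x \<in> S") (metis pmatch_invol pmatch_outside, simp add: pmatch_outside)

lemma ms_invol: "matchings d N s ==> c < d ==> s c (s c x) = x"
  and ms_neq: "matchings d N s ==> c < d ==> x < N ==> s c x ~= x"
  by (auto simp: matchings_def pmatch_def)

lemma ms_less: "matchings d N s ==> c < d ==> s c x < N \<longleftrightarrow> x < N"
  using pmatch_closed[of "s c" "{..<N}" x] by (simp add: matchings_def)

lemma ms_inj: "matchings d N s ==> c < d ==> s c x = s c y \<longleftrightarrow> x = y"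
  by (metis ms_invol)

lemma walk_less: "matchings d N s ==> set w \<subseteq> {..<d} ==> walk s v w < N \<longleftrightarrow> v < N"
  by (induction w arbitrary: v) (auto simp: ms_less)

lemma walk_rev: "matchings d N s ==> set w \<subseteq> {..<d} ==> walk s (walk s v w) (rev w) = v"
  by (induction w arbitrary: v) (auto simp: walk_append ms_invol)

lemma sum_match_reindex:
  assumes "matchings d N s" "c < d"
  shows "(\<Sum>v<N. f (s c v)) = (\<Sum>v<N. (f v :: 'a :: comm_monoid_add))"
  by (rule sum.reindex_bij_witness[of _ "s c" "s c"]) (use assms in \<open>auto simp: ms_invol ms_less\<close>)

lemma sum_match_swap:
  assumes "matchings d N s" "c < d"
  shows "(\<Sum>v<N. f (s c v) v) = (\<Sum>v<N. (f v (s c v) :: 'a :: comm_monoid_add))"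
  using sum_match_reindex[OF assms, of "\<lambda>v. f v (s c v)"] unfolding ms_invol[OF assms] .

lemma spectral_bound_mono: "spectral_bound d N s L ==> L \<le> L' ==> spectral_bound d N s L'"
  unfolding spectral_bound_def by (auto intro!: sum_nonneg intro: order_trans[OF _ mult_right_mono])

section \<open>Splitting the quadratic form by a partition of unity\<close>

lemma one_minus_cos_le: "1 - cos x \<le> x^2 / 2" for x :: real
proof -
  have "1 - cos x = 2 * (sin (x/2))^2" using cos_double_sin[of "x/2"] by simp
  also have "... \<le> 2 * (x/2)^2"
    using abs_sin_x_le_abs_x[of "x/2"] by (simp add: abs_le_square_iff[symmetric])
  finally show ?thesis by (simp add: power2_eq_square)
qed

text \<open>By the addition formula for the cosine, what is lost at an edge is
  \<open>f v * f (t c v) * (1 - cos (\<theta> v - \<theta> (t c v)))\<close>, which is quadratic in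
  the slope \<open>e\<close>.\<close>

lemma localization_form_split:
  fixes f \<theta> :: "nat => real"
  assumes ms: "matchings d N t"
    and \<theta>: "\<And>v c. v < N ==> c < d ==> \<bar>\<theta> v - \<theta> (t c v)\<bar> \<le> e"
  shows "\<bar>(\<Sum>v<N. \<Sum>c<d. f v * f (t c v))
     - (\<Sum>v<N. \<Sum>c<d. (cos (\<theta> v) * f v) * (cos (\<theta> (t c v)) * f (t c v)))
     - (\<Sum>v<N. \<Sum>c<d. (sin (\<theta> v) * f v) * (sin (\<theta> (t c v)) * f (t c v)))\<bar>
     \<le> real d * e^2 / 2 * (\<Sum>v<N. (f v)^2)" (is "\<bar>?l\<bar> \<le> _")
proof -
  have "?l = (\<Sum>v<N. \<Sum>c<d. f v * f (t c v) * (1 - cos (\<theta> v - \<theta> (t c v))))"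
    by (simp add: sum_subtractf[symmetric] cos_diff algebra_simps)
  also have "\<bar>...\<bar> \<le> (\<Sum>v<N. \<Sum>c<d. ((f v)^2 + (f (t c v))^2) / 2 * (e^2/2))"
  proof (intro order.trans[OF sum_abs] sum_mono)
    fix v c assume v: "v \<in> {..<N}" and c: "c \<in> {..<d}"
    have 1: "\<bar>f v * f (t c v)\<bar> \<le> ((f v)^2 + (f (t c v))^2) / 2"
      using sum_squares_bound[of "\<bar>f v\<bar>" "\<bar>f (t c v)\<bar>"] by (simp add: abs_mult)
    have "(\<theta> v - \<theta> (t c v))^2 \<le> e^2"
      using power_mono[OF \<theta>[of v c], of 2] v c by simp
    then have "1 - cos (\<theta> v - \<theta> (t c v)) \<le> e^2/2"
      using one_minus_cos_le[of "\<theta> v - \<theta> (t c v)"] by linarith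
    then show "\<bar>f v * f (t c v) * (1 - cos (\<theta> v - \<theta> (t c v)))\<bar> \<le> ((f v)^2 + (f (t c v))^2) / 2 * (e^2/2)"
      unfolding abs_mult[of _ "1 - _"] using 1 by (intro mult_mono) auto
  qed
  also have "... = (e^2/4) * (\<Sum>c<d. (\<Sum>v<N. (f v)^2) + (\<Sum>v<N. (f (t c v))^2))"
  proof -
    have "(\<Sum>v<N. \<Sum>c<d. ((f v)^2 + (f (t c v))^2) / 2 * (e^2/2)) = (\<Sum>c<d. \<Sum>v<N. (e^2/4) * ((f v)^2 + (f (t c v))^2))"
      by (subst sum.swap) (intro sum.cong refl, simp add: mult.commute)
    then show ?thesis by (simp only: sum.distrib sum_distrib_left[symmetric])
  qed
  also have "... = (e^2/4) * (\<Sum>c<d. 2 * (\<Sum>v<N. (f v)^2))"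
    using sum_match_reindex[OF ms, of _ "\<lambda>v. (f v)^2"] by simp
  finally show ?thesis by (simp add: field_simps)
qed

text \<open>Schur test with weight \<open>h\<close>: by the arithmetic-geometric mean each product
  \<open>a v * a u\<close> is at most the mean of \<open>(a v)^2 * h u / h v\<close> and the same
  term with \<open>u\<close> and \<open>v\<close> exchanged, and since matchings are symmetric both
  halves have the same sum.\<close>

lemma supersolution_form_bound:
  fixes a h :: "nat => real"
  assumes ms: "matchings d N t"
    and h0: "\<And>v. v < N ==> 0 \<le> h v"
    and h: "\<And>v. v < N ==> a v ~= 0 ==> 0 < h v & (\<Sum>c<d. h (t c v)) \<le> r * h v"
  shows "\<bar>\<Sum>v<N. \<Sum>c<d. a v * a (t c v)\<bar> \<le> r * (\<Sum>v<N. (a v)^2)"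
proof -
  \<comment> \<open>Set to 0 off the support of \<open>a\<close>, where \<open>h\<close> may
    vanish.\<close>
  define T where "T v u = (if a v = 0 then 0 else (a v)^2 * h u / h v)" for v u
  have T0: "0 \<le> T v u" if "v < N" "u < N" for u v
    unfolding T_def using that h0 h by (simp add: less_imp_le)
  have "\<bar>\<Sum>v<N. \<Sum>c<d. a v * a (t c v)\<bar> \<le> (\<Sum>v<N. \<Sum>c<d. (T v (t c v) + T (t c v) v) / 2)"
  proof (intro order.trans[OF sum_abs] sum_mono)
    fix v c assume "v \<in> {..<N}" "c \<in> {..<d}"
    then have v: "v < N" and u: "t c v < N" using ms_less[OF ms] by auto
    show "\<bar>a v * a (t c v)\<bar> \<le> (T v (t c v) + T (t c v) v) / 2"
    proof (cases "a v = 0 \<or> a (t c v) = 0")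
      case True then show ?thesis using T0[OF v u] T0[OF u v] by auto
    next
      case False
      define x where "x = sqrt (h (t c v) / h v)"
      have hv: "h v > 0" "h (t c v) > 0" using h[OF v] h[OF u] False by auto
      then have x: "x > 0" "x^2 = h (t c v) / h v" unfolding x_def by auto
      have "2 * (\<bar>a v\<bar> * x) * (\<bar>a (t c v)\<bar> / x) \<le> (\<bar>a v\<bar> * x)^2 + (\<bar>a (t c v)\<bar> / x)^2"
        by (rule sum_squares_bound)
      then show ?thesis using x hv False
        by (simp add: T_def abs_mult power_mult_distrib power_divide)
    qed
  qed
  also have "... = (\<Sum>v<N. \<Sum>c<d. T v (t c v))"
  proof -
    have "(\<Sum>v<N. \<Sum>c<d. (T v (t c v) + T (t c v) v) / 2)
       = (\<Sum>c<d. ((\<Sum>v<N. T v (t c v)) + (\<Sum>v<N. T (t c v) v)) / 2)"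
      by (subst sum.swap) (simp add: sum_divide_distrib sum.distrib add_divide_distrib)
    also have "... = (\<Sum>c<d. \<Sum>v<N. T v (t c v))"
      using sum_match_swap[OF ms, of _ T] by simp
    finally show ?thesis by (subst sum.swap)
  qed
  also have "... \<le> (\<Sum>v<N. r * (a v)^2)"
  proof (intro sum_mono)
    fix v assume v: "v \<in> {..<N}"
    show "(\<Sum>c<d. T v (t c v)) \<le> r * (a v)^2"
    proof (cases "a v = 0")
      case False
      then have "h v > 0" "(\<Sum>c<d. h (t c v)) \<le> r * h v" using h v by auto
      moreover have "(\<Sum>c<d. T v (t c v)) = (a v)^2 / h v * (\<Sum>c<d. h (t c v))"
        using False by (simp add: T_def sum_distrib_left)
      ultimately show ?thesis
        using mult_left_mono[of "\<Sum>c<d. h (t c v)" "r * h v" "(a v)^2 / h v"] by (simp add: mult.commute)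
    qed (simp add: T_def)
  qed
  finally show ?thesis by (simp add: sum_distrib_left)
qed

text \<open>Splitting off the mean leaves no cross terms; the constant part contributes
  \<open>d * N\<close> times the squared mean.\<close>

lemma spectral_bound_nonzero_mean:
  fixes b :: "nat => real"
  assumes ms: "matchings d N s" and L: "spectral_bound d N s L" "0 \<le> L" and N: "0 < N"
  shows "\<bar>\<Sum>v<N. \<Sum>c<d. b v * b (s c v)\<bar> \<le> L * (\<Sum>v<N. (b v)^2) + d * (\<Sum>v<N. b v)^2 / N"
proof -
  define m where "m = (\<Sum>v<N. b v) / N"
  define g where "g v = b v - m" for v
  have g0: "(\<Sum>v<N. g v) = 0" using N by (simp add: g_def m_def sum_subtractf)
  have b: "b v = g v + m" for v by (simp add: g_def)
  have gs: "(\<Sum>v<N. g (s c v)) = 0" if "c < d" for c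
    using sum_match_reindex[OF ms that, of g] g0 by simp
  have "(\<Sum>v<N. \<Sum>c<d. b v * b (s c v))
      = (\<Sum>v<N. \<Sum>c<d. g v * g (s c v)) + (\<Sum>c<d. m * (\<Sum>v<N. g (s c v)))
        + d * m * (\<Sum>v<N. g v) + d * N * m^2"
  proof -
    have "(\<Sum>v<N. \<Sum>c<d. b v * b (s c v))
       = (\<Sum>v<N. (\<Sum>c<d. g v * g (s c v)) + (\<Sum>c<d. m * g (s c v)) + d * m * g v + d * m^2)"
      unfolding b by (simp add: sum.distrib sum_distrib_left algebra_simps power2_eq_square)
    also have "... = (\<Sum>v<N. \<Sum>c<d. g v * g (s c v)) + (\<Sum>v<N. \<Sum>c<d. m * g (s c v))
        + d * m * (\<Sum>v<N. g v) + d * N * m^2"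
      by (simp add: sum.distrib sum_distrib_left)
    also have "(\<Sum>v<N. \<Sum>c<d. m * g (s c v)) = (\<Sum>c<d. m * (\<Sum>v<N. g (s c v)))"
      by (subst sum.swap) (simp add: sum_distrib_left)
    finally show ?thesis .
  qed
  then have 1: "(\<Sum>v<N. \<Sum>c<d. b v * b (s c v)) = (\<Sum>v<N. \<Sum>c<d. g v * g (s c v)) + d * N * m^2"
    using gs g0 by simp
  have "(\<Sum>v<N. (b v)^2) = (\<Sum>v<N. (g v)^2) + 2 * m * (\<Sum>v<N. g v) + N * m^2"
    unfolding b by (simp add: power2_sum sum.distrib sum_distrib_left algebra_simps)
  then have 2: "(\<Sum>v<N. (g v)^2) \<le> (\<Sum>v<N. (b v)^2)" using g0 by simp
  have "\<bar>\<Sum>v<N. \<Sum>c<d. g v * g (s c v)\<bar> \<le> L * (\<Sum>v<N. (g v)^2)"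
    using L g0 unfolding spectral_bound_def by blast
  also have "... \<le> L * (\<Sum>v<N. (b v)^2)" using 2 L by (intro mult_left_mono)
  finally have 3: "\<bar>\<Sum>v<N. \<Sum>c<d. g v * g (s c v)\<bar> \<le> L * (\<Sum>v<N. (b v)^2)" .
  have "d * N * m^2 = d * (\<Sum>v<N. b v)^2 / N"
    using N by (simp add: m_def power2_eq_square)
  moreover have "0 \<le> d * N * m^2" by simp
  ultimately show ?thesis using 1 3 by linarith
qed

text \<open>Splitting a function with \<open>cos \<theta>\<close> and \<open>sin \<theta>\<close> costs only the squared slope of \<open>\<theta>\<close>; the piece where the two
  systems may differ is controlled by the positive supersolution \<open>h\<close>, the other one by the bound for \<open>s\<close>.\<close>

theorem localization:
  fixes h \<theta> :: "nat => real"
  assumes s: "matchings d N s" and t: "matchings d N t"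
    and L: "spectral_bound d N s L" "0 \<le> L" and N: "0 < N"
    and \<theta>: "\<And>v. 0 \<le> \<theta> v" "\<And>v. \<theta> v \<le> pi / 2"
      "\<And>v c. v < N ==> c < d ==> s c v ~= t c v ==> \<theta> v = 0"
      "\<And>v c. v < N ==> c < d ==> \<bar>\<theta> v - \<theta> (t c v)\<bar> \<le> e"
    and h0: "\<And>v. v < N ==> 0 \<le> h v"
    and h: "\<And>v. v < N ==> \<theta> v < pi / 2 ==> 0 < h v & (\<Sum>c<d. h (t c v)) \<le> r * h v"
    and W: "card {v. v < N & \<theta> v < pi / 2} \<le> w"
  shows "spectral_bound d N t (max r L + real d * e^2 / 2 + real d * real w / real N)"
  unfolding spectral_bound_def
proof (intro allI impI)
  fix f :: "nat => real" assume f: "(\<Sum>v<N. f v) = 0"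
  define a b where "a v = cos (\<theta> v) * f v" and "b v = sin (\<theta> v) * f v" for v
  define S where "S = (\<Sum>v<N. (f v)^2)"
  have ab: "(\<Sum>v<N. (a v)^2) + (\<Sum>v<N. (b v)^2) = S"
    unfolding S_def a_def b_def sum.distrib[symmetric]
    by (simp add: power_mult_distrib distrib_right[symmetric] add.commute[of "(cos _)^2"])
  have S0: "0 \<le> (\<Sum>v<N. (a v)^2)" "0 \<le> (\<Sum>v<N. (b v)^2)" by (auto intro: sum_nonneg)
  have 1: "\<bar>(\<Sum>v<N. \<Sum>c<d. f v * f (t c v)) - (\<Sum>v<N. \<Sum>c<d. a v * a (t c v))
     - (\<Sum>v<N. \<Sum>c<d. b v * b (t c v))\<bar> \<le> real d * e^2 / 2 * S"
    unfolding a_def b_def S_def by (rule localization_form_split[OF t \<theta>(4)])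
  have 2: "\<bar>\<Sum>v<N. \<Sum>c<d. a v * a (t c v)\<bar> \<le> r * (\<Sum>v<N. (a v)^2)"
  proof (rule supersolution_form_bound[OF t h0])
    fix v assume v: "v < N" "a v ~= 0"
    then have "cos (\<theta> v) ~= 0" by (simp add: a_def)
    then have "\<theta> v ~= pi/2" using cos_pi_half by metis
    then show "0 < h v & (\<Sum>c<d. h (t c v)) \<le> r * h v" using h v \<theta>(2)[of v] by simp
  qed auto
  have "(\<Sum>v<N. \<Sum>c<d. b v * b (t c v)) = (\<Sum>v<N. \<Sum>c<d. b v * b (s c v))"
  proof (intro sum.cong refl)
    fix v c assume "v \<in> {..<N}" "c \<in> {..<d}"
    then show "b v * b (t c v) = b v * b (s c v)"
      using \<theta>(3)[of v c] by (cases "s c v = t c v") (auto simp: b_def)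
  qed
  moreover have "\<bar>\<Sum>v<N. \<Sum>c<d. b v * b (s c v)\<bar> \<le> L * (\<Sum>v<N. (b v)^2) + d * (\<Sum>v<N. b v)^2 / N"
    by (rule spectral_bound_nonzero_mean[OF s L N])
  moreover have "d * (\<Sum>v<N. b v)^2 / N \<le> real d * real w / real N * S"
  proof -
    let ?W = "{v. v < N & \<theta> v < pi / 2}"
    \<comment> \<open>Since \<open>f\<close> has sum zero, the sum of \<open>b\<close> is that of
      \<open>(sin \<theta> - 1) * f\<close>, which lives on the small set \<open>?W\<close>;
      Cauchy-Schwarz then yields the error \<open>d * w / N\<close>.\<close>
    have "(\<Sum>v<N. b v) = (\<Sum>v<N. b v) - (\<Sum>v<N. f v)" using f by simp
    also have "... = (\<Sum>v<N. (sin (\<theta> v) - 1) * f v)"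
      by (simp add: b_def sum_subtractf[symmetric] algebra_simps)
    also have "... = (\<Sum>v\<in>?W. (sin (\<theta> v) - 1) * f v)"
    proof (intro sum.mono_neutral_right ballI)
      fix i assume i: "i \<in> {..<N} - {v. v < N & \<theta> v < pi / 2}"
      then have "\<theta> i = pi/2" using \<theta>(2)[of i] by auto
      then show "(sin (\<theta> i) - 1) * f i = 0" by (simp only: sin_pi_half) simp
    qed auto
    finally have eq: "(\<Sum>v<N. b v) = (\<Sum>v\<in>?W. (sin (\<theta> v) - 1) * f v)" .
    have "(\<Sum>v<N. b v)^2 \<le> (\<Sum>v\<in>?W. (sin (\<theta> v) - 1)^2) * (\<Sum>v\<in>?W. (f v)^2)"
      unfolding eq by (rule Cauchy_Schwarz_ineq_sum)
    also have "... \<le> real w * S"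
    proof (intro mult_mono)
      have sq: "(sin (\<theta> v) - 1)^2 \<le> 1" for v
      proof -
        have "0 \<le> sin (\<theta> v)" using \<theta>(1,2)[of v] by (intro sin_ge_zero) auto
        then have "\<bar>sin (\<theta> v) - 1\<bar> \<le> 1" using sin_le_one[of "\<theta> v"] by linarith
        then show ?thesis by (rule iffD2[OF abs_square_le_1])
      qed
      have "(\<Sum>v\<in>?W. (sin (\<theta> v) - 1)^2) \<le> real (card ?W) * 1"
        by (rule sum_bounded_above) (rule sq)
      also have "... \<le> real w" unfolding mult_1_right by (rule of_nat_mono[OF W])
      finally show "(\<Sum>v\<in>?W. (sin (\<theta> v) - 1)^2) \<le> real w" .
      show "(\<Sum>v\<in>?W. (f v)^2) \<le> S" unfolding S_def by (intro sum_mono2) auto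
    qed (auto intro: sum_nonneg)
    finally have "(\<Sum>v<N. b v)^2 \<le> real w * S" .
    then show ?thesis
      using N by (simp add: divide_right_mono mult_left_mono mult.assoc)
  qed
  moreover have "r * (\<Sum>v<N. (a v)^2) + L * (\<Sum>v<N. (b v)^2) \<le> max r L * S"
    unfolding ab[symmetric] distrib_left using S0 by (intro add_mono mult_right_mono) auto
  ultimately show "\<bar>\<Sum>v<N. \<Sum>c<d. f v * f (t c v)\<bar>
     \<le> (max r L + real d * e^2 / 2 + real d * real w / real N) * (\<Sum>v<N. (f v)^2)"
    using 1 2 unfolding S_def[symmetric] distrib_right by linarith
qed

section \<open>Random systems\<close>

definition systems :: "nat => nat => (nat => nat => nat) set" where
  "systems d N = PiE {..<d} (\<lambda>_. pmatch {..<N})"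

text \<open>Number of perfect matchings of an \<open>n\<close>-set: the double factorial
  \<open>(n - 1)!!\<close> for even \<open>n\<close>, and 0 for odd \<open>n\<close>.\<close>

fun mcount :: "nat => nat" where
  "mcount 0 = 1"
| "mcount (Suc 0) = 0"
| "mcount (Suc (Suc n)) = Suc n * mcount n"

section \<open>Counting perfect matchings and their extensions\<close>

lemma finite_pmatch: "finite S ==> finite (pmatch S)"
proof -
  assume S: "finite S"
  have "inj_on (\<lambda>f. restrict f S) (pmatch S)"
  proof (rule inj_onI, rule ext)
    fix f g x assume fg: "f \<in> pmatch S" "g \<in> pmatch S" "restrict f S = restrict g S"
    show "f x = g x"
    proof (cases "x \<in> S")
      case True then show ?thesis using fg(3) by (metis restrict_apply')
    next
      case False then show ?thesis using fg(1,2) by (simp add: pmatch_outside)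
    qed
  qed
  moreover have "(\<lambda>f. restrict f S) ` pmatch S \<subseteq> PiE S (\<lambda>_. S)"
    by (auto simp: pmatch_closed)
  ultimately show ?thesis
    using S by (meson finite_PiE finite_imageD finite_subset)
qed

lemma card_pmatch_ext:
  assumes T: "T \<subseteq> S" and q: "q \<in> pmatch T"
  shows "card {f \<in> pmatch S. \<forall>x\<in>T. f x = q x} = card (pmatch (S - T))"
proof (rule bij_betw_same_card[of "\<lambda>f x. if x \<in> T then x else f x"],
    rule bij_betw_byWitness[where f' = "\<lambda>g x. if x \<in> T then q x else g x"])
  show "\<forall>a\<in>{f \<in> pmatch S. \<forall>x\<in>T. f x = q x}.
       (\<lambda>x. if x \<in> T then q x else if x \<in> T then x else a x) = a" by auto
  show "\<forall>a'\<in>pmatch (S - T). (\<lambda>x. if x \<in> T then x else if x \<in> T then q x else a' x) = a'"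
    by (auto simp: pmatch_outside)
  show "(\<lambda>f x. if x \<in> T then x else f x) ` {f \<in> pmatch S. \<forall>x\<in>T. f x = q x} \<subseteq> pmatch (S - T)"
  proof (rule image_subsetI)
    fix f assume "f \<in> {f \<in> pmatch S. \<forall>x\<in>T. f x = q x}"
    then have f: "f \<in> pmatch S" and fq: "\<And>x. x \<in> T ==> f x = q x" by auto
    have "f x \<notin> T" if "x \<notin> T" for x
      using that fq[of "f x"] pmatch_closed[OF q] pmatch_invol[OF f, of x] by metis
    then show "(\<lambda>x. if x \<in> T then x else f x) \<in> pmatch (S - T)"
      using f by (auto simp: pmatch_def)
  qed
  show "(\<lambda>g x. if x \<in> T then q x else g x) ` pmatch (S - T) \<subseteq> {f \<in> pmatch S. \<forall>x\<in>T. f x = q x}"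
  proof (rule image_subsetI)
    fix g assume g: "g \<in> pmatch (S - T)"
    have "g x \<notin> T" if "x \<notin> T" for x
      using that pmatch_closed[OF g, of x] pmatch_outside[OF g, of x] by (cases "x \<in> S - T") auto
    moreover have "q x \<in> T" if "x \<in> T" for x using that pmatch_closed[OF q] by blast
    ultimately show "(\<lambda>x. if x \<in> T then q x else g x) \<in> {f \<in> pmatch S. \<forall>x\<in>T. f x = q x}"
      using g q T by (auto simp: pmatch_def)
  qed
qed

lemma card_pmatch: "finite S ==> card (pmatch S) = mcount (card S)"
proof (induction "card S" arbitrary: S rule: less_induct)
  case less
  show ?case
  proof (cases "card S" rule: mcount.cases)
    case 1
    then have "S = {}" using less.prems by simp
    then have "pmatch S = {id}" by (auto simp: pmatch_def)
    then show ?thesis using 1 by simp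
  next
    case 2
    then obtain v where "S = {v}" by (metis One_nat_def card_1_singletonE)
    then have "pmatch S = {}" using pmatch_closed[of _ S v] pmatch_neq[of _ S v] by blast
    then show ?thesis using 2 by simp
  next
    case (3 n)
    then obtain v where v: "v \<in> S" by fastforce
    have fin: "finite (pmatch S)" by (rule finite_pmatch[OF less.prems])
    \<comment> \<open>Classify by the partner \<open>u\<close> of \<open>v\<close>; fixing it leaves
      two vertices fewer to match.\<close>
    have "card {f \<in> pmatch S. f v = u} = mcount n" if u: "u \<in> S - {v}" for u
    proof -
      define q where "q x = (if x = v then u else if x = u then v else x)" for x
      have q: "q \<in> pmatch {u, v}" using u by (auto simp: pmatch_def q_def)
      have "{f \<in> pmatch S. f v = u} = {f \<in> pmatch S. \<forall>x\<in>{u,v}. f x = q x}"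
        using u by (auto simp: q_def pmatch_def)
      then have "card {f \<in> pmatch S. f v = u} = card (pmatch (S - {u, v}))"
        using card_pmatch_ext[OF _ q, of S] u v by simp
      moreover have "card (S - {u, v}) = n" using u v 3 less.prems by (simp add: card_Diff_subset)
      ultimately show ?thesis using less.hyps[of "S - {u,v}"] less.prems 3 by simp
    qed
    moreover have "card (pmatch S) = (\<Sum>u\<in>S - {v}. card {f \<in> pmatch S. f v = u})"
    proof -
      have "card (pmatch S) = (\<Sum>u\<in>(\<lambda>f. f v) ` pmatch S. card {f \<in> pmatch S. f v = u})"
        using sum.image_gen[OF fin, of "\<lambda>_. 1::nat" "\<lambda>f. f v"] by simp
      also have "... = (\<Sum>u\<in>S - {v}. card {f \<in> pmatch S. f v = u})"
      proof (rule sum.mono_neutral_left)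
        show "(\<lambda>f. f v) ` pmatch S \<subseteq> S - {v}" using v by (auto simp: pmatch_closed pmatch_neq)
        show "\<forall>i\<in>S - {v} - (\<lambda>f. f v) ` pmatch S. card {f \<in> pmatch S. f v = i} = 0"
          by (auto simp: card_eq_0_iff)
      qed (use less.prems in auto)
      finally show ?thesis .
    qed
    ultimately show ?thesis using 3 v less.prems by simp
  qed
qed

lemma mcount_pos: "even n ==> 0 < mcount n"
  by (induction n rule: mcount.induct) auto

lemma mcount_rec: "2 \<le> n ==> mcount n = (n - 1) * mcount (n - 2)"
  by (cases n rule: mcount.cases) auto

definition ext_sys :: "nat => nat => nat list => (nat => nat => nat) => (nat => nat => nat) set" where
  "ext_sys d N vs P = {s \<in> systems d N.
     \<forall>c<d. \<forall>i<length vs. P c i ~= i --> s c (vs ! i) = vs ! P c i}"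

text \<open>State of an exposure: \<open>vs\<close> lists the vertices in order of discovery,
  \<open>P c\<close> is the revealed part of matching \<open>c\<close> acting on positions in
  \<open>vs\<close> (a fixed position is one whose partner is still unknown), and \<open>e c\<close>
  counts its revealed edges. Working with positions makes conditional probabilities depend on the
  shape \<open>P\<close> alone and not on the names of the vertices.\<close>

definition explored :: "nat => nat => nat list => (nat => nat => nat) => (nat => nat) => bool" where
  "explored d N vs P e \<longleftrightarrow> distinct vs & set vs \<subseteq> {..<N} &
     (\<forall>c<d. (\<forall>i. P c (P c i) = i) & (\<forall>i\<ge>length vs. P c i = i) &
            card {i. i < length vs & P c i ~= i} = 2 * e c)"

definition link :: "(nat => nat => nat) => nat => nat => nat => nat => nat => nat" where
  "link P c i j = P(c := (P c)(i := j, j := i))"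

lemma link_same: "link P c i j c = (P c)(i := j, j := i)"
  by (simp add: link_def)

lemma systems_ms: "s \<in> systems d N ==> matchings d N s"
  by (auto simp: systems_def matchings_def)

lemma finite_systems: "finite (systems d N)"
  by (simp add: systems_def finite_PiE finite_pmatch)

lemma finite_ext_sys: "finite (ext_sys d N vs P)"
  by (simp add: ext_sys_def finite_systems)

lemma explored_less:
  "explored d N vs P e ==> c < d ==> i < length vs ==> P c i < length vs"
  unfolding explored_def by (metis leI)

text \<open>The colours are independent, and colour \<open>c\<close> still has to match
  \<open>N - 2 * e c\<close> vertices. Only the edge counts enter, so all extensions of a state by
  one edge of a given colour have equally many completions.\<close>

lemma card_ext_sys:
  assumes ex: "explored d N vs P e"
  shows "card (ext_sys d N vs P) = (\<Prod>c<d. mcount (N - 2 * e c))"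
proof -
  let ?k = "length vs"
  have "ext_sys d N vs P = PiE {..<d} (\<lambda>c. {f \<in> pmatch {..<N}. \<forall>i<?k. P c i ~= i --> f (vs ! i) = vs ! P c i})"
    unfolding ext_sys_def systems_def PiE_def Pi_def by auto
  moreover have "card {f \<in> pmatch {..<N}. \<forall>i<?k. P c i ~= i --> f (vs ! i) = vs ! P c i} = mcount (N - 2 * e c)"
    if c: "c < d" for c
  proof -
    have dv: "distinct vs" "set vs \<subseteq> {..<N}" and inv: "\<And>i. P c (P c i) = i"
      and card: "card {i. i < ?k & P c i ~= i} = 2 * e c"
      using ex c by (auto simp: explored_def)
    have lt: "P c i < ?k" if "i < ?k" for i using explored_less[OF ex c that] .
    define I where "I = {i. i < ?k & P c i ~= i}"
    define ix where "ix x = (THE i. i < ?k & vs ! i = x)" for x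
    have ix: "ix (vs ! i) = i" if "i < ?k" for i
      unfolding ix_def using that dv(1) by (auto simp: nth_eq_iff_index_eq)
    define q where "q x = (if x \<in> set vs then vs ! P c (ix x) else x)" for x
    have qi: "q (vs ! i) = vs ! P c i" if "i < ?k" for i
      using that by (simp add: q_def ix)
    have "q \<in> pmatch ((!) vs ` I)"
      unfolding pmatch_def
    proof (intro CollectI conjI allI)
      fix x
      show "q (q x) = x"
      proof (cases "x \<in> set vs")
        case True
        then obtain i where "i < ?k" "x = vs ! i" by (metis in_set_conv_nth)
        then show ?thesis by (simp add: qi lt inv)
      qed (simp add: q_def)
      show "q x ~= x \<longleftrightarrow> x \<in> (!) vs ` I"
      proof (cases "x \<in> set vs")
        case True
        then obtain i where "i < ?k" "x = vs ! i" by (metis in_set_conv_nth)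
        then show ?thesis using dv lt by (auto simp: qi I_def nth_eq_iff_index_eq)
      next
        case False then show ?thesis by (auto simp: q_def I_def)
      qed
    qed
    moreover have sub: "(!) vs ` I \<subseteq> {..<N}" using dv by (force simp: I_def)
    ultimately have "card {f \<in> pmatch {..<N}. \<forall>x\<in>(!) vs ` I. f x = q x} = card (pmatch ({..<N} - (!) vs ` I))"
      by (rule card_pmatch_ext[rotated])
    moreover have "{f \<in> pmatch {..<N}. \<forall>x\<in>(!) vs ` I. f x = q x}
        = {f \<in> pmatch {..<N}. \<forall>i<?k. P c i ~= i --> f (vs ! i) = vs ! P c i}"
      by (auto simp: I_def qi)
    moreover have "card ((!) vs ` I) = 2 * e c"
      using card dv by (subst card_image) (auto simp: I_def inj_on_def nth_eq_iff_index_eq)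
    ultimately show ?thesis
      using sub by (simp add: card_pmatch card_Diff_subset finite_subset[OF sub])
  qed
  ultimately show ?thesis by (simp add: card_PiE)
qed

lemma swap_invol:
  assumes "\<And>i. p (p i) = i" "p v = v" "p u = u"
  shows "(p(v := u, u := v)) ((p(v := u, u := v)) i) = i"
proof -
  have "p i = v \<longleftrightarrow> i = v" "p i = u \<longleftrightarrow> i = u" using assms by metis+
  then show ?thesis using assms by auto
qed

lemma explored_link_old:
  assumes ex: "explored d N vs P e" and c: "c < d" and v: "v < length vs" "P c v = v"
    and u: "u < length vs" "u ~= v" "P c u = u"
  shows "explored d N vs (link P c v u) (e(c := Suc (e c)))"
proof -
  have "{i. i < length vs & link P c v u c i ~= i} = insert u (insert v {i. i < length vs & P c i ~= i})"
    using v u by (auto simp: link_same)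
  then have "card {i. i < length vs & link P c v u c i ~= i} = 2 * Suc (e c)"
    using ex c v u by (simp add: explored_def)
  moreover have "link P c v u c (link P c v u c i) = i" for i
    unfolding link_same by (rule swap_invol) (use ex c v u in \<open>auto simp: explored_def\<close>)
  ultimately show ?thesis
    using ex c v u unfolding explored_def by (auto simp: link_def)
qed

lemma explored_link_new:
  assumes ex: "explored d N vs P e" and c: "c < d" and v: "v < length vs" "P c v = v"
    and x: "x < N" "x \<notin> set vs"
  shows "explored d N (vs @ [x]) (link P c v (length vs)) (e(c := Suc (e c)))"
proof -
  let ?k = "length vs"
  have ek: "P c' i = i" if "i \<ge> ?k" "c' < d" for c' i using that ex by (simp add: explored_def)
  have "{i. i < Suc ?k & link P c v ?k c i ~= i} = insert ?k (insert v {i. i < ?k & P c i ~= i})"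
    using v by (auto simp: link_same)
  then have "card {i. i < Suc ?k & link P c v ?k c i ~= i} = 2 * Suc (e c)"
    using ex c v by (simp add: explored_def)
  moreover have "link P c v ?k c (link P c v ?k c i) = i" for i
    unfolding link_same by (rule swap_invol) (use ex c v ek[of ?k c] in \<open>auto simp: explored_def\<close>)
  moreover have "{i. i < Suc ?k & P c' i ~= i} = {i. i < ?k & P c' i ~= i}" if "c' < d" for c'
    using ek[of ?k c'] that by (auto simp: less_Suc_eq)
  ultimately show ?thesis
    using ex c v x unfolding explored_def by (auto simp: link_def)
qed

text \<open>One free vertex implies two, because an even number of vertices is left after removing
  whole edges.\<close>

lemma explored_free_bound:
  assumes ex: "explored d N vs P e" and c: "c < d" and v: "v < length vs" "P c v = v" and N: "even N"
  shows "2 \<le> N - 2 * e c" "2 * e c + 1 \<le> length vs"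
proof -
  have "{i. i < length vs & P c i ~= i} \<subseteq> {..<length vs} - {v}" using v by auto
  then have "card {i. i < length vs & P c i ~= i} \<le> card ({..<length vs} - {v})"
    by (intro card_mono) auto
  then have "2 * e c \<le> length vs - 1" using ex c v by (simp add: explored_def)
  then show "2 * e c + 1 \<le> length vs" using v by linarith
  moreover have "length vs \<le> N"
    using ex card_mono[of "{..<N}" "set vs"] by (simp add: explored_def distinct_card)
  ultimately have "2 * e c + 1 \<le> N" by linarith
  then show "2 \<le> N - 2 * e c" using N by presburger
qed

lemma card_ext_sys_rec:
  assumes ex: "explored d N vs P e" and ex': "explored d N vs' P' (e(c := Suc (e c)))"
    and c: "c < d" and e: "2 \<le> N - 2 * e c"
  shows "card (ext_sys d N vs P) = (N - 2 * e c - 1) * card (ext_sys d N vs' P')"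
proof -
  have "(\<Prod>c<d. mcount (N - 2 * e c)) = mcount (N - 2 * e c) * (\<Prod>c'\<in>{..<d} - {c}. mcount (N - 2 * e c'))"
    using c by (intro prod.remove) auto
  moreover have "(\<Prod>c'<d. mcount (N - 2 * (e(c := Suc (e c))) c'))
     = mcount (N - 2 * Suc (e c)) * (\<Prod>c'\<in>{..<d} - {c}. mcount (N - 2 * (e(c := Suc (e c))) c'))"
    using c by (subst prod.remove[of _ c]) auto
  moreover have "(\<Prod>c'\<in>{..<d} - {c}. mcount (N - 2 * (e(c := Suc (e c))) c')) = (\<Prod>c'\<in>{..<d} - {c}. mcount (N - 2 * e c'))"
    by (intro prod.cong) auto
  ultimately show ?thesis
    unfolding card_ext_sys[OF ex] card_ext_sys[OF ex'] using mcount_rec[OF e] by (simp add: diff_diff_left)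
qed

lemma ext_sys_link_old:
  assumes ex: "explored d N vs P e" and c: "c < d" and v: "v < length vs" "P c v = v"
    and u: "u < length vs" "u ~= v" "P c u = u"
  shows "{s \<in> ext_sys d N vs P. s c (vs ! v) = vs ! u} = ext_sys d N vs (link P c v u)" (is "?A = ?B")
proof (intro equalityI subsetI)
  fix s assume s: "s \<in> ?A"
  then have "s c (vs ! u) = vs ! v"
    using c by (auto simp: ext_sys_def dest!: systems_ms) (metis ms_invol)
  then show "s \<in> ?B" using s u v by (auto simp: ext_sys_def link_def)
next
  fix s assume s: "s \<in> ?B"
  have "s c (vs ! v) = vs ! u"
    using s c v u by (auto simp: ext_sys_def link_def split: if_splits)
  moreover have "s c' (vs ! i) = vs ! P c' i" if "c' < d" "i < length vs" "P c' i ~= i" for c' i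
    using s that u v unfolding ext_sys_def link_def by (auto split: if_splits simp: fun_upd_def)
  ultimately show "s \<in> ?A" using s by (auto simp: ext_sys_def)
qed

lemma ext_sys_link_new:
  assumes ex: "explored d N vs P e" and c: "c < d" and v: "v < length vs" "P c v = v"
    and x: "x < N" "x \<notin> set vs"
  shows "{s \<in> ext_sys d N vs P. s c (vs ! v) = x} = ext_sys d N (vs @ [x]) (link P c v (length vs))" (is "?A = ?B")
proof (intro equalityI subsetI)
  fix s assume s: "s \<in> ?A"
  then have "s c x = vs ! v"
    using c by (auto simp: ext_sys_def dest!: systems_ms) (metis ms_invol)
  then show "s \<in> ?B" using s v ex explored_less[OF ex]
    by (auto simp: ext_sys_def link_def nth_append less_Suc_eq explored_def)
next
  fix s assume s: "s \<in> ?B"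
  have lk: "s c' ((vs @ [x]) ! i) = (vs @ [x]) ! link P c v (length vs) c' i"
    if "c' < d" "i < Suc (length vs)" "link P c v (length vs) c' i ~= i" for c' i
    using s that by (auto simp: ext_sys_def)
  have "s c (vs ! v) = x"
    using lk[of c v] c v by (simp add: link_same nth_append)
  moreover have "s c' (vs ! i) = vs ! P c' i" if "c' < d" "i < length vs" "P c' i ~= i" for c' i
  proof -
    have "link P c v (length vs) c' i = P c' i" using that v by (auto simp: link_def)
    then show ?thesis using lk[of c' i] that explored_less[OF ex that(1,2)] by (simp add: nth_append)
  qed
  ultimately show "s \<in> ?A" using s by (auto simp: ext_sys_def)
qed

text \<open>Exposes the partner of position \<open>v\<close> in colour \<open>c\<close>: either a
  known position still free in this colour or one of the unseen vertices.\<close>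

lemma sum_ext_sys_split:
  fixes G :: "_ => real"
  assumes ex: "explored d N vs P e" and c: "c < d" and v: "v < length vs" "P c v = v"
  shows "(\<Sum>s\<in>ext_sys d N vs P. G s)
    = (\<Sum>u | u < length vs & u ~= v & P c u = u. \<Sum>s\<in>ext_sys d N vs (link P c v u). G s)
    + (\<Sum>x\<in>{..<N} - set vs. \<Sum>s\<in>ext_sys d N (vs @ [x]) (link P c v (length vs)). G s)"
proof -
  let ?E = "ext_sys d N vs P" and ?k = "length vs"
  have dv: "distinct vs" "set vs \<subseteq> {..<N}" using ex by (auto simp: explored_def)
  have ms: "matchings d N s" if "s \<in> ?E" for s using that systems_ms by (auto simp: ext_sys_def)
  have im: "(\<lambda>s. s c (vs ! v)) ` ?E \<subseteq> {..<N}"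
    using ms v dv c by (force simp: ms_less)
  have "(\<Sum>s\<in>?E. G s) = (\<Sum>y<N. \<Sum>s | s \<in> ?E & s c (vs ! v) = y. G s)"
    by (rule sum.group[symmetric]) (use im finite_ext_sys in auto)
  also have "... = (\<Sum>y\<in>set vs. \<Sum>s | s \<in> ?E & s c (vs ! v) = y. G s)
     + (\<Sum>y\<in>{..<N} - set vs. \<Sum>s | s \<in> ?E & s c (vs ! v) = y. G s)"
    using dv by (subst sum.subset_diff[of "set vs"]) auto
  also have "(\<Sum>y\<in>{..<N} - set vs. \<Sum>s | s \<in> ?E & s c (vs ! v) = y. G s)
    = (\<Sum>x\<in>{..<N} - set vs. \<Sum>s\<in>ext_sys d N (vs @ [x]) (link P c v ?k). G s)"
    by (intro sum.cong refl) (use ext_sys_link_new[OF ex c v] in auto)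
  also have "(\<Sum>y\<in>set vs. \<Sum>s | s \<in> ?E & s c (vs ! v) = y. G s)
    = (\<Sum>u<?k. \<Sum>s | s \<in> ?E & s c (vs ! v) = vs ! u. G s)"
  proof -
    have "set vs = (!) vs ` {..<?k}" by (auto simp: set_conv_nth)
    moreover have "inj_on ((!) vs) {..<?k}" using dv by (auto simp: inj_on_def nth_eq_iff_index_eq)
    ultimately show ?thesis by (simp add: sum.reindex)
  qed
  also have "... = (\<Sum>u | u < ?k & u ~= v & P c u = u. \<Sum>s | s \<in> ?E & s c (vs ! v) = vs ! u. G s)"
  proof (rule sum.mono_neutral_right)
    show "\<forall>u\<in>{..<?k} - {u. u < ?k & u ~= v & P c u = u}. (\<Sum>s | s \<in> ?E & s c (vs ! v) = vs ! u. G s) = 0"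
    proof
      fix u assume u: "u \<in> {..<?k} - {u. u < ?k & u ~= v & P c u = u}"
      have "False" if s: "s \<in> ?E" "s c (vs ! v) = vs ! u" for s
      proof (cases "u = v")
        case True
        then show False using ms_neq[OF ms[OF s(1)] c, of "vs ! v"] s(2) v dv by (auto simp: subset_iff)
      next
        case False
        then have "P c u ~= u" "u < ?k" using u by auto
        then have "s c (vs ! u) = vs ! P c u" using s(1) c by (auto simp: ext_sys_def)
        moreover have "s c (vs ! u) = vs ! v" using s ms_invol[OF ms[OF s(1)] c] by metis
        ultimately have "P c u = v"
          using dv v explored_less[OF ex c \<open>u < ?k\<close>] by (metis nth_eq_iff_index_eq)
        then show False using v ex c False unfolding explored_def by metis
      qed
      then have "{s. s \<in> ?E & s c (vs ! v) = vs ! u} = {}" by blast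
      then show "(\<Sum>s | s \<in> ?E & s c (vs ! v) = vs ! u. G s) = 0" by (metis sum.empty)
    qed
  qed auto
  also have "... = (\<Sum>u | u < ?k & u ~= v & P c u = u. \<Sum>s\<in>ext_sys d N vs (link P c v u). G s)"
    by (intro sum.cong refl) (use ext_sys_link_old[OF ex c v] in auto)
  finally show ?thesis .
qed

text \<open>Return probability of an exposed walk, with \<open>x\<close> standing for
  \<open>1 / N\<close> and \<open>k\<close> for the number of known vertices. Each candidate partner
  has conditional probability \<open>x / (1 - (2 * e c + 1) * x)\<close>; the \<open>N - k\<close>
  unseen ones are interchangeable and merged into one branch, whence the factor
  \<open>1 - k * x\<close>. A real \<open>x\<close> allows evaluation and differentiation at
  \<open>x = 0\<close>.\<close>

fun ret_prob :: "real => nat => (nat => nat) => (nat => nat => nat) => nat => nat list => real" where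
  "ret_prob x k e P v [] = (if v = 0 then 1 else 0)"
| "ret_prob x k e P v (c # w) = (if P c v ~= v then ret_prob x k e P (P c v) w
     else (x * (\<Sum>u | u < k & u ~= v & P c u = u. ret_prob x k (e(c := Suc (e c))) (link P c v u) u w)
           + (1 - k * x) * ret_prob x (Suc k) (e(c := Suc (e c))) (link P c v k) k w)
          / (1 - (2 * e c + 1) * x))"

theorem card_return:
  assumes "explored d N vs P e" "v < length vs" "set w \<subseteq> {..<d}" "even N"
  shows "real (card {s \<in> ext_sys d N vs P. walk s (vs ! v) w = vs ! 0})
    = ret_prob (1 / N) (length vs) e P v w * real (card (ext_sys d N vs P))"
  using assms(1-3)
proof (induction w arbitrary: vs P e v)
  case Nil
  then have "vs ! v = vs ! 0 \<longleftrightarrow> v = 0"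
    using nth_eq_iff_index_eq[of vs v 0] by (cases vs) (auto simp: explored_def)
  then show ?case by auto
next
  case (Cons c w)
  note ex = Cons.prems(1) and v = Cons.prems(2)
  have c: "c < d" using Cons.prems by simp
  let ?k = "length vs" and ?e = "e(c := Suc (e c))"
  show ?case
  proof (cases "P c v = v")
    case False
    have "s c (vs ! v) = vs ! P c v" if "s \<in> ext_sys d N vs P" for s
      using that c v False by (auto simp: ext_sys_def)
    then have "{s \<in> ext_sys d N vs P. walk s (vs ! v) (c # w) = vs ! 0}
      = {s \<in> ext_sys d N vs P. walk s (vs ! P c v) w = vs ! 0}" by auto
    then show ?thesis using Cons.IH[OF ex explored_less[OF ex c v]] Cons.prems False by simp
  next
    case True
    have N2: "2 \<le> N - 2 * e c" and k1: "2 * e c + 1 \<le> ?k"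
      using explored_free_bound[OF ex c v True assms(4)] by auto
    have kN: "?k \<le> N"
      using ex card_mono[of "{..<N}" "set vs"] by (simp add: explored_def distinct_card)
    \<comment> \<open>The common number of completions of all one-edge extensions, by
      \<open>card_ext_sys_rec\<close>.\<close>
    define C where "C = real (card (ext_sys d N vs P)) / real (N - 2 * e c - 1)"
    have child: "real (card (ext_sys d N vs' P')) = C" if "explored d N vs' P' ?e" for vs' P'
      unfolding C_def card_ext_sys_rec[OF ex that c N2] using N2 by simp
    have ind: "real (card {s \<in> A. Q s}) = (\<Sum>s\<in>A. if Q s then 1 else 0)" if "finite A" for A :: "(nat => nat => nat) set" and Q
      using that by (simp add: sum.If_cases Int_def)
    have old: "(\<Sum>s\<in>ext_sys d N vs (link P c v u). if walk s (vs ! v) (c # w) = vs ! 0 then 1 else 0)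
      = ret_prob (1/N) ?k ?e (link P c v u) u w * C" if u: "u < ?k" "u ~= v" "P c u = u" for u
    proof -
      note ex' = explored_link_old[OF ex c v True u]
      have "s c (vs ! v) = vs ! u" if "s \<in> ext_sys d N vs (link P c v u)" for s
        using that ext_sys_link_old[OF ex c v True u] by blast
      then have "{s \<in> ext_sys d N vs (link P c v u). walk s (vs ! v) (c # w) = vs ! 0}
        = {s \<in> ext_sys d N vs (link P c v u). walk s (vs ! u) w = vs ! 0}" by auto
      then show ?thesis
        using Cons.IH[OF ex' u(1)] Cons.prems child[OF ex'] by (simp add: ind[OF finite_ext_sys, symmetric] fun_upd_def)
    qed
    have new: "(\<Sum>s\<in>ext_sys d N (vs @ [x]) (link P c v ?k). if walk s (vs ! v) (c # w) = vs ! 0 then 1 else 0)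
      = ret_prob (1/N) (Suc ?k) ?e (link P c v ?k) ?k w * C" if x: "x \<in> {..<N} - set vs" for x
    proof -
      have x': "x < N" "x \<notin> set vs" using x by auto
      note ex' = explored_link_new[OF ex c v True x']
      have "s c (vs ! v) = x" if "s \<in> ext_sys d N (vs @ [x]) (link P c v ?k)" for s
        using that ext_sys_link_new[OF ex c v True x'] by blast
      moreover have "(vs @ [x]) ! ?k = x" "(vs @ [x]) ! 0 = vs ! 0" using v by (auto simp: nth_append)
      ultimately have "{s \<in> ext_sys d N (vs @ [x]) (link P c v ?k). walk s (vs ! v) (c # w) = vs ! 0}
        = {s \<in> ext_sys d N (vs @ [x]) (link P c v ?k). walk s ((vs @ [x]) ! ?k) w = (vs @ [x]) ! 0}" by auto
      then show ?thesis
        using Cons.IH[OF ex', of ?k] Cons.prems child[OF ex'] by (simp add: ind[OF finite_ext_sys, symmetric] fun_upd_def)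
    qed
    have "real (card {s \<in> ext_sys d N vs P. walk s (vs ! v) (c # w) = vs ! 0})
      = (\<Sum>u | u < ?k & u ~= v & P c u = u. ret_prob (1/N) ?k ?e (link P c v u) u w * C)
       + (\<Sum>x\<in>{..<N} - set vs. ret_prob (1/N) (Suc ?k) ?e (link P c v ?k) ?k w * C)"
      unfolding ind[OF finite_ext_sys] sum_ext_sys_split[OF ex c v True]
      by (intro arg_cong2[where f = "(+)"] sum.cong refl old new) auto
    also have "... = ((\<Sum>u | u < ?k & u ~= v & P c u = u. ret_prob (1/N) ?k ?e (link P c v u) u w)
       + (real N - ?k) * ret_prob (1/N) (Suc ?k) ?e (link P c v ?k) ?k w) * C"
      using ex kN by (simp add: sum_distrib_right distrib_right explored_def card_Diff_subset distinct_card of_nat_diff)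
    also have "... = ret_prob (1 / N) ?k e P v (c # w) * real (card (ext_sys d N vs P))"
    proof -
      have alg: "(a + (n - k) * b) * (C' / (n - m)) = (1 / n * a + (1 - k * (1 / n)) * b) / (1 - m * (1 / n)) * C'"
        if "n > 0" "n - m > 0" for a b n m k C' :: real
      proof -
        have "1 - m * (1 / n) = (n - m) / n" using that by (simp add: field_simps)
        moreover have "1 / n * a + (1 - k * (1 / n)) * b = (a + (n - k) * b) / n"
          using that by (simp add: field_simps)
        ultimately show ?thesis using that by simp
      qed
      have "real (N - 2 * e c - 1) = real N - (2 * e c + 1)" using N2 by (simp add: of_nat_diff)
      moreover have "real N - (2 * e c + 1) > 0" "real N > 0" using N2 by linarith+
      ultimately show ?thesis using True alg[of "real N" "2 * e c + 1"] unfolding C_def by simp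
    qed
    finally show ?thesis .
  qed
qed

section \<open>Exponential moments of the excess of traced subgraphs\<close>

definition half_edges :: "nat => nat list => (nat => nat => nat) => (nat \<times> nat) set" where
  "half_edges d vs P = {(c, vs ! i) | c i. c < d & i < length vs & P c i ~= i}"

text \<open>Half-edges (colour, endpoint) met by a walk program in which \<open>None\<close> jumps
  back to \<open>v0\<close>. The traced graph stays connected to \<open>v0\<close>, and one program
  can draw several walks out of one vertex.\<close>

fun prog_edges :: "(nat => nat => nat) => nat => nat => nat option list => (nat \<times> nat) set" where
  "prog_edges s v0 v [] = {}"
| "prog_edges s v0 v (None # r) = prog_edges s v0 v0 r"
| "prog_edges s v0 v (Some c # r) = {(c, v), (c, s c v)} \<union> prog_edges s v0 (s c v) r"

lemma finite_half_edges [simp]: "finite (half_edges d vs P)"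
proof -
  have "half_edges d vs P \<subseteq> {..<d} \<times> set vs" by (auto simp: half_edges_def)
  then show ?thesis by (rule finite_subset) auto
qed

lemma half_edges_link_old:
  assumes "c < d" "v < length vs" "P c v = v" "u < length vs" "u ~= v" "P c u = u"
  shows "half_edges d vs (link P c v u) = half_edges d vs P \<union> {(c, vs ! v), (c, vs ! u)}"
  using assms by (auto simp: half_edges_def link_def split: if_splits)

lemma half_edges_link_new:
  assumes ex: "explored d N vs P e" and c: "c < d" and v: "v < length vs" "P c v = v"
  shows "half_edges d (vs @ [x]) (link P c v (length vs)) = half_edges d vs P \<union> {(c, vs ! v), (c, x)}"
proof -
  have ek: "P c' (length vs) = length vs" if "c' < d" for c' using that ex by (simp add: explored_def)
  show ?thesis
  proof (intro equalityI subsetI)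
    fix y assume "y \<in> half_edges d (vs @ [x]) (link P c v (length vs))"
    then obtain c' i where "y = (c', (vs @ [x]) ! i)" "c' < d" "i < Suc (length vs)" "link P c v (length vs) c' i ~= i"
      by (auto simp: half_edges_def)
    then show "y \<in> half_edges d vs P \<union> {(c, vs ! v), (c, x)}"
      using ek[of c'] by (cases "i = length vs"; cases "c' = c"; cases "i = v") (auto simp: half_edges_def link_def nth_append)
  next
    fix y assume "y \<in> half_edges d vs P \<union> {(c, vs ! v), (c, x)}"
    then consider "y = (c, vs ! v)" | "y = (c, x)" | c' i where "y = (c', vs ! i)" "c' < d" "i < length vs" "P c' i ~= i"
      by (auto simp: half_edges_def)
    then show "y \<in> half_edges d (vs @ [x]) (link P c v (length vs))"
    proof cases
      case 1
      then show ?thesis unfolding half_edges_def using c v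
        by (intro CollectI exI[of _ c] exI[of _ v]) (auto simp: link_def nth_append)
    next
      case 2
      then show ?thesis unfolding half_edges_def using c v
        by (intro CollectI exI[of _ c] exI[of _ "length vs"]) (auto simp: link_def nth_append)
    next
      case 3
      then show ?thesis unfolding half_edges_def using v
        by (intro CollectI exI[of _ c'] exI[of _ i]) (auto simp: link_def nth_append)
    qed
  qed
qed

lemma half_edges_not_in:
  assumes "explored d N vs P e" "v < length vs" "P c v = v"
  shows "(c, vs ! v) \<notin> half_edges d vs P"
  using assms by (auto simp: half_edges_def explored_def nth_eq_iff_index_eq)

lemma half_edges_fst_in: "(c, x) \<in> half_edges d vs P ==> x \<in> set vs"
  by (auto simp: half_edges_def)

text \<open>Exponential moment of the number of half-edges minus twice the number of vertices. A
  step to an unseen vertex adds two half-edges and one vertex, so the weight is unchanged; a step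
  closing up on a known vertex multiplies it by \<open>z^2\<close>, but has at most \<open>L\<close>
  targets out of at least \<open>N - 2 * L\<close>. Hence each step costs at most the factor
  \<open>B\<close>.\<close>

theorem excess_weight:
  fixes z :: real
  assumes "explored d N vs P e" "v < length vs" "\<And>c. Some c \<in> set r ==> c < d" "even N"
    and z: "1 \<le> z" and L: "length vs + length r \<le> L" "2 * L < N"
  defines "B \<equiv> (N + L * z^2) / (N - 2 * L)"
  shows "(\<Sum>s\<in>ext_sys d N vs P. z ^ card (half_edges d vs P \<union> prog_edges s (vs ! 0) (vs ! v) r)
             / z ^ (2 * card (set vs \<union> snd ` prog_edges s (vs ! 0) (vs ! v) r)))
    \<le> real (card (ext_sys d N vs P)) * (z ^ card (half_edges d vs P) / z ^ (2 * length vs)) * B ^ length r"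
  using assms(1-3) L(1)
proof (induction r arbitrary: vs P e v)
  case Nil
  then show ?case by (simp add: explored_def distinct_card)
next
  case (Cons a r)
  note ex = Cons.prems(1) and v = Cons.prems(2)
  have Npos: "real N - 2 * real L > 0" using L(2) by linarith
  have "0 \<le> real L * z^2" by simp
  then have "real N - 2 * real L \<le> N + L * z^2" by linarith
  then have B1: "1 \<le> B" unfolding B_def using Npos by (simp add: of_nat_diff)
  let ?k = "length vs" and ?H = "half_edges d vs P"
  let ?C = "real (card (ext_sys d N vs P))"
  have mono: "?C * (z ^ card ?H / z ^ (2 * ?k)) * B ^ length r \<le> ?C * (z ^ card ?H / z ^ (2 * ?k)) * B ^ length (a # r)"
    using B1 z by (intro mult_left_mono power_increasing) auto
  show ?case
  proof (cases a)
    case None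
    have "0 < ?k" using v by linarith
    then show ?thesis using Cons.IH[OF ex, of 0] Cons.prems None mono by simp
  next
    case (Some c)
    have c: "c < d" using Cons.prems Some by simp
    let ?e = "e(c := Suc (e c))"
    show ?thesis
    proof (cases "P c v = v")
      case False
      have sv: "s c (vs ! v) = vs ! P c v" if "s \<in> ext_sys d N vs P" for s
        using that c v False by (auto simp: ext_sys_def)
      have lt: "P c v < ?k" by (rule explored_less[OF ex c v])
      have PP: "P c (P c v) = v" using ex c by (auto simp: explored_def)
      have "(c, vs ! v) \<in> ?H" using c v False by (auto simp: half_edges_def)
      moreover have "(c, vs ! P c v) \<in> ?H"
        unfolding half_edges_def using c lt False PP
        by (intro CollectI exI[of _ c] exI[of _ "P c v"]) auto
      ultimately have E: "?H \<union> prog_edges s (vs ! 0) (vs ! v) (a # r) = ?H \<union> prog_edges s (vs ! 0) (vs ! P c v) r"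
        if "s \<in> ext_sys d N vs P" for s using sv[OF that] Some by auto
      have V: "set vs \<union> snd ` prog_edges s (vs ! 0) (vs ! v) (a # r) = set vs \<union> snd ` prog_edges s (vs ! 0) (vs ! P c v) r"
        if "s \<in> ext_sys d N vs P" for s using sv[OF that] Some v lt by auto
      have "(\<Sum>s\<in>ext_sys d N vs P. z ^ card (?H \<union> prog_edges s (vs ! 0) (vs ! v) (a # r))
             / z ^ (2 * card (set vs \<union> snd ` prog_edges s (vs ! 0) (vs ! v) (a # r))))
         = (\<Sum>s\<in>ext_sys d N vs P. z ^ card (?H \<union> prog_edges s (vs ! 0) (vs ! P c v) r)
             / z ^ (2 * card (set vs \<union> snd ` prog_edges s (vs ! 0) (vs ! P c v) r)))"
        by (intro sum.cong refl) (simp only: E V)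
      also have "... \<le> ?C * (z ^ card ?H / z ^ (2 * ?k)) * B ^ length r"
        using Cons.IH[OF ex lt] Cons.prems by simp
      finally show ?thesis using mono by linarith
    next
      case True
      have N2: "2 \<le> N - 2 * e c" and k1: "2 * e c + 1 \<le> ?k"
        using explored_free_bound[OF ex c v True assms(4)] by auto
      define C where "C = ?C / real (N - 2 * e c - 1)"
      define W where "W = z ^ card ?H / z ^ (2 * ?k)"
      have W0: "0 \<le> W" unfolding W_def using z by simp
      have C0: "0 \<le> C" unfolding C_def by simp
      have child: "real (card (ext_sys d N vs' P')) = C" if "explored d N vs' P' ?e" for vs' P'
        unfolding C_def card_ext_sys_rec[OF ex that c N2] using N2 by simp
      let ?G = "\<lambda>s. z ^ card (?H \<union> prog_edges s (vs ! 0) (vs ! v) (a # r))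
             / z ^ (2 * card (set vs \<union> snd ` prog_edges s (vs ! 0) (vs ! v) (a # r)))"
      have nv: "(c, vs ! v) \<notin> ?H" by (rule half_edges_not_in[OF ex v True])
      have old: "(\<Sum>s\<in>ext_sys d N vs (link P c v u). ?G s) \<le> C * (z^2 * W) * B ^ length r"
        if u: "u < ?k" "u ~= v" "P c u = u" for u
      proof -
        note ex' = explored_link_old[OF ex c v True u]
        note H' = half_edges_link_old[of c d v vs P u, OF c v True u]
        have sv: "s c (vs ! v) = vs ! u" if "s \<in> ext_sys d N vs (link P c v u)" for s
          using that ext_sys_link_old[OF ex c v True u] by blast
        have "(c, vs ! u) \<notin> ?H" by (rule half_edges_not_in[OF ex u(1,3)])
        moreover have "vs ! u ~= vs ! v" using ex u v by (simp add: explored_def nth_eq_iff_index_eq)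
        ultimately have cH: "card (half_edges d vs (link P c v u)) = card ?H + 2"
          unfolding H' using nv by simp
        have E: "?H \<union> prog_edges s (vs ! 0) (vs ! v) (a # r)
            = half_edges d vs (link P c v u) \<union> prog_edges s (vs ! 0) (vs ! u) r"
          if "s \<in> ext_sys d N vs (link P c v u)" for s using sv[OF that] Some H' by auto
        have V: "set vs \<union> snd ` prog_edges s (vs ! 0) (vs ! v) (a # r) = set vs \<union> snd ` prog_edges s (vs ! 0) (vs ! u) r"
          if "s \<in> ext_sys d N vs (link P c v u)" for s using sv[OF that] Some v u by auto
        have "(\<Sum>s\<in>ext_sys d N vs (link P c v u). ?G s) = (\<Sum>s\<in>ext_sys d N vs (link P c v u).
          z ^ card (half_edges d vs (link P c v u) \<union> prog_edges s (vs ! 0) (vs ! u) r)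
             / z ^ (2 * card (set vs \<union> snd ` prog_edges s (vs ! 0) (vs ! u) r)))"
          by (intro sum.cong refl) (simp only: E V)
        also have "... \<le> C * (z ^ (card ?H + 2) / z ^ (2 * ?k)) * B ^ length r"
          using Cons.IH[OF ex' u(1)] Cons.prems child[OF ex'] cH by (simp add: fun_upd_def)
        finally show ?thesis by (simp add: W_def power_add power2_eq_square mult_ac)
      qed
      have new: "(\<Sum>s\<in>ext_sys d N (vs @ [x]) (link P c v ?k). ?G s) \<le> C * W * B ^ length r"
        if x: "x \<in> {..<N} - set vs" for x
      proof -
        have x': "x < N" "x \<notin> set vs" using x by auto
        note ex' = explored_link_new[OF ex c v True x']
        note H' = half_edges_link_new[OF ex c v True, of x]
        have sv: "s c (vs ! v) = x" if "s \<in> ext_sys d N (vs @ [x]) (link P c v ?k)" for s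
          using that ext_sys_link_new[OF ex c v True x'] by blast
        have nth: "(vs @ [x]) ! ?k = x" "(vs @ [x]) ! 0 = vs ! 0" using v by (auto simp: nth_append)
        have "(c, x) \<notin> ?H" using x' half_edges_fst_in by blast
        moreover have "x ~= vs ! v" using x' v by auto
        ultimately have cH: "card (half_edges d (vs @ [x]) (link P c v ?k)) = card ?H + 2"
          unfolding H' using nv by simp
        have E: "?H \<union> prog_edges s (vs ! 0) (vs ! v) (a # r)
            = half_edges d (vs @ [x]) (link P c v ?k) \<union> prog_edges s (vs ! 0) x r"
          if "s \<in> ext_sys d N (vs @ [x]) (link P c v ?k)" for s using sv[OF that] Some H' by auto
        have V: "set vs \<union> snd ` prog_edges s (vs ! 0) (vs ! v) (a # r) = set (vs @ [x]) \<union> snd ` prog_edges s (vs ! 0) x r"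
          if "s \<in> ext_sys d N (vs @ [x]) (link P c v ?k)" for s using sv[OF that] Some v by auto
        have "(\<Sum>s\<in>ext_sys d N (vs @ [x]) (link P c v ?k). ?G s) = (\<Sum>s\<in>ext_sys d N (vs @ [x]) (link P c v ?k).
          z ^ card (half_edges d (vs @ [x]) (link P c v ?k) \<union> prog_edges s (vs ! 0) x r)
             / z ^ (2 * card (set (vs @ [x]) \<union> snd ` prog_edges s (vs ! 0) x r)))"
          by (intro sum.cong refl) (simp only: E V)
        also have "... \<le> C * (z ^ (card ?H + 2) / z ^ (2 * Suc ?k)) * B ^ length r"
          using Cons.IH[OF ex', of ?k] Cons.prems child[OF ex'] cH nth by (simp add: fun_upd_def)
        also have "z ^ (card ?H + 2) / z ^ (2 * Suc ?k) = W"
          using z by (simp add: W_def power_add power2_eq_square)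
        finally show ?thesis .
      qed
      have fin: "finite {u. u < ?k & u ~= v & P c u = u}" by simp
      have cardu: "card {u. u < ?k & u ~= v & P c u = u} \<le> L"
      proof -
        have "card {u. u < ?k & u ~= v & P c u = u} \<le> card {..<?k}" by (intro card_mono) auto
        then show ?thesis using Cons.prems by simp
      qed
      have cardx: "card ({..<N} - set vs) \<le> N"
        using card_mono[of "{..<N}" "{..<N} - set vs"] by simp
      have "(\<Sum>s\<in>ext_sys d N vs P. ?G s) \<le> (\<Sum>u | u < ?k & u ~= v & P c u = u. C * (z^2 * W) * B ^ length r)
         + (\<Sum>x\<in>{..<N} - set vs. C * W * B ^ length r)"
        unfolding sum_ext_sys_split[OF ex c v True, of ?G]
        by (intro add_mono sum_mono old new) auto
      also have "... \<le> L * (C * (z^2 * W) * B ^ length r) + N * (C * W * B ^ length r)"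
        unfolding sum_constant using cardu cardx C0 W0 B1
        by (intro add_mono mult_right_mono of_nat_mono mult_nonneg_nonneg) auto
      also have "... = C * (N + L * z^2) * (W * B ^ length r)" by (simp add: algebra_simps)
      also have "... \<le> ?C * B * (W * B ^ length r)"
      proof (intro mult_right_mono mult_nonneg_nonneg W0)
        have "real (N - 2 * e c - 1) \<ge> N - 2 * L"
          using k1 Cons.prems by simp
        moreover have "real (N - 2 * L) = real N - 2 * real L" using L(2) by (simp add: of_nat_diff)
        ultimately have "real (N - 2 * e c - 1) \<ge> real N - 2 * real L" by linarith
        then have "?C / real (N - 2 * e c - 1) \<le> ?C / (real N - 2 * real L)"
          using Npos N2 by (intro divide_left_mono) auto
        then have "C * (N + L * z^2) \<le> ?C / (real N - 2 * real L) * (N + L * z^2)"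
          unfolding C_def by (intro mult_right_mono) auto
        then show "C * (N + L * z^2) \<le> ?C * B" by (simp add: B_def)
      qed (use B1 in auto)
      finally show ?thesis by (simp add: W_def mult_ac)
    qed
  qed
qed

lemma explored_start: "v < N ==> explored d N [v] (\<lambda>c i. i) (\<lambda>_. 0)"
  by (simp add: explored_def)

lemma ext_sys_start: "ext_sys d N [v] (\<lambda>c i. i) = systems d N"
  by (simp add: ext_sys_def)

corollary excess_weight_start:
  fixes z :: real
  assumes v: "v < N" and r: "\<And>c. Some c \<in> set r ==> c < d" and N: "even N"
    and z: "1 \<le> z" and L: "Suc (length r) \<le> L" "2 * L < N"
  shows "(\<Sum>s\<in>systems d N. z ^ card (prog_edges s v v r) / z ^ (2 * card (insert v (snd ` prog_edges s v v r))))
    \<le> real (card (systems d N)) * ((N + L * z^2) / (N - 2 * L)) ^ length r / z^2"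
proof -
  have "half_edges d [v] (\<lambda>c i. i) = {}" by (simp add: half_edges_def)
  then show ?thesis
    using excess_weight[OF explored_start[OF v], where d = d and v = 0 and r = r and z = z and L = L] assms by (simp add: ext_sys_start)
qed

text \<open>Along any branch colour \<open>c\<close> meets the denominators
  \<open>1 - (2 * j + 1) * x\<close> for successive \<open>j\<close> from \<open>e c\<close> on,
  each at most once; so one common denominator serves all branches and all words of bounded
  length.\<close>

theorem ret_prob_poly:
  assumes "\<And>c. c < d ==> e c + length w \<le> q" "set w \<subseteq> {..<d}"
  shows "\<exists>Q :: real poly. degree Q \<le> d * q + length w &
    (\<forall>x. (\<forall>j<q. 1 - (2 * real j + 1) * x ~= 0) -->
      ret_prob x k e P v w * (\<Prod>c<d. \<Prod>j=e c..<q. 1 - (2 * real j + 1) * x) = poly Q x)"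
  using assms
proof (induction w arbitrary: k e P v)
  case Nil
  define Q :: "real poly" where "Q = (if v = 0 then 1 else 0) * (\<Prod>c<d. \<Prod>j=e c..<q. [:1, - (2 * real j + 1):])"
  have "degree (\<Prod>c<d. \<Prod>j=e c..<q. [:1, - (2 * real j + 1):]) \<le> (\<Sum>c<d. degree (\<Prod>j=e c..<q. [:1, - (2 * real j + 1):]))"
    using degree_prod_sum_le[of "{..<d}" "\<lambda>c. \<Prod>j=e c..<q. [:1, - (2 * real j + 1):]"] by (simp add: o_def)
  also have "... \<le> (\<Sum>c<d. q)"
  proof (intro sum_mono)
    fix c
    have "degree (\<Prod>j=e c..<q. [:1, - (2 * real j + 1):]) \<le> (\<Sum>j=e c..<q. degree [:1, - (2 * real j + 1):])"
      using degree_prod_sum_le[of "{e c..<q}" "\<lambda>j. [:1, - (2 * real j + 1):]"] by (simp add: o_def)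
    also have "... \<le> (\<Sum>j=e c..<q. 1)" by (intro sum_mono) simp
    finally show "degree (\<Prod>j=e c..<q. [:1, - (2 * real j + 1):]) \<le> q" by simp
  qed
  finally have "degree Q \<le> d * q" by (auto simp: Q_def)
  moreover have "ret_prob x k e P v [] * (\<Prod>c<d. \<Prod>j=e c..<q. 1 - (2 * real j + 1) * x) = poly Q x" for x
    by (simp add: Q_def poly_prod algebra_simps)
  ultimately show ?case by (intro exI[of _ Q]) auto
next
  case (Cons c w)
  have c: "c < d" using Cons.prems by simp
  show ?case
  proof (cases "P c v = v")
    case False
    have "e c' + length w \<le> q" if "c' < d" for c' using Cons.prems(1)[OF that] by simp
    then have "\<exists>Q :: real poly. degree Q \<le> d * q + length w &
      (\<forall>x. (\<forall>j<q. 1 - (2 * real j + 1) * x ~= 0) -->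
      ret_prob x k e P (P c v) w * (\<Prod>c<d. \<Prod>j=e c..<q. 1 - (2 * real j + 1) * x) = poly Q x)"
      by (intro Cons.IH) (use Cons.prems in auto)
    then obtain Q :: "real poly" where "degree Q \<le> d * q + length w"
      "\<forall>x. (\<forall>j<q. 1 - (2 * real j + 1) * x ~= 0) -->
      ret_prob x k e P (P c v) w * (\<Prod>c<d. \<Prod>j=e c..<q. 1 - (2 * real j + 1) * x) = poly Q x" by blast
    then show ?thesis using False by (intro exI[of _ Q]) auto
  next
    case True
    let ?e = "e(c := Suc (e c))"
    have eq: "?e c' + length w \<le> q" if "c' < d" for c' using Cons.prems(1)[OF that] Cons.prems(1)[OF c] by simp
    have "\<exists>Q :: real poly. degree Q \<le> d * q + length w &
      (\<forall>x. (\<forall>j<q. 1 - (2 * real j + 1) * x ~= 0) -->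
      ret_prob x k' ?e P' v' w * (\<Prod>c<d. \<Prod>j=?e c..<q. 1 - (2 * real j + 1) * x) = poly Q x)" for k' P' v'
      by (rule Cons.IH) (use Cons.prems eq in auto)
    then obtain Q where Q: "\<And>k' P' v'. degree (Q k' P' v') \<le> d * q + length w"
      "\<And>k' P' v' x. (\<forall>j<q. 1 - (2 * real j + 1) * x ~= 0) ==>
      ret_prob x k' ?e P' v' w * (\<Prod>c<d. \<Prod>j=?e c..<q. 1 - (2 * real j + 1) * x) = poly (Q k' P' v') x"
      by metis
    let ?U = "{u. u < k & u ~= v & P c u = u}"
    define R :: "real poly" where
      "R = [:0, 1:] * (\<Sum>u\<in>?U. Q k (link P c v u) u) + [:1, - real k:] * Q (Suc k) (link P c v k) k"
    have "degree (\<Sum>u\<in>?U. Q k (link P c v u) u) \<le> d * q + length w"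
      by (rule degree_sum_le) (use Q in auto)
    then have "degree R \<le> d * q + length (c # w)"
      unfolding R_def using Q(1)[of "Suc k" "link P c v k" k]
      by (intro degree_add_le order.trans[OF degree_mult_le]) auto
    moreover have "ret_prob x k e P v (c # w) * (\<Prod>c<d. \<Prod>j=e c..<q. 1 - (2 * real j + 1) * x) = poly R x"
      if x: "\<forall>j<q. 1 - (2 * real j + 1) * x ~= 0" for x
    proof -
      have ec: "e c < q" using Cons.prems(1)[OF c] by simp
      define D where "D = (\<Prod>c<d. \<Prod>j=?e c..<q. 1 - (2 * real j + 1) * x)"
      have "(\<Prod>c<d. \<Prod>j=e c..<q. 1 - (2 * real j + 1) * x)
        = (\<Prod>j=e c..<q. 1 - (2 * real j + 1) * x) * (\<Prod>c'\<in>{..<d}-{c}. \<Prod>j=e c'..<q. 1 - (2 * real j + 1) * x)"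
        using c by (intro prod.remove) auto
      also have "(\<Prod>j=e c..<q. 1 - (2 * real j + 1) * x) = (1 - (2 * real (e c) + 1) * x) * (\<Prod>j=?e c..<q. 1 - (2 * real j + 1) * x)"
        using ec by (simp add: prod.atLeast_Suc_lessThan)
      also have "(\<Prod>c'\<in>{..<d}-{c}. \<Prod>j=e c'..<q. 1 - (2 * real j + 1) * x) = (\<Prod>c'\<in>{..<d}-{c}. \<Prod>j=?e c'..<q. 1 - (2 * real j + 1) * x)"
        by (intro prod.cong) auto
      also have "(1 - (2 * real (e c) + 1) * x) * (\<Prod>j=?e c..<q. 1 - (2 * real j + 1) * x) * ... = (1 - (2 * real (e c) + 1) * x) * D"
        unfolding D_def using c by (subst prod.remove[of "{..<d}" c]) auto
      finally have D: "(\<Prod>c<d. \<Prod>j=e c..<q. 1 - (2 * real j + 1) * x) = (1 - (2 * real (e c) + 1) * x) * D" .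
      have nz: "1 - (2 * real (e c) + 1) * x ~= 0" using x ec by blast
      have "ret_prob x k e P v (c # w) * ((1 - (2 * real (e c) + 1) * x) * D)
        = x * (\<Sum>u\<in>?U. ret_prob x k ?e (link P c v u) u w * D)
          + (1 - k * x) * (ret_prob x (Suc k) ?e (link P c v k) k w * D)"
      proof -
        define A where "A = x * (\<Sum>u\<in>?U. ret_prob x k ?e (link P c v u) u w) + (1 - k * x) * ret_prob x (Suc k) ?e (link P c v k) k w"
        have "ret_prob x k e P v (c # w) = A / (1 - (2 * real (e c) + 1) * x)" using True by (simp add: A_def)
        then have "ret_prob x k e P v (c # w) * ((1 - (2 * real (e c) + 1) * x) * D) = A * D" using nz by simp
        then show ?thesis by (simp add: A_def sum_distrib_right distrib_right mult.assoc)
      qed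
      also have "... = poly R x"
        unfolding Q(2)[OF x, folded D_def] by (simp add: R_def poly_sum algebra_simps)
      finally show ?thesis unfolding D .
    qed
    ultimately show ?thesis by blast
  qed
qed

section \<open>Expansion of return probabilities\<close>

definition reduced_words :: "nat => nat => nat list set" where
  "reduced_words d m = {w. set w \<subseteq> {..<d} & length w = m & distinct_adj w}"

lemma finite_reduced_words: "finite (reduced_words d m)"
proof -
  have "reduced_words d m \<subseteq> {w. set w \<subseteq> {..<d} & length w = m}" by (auto simp: reduced_words_def)
  then show ?thesis by (rule finite_subset) (simp add: finite_lists_length_eq)
qed

lemma reduced_words_0: "reduced_words d 0 = {[]}"
  by (auto simp: reduced_words_def)

lemma card_reduced_words: "card (reduced_words d (Suc m)) = d * (d - 1) ^ m"
proof -
  have 1: "card {w \<in> reduced_words d (Suc m). hd w = c} = (d - 1) ^ m" if "c < d" for c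
    using that
  proof (induction m arbitrary: c)
    case 0
    have "{w \<in> reduced_words d (Suc 0). hd w = c} = {[c]}"
      using 0 by (auto simp: reduced_words_def length_Suc_conv)
    then show ?case by simp
  next
    case (Suc m)
    have "{w \<in> reduced_words d (Suc (Suc m)). hd w = c} = (\<Union>c'\<in>{..<d} - {c}. (#) c ` {w \<in> reduced_words d (Suc m). hd w = c'})"
      (is "?A = ?B")
    proof (intro equalityI subsetI)
      fix w assume w: "w \<in> ?A"
      then obtain c' w' where "w = c # c' # w'" by (auto simp: reduced_words_def length_Suc_conv)
      then show "w \<in> ?B" using w by (auto simp: reduced_words_def intro!: bexI[of _ c'])
    next
      fix w assume "w \<in> ?B"
      then show "w \<in> ?A" using Suc.prems by (auto simp: reduced_words_def length_Suc_conv)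
    qed
    moreover have "card ?B = (\<Sum>c'\<in>{..<d} - {c}. card ((#) c ` {w \<in> reduced_words d (Suc m). hd w = c'}))"
      by (intro card_UN_disjoint) (auto simp: finite_reduced_words)
    moreover have "... = (\<Sum>c'\<in>{..<d} - {c}. (d - 1) ^ m)"
      by (intro sum.cong refl, subst card_image) (auto simp: Suc.IH)
    ultimately show ?case using Suc.prems by simp
  qed
  have "card (reduced_words d (Suc m)) = (\<Sum>c<d. card {w \<in> reduced_words d (Suc m). hd w = c})"
  proof -
    have "hd ` reduced_words d (Suc m) \<subseteq> {..<d}"
      by (auto simp: reduced_words_def length_Suc_conv)
    then show ?thesis
      using sum.group[OF finite_reduced_words, of "{..<d}" hd d "Suc m" "\<lambda>_. 1::nat"] by simp
  qed
  then show ?thesis using 1 by simp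
qed

lemma card_reduced_words_le: "card (reduced_words (Suc p) m) \<le> 2 * p ^ m" if "0 < p"
  by (cases m) (use that in \<open>simp_all add: reduced_words_0 card_reduced_words\<close>)

text \<open>State of an exposure that met only unseen vertices: a path
  \<open>0, ..., length w\<close> whose edges are coloured by \<open>w\<close>.\<close>

definition path_sys :: "nat list => nat => nat => nat" where
  "path_sys w c i = (if i < length w & w ! i = c then Suc i
     else if 0 < i & i \<le> length w & w ! (i - 1) = c then i - 1 else i)"

lemma path_sys_Nil: "path_sys [] = (\<lambda>c i. i)"
  by (auto simp: path_sys_def fun_eq_iff)

lemma path_sys_last:
  "w = [] \<or> last w ~= c ==> path_sys w c (length w) = length w"
  by (cases w rule: rev_cases) (auto simp: path_sys_def nth_append)

lemma path_sys_snoc: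
  assumes "w = [] \<or> last w ~= c"
  shows "link (path_sys w) c (length w) (Suc (length w)) = path_sys (w @ [c])"
proof (intro ext)
  fix c' i
  consider "i < length w" | "i = length w" | "i = Suc (length w)" | "i > Suc (length w)" by linarith
  then show "link (path_sys w) c (length w) (Suc (length w)) c' i = path_sys (w @ [c]) c' i"
    by cases (auto simp: link_def path_sys_def nth_append)
qed

text \<open>Once a reduced walk has entered a fresh vertex, at leading order it only meets fresh vertices
  and never comes back.\<close>

lemma ret_prob_0_fresh:
  assumes "0 < v" "\<And>c. c ~= b ==> P c v = v" "\<And>c i. v < i ==> P c i = i" "distinct_adj (b # w)"
  shows "ret_prob 0 (Suc v) e P v w = 0"
  using assms
proof (induction w arbitrary: v b P e)
  case (Cons c w)
  have bc: "P c v = v" using Cons.prems by auto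
  have "ret_prob 0 (Suc (Suc v)) (e(c := Suc (e c))) (link P c v (Suc v)) (Suc v) w = 0"
    by (rule Cons.IH[of "Suc v" c]) (use Cons.prems in \<open>auto simp: link_def distinct_adj_Cons\<close>)
  then show ?case using bc by simp
qed simp

text \<open>At \<open>x = 0\<close> all denominators are 1, so the edge counts drop out.\<close>

lemma ret_prob_0_e: "ret_prob 0 k e P v w = ret_prob 0 k e' P v w"
proof (induction w arbitrary: k e e' P v)
  case (Cons c w)
  have "ret_prob 0 k (e(c := Suc (e c))) P v w = ret_prob 0 k (e'(c := Suc (e' c))) P v w" for k P v
    by (rule Cons.IH)
  moreover have "ret_prob 0 k e P v w = ret_prob 0 k e' P v w" for v by (rule Cons.IH)
  ultimately show ?case by simp
qed simp

text \<open>Derivative of \<open>ret_prob\<close> at \<open>x = 0\<close>: the first sum is the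
  branch with the explicit factor \<open>x\<close>, and \<open>2 * e c + 1 - k\<close> is the
  derivative of \<open>(1 - k * x) / (1 - (2 * e c + 1) * x)\<close>.\<close>

fun ret_deriv :: "nat => (nat => nat) => (nat => nat => nat) => nat => nat list => real" where
  "ret_deriv k e P v [] = 0"
| "ret_deriv k e P v (c # w) = (if P c v ~= v then ret_deriv k e P (P c v) w
     else (\<Sum>u | u < k & u ~= v & P c u = u. ret_prob 0 k (e(c := Suc (e c))) (link P c v u) u w)
       + ret_deriv (Suc k) (e(c := Suc (e c))) (link P c v k) k w
       + (2 * real (e c) + 1 - k) * ret_prob 0 (Suc k) (e(c := Suc (e c))) (link P c v k) k w)"

lemma ret_prob_has_derivative:
  "((\<lambda>x. ret_prob x k e P v w) has_real_derivative ret_deriv k e P v w) (at 0)"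
proof (induction w arbitrary: k e P v)
  case (Cons c w)
  show ?case
  proof (cases "P c v = v")
    case True
    note IH = Cons.IH
    have "((\<lambda>x. (x * (\<Sum>u | u < k & u ~= v & P c u = u. ret_prob x k (e(c := Suc (e c))) (link P c v u) u w)
           + (1 - k * x) * ret_prob x (Suc k) (e(c := Suc (e c))) (link P c v k) k w)
          / (1 - (2 * e c + 1) * x)) has_real_derivative ret_deriv k e P v (c # w)) (at 0)"
      using True by (auto intro!: derivative_eq_intros IH simp: algebra_simps fun_upd_def)
    then show ?thesis using True by (simp add: add.commute)
  qed (use Cons in simp)
qed simp

section \<open>First-order terms: returns on a path closed up once\<close>

abbreviation lolli :: "nat list => nat => nat => nat => nat => nat" where
  "lolli w j u \<equiv> link (path_sys (take j w)) (w ! j) j u"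

abbreviation lolli_ret :: "nat list => nat => nat => nat => nat list => real" where
  "lolli_ret w j u i r \<equiv> ret_prob 0 (Suc j) (\<lambda>_. 0) (lolli w j u) i r"

text \<open>The path drawn by the first \<open>j\<close> letters is closed by an edge of colour
  \<open>w ! j\<close> from its end \<open>j\<close> back to \<open>u\<close>, which needs this
  colour to be free at \<open>u\<close>. The resulting \<open>lolli w j u\<close> is a tail from 0
  to \<open>u\<close> with a cycle attached at \<open>u\<close>.\<close>

definition closing :: "nat list => nat => nat => bool" where
  "closing w j u \<longleftrightarrow> u < j & j < length w & path_sys (take j w) (w ! j) u = u"

text \<open>To first order exactly one step closes up. Before it the walk runs along a fresh path;
  after it the value at \<open>x = 0\<close> only tells whether the remaining word leads back to 0.
  Terms without a closing step vanish by \<open>ret_prob_0_fresh\<close>.\<close>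

lemma ret_deriv_path:
  assumes "distinct_adj (pre @ w)"
  shows "ret_deriv (Suc (length pre)) e (path_sys pre) (length pre) w
    = (\<Sum>j = length pre..<length (pre @ w). \<Sum>u | closing (pre @ w) j u.
         lolli_ret (pre @ w) j u u (drop (Suc j) (pre @ w)))"
  using assms
proof (induction w arbitrary: pre e)
  case (Cons c w)
  let ?t = "length pre" and ?e = "e(c := Suc (e c))" and ?w = "pre @ c # w"
  have l: "pre = [] \<or> last pre ~= c" using Cons.prems by (auto simp: distinct_adj_append_iff)
  have free: "path_sys pre c ?t = ?t" by (rule path_sys_last[OF l])
  have 1: "ret_prob 0 (Suc (Suc ?t)) ?e (path_sys (pre @ [c])) (Suc ?t) w = 0"
  proof (rule ret_prob_0_fresh[where b = c])
    show "distinct_adj (c # w)" using Cons.prems by (auto simp: distinct_adj_append_iff)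
  qed (auto simp: path_sys_def nth_append)
  have 2: "ret_deriv (Suc (Suc ?t)) ?e (path_sys (pre @ [c])) (Suc ?t) w
      = (\<Sum>j = Suc ?t..<length ?w. \<Sum>u | closing ?w j u. lolli_ret ?w j u u (drop (Suc j) ?w))"
  proof -
    have "distinct_adj ((pre @ [c]) @ w)" using Cons.prems by simp
    from Cons.IH[OF this, of ?e] show ?thesis
      by (simp only: append_assoc append.simps length_append_singleton)
  qed
  have U: "{u. u < Suc ?t & u ~= ?t & path_sys pre c u = u} = {u. closing ?w ?t u}"
    by (auto simp: closing_def)
  have "ret_deriv (Suc ?t) e (path_sys pre) ?t (c # w)
    = (\<Sum>u | closing ?w ?t u. ret_prob 0 (Suc ?t) ?e (link (path_sys pre) c ?t u) u w)
     + (\<Sum>j = Suc ?t..<length ?w. \<Sum>u | closing ?w j u. lolli_ret ?w j u u (drop (Suc j) ?w))"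
    using free 1 2 by (simp add: path_sys_snoc[OF l] U)
  also have "(\<Sum>u | closing ?w ?t u. ret_prob 0 (Suc ?t) ?e (link (path_sys pre) c ?t u) u w)
    = (\<Sum>u | closing ?w ?t u. lolli_ret ?w ?t u u (drop (Suc ?t) ?w))"
    by (subst ret_prob_0_e[where e' = "\<lambda>_. 0"]) simp
  also have "... + (\<Sum>j = Suc ?t..<length ?w. \<Sum>u | closing ?w j u. lolli_ret ?w j u u (drop (Suc j) ?w))
    = (\<Sum>j = ?t..<length ?w. \<Sum>u | closing ?w j u. lolli_ret ?w j u u (drop (Suc j) ?w))"
    by (rule sum.atLeast_Suc_lessThan[symmetric]) simp
  finally show ?case .
qed simp

lemma lolli_edges:
  assumes cl: "closing w j u" and d: "distinct_adj w" and i: "i \<le> j"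
  shows "lolli w j u c i = (if i < j & c = w ! i then Suc i
     else if 0 < i & c = w ! (i - 1) then i - 1
     else if c = w ! j & i = u then j else if c = w ! j & i = j then u else i)"
    (is "_ = ?R")
proof -
  have j: "u < j" "j < length w" and f: "path_sys (take j w) (w ! j) u = u" using cl by (auto simp: closing_def)
  have wu: "w ! u ~= w ! j" using f j by (auto simp: path_sys_def split: if_splits)
  have wu': "w ! (u - 1) ~= w ! j" if "0 < u" using f j that by (auto simp: path_sys_def split: if_splits)
  have wj: "w ! (j - 1) ~= w ! j" using distinct_adj_nth[OF d, of "j - 1"] j by simp
  have p: "path_sys (take j w) c i = (if i < j & w ! i = c then Suc i else if 0 < i & w ! (i - 1) = c then i - 1 else i)"
    using i j by (auto simp: path_sys_def)
  show ?thesis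
  proof (cases "c = w ! j & (i = u \<or> i = j)")
    case True
    then show ?thesis using j wu wu' wj f i p
      by (auto simp: link_def)
  next
    case False
    then have "lolli w j u c i = path_sys (take j w) c i" by (auto simp: link_def)
    then show ?thesis using False p by auto
  qed
qed

text \<open>Such a step leads to a fresh vertex, from which a reduced word does not return at
  \<open>x = 0\<close>.\<close>

lemma lolli_no_exit:
  assumes cl: "closing w j u" and i: "i \<le> j" and fix_i: "lolli w j u c i = i" and d: "distinct_adj (c # r)"
  shows "lolli_ret w j u i (c # r) = 0"
proof -
  have "ret_prob 0 (Suc (Suc j)) e (link (lolli w j u) c i (Suc j)) (Suc j) r = 0" for e
    by (rule ret_prob_0_fresh[where b = c])
      (use d cl i in \<open>auto simp: link_def path_sys_def closing_def\<close>)
  then show ?thesis using fix_i by simp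
qed

text \<open>After stepping down to \<open>i\<close> on the tail, turning back is not reduced and
  leaving is fatal, so the word has to run down to 0 and stop there.\<close>

lemma lolli_tail:
  assumes cl: "closing w j u" and d: "distinct_adj w"
  shows "i < u ==> lolli_ret w j u i r ~= 0 ==> distinct_adj (w ! i # r) ==> r = rev (take i w)"
proof (induction i arbitrary: r)
  case 0
  show ?case
  proof (cases r)
    case (Cons c r')
    have "lolli w j u c 0 = 0" using 0 cl Cons by (subst lolli_edges[OF cl d]) (auto simp: closing_def)
    then have "lolli_ret w j u 0 (c # r') = 0"
      using lolli_no_exit[OF cl, of 0 c r'] 0 Cons by (auto simp: distinct_adj_Cons)
    then show ?thesis using 0 Cons by simp
  qed simp
next
  case (Suc i)
  have j: "u < j" "j < length w" using cl by (auto simp: closing_def)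
  show ?case
  proof (cases r)
    case Nil then show ?thesis using Suc.prems by simp
  next
    case (Cons c r')
    have c: "c ~= w ! Suc i" using Suc.prems Cons by simp
    show ?thesis
    proof (cases "c = w ! i")
      case True
      then have e: "lolli w j u c (Suc i) = i" using c j Suc.prems by (subst lolli_edges[OF cl d]) auto
      then have "lolli_ret w j u i r' ~= 0" using Suc.prems(2) Cons by simp
      then have "r' = rev (take i w)" using Suc.IH[of r'] Suc.prems Cons True by simp
      then show ?thesis using Cons True j Suc.prems by (simp add: take_Suc_conv_app_nth)
    next
      case False
      then have "lolli w j u c (Suc i) = Suc i" using c j Suc.prems by (subst lolli_edges[OF cl d]) auto
      then have "lolli_ret w j u (Suc i) (c # r') = 0"
        using lolli_no_exit[OF cl, of "Suc i" c r'] Suc.prems Cons j by (auto simp: distinct_adj_Cons)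
      then show ?thesis using Suc.prems Cons by simp
    qed
  qed
qed

text \<open>There is no branching inside the cycle: the walk is forced around until it is back at
  \<open>u\<close>.\<close>

lemma lolli_cycle:
  assumes cl: "closing w j u" and d: "distinct_adj w"
  shows "u < i ==> i \<le> j ==> lolli_ret w j u i r ~= 0 ==> distinct_adj (w ! (i - 1) # r) ==>
    \<exists>r'. r = drop i (take (Suc j) w) @ r' & lolli_ret w j u u r' ~= 0 & distinct_adj (w ! j # r')"
proof (induction "j - i" arbitrary: i r)
  case 0
  have j: "u < j" "j < length w" using cl by (auto simp: closing_def)
  have ij: "i = j" using 0 by simp
  obtain c r' where r: "r = c # r'" using 0 by (cases r) auto
  have c: "c ~= w ! (j - 1)" using 0 r ij by simp
  show ?case
  proof (cases "c = w ! j")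
    case True
    then have "lolli w j u c j = u" using c j by (subst lolli_edges[OF cl d]) auto
    then have "lolli_ret w j u u r' ~= 0" using 0 r ij j by simp
    then show ?thesis using True r ij j 0 by (intro exI[of _ r']) (simp add: take_Suc_conv_app_nth)
  next
    case False
    then have "lolli w j u c j = j" using c j by (subst lolli_edges[OF cl d]) auto
    then have "lolli_ret w j u j (c # r') = 0"
      using lolli_no_exit[OF cl, of j c r'] 0 r by (auto simp: distinct_adj_Cons)
    then show ?thesis using 0 r ij by simp
  qed
next
  case (Suc n)
  have j: "u < j" "j < length w" using cl by (auto simp: closing_def)
  have ij: "i < j" using Suc by simp
  obtain c r' where r: "r = c # r'" using Suc by (cases r) auto
  have c: "c ~= w ! (i - 1)" using Suc r by simp
  show ?case
  proof (cases "c = w ! i")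
    case True
    then have "lolli w j u c i = Suc i" using ij by (subst lolli_edges[OF cl d]) auto
    then have "lolli_ret w j u (Suc i) r' ~= 0" using Suc.prems r by simp
    moreover have "n = j - Suc i" using Suc.hyps(2) by simp
    ultimately obtain r'' where r'': "r' = drop (Suc i) (take (Suc j) w) @ r''" "lolli_ret w j u u r'' ~= 0" "distinct_adj (w ! j # r'')"
      using Suc.hyps(1)[of "Suc i" r'] Suc.prems r True ij by (auto simp del: ret_prob.simps)
    moreover have "drop i (take (Suc j) w) = w ! i # drop (Suc i) (take (Suc j) w)"
      using Cons_nth_drop_Suc[of i "take (Suc j) w"] ij j by simp
    ultimately show ?thesis using r True by auto
  next
    case False
    then have "lolli w j u c i = i" using c ij Suc.prems by (subst lolli_edges[OF cl d]) auto
    then have "lolli_ret w j u i (c # r') = 0"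
      using lolli_no_exit[OF cl, of i c r'] Suc.prems r by (auto simp: distinct_adj_Cons)
    then show ?thesis using Suc.prems r by simp
  qed
qed

text \<open>At \<open>u\<close> after the closing edge, a reduced word may go round the cycle again
  in the same direction, the opposite one being a backtrack, or take the tail, from which it does
  not come back.\<close>

lemma lolli_base:
  assumes cl: "closing w j u" and d: "distinct_adj w"
  shows "lolli_ret w j u u r ~= 0 ==> distinct_adj (w ! j # r) ==>
    \<exists>n. r = concat (replicate n (drop u (take (Suc j) w))) @ rev (take u w)"
proof (induction "length r" arbitrary: r rule: less_induct)
  case less
  have j: "u < j" "j < length w" using cl by (auto simp: closing_def)
  show ?case
  proof (cases r)
    case Nil
    then have "u = 0" using less.prems by (auto split: if_splits)
    then show ?thesis using Nil by (intro exI[of _ 0]) simp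
  next
    case (Cons c r')
    have c: "c ~= w ! j" using less.prems Cons by simp
    consider "c = w ! u" | "0 < u" "c = w ! (u - 1)" "c ~= w ! u" | "c ~= w ! u" "u = 0 \<or> c ~= w ! (u - 1)" by blast
    then show ?thesis
    proof cases
      case 1
      then have "lolli w j u c u = Suc u" using j by (subst lolli_edges[OF cl d]) auto
      then have "lolli_ret w j u (Suc u) r' ~= 0" using less.prems Cons by simp
      then obtain r'' where r'': "r' = drop (Suc u) (take (Suc j) w) @ r''" "lolli_ret w j u u r'' ~= 0" "distinct_adj (w ! j # r'')"
        using lolli_cycle[OF cl d, of "Suc u" r'] less.prems Cons 1 j by auto
      obtain n where "r'' = concat (replicate n (drop u (take (Suc j) w))) @ rev (take u w)"
        using less.hyps[OF _ r''(2,3)] r''(1) Cons by auto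
      moreover have "drop u (take (Suc j) w) = w ! u # drop (Suc u) (take (Suc j) w)"
        using Cons_nth_drop_Suc[of u "take (Suc j) w"] j by simp
      ultimately show ?thesis using r'' Cons 1 by (intro exI[of _ "Suc n"]) simp
    next
      case 2
      then have "lolli w j u c u = u - 1" using j by (subst lolli_edges[OF cl d]) auto
      moreover have "u - 1 ~= u" using 2 by simp
      ultimately have "lolli_ret w j u (u - 1) r' ~= 0"
        using less.prems(1) unfolding Cons 2(2) ret_prob.simps by (simp only: if_True not_False_eq_True)
      then have "r' = rev (take (u - 1) w)"
        using lolli_tail[OF cl d, of "u - 1" r'] less.prems Cons 2 by auto
      then have "r = rev (take u w)" using Cons 2 j take_Suc_conv_app_nth[of "u - 1" w] by simp
      then show ?thesis by (intro exI[of _ 0]) simp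
    next
      case 3
      then have "lolli w j u c u = u" using j c by (subst lolli_edges[OF cl d]) auto
      then have "lolli_ret w j u u (c # r') = 0"
        using lolli_no_exit[OF cl, of u c r'] less.prems Cons j by (auto simp: distinct_adj_Cons)
      then show ?thesis using less.prems Cons by simp
    qed
  qed
qed

lemma lolli_rev:
  assumes cl: "closing w j u" and d: "distinct_adj w"
  shows "i \<le> u ==> lolli_ret w j u i (rev (take i w)) = 1"
proof (induction i)
  case (Suc i)
  have j: "u < j" "j < length w" using cl by (auto simp: closing_def)
  have wi: "w ! i ~= w ! Suc i" using distinct_adj_nth[OF d] j Suc.prems by simp
  have "lolli w j u (w ! i) (Suc i) = i" using wi j Suc.prems by (subst lolli_edges[OF cl d]) auto
  then show ?case using Suc j by (simp add: take_Suc_conv_app_nth)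
qed simp

lemma ret_prob_0_cases: "ret_prob 0 k e P v w = 0 \<or> ret_prob 0 k e P v w = 1"
  by (induction w arbitrary: k e P v) auto

text \<open>This is the cyclic reduction of \<open>w\<close>: \<open>u\<close> is forced to be the
  first position at which \<open>w\<close> differs from its reversal, and \<open>j\<close> its
  mirror image. A palindrome has no such position.\<close>

lemma closing_reverse_unique:
  assumes w: "distinct_adj w" "w ~= []"
  shows "card {(j, u). closing w j u & drop (Suc j) w = rev (take u w)} = (if rev w = w then 0 else 1)"
    (is "card ?S = _")
proof -
  let ?m = "length w"
  have nth: "w ! (?m - 1 - i) = w ! i" if "closing w j u" "drop (Suc j) w = rev (take u w)" "i < u" for i j u
  proof -
    have j: "u < j" "j < ?m" using that(1) by (auto simp: closing_def)
    have len: "?m - Suc j = u" using arg_cong[OF that(2), of length] j by simp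
    have "?m - 1 - i = Suc j + (u - 1 - i)" using that(3) len j by linarith
    then have "w ! (?m - 1 - i) = drop (Suc j) w ! (u - 1 - i)" using j by simp
    also have "... = w ! i" unfolding that(2) using that(3) j by (simp add: rev_nth)
    finally show ?thesis .
  qed
  have mis: "w ! (?m - 1 - u) ~= w ! u" "j = ?m - 1 - u" "u < ?m"
    if "closing w j u" "drop (Suc j) w = rev (take u w)" for j u
  proof -
    have j: "u < j" "j < ?m" using that(1) by (auto simp: closing_def)
    have len: "?m - Suc j = u" using arg_cong[OF that(2), of length] j by simp
    then show "j = ?m - 1 - u" "u < ?m" using j by auto
    moreover have "w ! u ~= w ! j" using that(1) by (auto simp: closing_def path_sys_def split: if_splits)
    ultimately show "w ! (?m - 1 - u) ~= w ! u" by auto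
  qed
  show ?thesis
  proof (cases "rev w = w")
    case True
    have "w ! (?m - 1 - u) = w ! u" if "u < ?m" for u
      using rev_nth[of u w] True that by simp
    then have "?S = {}" using mis by blast
    then have "card ?S = 0" by (simp only: card.empty)
    then show ?thesis using True by simp
  next
    case False
    then have "\<exists>u<?m. rev w ! u ~= w ! u" using nth_equalityI[of "rev w" w] by auto
    then have ex: "\<exists>u. u < ?m & w ! (?m - 1 - u) ~= w ! u" by (auto simp: rev_nth)
    define u where "u = (LEAST u. u < ?m & w ! (?m - 1 - u) ~= w ! u)"
    have u: "u < ?m" "w ! (?m - 1 - u) ~= w ! u"
      using LeastI_ex[OF ex] unfolding u_def by auto
    have least: "w ! (?m - 1 - i) = w ! i" if "i < u" for i
      using not_less_Least[of i "\<lambda>u. u < ?m & w ! (?m - 1 - u) ~= w ! u"] that u unfolding u_def by auto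
    have "\<not> ?m - 1 - u < u"
      using least[of "?m - 1 - u"] u by auto
    moreover have "?m - 1 - u ~= u" using u by auto
    ultimately have uj: "u < ?m - 1 - u" by linarith
    define j where "j = ?m - 1 - u"
    have jm: "j < ?m" "Suc j + u = ?m" using uj unfolding j_def by auto
    have "w ! (u - 1) ~= w ! j" if "0 < u"
    proof -
      have "w ! (u - 1) = w ! Suc j" using least[of "u - 1"] that jm by (simp add: j_def Suc_diff_Suc)
      then show ?thesis using distinct_adj_nth[OF w(1), of j] jm that by auto
    qed
    then have cl: "closing w j u"
      using uj u jm by (auto simp: closing_def path_sys_def j_def)
    have rv: "drop (Suc j) w = rev (take u w)"
    proof (rule nth_equalityI)
      show "length (drop (Suc j) w) = length (rev (take u w))" using jm by simp
      fix i assume "i < length (drop (Suc j) w)"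
      then have i: "i < u" using jm by simp
      have e: "?m - 1 - (u - 1 - i) = Suc j + i" using i jm by linarith
      show "drop (Suc j) w ! i = rev (take u w) ! i"
        using least[of "u - 1 - i"] i jm unfolding e by (simp add: rev_nth)
    qed
    have "?S = {(j, u)}"
    proof (intro equalityI subsetI)
      fix x assume "x \<in> ?S"
      then obtain j' u' where x: "x = (j', u')" and c': "closing w j' u'" "drop (Suc j') w = rev (take u' w)" by blast
      have "u' = u"
      proof -
        have "\<not> u < u'" using nth[OF c', of u] u(2) by blast
        moreover have "\<not> u' < u" using least[of u'] mis(1)[OF c'] by blast
        ultimately show ?thesis by linarith
      qed
      then show "x \<in> {(j, u)}" using mis(2)[OF c'] x by (simp add: j_def)
    qed (use cl rv in auto)
    then have "card ?S = card {(j, u)}" by (rule arg_cong)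
    also have "... = 1" by simp
    finally have "card ?S = 1" .
    then show ?thesis using False by simp
  qed
qed

lemma distinct_adj_take: "distinct_adj w ==> distinct_adj (take n w)"
  by (metis append_take_drop_id distinct_adj_appendD1)

text \<open>Returns that go round the cycle more than once; the excluded equation describes those
  with a single turn.\<close>

definition long_return :: "nat list => nat => nat => bool" where
  "long_return w j u \<longleftrightarrow> closing w j u & drop (Suc j) w ~= rev (take u w) & lolli_ret w j u u (drop (Suc j) w) ~= 0"

lemma finite_closing: "finite {u. closing w j u}" "finite {(j, u). closing w j u & Q j u}"
proof -
  show "finite {u. closing w j u}"
    by (rule finite_subset[of _ "{..<j}"]) (auto simp: closing_def)
  show "finite {(j, u). closing w j u & Q j u}"
    by (rule finite_subset[of _ "{..<length w} \<times> {..<length w}"]) (auto simp: closing_def)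
qed

lemma ret_deriv_reduced:
  assumes w: "distinct_adj w" "w ~= []"
  shows "ret_deriv 1 (\<lambda>_. 0) (\<lambda>c i. i) 0 w
    = (if rev w = w then 0 else 1) + real (card {(j, u). long_return w j u})"
proof -
  let ?S = "{(j, u). closing w j u & drop (Suc j) w = rev (take u w)}"
  let ?T = "{(j, u). long_return w j u}"
  let ?A = "Sigma {..<length w} (\<lambda>j. {u. closing w j u})"
  have A: "?A = {(j, u). closing w j u}" by (auto simp: closing_def)
  have fin: "finite {(j, u). closing w j u}" using finite_closing(2)[of w "\<lambda>_ _. True"] by simp
  have finST: "finite ?S" "finite ?T"
    by (rule finite_closing(2)) (rule finite_subset[OF _ fin], auto simp: long_return_def)
  have v: "lolli_ret w j u u (drop (Suc j) w) = (if (j, u) \<in> ?S then 1 else 0) + (if (j, u) \<in> ?T then 1 else 0)"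
    if "closing w j u" for j u
    using that lolli_rev[OF that w(1), of u] ret_prob_0_cases[of "Suc j" "\<lambda>_. 0" "lolli w j u" u "drop (Suc j) w"]
    by (auto simp: long_return_def)
  have "ret_deriv 1 (\<lambda>_. 0) (\<lambda>c i. i) 0 w
      = (\<Sum>j<length w. \<Sum>u | closing w j u. lolli_ret w j u u (drop (Suc j) w))"
    using ret_deriv_path[of "[]" w "\<lambda>_. 0"] w by (simp add: path_sys_Nil atLeast0LessThan)
  also have "... = (\<Sum>(j, u)\<in>?A. lolli_ret w j u u (drop (Suc j) w))"
    by (subst sum.Sigma) (auto simp: finite_closing)
  also have "... = (\<Sum>x\<in>{(j, u). closing w j u}. (if x \<in> ?S then 1 else 0) + (if x \<in> ?T then 1 else 0))"
  proof (intro sum.cong A)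
    fix x assume "x \<in> {(j, u). closing w j u}"
    then obtain j u where x: "x = (j, u)" and cl: "closing w j u" by blast
    show "(case x of (j, u) => lolli_ret w j u u (drop (Suc j) w)) = (if x \<in> ?S then 1 else 0) + (if x \<in> ?T then 1 else 0)"
      unfolding x prod.case by (rule v[OF cl])
  qed
  also have "... = real (card ({(j, u). closing w j u} \<inter> ?S)) + real (card ({(j, u). closing w j u} \<inter> ?T))"
    using fin by (simp add: sum.distrib sum.If_cases Int_def)
  also have "{(j, u). closing w j u} \<inter> ?S = ?S" by auto
  also have "{(j, u). closing w j u} \<inter> ?T = ?T" by (auto simp: long_return_def)
  finally show ?thesis using closing_reverse_unique[OF w] by simp
qed

text \<open>The first \<open>Suc j\<close> letters contain the tail and one turn and determine
  \<open>w\<close>. A second turn and the way back follow, so they make up at most half of the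
  word.\<close>

lemma long_return_card:
  assumes p: "0 < p"
  shows "real (card {w \<in> reduced_words (Suc p) m. long_return w j u}) \<le> 2 * sqrt p ^ m"
proof (cases "{w \<in> reduced_words (Suc p) m. long_return w j u} = {}")
  case True
  then show ?thesis by (simp only: card.empty) simp
next
  case False
  let ?B = "{w \<in> reduced_words (Suc p) m. long_return w j u}"
  have form: "\<exists>n>0. drop (Suc j) w = concat (replicate n (drop u (take (Suc j) w))) @ rev (take u w)
    & m - Suc j = n * (Suc j - u) + u & u < j & j < m" if "w \<in> ?B" for w
  proof -
    have w: "distinct_adj w" "length w = m" and cl: "closing w j u" and ne: "drop (Suc j) w ~= rev (take u w)"
      and nz: "lolli_ret w j u u (drop (Suc j) w) ~= 0"
      using that by (auto simp: reduced_words_def long_return_def)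
    have j: "u < j" "j < m" using cl w by (auto simp: closing_def)
    have "distinct_adj (w ! j # drop (Suc j) w)"
      using w j Cons_nth_drop_Suc[of j w] by (metis append_take_drop_id distinct_adj_appendD2)
    from lolli_base[OF cl w(1) nz this] obtain n where
      n: "drop (Suc j) w = concat (replicate n (drop u (take (Suc j) w))) @ rev (take u w)" by blast
    moreover have "n > 0" using n ne by (cases n) auto
    moreover have "m - Suc j = n * (Suc j - u) + u"
      using arg_cong[OF n, of length] w j by (simp add: length_concat sum_list_replicate)
    ultimately show ?thesis using j by blast
  qed
  from False obtain w0 where "w0 \<in> ?B" by blast
  from form[OF this] obtain n where n: "n > 0" "m - Suc j = n * (Suc j - u) + u" "u < j" "j < m" by blast
  have "Suc j - u \<le> n * (Suc j - u)" using n(1) by simp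
  then have "Suc j \<le> n * (Suc j - u) + u" by linarith
  then have "Suc j \<le> m - Suc j" using n by simp
  then have mj: "2 * Suc j \<le> m" by arith
  have inj: "inj_on (take (Suc j)) ?B"
  proof (rule inj_onI)
    fix w w' assume w: "w \<in> ?B" "w' \<in> ?B" and eq: "take (Suc j) w = take (Suc j) w'"
    from form[OF w(1)] obtain k where k: "drop (Suc j) w = concat (replicate k (drop u (take (Suc j) w))) @ rev (take u w)"
      "m - Suc j = k * (Suc j - u) + u" "u < j" by blast
    from form[OF w(2)] obtain k' where k': "drop (Suc j) w' = concat (replicate k' (drop u (take (Suc j) w'))) @ rev (take u w')"
      "m - Suc j = k' * (Suc j - u) + u" by blast
    have "k = k'" using k k' by (metis add_right_cancel mult_cancel2 less_SucI not_less_eq zero_less_diff less_irrefl)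
    moreover have "take u w = take u w'"
      using arg_cong[OF eq, of "take u"] k(3) by (simp add: min_def)
    ultimately have "drop (Suc j) w = drop (Suc j) w'" using k k' eq by simp
    then show "w = w'" using eq by (metis append_take_drop_id)
  qed
  have "take (Suc j) ` ?B \<subseteq> reduced_words (Suc p) (Suc j)"
  proof (rule image_subsetI)
    fix w assume "w \<in> ?B"
    then have "distinct_adj w" "length w = m" "set w \<subseteq> {..<Suc p}"
      by (auto simp: reduced_words_def)
    then show "take (Suc j) w \<in> reduced_words (Suc p) (Suc j)"
      using mj set_take_subset[of "Suc j" w] distinct_adj_take[of w "Suc j"]
      unfolding reduced_words_def by auto
  qed
  then have "card ?B \<le> card (reduced_words (Suc p) (Suc j))"
    using card_inj_on_le[OF inj] finite_reduced_words by blast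
  also have "... \<le> 2 * p ^ Suc j" by (rule card_reduced_words_le[OF p])
  finally have "real (card ?B) \<le> real (2 * p ^ Suc j)" by (rule of_nat_mono)
  also have "... = 2 * sqrt p ^ (2 * Suc j)" by (simp add: power_mult power_mult_distrib)
  also have "... \<le> 2 * sqrt p ^ m"
    using mj p by (intro mult_left_mono power_increasing) auto
  finally show ?thesis .
qed

lemma palindrome_card:
  assumes p: "0 < p"
  shows "real (card {w \<in> reduced_words (Suc p) m. rev w = w}) \<le> 2 * p * sqrt p ^ m"
proof -
  let ?B = "{w \<in> reduced_words (Suc p) m. rev w = w}"
  define h where "h = (m + 1) div 2"
  have h: "m - h \<le> h" "2 * h \<le> m + 1" "h \<le> m" by (auto simp: h_def)
  have inj: "inj_on (take h) ?B"
  proof (rule inj_onI)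
    fix w w' assume w: "w \<in> ?B" "w' \<in> ?B" and eq: "take h w = take h w'"
    have dr: "drop h v = rev (take (m - h) (take h v))" if "v \<in> ?B" for v
    proof -
      have "rev v = v" "length v = m" using that by (auto simp: reduced_words_def)
      then show ?thesis using h drop_rev[of h v] by (simp add: min_def)
    qed
    have "drop h w = drop h w'" unfolding dr[OF w(1)] dr[OF w(2)] eq ..
    then show "w = w'" using eq by (metis append_take_drop_id)
  qed
  have "take h ` ?B \<subseteq> reduced_words (Suc p) h"
  proof (rule image_subsetI)
    fix w assume "w \<in> ?B"
    then have "distinct_adj w" "length w = m" "set w \<subseteq> {..<Suc p}"
      by (auto simp: reduced_words_def)
    then show "take h w \<in> reduced_words (Suc p) h"
      using h set_take_subset[of h w] distinct_adj_take[of w h]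
      unfolding reduced_words_def by auto
  qed
  then have "card ?B \<le> card (reduced_words (Suc p) h)"
    using card_inj_on_le[OF inj] finite_reduced_words by blast
  also have "... \<le> 2 * p ^ h" by (rule card_reduced_words_le[OF p])
  finally have "real (card ?B) \<le> real (2 * p ^ h)" by (rule of_nat_mono)
  also have "... = 2 * sqrt p ^ (2 * h)" by (simp add: power_mult power_mult_distrib)
  also have "... \<le> 2 * sqrt p ^ (m + 1)"
    using h p by (intro mult_left_mono power_increasing) auto
  also have "... \<le> 2 * real p * sqrt p ^ m"
  proof -
    have "sqrt p * 1 \<le> sqrt p * sqrt p" using p by (intro mult_left_mono) auto
    then show ?thesis by (simp add: mult_right_mono)
  qed
  finally show ?thesis .
qed

text \<open>Every reduced word contributes 1, except for the palindromes, plus its long returns;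
  both corrections are of order \<open>p^(m/2)\<close> up to polynomial factors. The main term is
  the share of the trivial eigenvalue in the trace, see \<open>nb_poly_at_degree\<close>.\<close>

theorem sum_ret_deriv:
  assumes p: "0 < p" and m: "0 < m"
  shows "\<bar>(\<Sum>w\<in>reduced_words (Suc p) m. ret_deriv 1 (\<lambda>_. 0) (\<lambda>c i. i) 0 w) - card (reduced_words (Suc p) m)\<bar>
    \<le> (2 * p + 2 * (real m)^2) * sqrt p ^ m"
proof -
  let ?R = "reduced_words (Suc p) m"
  have fin: "finite ?R" by (rule finite_reduced_words)
  have "(\<Sum>w\<in>?R. ret_deriv 1 (\<lambda>_. 0) (\<lambda>c i. i) 0 w)
    = (\<Sum>w\<in>?R. 1 - (if rev w = w then 1 else 0) + real (card {(j, u). long_return w j u}))"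
    using m by (intro sum.cong refl, subst ret_deriv_reduced) (auto simp: reduced_words_def)
  also have "... = card ?R - real (card {w \<in> ?R. rev w = w}) + (\<Sum>w\<in>?R. real (card {(j, u). long_return w j u}))"
    using fin by (simp add: sum.distrib sum_subtractf sum.If_cases Int_def)
  finally have 1: "(\<Sum>w\<in>?R. ret_deriv 1 (\<lambda>_. 0) (\<lambda>c i. i) 0 w) - card ?R
    = (\<Sum>w\<in>?R. real (card {(j, u). long_return w j u})) - real (card {w \<in> ?R. rev w = w})" by simp
  have "(\<Sum>w\<in>?R. real (card {(j, u). long_return w j u}))
      = (\<Sum>w\<in>?R. \<Sum>x\<in>{..<m} \<times> {..<m}. if long_return w (fst x) (snd x) then 1 else 0)"
  proof (intro sum.cong refl)
    fix w assume "w \<in> ?R"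
    then have "length w = m" by (simp add: reduced_words_def)
    then have "{(j, u). long_return w j u} = ({..<m} \<times> {..<m}) \<inter> {x. long_return w (fst x) (snd x)}"
      by (auto simp: long_return_def closing_def)
    then show "real (card {(j, u). long_return w j u}) = (\<Sum>x\<in>{..<m} \<times> {..<m}. if long_return w (fst x) (snd x) then 1 else 0)"
      by (simp add: sum.If_cases)
  qed
  also have "... = (\<Sum>x\<in>{..<m} \<times> {..<m}. \<Sum>w\<in>?R. if long_return w (fst x) (snd x) then 1 else 0)"
    by (rule sum.swap)
  also have "... = (\<Sum>x\<in>{..<m} \<times> {..<m}. real (card {w \<in> ?R. long_return w (fst x) (snd x)}))"
    using fin by (simp add: sum.If_cases Int_def)
  also have "... \<le> (\<Sum>x\<in>{..<m} \<times> {..<m}. 2 * sqrt p ^ m)"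
    by (intro sum_mono long_return_card[OF p])
  also have "... = 2 * (real m)^2 * sqrt p ^ m" by (simp add: power2_eq_square)
  finally have 2: "(\<Sum>w\<in>?R. real (card {(j, u). long_return w j u})) \<le> 2 * (real m)^2 * sqrt p ^ m" .
  have "0 \<le> (\<Sum>w\<in>?R. real (card {(j, u). long_return w j u}))" by (intro sum_nonneg) simp
  moreover have "0 \<le> 2 * (real m)^2 * sqrt p ^ m" "0 \<le> 2 * p * sqrt p ^ m" by simp_all
  ultimately show ?thesis using 1 2 palindrome_card[OF p, of m] unfolding distrib_right by linarith
qed

section \<open>Polynomial inequalities\<close>

fun chebT :: "nat => real poly" where
  "chebT 0 = 1"
| "chebT (Suc 0) = [:0, 1:]"
| "chebT (Suc (Suc n)) = [:0, 2:] * chebT (Suc n) - chebT n"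

lemma chebT_cos: "poly (chebT n) (cos t) = cos (n * t)"
proof (induction n rule: chebT.induct)
  case (3 n)
  have "cos (real (Suc (Suc n)) * t) + cos (real n * t) = 2 * cos t * cos (real (Suc n) * t)"
    using cos_add[of "real (Suc n) * t" t] cos_diff[of "real (Suc n) * t" t] by (simp add: algebra_simps)
  then show ?case using 3 by (simp add: algebra_simps)
qed auto

lemma degree_chebT: "degree (chebT n) = n & coeff (chebT n) n ~= 0"
proof (induction n rule: chebT.induct)
  case (3 n)
  have c: "coeff (chebT n) (Suc (Suc n)) = 0" using 3 by (intro coeff_eq_0) auto
  have co: "coeff (chebT (Suc (Suc n))) (Suc (Suc n)) = 2 * coeff (chebT (Suc n)) (Suc n)"
    using c by (simp add: coeff_pCons)
  have "degree (chebT (Suc (Suc n))) \<le> Suc (Suc n)"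
    unfolding chebT.simps using 3 by (intro degree_diff_le order.trans[OF degree_mult_le]) auto
  moreover have "Suc (Suc n) \<le> degree (chebT (Suc (Suc n)))"
    using co 3 by (intro le_degree) simp
  ultimately have "degree (chebT (Suc (Suc n))) = Suc (Suc n)" by (rule antisym)
  then show ?case using co 3 by simp
qed auto

lemma poly_basis_expansion:
  fixes b :: "nat => real poly"
  assumes "\<And>n. degree (b n) = n" "\<And>n. coeff (b n) n ~= 0"
  shows "degree f \<le> n ==> \<exists>a. f = (\<Sum>k\<le>n. psmult (a k) (b k))"
proof (induction n arbitrary: f)
  case 0
  then have "f = [:coeff f 0:]" by (metis degree_0_id le_zero_eq)
  moreover have "b 0 = [:coeff (b 0) 0:]" using assms(1)[of 0] by (metis degree_0_id)
  ultimately have "f = psmult (coeff f 0 / coeff (b 0) 0) (b 0)"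
    using assms(2)[of 0] by (metis mult.commute mult_cancel_left nonzero_mult_div_cancel_right smult_0_right smult_pCons times_divide_eq_left)
  then show ?case by (intro exI[of _ "\<lambda>_. coeff f 0 / coeff (b 0) 0"]) simp
next
  case (Suc n)
  define t where "t = coeff f (Suc n) / coeff (b (Suc n)) (Suc n)"
  have "degree (f - psmult t (b (Suc n))) \<le> n"
  proof (rule degree_le, intro allI impI)
    fix i assume i: "n < i"
    show "coeff (f - psmult t (b (Suc n))) i = 0"
    proof (cases "i = Suc n")
      case True then show ?thesis using assms(2)[of "Suc n"] by (simp add: t_def)
    next
      case False
      then have "Suc n < i" using i by simp
      then show ?thesis using Suc.prems assms(1)[of "Suc n"] by (simp add: coeff_eq_0)
    qed
  qed
  from Suc.IH[OF this] obtain a where a: "f - psmult t (b (Suc n)) = (\<Sum>k\<le>n. psmult (a k) (b k))" by blast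
  have "f = (\<Sum>k\<le>Suc n. psmult ((a(Suc n := t)) k) (b k))"
  proof -
    have "(\<Sum>k\<le>n. psmult ((a(Suc n := t)) k) (b k)) = (\<Sum>k\<le>n. psmult (a k) (b k))"
      by (intro sum.cong) auto
    then show ?thesis using a by (simp add: algebra_simps)
  qed
  then show ?case by blast
qed

text \<open>Discrete orthogonality at the Chebyshev nodes; multiplied by \<open>2 * sin x\<close>
  the sum telescopes.\<close>

lemma sum_cos_odd:
  fixes L k :: nat
  assumes "0 < L" "0 < k" "k < 2 * L"
  shows "(\<Sum>j<L. cos (real k * ((2 * real j + 1) * (pi / (2 * real L))))) = 0"
proof -
  define x where "x = k * pi / (2 * real L)"
  have t: "(\<Sum>j<n. 2 * sin x * cos ((2 * real j + 1) * x)) = sin (2 * real n * x)" for n :: nat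
  proof (induction n)
    case (Suc n)
    have "sin ((2 * n + 1) * x + x) - sin ((2 * n + 1) * x - x) = 2 * sin x * cos ((2 * real n + 1) * x)"
      unfolding sin_add sin_diff by (simp add: algebra_simps)
    moreover have "(2 * n + 1) * x + x = 2 * real (Suc n) * x" "(2 * n + 1) * x - x = 2 * real n * x"
      by (simp_all add: algebra_simps)
    ultimately show ?case using Suc by simp
  qed simp
  have "2 * real L * x = k * pi" using assms by (simp add: x_def)
  then have "sin (2 * real L * x) = 0" using sin_npi[of k] by simp
  then have "2 * sin x * (\<Sum>j<L. cos ((2 * real j + 1) * x)) = 0" using t[of L] by (simp add: sum_distrib_left)
  moreover have "sin x > 0"
  proof (rule sin_gt_zero)
    show "0 < x" using assms by (simp add: x_def)
    have "real k / (2 * real L) < 1" using assms by simp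
    then show "x < pi" using mult_strict_right_mono[of "real k / (2 * real L)" 1 pi] by (simp add: x_def)
  qed
  ultimately have "(\<Sum>j<L. cos ((2 * real j + 1) * x)) = 0" by simp
  moreover have "real k * ((2 * real j + 1) * (pi / (2 * real L))) = (2 * real j + 1) * x" for j :: nat
    by (simp add: x_def)
  ultimately show ?thesis by simp
qed

text \<open>The coefficients are recovered by averaging over the Chebyshev nodes.\<close>

theorem chebT_coeff_bound:
  assumes f: "f = (\<Sum>k\<le>n. psmult (a k) (chebT k))" and m: "m \<le> n"
    and M: "\<And>x. -1 \<le> x ==> x \<le> 1 ==> \<bar>poly f x\<bar> \<le> M"
  shows "\<bar>a m\<bar> \<le> 2 * M"
proof -
  define L where "L = n + 1"
  define x where "x j = (2 * real j + 1) * (pi / (2 * real L))" for j :: nat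
  have L0: "0 < L" by (simp add: L_def)
  have cc: "(\<Sum>j<L. cos (real k * x j) * cos (real m * x j)) = (if k = m then (if m = 0 then real L else L / 2) else 0)"
    if "k \<le> n" for k
  proof -
    define D where "D = nat \<bar>int k - int m\<bar>"
    have p: "cos (real k * y) * cos (real m * y) = (cos (real (k + m) * y) + cos (real D * y)) / 2" for y
    proof -
      have "cos (real k * y - real m * y) = cos (real D * y)"
      proof (cases "m \<le> k")
        case True
        then have "real D = real k - real m" by (simp add: D_def)
        then show ?thesis by (simp add: left_diff_distrib)
      next
        case False
        then have "real D = real m - real k" by (simp add: D_def)
        then have "real k * y - real m * y = - (real D * y)" by (simp add: left_diff_distrib)
        then show ?thesis by (simp only: cos_minus)
      qed
      moreover have "real k * y + real m * y = real (k + m) * y" by (simp add: distrib_right)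
      ultimately show ?thesis unfolding cos_times_cos by simp
    qed
    have odd: "(\<Sum>j<L. cos (real i * x j)) = 0" if "0 < i" "i < 2 * L" for i
      using sum_cos_odd[OF L0 that] unfolding x_def .
    have s: "(\<Sum>j<L. cos (real k * x j) * cos (real m * x j))
        = ((\<Sum>j<L. cos (real (k + m) * x j)) + (\<Sum>j<L. cos (real D * x j))) / 2"
      unfolding p by (simp only: sum_divide_distrib[symmetric] sum.distrib)
    show ?thesis
    proof (cases "k = m")
      case True
      then have D: "D = 0" by (simp add: D_def)
      show ?thesis
      proof (cases "m = 0")
        case True
        then show ?thesis unfolding s D using \<open>k = m\<close> by simp
      next
        case False
        then have "(\<Sum>j<L. cos (real (k + m) * x j)) = 0" using m \<open>k = m\<close> by (intro odd) (auto simp: L_def)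
        then show ?thesis unfolding s D using \<open>k = m\<close> False by simp
      qed
    next
      case False
      then have "0 < D" "D < 2 * L" "0 < k + m" "k + m < 2 * L"
        using that m by (auto simp: L_def D_def)
      then show ?thesis using False odd[of D] odd[of "k + m"] unfolding s by simp
    qed
  qed
  have "(\<Sum>j<L. poly f (cos (x j)) * cos (real m * x j))
    = (\<Sum>k\<le>n. a k * (\<Sum>j<L. cos (real k * x j) * cos (real m * x j)))"
    unfolding f by (simp add: poly_sum chebT_cos sum_distrib_right sum_distrib_left sum.swap[of _ "{..<L}"] mult_ac)
  also have "... = (\<Sum>k\<le>n. if k = m then a k * (if m = 0 then real L else L / 2) else 0)"
    by (intro sum.cong refl) (use cc in auto)
  also have "... = a m * (if m = 0 then real L else L / 2)" using m by simp
  finally have e: "(\<Sum>j<L. poly f (cos (x j)) * cos (real m * x j)) = a m * (if m = 0 then real L else L / 2)" .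
  have "\<bar>a m\<bar> * (L / 2) \<le> \<bar>a m * (if m = 0 then real L else L / 2)\<bar>"
    by (auto simp: abs_mult intro!: mult_left_mono)
  also have "... \<le> (\<Sum>j<L. \<bar>poly f (cos (x j)) * cos (real m * x j)\<bar>)" unfolding e[symmetric] by (rule sum_abs)
  also have "... \<le> (\<Sum>j<L. M * 1)"
    unfolding abs_mult by (intro sum_mono mult_mono M) (auto intro: order.trans[OF abs_ge_zero M[of 0]])
  finally show ?thesis using L0 by (simp add: field_simps)
qed

lemma abs_sin_mult_le: "\<bar>sin (real n * t)\<bar> \<le> n * \<bar>sin t\<bar>"
proof (induction n)
  case (Suc n)
  have "\<bar>sin (real (Suc n) * t)\<bar> = \<bar>sin (n * t) * cos t + cos (n * t) * sin t\<bar>"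
    using sin_add[of "n * t" t] by (simp add: algebra_simps)
  also have "... \<le> \<bar>sin (n * t)\<bar> * \<bar>cos t\<bar> + \<bar>cos (n * t)\<bar> * \<bar>sin t\<bar>"
    by (metis abs_mult abs_triangle_ineq)
  also have "... \<le> \<bar>sin (n * t)\<bar> * 1 + 1 * \<bar>sin t\<bar>" by (intro add_mono mult_mono) auto
  finally show ?case using Suc by (simp add: algebra_simps)
qed simp

text \<open>Differentiating \<open>T_n(cos t) = cos (n t)\<close> reduces the bound to
  \<open>|sin (n t)| <= n * |sin t|\<close>.\<close>

lemma chebT_deriv_bound:
  assumes "-1 < x" "x < 1"
  shows "\<bar>poly (pderiv (chebT n)) x\<bar> \<le> (real n)^2"
proof -
  define t where "t = arccos x"
  have x: "x = cos t" using assms by (simp add: t_def)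
  have t: "0 < t" "t < pi" using assms arccos_lt_bounded[of x] by (auto simp: t_def)
  then have s: "sin t > 0" by (rule sin_gt_zero)
  have "((\<lambda>u. poly (chebT n) (cos u)) has_real_derivative poly (pderiv (chebT n)) (cos t) * (- sin t)) (at t)"
    by (auto intro!: derivative_eq_intros)
  moreover have "((\<lambda>u. cos (n * u)) has_real_derivative - sin (n * t) * n) (at t)"
    by (auto intro!: derivative_eq_intros)
  ultimately have "poly (pderiv (chebT n)) (cos t) * (- sin t) = - sin (n * t) * n"
    unfolding chebT_cos by (rule DERIV_unique)
  then have "\<bar>poly (pderiv (chebT n)) x\<bar> * sin t = \<bar>sin (n * t)\<bar> * n"
    using s unfolding x by (metis abs_minus_cancel abs_mult abs_of_nat abs_of_pos mult_minus_left mult_minus_right)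
  also have "... \<le> (n * sin t) * n" using abs_sin_mult_le[of n t] s by (intro mult_right_mono) auto
  finally show ?thesis using s by (simp add: power2_eq_square)
qed

text \<open>Termwise in the Chebyshev expansion: \<open>n\<close> coefficients of size at most
  \<open>2 * M\<close>, each with a derivative of size at most \<open>n^2\<close>. A cubic factor is
  good enough for polylogarithmic degrees.\<close>

lemma markov_weak:
  assumes n: "degree f \<le> n" and M: "\<And>x. -1 \<le> x ==> x \<le> 1 ==> \<bar>poly f x\<bar> \<le> M"
    and x: "-1 < x" "x < 1"
  shows "\<bar>poly (pderiv f) x\<bar> \<le> 2 * real n ^ 3 * M"
proof -
  have "\<exists>a. f = (\<Sum>k\<le>n. psmult (a k) (chebT k))"
    by (rule poly_basis_expansion[OF _ _ n]) (use degree_chebT in auto)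
  then obtain a where a: "f = (\<Sum>k\<le>n. psmult (a k) (chebT k))" by blast
  have M0: "0 \<le> M" using M[of 0] by linarith
  have "\<bar>poly (pderiv f) x\<bar> = \<bar>\<Sum>k\<in>{1..n}. a k * poly (pderiv (chebT k)) x\<bar>"
  proof -
    have "poly (pderiv f) x = (\<Sum>k\<le>n. a k * poly (pderiv (chebT k)) x)"
      unfolding a by (simp add: pderiv_sum pderiv_smult poly_sum)
    also have "... = (\<Sum>k\<in>{1..n}. a k * poly (pderiv (chebT k)) x)"
      by (rule sum.mono_neutral_right) (auto simp: not_le)
    finally show ?thesis by simp
  qed
  also have "... \<le> (\<Sum>k\<in>{1..n}. \<bar>a k * poly (pderiv (chebT k)) x\<bar>)" by (rule sum_abs)
  also have "... \<le> (\<Sum>k\<in>{1..n}. (2 * M) * (real n)^2)"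
  proof (intro sum_mono)
    fix k assume k: "k \<in> {1..n}"
    have "\<bar>poly (pderiv (chebT k)) x\<bar> \<le> (real k)^2" by (rule chebT_deriv_bound[OF x])
    also have "... \<le> (real n)^2" using k by (intro power_mono) auto
    finally show "\<bar>a k * poly (pderiv (chebT k)) x\<bar> \<le> (2 * M) * (real n)^2"
      unfolding abs_mult using chebT_coeff_bound[OF a _ M, of k] k M0 by (intro mult_mono) auto
  qed
  finally show ?thesis by (simp add: power2_eq_square power3_eq_cube mult_ac)
qed

lemma markov_weak_interval:
  assumes n: "degree f \<le> n" and b: "0 < b" and M: "\<And>x. 0 \<le> x ==> x \<le> b ==> \<bar>poly f x\<bar> \<le> M"
    and x: "0 < x" "x < b"
  shows "\<bar>poly (pderiv f) x\<bar> \<le> 4 * real n ^ 3 * M / b"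
proof -
  define q where "q = [:b/2, b/2:]"
  define g where "g = pcompose f q"
  define y where "y = 2 * x / b - 1"
  have g: "degree g \<le> n" using n by (simp add: g_def q_def)
  have qy: "poly q u = b / 2 * (u + 1)" for u by (simp add: q_def algebra_simps)
  have "\<bar>poly g u\<bar> \<le> M" if "-1 \<le> u" "u \<le> 1" for u
    unfolding g_def poly_pcompose
    by (rule M) (use that b mult_left_mono[of u 1 "b/2"] in \<open>auto simp: qy\<close>)
  then have "\<bar>poly (pderiv g) y\<bar> \<le> 2 * real n ^ 3 * M"
    by (rule markov_weak[OF g]) (use x b in \<open>auto simp: y_def field_simps\<close>)
  moreover have "poly (pderiv g) y = poly (pderiv f) x * (b / 2)"
    using b by (simp add: g_def pderiv_pcompose poly_pcompose qy y_def, simp add: q_def pderiv_pCons)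
  ultimately show ?thesis using b by (simp add: abs_mult field_simps)
qed

lemma markov_weak_closed:
  assumes n: "degree f \<le> n" and b: "0 < b" and M: "\<And>x. 0 \<le> x ==> x \<le> b ==> \<bar>poly f x\<bar> \<le> M"
    and x: "0 \<le> x" "x \<le> b"
  shows "\<bar>poly (pderiv f) x\<bar> \<le> 4 * real n ^ 3 * M / b"
proof -
  have "x \<in> closure {0<..<b}" using b x by simp
  moreover have "continuous_on (closure {0<..<b}) (\<lambda>x. \<bar>poly (pderiv f) x\<bar>)" by (intro continuous_intros)
  ultimately show ?thesis
    using continuous_le_on_closure[of "{0<..<b}" "\<lambda>x. \<bar>poly (pderiv f) x\<bar>" x] markov_weak_interval[OF n b M] by auto
qed

lemma poly_lipschitz:
  fixes f :: "real poly"
  assumes "x \<le> y" and M: "\<And>z. x \<le> z ==> z \<le> y ==> \<bar>poly (pderiv f) z\<bar> \<le> M"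
  shows "\<bar>poly f y - poly f x\<bar> \<le> (y - x) * M"
proof (cases "x = y")
  case False
  then have "x < y" using assms by simp
  from poly_MVT[OF this, of f] obtain z where "x < z" "z < y" "poly f y - poly f x = (y - x) * poly (pderiv f) z" by blast
  then show ?thesis using M[of z] assms by (simp add: abs_mult mult_left_mono)
qed simp

text \<open>The points \<open>1/N\<close> with \<open>N\<close> even are dense enough in a short interval to control a polynomial.\<close>

lemma poly_bound_from_reciprocals:
  fixes f :: "real poly"
  assumes K: "degree f \<le> K" and f: "\<And>N. even N ==> n1 \<le> N ==> \<bar>poly f (1 / real N)\<bar> \<le> 1"
    and n1: "16 * K ^ 3 \<le> n1" "0 < n1" and y: "0 \<le> y" "y \<le> 1 / real n1"
  shows "\<bar>poly f y\<bar> \<le> 2"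
proof -
  define b where "b = 1 / real n1"
  have b: "0 < b" using n1 by (simp add: b_def)
  have "\<exists>x\<in>{0..b}. \<forall>y\<in>{0..b}. \<bar>poly f y\<bar> \<le> \<bar>poly f x\<bar>"
    by (rule continuous_attains_sup) (use b in \<open>auto intro!: continuous_intros\<close>)
  then obtain x where x: "0 \<le> x" "x \<le> b" and max: "\<And>y. 0 \<le> y ==> y \<le> b ==> \<bar>poly f y\<bar> \<le> \<bar>poly f x\<bar>" by auto
  define M where "M = \<bar>poly f x\<bar>"
  have M0: "0 \<le> M" by (simp add: M_def)
  have "M \<le> 2"
  proof (cases "x = 0")
    case True
    have "(\<lambda>k. \<bar>poly f (1 / real (2 * k + 2 * n1))\<bar>) \<longlonglongrightarrow> \<bar>poly f 0\<bar>"
    proof (intro tendsto_intros)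
      show "(\<lambda>k. 1 / real (2 * k + 2 * n1)) \<longlonglongrightarrow> 0" by real_asymp
    qed
    moreover have "\<bar>poly f (1 / real (2 * k + 2 * n1))\<bar> \<le> 1" for k by (rule f) auto
    ultimately have "\<bar>poly f 0\<bar> \<le> 1" by (intro LIMSEQ_le_const2) auto
    then show ?thesis using True by (simp add: M_def)
  next
    case False
    then have x0: "0 < x" using x by simp
    \<comment> \<open>\<open>2 * k\<close> is the first even integer whose reciprocal is at most
      \<open>x\<close>, so \<open>x\<close> is within \<open>2 * b * b\<close> of a point where the
      bound 1 is known.\<close>
    define k where "k = nat \<lceil>1 / (2 * x)\<rceil>"
    define N where "N = 2 * k"
    have k: "1 / (2 * x) \<le> real k" "real k < 1 / (2 * x) + 1"
      using x0 by (auto simp: k_def) linarith+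
    have N: "1 / x \<le> real N" "real N < 1 / x + 2" using k by (auto simp: N_def field_simps)
    have Npos: "real N > 0" 
    proof -
      have "0 < 1 / x" using x0 by simp
      then show ?thesis using N(1) by linarith
    qed
    have "real n1 \<le> 1 / x" using x x0 n1 by (simp add: b_def field_simps)
    then have "n1 \<le> N" using N(1) by linarith
    then have fN: "\<bar>poly f (1 / real N)\<bar> \<le> 1" by (intro f) (auto simp: N_def)
    have Nx: "1 / real N \<le> x" using N(1) x0 Npos by (simp add: field_simps)
    have "x * real N \<le> 1 + 2 * x"
      using mult_left_mono[OF less_imp_le[OF N(2)], of x] x0 by (simp add: distrib_left)
    then have "x \<le> (1 + 2 * x) / real N" using Npos by (simp add: pos_le_divide_eq)
    then have "x - 1 / real N \<le> 2 * x / real N" by (simp add: add_divide_distrib)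
    also have "... = 2 * x * (1 / real N)" by simp
    also have "... \<le> 2 * b * b" using Nx x x0 Npos b by (intro mult_mono) auto
    finally have gap: "x - 1 / real N \<le> 2 * b * b" .
    have "\<bar>poly f x - poly f (1 / real N)\<bar> \<le> (x - 1 / real N) * (4 * real K ^ 3 * M / b)"
      by (rule poly_lipschitz[OF Nx], rule markov_weak_closed[OF K b])
        (use max x Npos in \<open>auto simp: M_def intro: order_trans[of 0 "1 / real N"]\<close>)
    also have "... \<le> (2 * b * b) * (4 * real K ^ 3 * M / b)"
      using gap M0 b by (intro mult_right_mono) auto
    also have "... = M * (8 * real K ^ 3 * b)" using b by (simp add: field_simps)
    \<comment> \<open>With \<open>n1\<close> at least \<open>16 * K^3\<close> the variation over the
      gap is at most half of the maximum, so \<open>M <= 1 + M / 2\<close>.\<close>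
    also have "... \<le> M * (1 / 2)"
    proof -
      have "real (16 * K ^ 3) \<le> real n1" using n1(1) by (rule of_nat_mono)
      then have "8 * real K ^ 3 * b \<le> 1 / 2" using n1 by (simp add: b_def field_simps)
      then show ?thesis using M0 by (intro mult_left_mono) auto
    qed
    finally show ?thesis using fN unfolding M_def by linarith
  qed
  then show ?thesis using max[of y] y unfolding M_def b_def by linarith
qed

text \<open>The bound 2 on the whole interval, fed twice into the Markov inequality, bounds the
  second derivative by \<open>2 * (4 * K^3 * n1)^2\<close>, the constant in the remainder.\<close>

theorem poly_taylor_from_reciprocals:
  fixes f :: "real poly"
  assumes K: "degree f \<le> K" and f: "\<And>N. even N ==> n1 \<le> N ==> \<bar>poly f (1 / real N)\<bar> \<le> 1"
    and n1: "16 * K ^ 3 \<le> n1" "0 < n1" and x: "0 \<le> x" "x \<le> 1 / real n1"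
  shows "\<bar>poly f x - poly f 0 - x * poly (pderiv f) 0\<bar> \<le> 32 * real K ^ 6 * (real n1)^2 * x^2"
proof -
  define b where "b = 1 / real n1"
  have b: "0 < b" using n1 by (simp add: b_def)
  have 0: "\<bar>poly f y\<bar> \<le> 2" if "0 \<le> y" "y \<le> b" for y
    by (rule poly_bound_from_reciprocals[OF K f n1]) (use that in \<open>auto simp: b_def\<close>)
  have 1: "\<bar>poly (pderiv f) y\<bar> \<le> 4 * real K ^ 3 * 2 / b" if "0 \<le> y" "y \<le> b" for y
    by (rule markov_weak_closed[OF K b 0 that])
  have dK: "degree (pderiv f) \<le> K" using K by (simp add: degree_pderiv)
  have 2: "\<bar>poly (pderiv (pderiv f)) y\<bar> \<le> 4 * real K ^ 3 * (4 * real K ^ 3 * 2 / b) / b" if "0 \<le> y" "y \<le> b" for y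
    by (rule markov_weak_closed[OF dK b 1 that])
  define B where "B = 4 * real K ^ 3 * (4 * real K ^ 3 * 2 / b) / b"
  have Beq: "B = 32 * real K ^ 6 * (real n1)^2"
    using n1 by (simp add: B_def b_def power2_eq_square field_simps flip: power_add)
  have xb: "x \<le> b" using x by (simp add: b_def)
  define g where "g = f - [:0, poly (pderiv f) 0:]"
  have g': "pderiv g = pderiv f - [:poly (pderiv f) 0:]" by (simp add: g_def pderiv_diff pderiv_pCons)
  have "\<bar>poly (pderiv g) z\<bar> \<le> x * B" if z: "0 \<le> z" "z \<le> x" for z
  proof -
    have "\<bar>poly (pderiv f) z - poly (pderiv f) 0\<bar> \<le> (z - 0) * B"
      by (rule poly_lipschitz) (use z xb 2 in \<open>auto simp: B_def\<close>)
    also have "... \<le> x * B" using z by (intro mult_right_mono) (auto simp: Beq)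
    finally show ?thesis unfolding g' by simp
  qed
  then have "\<bar>poly g x - poly g 0\<bar> \<le> (x - 0) * (x * B)"
    by (intro poly_lipschitz x) auto
  then show ?thesis unfolding Beq by (simp add: g_def power2_eq_square algebra_simps)
qed

section \<open>Non-backtracking polynomials\<close>

text \<open>The polynomials expressing counts of non-backtracking walks in the adjacency operator of a
  \<open>(p+1)\<close>-regular graph.\<close>

fun nb_poly :: "real => nat => real poly" where
  "nb_poly p 0 = 1"
| "nb_poly p (Suc 0) = [:0, 1:]"
| "nb_poly p (Suc (Suc 0)) = [:- (p + 1), 0, 1:]"
| "nb_poly p (Suc (Suc (Suc m))) = [:0, 1:] * nb_poly p (Suc (Suc m)) - psmult p (nb_poly p (Suc m))"

text \<open>The same recurrence without the exceptional start, i.e. rescaled Chebyshev polynomials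
  of the second kind; in \<open>nb_poly\<close> the first step of a walk has \<open>p + 1\<close>
  choices instead of \<open>p\<close>.\<close>

fun nb_polyU :: "real => nat => real poly" where
  "nb_polyU p 0 = 1"
| "nb_polyU p (Suc 0) = [:0, 1:]"
| "nb_polyU p (Suc (Suc m)) = [:0, 1:] * nb_polyU p (Suc m) - psmult p (nb_polyU p m)"

lemma nb_poly_U: "nb_poly p (Suc (Suc m)) = nb_polyU p (Suc (Suc m)) - nb_polyU p m"
proof (rule poly_eq_poly_eq_iff[THEN iffD1], rule ext)
  fix x
  define n u where "n i = poly (nb_poly p i) x" and "u i = poly (nb_polyU p i) x" for i
  have n: "n (Suc 0) = x" "n (Suc (Suc 0)) = x * x - p - 1" "\<And>i. n (Suc (Suc (Suc i))) = x * n (Suc (Suc i)) - p * n (Suc i)"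
    by (auto simp: n_def algebra_simps)
  have u: "u 0 = 1" "u (Suc 0) = x" "\<And>i. u (Suc (Suc i)) = x * u (Suc i) - p * u i"
    by (auto simp: u_def)
  have "n (Suc (Suc m)) = u (Suc (Suc m)) - u m"
  proof (induction m rule: less_induct)
    case (less m)
    consider "m = 0" | "m = Suc 0" | k where "m = Suc (Suc k)" by (metis not0_implies_Suc)
    then show ?case
    proof cases
      case 3
      then show ?thesis using less.IH[of k] less.IH[of "Suc k"]
        by (simp add: n(3) u(3)[of "Suc (Suc k)"] u(3)[of k] right_diff_distrib)
    qed (simp_all add: n u algebra_simps)
  qed
  then show "poly (nb_poly p (Suc (Suc m))) x = poly (nb_polyU p (Suc (Suc m)) - nb_polyU p m) x"
    unfolding n_def u_def by simp
qed

lemma nb_polyU_sum: "nb_polyU p m = (\<Sum>i\<le>m. psmult (if even (m - i) then 1 else 0) (nb_poly p i))"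
proof (induction m rule: less_induct)
  case (less m)
  show ?case
  proof (cases m)
    case (Suc m1)
    show ?thesis
    proof (cases m1)
      case (Suc k)
      have "(\<Sum>i\<le>Suc (Suc k). psmult (if even (Suc (Suc k) - i) then 1 else 0) (nb_poly p i))
        = nb_poly p (Suc (Suc k)) + (\<Sum>i\<le>k. psmult (if even (Suc (Suc k) - i) then 1 else 0) (nb_poly p i))"
        by simp
      also have "(\<Sum>i\<le>k. psmult (if even (Suc (Suc k) - i) then 1 else 0) (nb_poly p i)) = nb_polyU p k"
        unfolding less.IH[of k, unfolded \<open>m = Suc m1\<close> Suc, OF less_trans[OF lessI lessI]]
        by (intro sum.cong) (auto simp: Suc_diff_le)
      also have "nb_poly p (Suc (Suc k)) + nb_polyU p k = nb_polyU p (Suc (Suc k))" by (simp only: nb_poly_U diff_add_cancel)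
      finally show ?thesis using \<open>m = Suc m1\<close> Suc by simp
    qed (use Suc in simp)
  qed simp
qed

text \<open>Rescaled form of \<open>2 T_k = U_k - U_(k-2)\<close>; both sides obey the recurrence of
  \<open>nb_polyU\<close>.\<close>

lemma cheb_nb:
  assumes p: "0 < p"
  defines "q \<equiv> [:0, 1 / (2 * sqrt p):]"
  shows "psmult (2 * sqrt p ^ Suc (Suc k)) (pcompose (chebT (Suc (Suc k))) q)
    = nb_polyU p (Suc (Suc k)) - psmult p (nb_polyU p k)"
proof -
  have sp: "sqrt p * sqrt p = p" "sqrt p ~= 0" using p by auto
  show ?thesis
  proof (rule poly_eq_poly_eq_iff[THEN iffD1], rule ext)
    fix x
    define t u where "t i = 2 * sqrt p ^ i * poly (chebT i) (x / (2 * sqrt p))" and "u i = poly (nb_polyU p i) x" for i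
    have u: "u 0 = 1" "u (Suc 0) = x" "\<And>i. u (Suc (Suc i)) = x * u (Suc i) - p * u i"
      by (auto simp: u_def)
    have t: "t 0 = 2" "t (Suc 0) = x" using sp by (auto simp: t_def)
    have t2: "t (Suc (Suc i)) = x * t (Suc i) - p * t i" for i
    proof -
      have "t (Suc (Suc i)) = 2 * (sqrt p * sqrt p * sqrt p ^ i) * (2 * (x / (2 * sqrt p)) * poly (chebT (Suc i)) (x / (2 * sqrt p)) - poly (chebT i) (x / (2 * sqrt p)))"
        by (simp add: t_def mult.assoc)
      also have "... = x * t (Suc i) - p * t i" unfolding sp(1) using sp
        by (simp add: t_def field_simps)
      finally show ?thesis .
    qed
    have "t (Suc (Suc k)) = u (Suc (Suc k)) - p * u k"
    proof (induction k rule: less_induct)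
      case (less m)
      consider "m = 0" | "m = Suc 0" | k where "m = Suc (Suc k)" by (metis not0_implies_Suc)
      then show ?case
      proof cases
        case 3
        then show ?thesis using less.IH[of k] less.IH[of "Suc k"]
          by (simp add: t2[of "Suc (Suc k)"] u(3)[of "Suc (Suc k)"] right_diff_distrib) (simp add: u(3) algebra_simps)
      qed (simp_all add: t t2 u algebra_simps)
    qed
    then show "poly (psmult (2 * sqrt p ^ Suc (Suc k)) (pcompose (chebT (Suc (Suc k))) q)) x
      = poly (nb_polyU p (Suc (Suc k)) - psmult p (nb_polyU p k)) x"
      unfolding t_def u_def by (simp add: poly_pcompose q_def)
  qed
qed

text \<open>Expanding \<open>nb_polyU\<close> gives the coefficient \<open>1 / (2 * p^(k/2))\<close>
  for \<open>i = k\<close> and \<open>-(p - 1) / (2 * p^(k/2))\<close> for \<open>i <= k - 2\<close>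
  of the same parity; in the latter case \<open>p^(i/2) * (p - 1) <= p^(k/2)\<close>.\<close>

lemma cheb_nb_expansion:
  assumes p: "1 \<le> p"
  shows "\<exists>\<tau>. pcompose (chebT k) [:0, 1 / (2 * sqrt p):] = (\<Sum>i\<le>k. psmult (\<tau> i) (nb_poly p i))
     & (\<forall>i\<le>k. \<bar>\<tau> i\<bar> * sqrt p ^ i \<le> 1)"
proof -
  have sp: "1 \<le> sqrt p" "sqrt p * sqrt p = p" using p by auto
  have p0: "0 < p" using p by simp
  consider "k = 0" | "k = Suc 0" | j where "k = Suc (Suc j)" by (metis not0_implies_Suc)
  then show ?thesis
  proof cases
    case 1 then show ?thesis by (intro exI[of _ "\<lambda>_. 1"]) simp
  next
    case 2
    then show ?thesis using sp by (intro exI[of _ "\<lambda>i. if i = 0 then 0 else 1 / (2 * sqrt p)"]) (auto simp: le_Suc_eq)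
  next
    case 3
    let ?c = "1 / (2 * sqrt p ^ k)"
    define \<tau> where "\<tau> i = (if i = k then ?c else if i \<le> j & even (j - i) then - (p - 1) * ?c else 0)" for i
    have nz: "sqrt p ^ k ~= 0" using sp by simp
    have "pcompose (chebT k) [:0, 1 / (2 * sqrt p):]
      = psmult ?c (nb_polyU p k - psmult p (nb_polyU p j))"
      unfolding 3 cheb_nb[OF p0, symmetric] smult_smult using nz 3 sp by (simp del: chebT.simps)
    also have "nb_polyU p k = nb_poly p k + nb_polyU p j" unfolding 3 nb_poly_U by simp
    also have "psmult ?c (nb_poly p k + nb_polyU p j - psmult p (nb_polyU p j))
      = psmult ?c (nb_poly p k) + psmult (- (p - 1) * ?c) (nb_polyU p j)"
      by (rule poly_eq_poly_eq_iff[THEN iffD1], rule ext) (simp add: algebra_simps add_divide_distrib diff_divide_distrib)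
    also have "psmult (- (p - 1) * ?c) (nb_polyU p j) = (\<Sum>i\<le>j. psmult (\<tau> i) (nb_poly p i))"
      unfolding nb_polyU_sum[of p j] smult_sum2 using 3 by (intro sum.cong) (auto simp: \<tau>_def)
    also have "psmult ?c (nb_poly p k) + ... = (\<Sum>i\<le>k. psmult (\<tau> i) (nb_poly p i))"
      using 3 by (simp add: \<tau>_def)
    finally have e: "pcompose (chebT k) [:0, 1 / (2 * sqrt p):] = (\<Sum>i\<le>k. psmult (\<tau> i) (nb_poly p i))" .
    have "\<bar>\<tau> i\<bar> * sqrt p ^ i \<le> 1" if "i \<le> k" for i
    proof -
      have "i = k \<or> (i \<le> j & even (j - i) & i ~= k) \<or> \<tau> i = 0" unfolding \<tau>_def by meson
      then consider "i = k" | "i \<le> j" "even (j - i)" "i ~= k" | "\<tau> i = 0" by blast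
      then show ?thesis
      proof cases
        case 1 then show ?thesis using nz sp by (simp add: \<tau>_def)
      next
        case 2
        then have "sqrt p ^ k = sqrt p ^ i * sqrt p ^ (j - i) * p" using 3 sp by (simp add: power_add[symmetric] mult.assoc)
        moreover have "1 \<le> sqrt p ^ (j - i)" using sp by (simp add: one_le_power)
        ultimately have "(p - 1) * sqrt p ^ i \<le> 2 * sqrt p ^ k"
        proof -
          have A: "0 \<le> sqrt p ^ i" using sp by simp
          have "(p - 1) * sqrt p ^ i \<le> p * sqrt p ^ i * 1" using A by (simp add: mult_right_mono)
          also have "... \<le> p * sqrt p ^ i * sqrt p ^ (j - i)"
            using \<open>1 \<le> sqrt p ^ (j - i)\<close> A p by (intro mult_left_mono mult_nonneg_nonneg) auto
          also have "... = sqrt p ^ k" using \<open>sqrt p ^ k = _\<close> by (simp add: mult_ac)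
          also have "... \<le> 2 * sqrt p ^ k" using sp by simp
          finally show ?thesis .
        qed
        then show ?thesis using 2 nz sp p by (simp add: \<tau>_def abs_mult field_simps)
      qed simp
    qed
    then show ?thesis using e by blast
  qed
qed

text \<open>Smallness on the interval \<open>[-2 sqrt p, 2 sqrt p]\<close> turns into coefficients
  of order \<open>p^(-i/2)\<close>, which offsets the growth \<open>p^(m/2)\<close> of the error in
  \<open>sum_ret_deriv\<close>.\<close>

theorem nb_coeff_bound:
  assumes p: "1 \<le> p" and n: "degree f \<le> n"
    and M: "\<And>x. \<bar>x\<bar> \<le> 2 * sqrt p ==> \<bar>poly f x\<bar> \<le> M"
  shows "\<exists>c. f = (\<Sum>i\<le>n. psmult (c i) (nb_poly p i)) & (\<forall>i\<le>n. \<bar>c i\<bar> * sqrt p ^ i \<le> 2 * (real n + 1) * M)"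
proof -
  have sp: "0 < sqrt p" using p by simp
  define g where "g = pcompose f [:0, 2 * sqrt p:]"
  have "degree g \<le> n" using n by (simp add: g_def)
  then have "\<exists>a. g = (\<Sum>k\<le>n. psmult (a k) (chebT k))"
    by (intro poly_basis_expansion) (use degree_chebT in auto)
  then obtain a where a: "g = (\<Sum>k\<le>n. psmult (a k) (chebT k))" by blast
  have ab: "\<bar>a k\<bar> \<le> 2 * M" if "k \<le> n" for k
  proof (rule chebT_coeff_bound[OF a that])
    fix x :: real assume "-1 \<le> x" "x \<le> 1"
    then have "\<bar>2 * sqrt p * x\<bar> \<le> 2 * sqrt p" using sp by (simp add: abs_mult)
    then show "\<bar>poly g x\<bar> \<le> M" unfolding g_def poly_pcompose using M by (simp add: mult_ac)
  qed
  have M0: "0 \<le> M" using ab[of 0] by linarith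
  from cheb_nb_expansion[OF p] obtain \<tau> where \<tau>:
    "\<And>k. pcompose (chebT k) [:0, 1 / (2 * sqrt p):] = (\<Sum>i\<le>k. psmult (\<tau> k i) (nb_poly p i))"
    "\<And>k i. i \<le> k ==> \<bar>\<tau> k i\<bar> * sqrt p ^ i \<le> 1" by metis
  have "f = pcompose g [:0, 1 / (2 * sqrt p):]"
    using sp by (simp add: g_def pcompose_assoc[symmetric] pcompose_pCons pcompose_idR)
  also have "... = (\<Sum>k\<le>n. psmult (a k) (\<Sum>i\<le>k. psmult (\<tau> k i) (nb_poly p i)))"
    unfolding a by (simp add: pcompose_sum pcompose_smult \<tau>)
  also have "... = (\<Sum>k\<le>n. \<Sum>i\<le>n. psmult (if i \<le> k then a k * \<tau> k i else 0) (nb_poly p i))"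
  proof (intro sum.cong refl)
    fix k assume "k \<in> {..n}"
    then show "psmult (a k) (\<Sum>i\<le>k. psmult (\<tau> k i) (nb_poly p i))
      = (\<Sum>i\<le>n. psmult (if i \<le> k then a k * \<tau> k i else 0) (nb_poly p i))"
      unfolding smult_sum2 by (intro sum.mono_neutral_cong_left) auto
  qed
  also have "... = (\<Sum>i\<le>n. psmult (\<Sum>k\<le>n. if i \<le> k then a k * \<tau> k i else 0) (nb_poly p i))"
    by (subst sum.swap) (simp add: smult_sum)
  finally have e: "f = (\<Sum>i\<le>n. psmult (\<Sum>k\<le>n. if i \<le> k then a k * \<tau> k i else 0) (nb_poly p i))" .
  have "\<bar>\<Sum>k\<le>n. if i \<le> k then a k * \<tau> k i else 0\<bar> * sqrt p ^ i \<le> 2 * (real n + 1) * M" for i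
  proof -
    have "\<bar>\<Sum>k\<le>n. if i \<le> k then a k * \<tau> k i else 0\<bar> * sqrt p ^ i
      \<le> (\<Sum>k\<le>n. \<bar>if i \<le> k then a k * \<tau> k i else 0\<bar>) * sqrt p ^ i"
      using sp by (intro mult_right_mono sum_abs) auto
    also have "... = (\<Sum>k\<le>n. \<bar>if i \<le> k then a k * \<tau> k i else 0\<bar> * sqrt p ^ i)" by (rule sum_distrib_right)
    also have "... \<le> (\<Sum>k\<le>n. 2 * M)"
    proof (intro sum_mono)
      fix k assume k: "k \<in> {..n}"
      show "\<bar>if i \<le> k then a k * \<tau> k i else 0\<bar> * sqrt p ^ i \<le> 2 * M"
      proof (cases "i \<le> k")
        case True
        have "\<bar>a k\<bar> * (\<bar>\<tau> k i\<bar> * sqrt p ^ i) \<le> (2 * M) * 1"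
          using ab[of k] \<tau>(2)[OF True] k sp M0 by (intro mult_mono) auto
        then show ?thesis using True by (simp add: abs_mult mult.assoc)
      qed (use M0 in simp)
    qed
    finally show ?thesis by (simp add: algebra_simps)
  qed
  then show ?thesis using e by (intro exI[of _ "\<lambda>i. \<Sum>k\<le>n. if i \<le> k then a k * \<tau> k i else 0"] conjI) auto
qed

section \<open>Spectra\<close>

lemma symmetric_real_eigenvector:
  assumes A: "A \<in> carrier_mat n n" and sym: "\<And>i j. i < n ==> j < n ==> A $$ (i, j) = (A $$ (j, i) :: real)" and n: "0 < n"
  shows "\<exists>(v :: nat => real) l. (\<Sum>i<n. (v i)^2) = 1 & (\<forall>i<n. (\<Sum>j<n. A $$ (i, j) * v j) = l * v i)"
proof -
  let ?C = "map_mat complex_of_real A"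
  have C: "?C \<in> carrier_mat n n" using A by simp
  then obtain z where "eigenvalue ?C z" using spectrum_non_empty[OF C n] by (auto simp: spectrum_def)
  then obtain x where x: "x \<in> carrier_vec n" "x ~= 0\<^sub>v n" "?C *\<^sub>v x = z \<cdot>\<^sub>v x"
    using C unfolding eigenvalue_def eigenvector_def by auto
  have ev: "(\<Sum>j<n. complex_of_real (A $$ (i, j)) * (x $ j)) = z * x $ i" if "i < n" for i
  proof -
    have "(?C *\<^sub>v x) $ i = (\<Sum>j<n. complex_of_real (A $$ (i, j)) * (x $ j))"
      using that A x(1) by (simp add: scalar_prod_def atLeast0LessThan)
    moreover have "(z \<cdot>\<^sub>v x) $ i = z * x $ i" using x(1) that by simp
    ultimately show ?thesis by (simp only: x(3))
  qed
  define R where "R = (\<Sum>i<n. (cmod (x $ i))^2)"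
  obtain i0 where i0: "i0 < n" "x $ i0 ~= 0" using x(1,2) by (metis eq_vecI carrier_vecD index_zero_vec)
  have R: "R > 0" unfolding R_def using i0 by (intro sum_pos2[of _ i0]) auto
  define F where "F = (\<Sum>i<n. \<Sum>j<n. cnj (x $ i) * complex_of_real (A $$ (i, j)) * (x $ j))"
  have F: "F = z * of_real R"
  proof -
    have "F = (\<Sum>i<n. cnj (x $ i) * (\<Sum>j<n. complex_of_real (A $$ (i, j)) * (x $ j)))"
      unfolding F_def by (simp add: sum_distrib_left mult.assoc)
    also have "... = (\<Sum>i<n. cnj (x $ i) * (z * x $ i))" using ev by (intro sum.cong) auto
    also have "... = z * (\<Sum>i<n. x $ i * cnj (x $ i))" by (simp add: sum_distrib_left mult_ac)
    also have "(\<Sum>i<n. x $ i * cnj (x $ i)) = of_real R"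
      unfolding R_def of_real_sum complex_norm_square ..
    finally show ?thesis .
  qed
  have "cnj F = (\<Sum>i<n. \<Sum>j<n. x $ i * complex_of_real (A $$ (i, j)) * cnj (x $ j))"
    unfolding F_def by simp
  also have "... = (\<Sum>j<n. \<Sum>i<n. x $ i * complex_of_real (A $$ (i, j)) * cnj (x $ j))" by (rule sum.swap)
  also have "... = F" unfolding F_def by (intro sum.cong refl) (use sym in \<open>auto simp: mult_ac\<close>)
  finally have "cnj z * of_real R = z * of_real R" unfolding F by simp
  then have "cnj z = z" using R by simp
  then have zr: "z = of_real (Re z)" by (metis Reals_cnj_iff of_real_Re)
  then have imz: "Im z = 0" by (metis Im_complex_of_real)
  have re: "(\<Sum>j<n. A $$ (i, j) * Re (x $ j)) = Re z * Re (x $ i)" if "i < n" for i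
    using arg_cong[OF ev[OF that], of Re] imz by simp
  have im: "(\<Sum>j<n. A $$ (i, j) * Im (x $ j)) = Re z * Im (x $ i)" if "i < n" for i
    using arg_cong[OF ev[OF that], of Im] imz by simp
  \<comment> \<open>Both \<open>A\<close> and \<open>z\<close> are real, so the real and the
    imaginary part of \<open>x\<close> satisfy the eigenvector equation separately, and one of them
    is nonzero.\<close>
  have "Re (x $ i0) ~= 0 \<or> Im (x $ i0) ~= 0" using i0(2) by (simp add: complex_eq_iff)
  then have "\<exists>y. y i0 ~= 0 & (\<forall>i<n. (\<Sum>j<n. A $$ (i, j) * y j) = Re z * y i)"
  proof
    assume "Re (x $ i0) ~= 0"
    then show ?thesis using re by (intro exI[of _ "\<lambda>i. Re (x $ i)"]) simp
  next
    assume "Im (x $ i0) ~= 0"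
    then show ?thesis using im by (intro exI[of _ "\<lambda>i. Im (x $ i)"]) simp
  qed
  then obtain y where y: "y i0 ~= 0" "\<And>i. i < n ==> (\<Sum>j<n. A $$ (i, j) * y j) = Re z * y i" by blast
  define r where "r = sqrt (\<Sum>i<n. (y i)^2)"
  have r: "r > 0" unfolding r_def real_sqrt_gt_0_iff using y i0 by (intro sum_pos2[of _ i0]) auto
  have "(\<Sum>i<n. (y i / r)^2) = (\<Sum>i<n. (y i)^2) / r^2" by (simp add: power_divide sum_divide_distrib)
  also have "... = 1" using r by (simp add: r_def)
  finally have "(\<Sum>i<n. (y i / r)^2) = 1" .
  moreover have "(\<Sum>j<n. A $$ (i, j) * (y j / r)) = Re z * (y i / r)" if "i < n" for i
    using y(2)[OF that] by (simp add: sum_divide_distrib[symmetric])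
  ultimately show ?thesis by (intro exI[of _ "\<lambda>i. y i / r"] exI[of _ "Re z"]) simp
qed

lemma mat_prod_entry:
  assumes "A \<in> carrier_mat n m" "B \<in> carrier_mat m k" "i < n" "j < k"
  shows "(A * B) $$ (i, j) = (\<Sum>l<m. A $$ (i, l) * B $$ (l, j))"
  using assms by (simp add: scalar_prod_def atLeast0LessThan)

text \<open>The reflection exchanging \<open>v\<close> with the first unit vector. If the two
  coincide then \<open>r = 0\<close>, \<open>u\<close> vanishes, and \<open>H\<close> is the
  identity.\<close>

lemma householder_exists:
  assumes v: "(\<Sum>i<n. (v i)^2) = (1::real)" and n: "0 < n"
  shows "\<exists>H \<in> carrier_mat n n. H * H = 1\<^sub>m n & transpose_mat H = H & (\<forall>i<n. H $$ (i, 0) = v i)"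
proof -
  define u where "u i = v i - (if i = 0 then 1 else 0)" for i :: nat
  define r where "r = (\<Sum>i<n. (u i)^2)"
  have sum0: "(\<Sum>i<n. g i * (if i = 0 then 1 else 0)) = (g 0 :: real)" for g
    using n by (simp add: if_distrib cong: if_cong)
  have r: "r = 2 - 2 * v 0"
  proof -
    have "r = (\<Sum>i<n. (v i)^2 - 2 * (v i * (if i = 0 then 1 else 0)) + 1 * (if i = 0 then 1 else 0))"
      unfolding r_def u_def by (intro sum.cong) (auto simp: power2_eq_square algebra_simps)
    also have "... = 1 - 2 * v 0 + 1"
      unfolding sum.distrib sum_subtractf v sum_distrib_left[symmetric] sum0 using n by simp
    finally show ?thesis by simp
  qed
  define H where "H = mat n n (\<lambda>(i, j). (if i = j then 1 else 0) - 2 / r * (u i * u j))"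
  have H: "H \<in> carrier_mat n n" by (simp add: H_def)
  have u0: "u i = 0" if "r = 0" "i < n" for i
  proof -
    have "(u i)^2 = 0" using that sum_nonneg_eq_0_iff[of "{..<n}" "\<lambda>i. (u i)^2"] by (simp add: r_def)
    then show ?thesis by simp
  qed
  have "H * H = 1\<^sub>m n"
  proof (rule eq_matI)
    fix i j assume ij: "i < dim_row (1\<^sub>m n :: real mat)" "j < dim_col (1\<^sub>m n :: real mat)"
    then have ij: "i < n" "j < n" by auto
    have "(H * H) $$ (i, j) = (\<Sum>l<n. ((if i = l then 1 else 0) - 2 / r * (u i * u l)) * ((if l = j then 1 else 0) - 2 / r * (u l * u j)))"
      unfolding mat_prod_entry[OF H H ij] using ij by (intro sum.cong) (auto simp: H_def)
    also have "... = (\<Sum>l<n. (if l = i then (if i = j then 1 else 0) else 0) - (if l = i then 2 / r * (u i * u j) else 0)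
        - (if l = j then 2 / r * (u i * u j) else 0) + (2 / r)^2 * (u i * u j) * (u l)^2)"
      by (intro sum.cong) (auto simp: power2_eq_square algebra_simps)
    also have "... = (if i = j then 1 else 0) - 2 / r * (u i * u j) - 2 / r * (u i * u j) + (2 / r)^2 * (u i * u j) * r"
      unfolding sum.distrib sum_subtractf sum_distrib_left[symmetric] r_def[symmetric] using ij by simp
    also have "... = (if i = j then 1 else 0)"
      using u0 ij by (cases "r = 0") (simp_all add: power2_eq_square field_simps)
    finally show "(H * H) $$ (i, j) = 1\<^sub>m n $$ (i, j)" using ij by simp
  qed (use H in auto)
  moreover have "transpose_mat H = H" by (rule eq_matI) (auto simp: H_def mult.commute)
  moreover have "H $$ (i, 0) = v i" if "i < n" for i
  proof (cases "r = 0")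
    case True
    then show ?thesis using that n u0[OF True that] by (auto simp: H_def u_def)
  next
    case False
    have "u 0 = - r / 2" using r by (simp add: u_def)
    then have "H $$ (i, 0) = (if i = 0 then 1 else 0) + u i" using that n False by (simp add: H_def)
    then show ?thesis by (simp add: u_def)
  qed
  ultimately show ?thesis using H by blast
qed

text \<open>The eigenvector of the first column can be prescribed; for a regular graph it will be the
  constant one.\<close>

theorem spectral_theorem:
  assumes A: "A \<in> carrier_mat n n" and sym: "transpose_mat A = (A :: real mat)"
    and v: "0 < n ==> (\<Sum>i<n. (v i)^2) = 1 & (\<forall>i<n. (\<Sum>j<n. A $$ (i, j) * v j) = l * v i)"
  shows "\<exists>Q \<in> carrier_mat n n. \<exists>D \<in> carrier_mat n n. transpose_mat Q * Q = 1\<^sub>m n & A * Q = Q * D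
    & diagonal_mat D & (0 < n --> D $$ (0, 0) = l & (\<forall>i<n. Q $$ (i, 0) = v i))"
  using assms
proof (induction n arbitrary: A v l)
  case 0
  then show ?case by (intro bexI[of _ "0\<^sub>m 0 0"]) (auto simp: diagonal_mat_def)
next
  case (Suc m)
  note A = Suc.prems(1)
  let ?n = "Suc m"
  have v: "(\<Sum>i<?n. (v i)^2) = 1" "\<And>i. i < ?n ==> (\<Sum>j<?n. A $$ (i, j) * v j) = l * v i"
    using Suc.prems(3) by auto
  obtain H where H: "H \<in> carrier_mat ?n ?n" "H * H = 1\<^sub>m ?n" "transpose_mat H = H" "\<And>i. i < ?n ==> H $$ (i, 0) = v i"
    using householder_exists[OF v(1)] by auto
  have Hs: "H $$ (i, j) = H $$ (j, i)" if "i < ?n" "j < ?n" for i j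
    using H(1,3) that by (metis carrier_matD index_transpose_mat(1))
  \<comment> \<open>Conjugation by \<open>H\<close> moves the prescribed eigenvector to the first
    unit vector, so by symmetry \<open>S\<close> splits into the block \<open>l\<close> and a
    symmetric block \<open>T\<close>, to which the induction hypothesis applies.\<close>
  define S where "S = H * A * H"
  have S: "S \<in> carrier_mat ?n ?n" using H A by (simp add: S_def)
  have HA: "H * A \<in> carrier_mat ?n ?n" using H A by simp
  have AH: "A * H \<in> carrier_mat ?n ?n" using H A by simp
  have symS: "transpose_mat S = S"
    unfolding S_def transpose_mult[OF HA H(1)] transpose_mult[OF H(1) A] H(3) Suc.prems(2)
    using H A by (simp add: assoc_mult_mat[of _ ?n ?n _ ?n _ ?n])
  have Ss: "S $$ (i, j) = S $$ (j, i)" if "i < ?n" "j < ?n" for i j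
    using S symS that by (metis carrier_matD index_transpose_mat(1))
  have S0: "S $$ (i, 0) = (if i = 0 then l else 0)" if i: "i < ?n" for i
  proof -
    have ah: "(A * H) $$ (k, 0) = l * H $$ (k, 0)" if "k < ?n" for k
      unfolding mat_prod_entry[OF A H(1) that zero_less_Suc] using v(2)[OF that] H(4) that by simp
    have "S $$ (i, 0) = (H * (A * H)) $$ (i, 0)"
      using H A unfolding S_def by (subst assoc_mult_mat[of _ ?n ?n _ ?n _ ?n]) auto
    also have "... = (\<Sum>k<?n. H $$ (i, k) * (l * H $$ (k, 0)))"
      unfolding mat_prod_entry[OF H(1) AH i zero_less_Suc] using ah by (intro sum.cong) auto
    also have "... = l * (H * H) $$ (i, 0)"
      unfolding mat_prod_entry[OF H(1) H(1) i zero_less_Suc] by (simp only: sum_distrib_left mult_ac)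
    finally show ?thesis using H(2) i by simp
  qed
  define T where "T = mat m m (\<lambda>(i, j). S $$ (Suc i, Suc j))"
  have T: "T \<in> carrier_mat m m" by (simp add: T_def)
  have symT: "transpose_mat T = T" by (rule eq_matI) (use Ss in \<open>auto simp: T_def\<close>)
  have Sb: "S = four_block_mat (mat 1 1 (\<lambda>_. l)) (0\<^sub>m 1 m) (0\<^sub>m m 1) T"
  proof (rule eq_matI)
    fix i j assume "i < dim_row (four_block_mat (mat 1 1 (\<lambda>_. l)) (0\<^sub>m 1 m) (0\<^sub>m m 1) T)"
      "j < dim_col (four_block_mat (mat 1 1 (\<lambda>_. l)) (0\<^sub>m 1 m) (0\<^sub>m m 1) T)"
    then have ij: "i < ?n" "j < ?n" using T by auto
    then show "S $$ (i, j) = four_block_mat (mat 1 1 (\<lambda>_. l)) (0\<^sub>m 1 m) (0\<^sub>m m 1) T $$ (i, j)"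
      using S0[of i] S0[of j] Ss[of 0 j] T by (cases i; cases j) (auto simp: T_def)
  qed (use S T in auto)
  have "\<exists>v' l'. 0 < m --> (\<Sum>i<m. (v' i)^2) = 1 & (\<forall>i<m. (\<Sum>j<m. T $$ (i, j) * v' j) = (l'::real) * v' i)"
  proof (cases "0 < m")
    case True
    have "T $$ (i, j) = T $$ (j, i)" if "i < m" "j < m" for i j
      using T symT that by (metis carrier_matD index_transpose_mat(1))
    then show ?thesis using symmetric_real_eigenvector[OF T _ True] by blast
  qed simp
  then obtain v' l' where "0 < m --> (\<Sum>i<m. (v' i)^2) = 1 & (\<forall>i<m. (\<Sum>j<m. T $$ (i, j) * v' j) = (l'::real) * v' i)" by blast
  then obtain Q D where Q: "Q \<in> carrier_mat m m" "D \<in> carrier_mat m m" "transpose_mat Q * Q = 1\<^sub>m m" "T * Q = Q * D" "diagonal_mat D"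
    using Suc.IH[OF T symT, of v' l'] by blast
  define F where "F = four_block_mat (1\<^sub>m 1) (0\<^sub>m 1 m) (0\<^sub>m m 1) Q"
  define E where "E = four_block_mat (mat 1 1 (\<lambda>_. l)) (0\<^sub>m 1 m) (0\<^sub>m m 1) D"
  have F: "F \<in> carrier_mat ?n ?n" and E: "E \<in> carrier_mat ?n ?n"
    using Q four_block_carrier_mat[of "1\<^sub>m 1 :: real mat" 1 1 Q m m] four_block_carrier_mat[of "mat 1 1 (\<lambda>_. l)" 1 1 D m m]
    by (auto simp: F_def E_def)
  have one: "(1\<^sub>m 1 :: real mat) \<in> carrier_mat 1 1" "mat 1 1 (\<lambda>_. l) \<in> carrier_mat 1 1"
    "(0\<^sub>m 1 m :: real mat) \<in> carrier_mat 1 m" "(0\<^sub>m m 1 :: real mat) \<in> carrier_mat m 1" by auto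
  have SF: "S * F = F * E"
    unfolding Sb F_def E_def
    by (subst mult_four_block_mat[OF one(2,3,4) T one(1,3,4) Q(1)], subst mult_four_block_mat[OF one(1,3,4) Q(1) one(2,3,4) Q(2)])
      (use Q T one in \<open>auto\<close>)
  have FF: "transpose_mat F * F = 1\<^sub>m ?n"
  proof -
    have "transpose_mat F = four_block_mat (1\<^sub>m 1) (0\<^sub>m 1 m) (0\<^sub>m m 1) (transpose_mat Q)"
      unfolding F_def by (subst transpose_four_block_mat[OF one(1,3,4) Q(1)]) (auto intro!: arg_cong2[where f = "\<lambda>a b. four_block_mat _ a b _"] eq_matI)
    moreover have "four_block_mat (1\<^sub>m 1) (0\<^sub>m 1 m) (0\<^sub>m m 1) (transpose_mat Q) * F = 1\<^sub>m (1 + m)"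
      unfolding F_def using Q one
      by (subst mult_four_block_mat[OF one(1,3,4) _ one(1,3,4) Q(1)]) (auto simp: Q(3))
    ultimately show ?thesis by simp
  qed
  define G where "G = H * F"
  have G: "G \<in> carrier_mat ?n ?n" using H F by (simp add: G_def)
  note as = assoc_mult_mat[of _ ?n ?n _ ?n _ ?n]
  have HH: "H * (H * X) = X" if "X \<in> carrier_mat ?n ?n" for X
    using H that as[of H H X] by simp
  have "transpose_mat G * G = transpose_mat F * (H * H) * F"
    unfolding G_def transpose_mult[OF H(1) F] H(3) using H F HH[OF F] by (simp add: as)
  then have 1: "transpose_mat G * G = 1\<^sub>m ?n" using F FF by (simp add: H(2))
  have "H * (S * F) = H * (H * (A * (H * F)))" unfolding S_def using A H(1) F by (simp add: as)
  also have "... = A * G" unfolding G_def by (rule HH) (use A H(1) F in auto)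
  finally have "A * G = H * (S * F)" by simp
  also have "... = G * E" unfolding SF G_def using H F E by (simp add: as)
  finally have 2: "A * G = G * E" .
  have 3: "diagonal_mat E" using Q(2,5) unfolding E_def diagonal_mat_def by (auto simp: less_Suc_eq_0_disj) blast
  have 4: "E $$ (0, 0) = l" using Q by (simp add: E_def)
  have "G $$ (i, 0) = v i" if i: "i < ?n" for i
  proof -
    have "F $$ (k, 0) = (if k = 0 then 1 else 0)" if "k < ?n" for k
      using that Q by (cases k) (auto simp: F_def)
    then have "G $$ (i, 0) = (\<Sum>k<?n. H $$ (i, k) * (if k = 0 then 1 else 0))"
      unfolding G_def mat_prod_entry[OF H(1) F i zero_less_Suc] by (intro sum.cong) auto
    also have "... = H $$ (i, 0)" by (simp add: if_distrib cong: if_cong)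
    finally show ?thesis using H(4)[OF i] by simp
  qed
  then show ?case using G E 1 2 3 4 by blast
qed

text \<open>Entries count colours because different matchings of a random system may share an edge;
  once girth rules this out it is the 0/1 adjacency matrix.\<close>

definition sys_mat :: "nat => nat => (nat => nat => nat) => real mat" where
  "sys_mat d N s = mat N N (\<lambda>(i, j). real (card {c. c < d & s c i = j}))"

lemma sys_mat_carrier [simp]: "sys_mat d N s \<in> carrier_mat N N"
  by (simp add: sys_mat_def)

lemma sys_mat_sum:
  assumes ms: "matchings d N s" and i: "i < N"
  shows "(\<Sum>j<N. sys_mat d N s $$ (i, j) * g j) = (\<Sum>c<d. g (s c i))"
proof -
  have "(\<Sum>c<d. g (s c i)) = (\<Sum>j<N. \<Sum>c | c \<in> {..<d} & s c i = j. g (s c i))"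
    by (rule sum.group[symmetric]) (use ms i in \<open>auto simp: ms_less\<close>)
  also have "... = (\<Sum>j<N. sys_mat d N s $$ (i, j) * g j)"
    using i by (intro sum.cong) (auto simp: sys_mat_def)
  finally show ?thesis by simp
qed

lemma sys_mat_sym:
  assumes ms: "matchings d N s"
  shows "transpose_mat (sys_mat d N s) = sys_mat d N s"
proof (rule eq_matI)
  fix i j assume "i < dim_row (sys_mat d N s)" "j < dim_col (sys_mat d N s)"
  then have ij: "i < N" "j < N" by (auto simp: sys_mat_def)
  have "{c. c < d & s c i = j} = {c. c < d & s c j = i}"
    using ms_invol[OF ms] by blast
  then show "transpose_mat (sys_mat d N s) $$ (i, j) = sys_mat d N s $$ (i, j)"
    using ij by (simp add: sys_mat_def)
qed (auto simp: sys_mat_def)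

section \<open>Non-backtracking walks and the trace formula\<close>

definition nbw :: "nat => (nat => nat => nat) => nat => nat => nat => real" where
  "nbw d s m v u = (\<Sum>w\<in>reduced_words d m. if walk s v w = u then 1 else 0)"

lemma reduced_words_Suc_sum:
  "(\<Sum>w\<in>reduced_words d (Suc m). F w)
    = (\<Sum>c<d. \<Sum>w | w \<in> reduced_words d m & (w = [] \<or> hd w ~= c). (F (c # w) :: real))"
proof -
  have "(\<Sum>c<d. \<Sum>w | w \<in> reduced_words d m & (w = [] \<or> hd w ~= c). F (c # w))
     = (\<Sum>(c, w)\<in>(SIGMA c:{..<d}. {w. w \<in> reduced_words d m & (w = [] \<or> hd w ~= c)}). F (c # w))"
    by (rule sum.Sigma) (auto simp: finite_reduced_words)
  also have "... = (\<Sum>w\<in>reduced_words d (Suc m). F w)"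
    by (rule sum.reindex_bij_witness[of _ "\<lambda>w. (hd w, tl w)" "\<lambda>(c, w). c # w"])
      (auto simp: reduced_words_def length_Suc_conv distinct_adj_Cons)
  finally show ?thesis by simp
qed

lemma nbw_0: "nbw d s 0 v u = (if v = u then 1 else 0)"
  by (simp add: nbw_def reduced_words_0)

lemma nbw_1: "nbw d s (Suc 0) v u = (\<Sum>c<d. nbw d s 0 (s c v) u)"
proof -
  have "{w. w \<in> reduced_words d 0 & (w = [] \<or> hd w ~= c)} = {[]}" for c
    by (auto simp: reduced_words_0)
  then show ?thesis unfolding nbw_def reduced_words_Suc_sum by (simp add: reduced_words_0)
qed

text \<open>Prepending a colour to a reduced word either gives a longer reduced word or cancels the
  first letter; a word of length \<open>m\<close> arises by cancellation in \<open>d\<close> ways if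
  empty and in \<open>d - 1\<close> ways otherwise.\<close>

lemma nbw_Suc:
  assumes ms: "matchings d N s"
  shows "(\<Sum>c<d. nbw d s (Suc m) (s c v) u)
    = nbw d s (Suc (Suc m)) v u + real (if m = 0 then d else d - 1) * nbw d s m v u"
proof -
  let ?I = "\<lambda>v w. (if walk s v w = u then 1 else 0) :: real"
  have "(\<Sum>c<d. nbw d s (Suc m) (s c v) u) = (\<Sum>c<d.
     (\<Sum>w | w \<in> reduced_words d (Suc m) & (w = [] \<or> hd w ~= c). ?I v (c # w))
     + (\<Sum>w | w \<in> reduced_words d (Suc m) & \<not> (w = [] \<or> hd w ~= c). ?I v (c # w)))"
  proof (rule sum.cong[OF refl])
    fix c
    have "nbw d s (Suc m) (s c v) u = (\<Sum>w\<in>reduced_words d (Suc m). ?I v (c # w))"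
      by (simp add: nbw_def)
    also have "... = (\<Sum>w\<in>{w. w \<in> reduced_words d (Suc m) & (w = [] \<or> hd w ~= c)} \<union> {w. w \<in> reduced_words d (Suc m) & \<not> (w = [] \<or> hd w ~= c)}. ?I v (c # w))"
      by (intro sum.cong) auto
    also have "... = (\<Sum>w | w \<in> reduced_words d (Suc m) & (w = [] \<or> hd w ~= c). ?I v (c # w))
     + (\<Sum>w | w \<in> reduced_words d (Suc m) & \<not> (w = [] \<or> hd w ~= c). ?I v (c # w))"
      by (rule sum.union_disjoint) (auto simp: finite_reduced_words)
    finally show "nbw d s (Suc m) (s c v) u = (\<Sum>w | w \<in> reduced_words d (Suc m) & (w = [] \<or> hd w ~= c). ?I v (c # w))
     + (\<Sum>w | w \<in> reduced_words d (Suc m) & \<not> (w = [] \<or> hd w ~= c). ?I v (c # w))" .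
  qed
  also have "... = nbw d s (Suc (Suc m)) v u + (\<Sum>c<d. \<Sum>w | w \<in> reduced_words d (Suc m) & \<not> (w = [] \<or> hd w ~= c). ?I v (c # w))"
    unfolding sum.distrib by (simp add: nbw_def reduced_words_Suc_sum[of _ d "Suc m"])
  also have "(\<Sum>c<d. \<Sum>w | w \<in> reduced_words d (Suc m) & \<not> (w = [] \<or> hd w ~= c). ?I v (c # w))
    = (\<Sum>c<d. \<Sum>w | w \<in> reduced_words d m & (w = [] \<or> hd w ~= c). ?I v w)"
  proof (rule sum.cong[OF refl])
    fix c assume c: "c \<in> {..<d}"
    show "(\<Sum>w | w \<in> reduced_words d (Suc m) & \<not> (w = [] \<or> hd w ~= c). ?I v (c # w))
      = (\<Sum>w | w \<in> reduced_words d m & (w = [] \<or> hd w ~= c). ?I v w)"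
      by (rule sum.reindex_bij_witness[of _ "(#) c" tl])
        (use c ms in \<open>auto simp: reduced_words_def length_Suc_conv distinct_adj_Cons ms_invol\<close>)
  qed
  also have "... = (\<Sum>w\<in>reduced_words d m. \<Sum>c<d. if w = [] \<or> hd w ~= c then ?I v w else 0)"
    by (subst sum.swap) (simp add: sum.If_cases finite_reduced_words Int_def)
  also have "... = (\<Sum>w\<in>reduced_words d m. real (if m = 0 then d else d - 1) * ?I v w)"
  proof (rule sum.cong[OF refl])
    fix w assume w: "w \<in> reduced_words d m"
    show "(\<Sum>c<d. if w = [] \<or> hd w ~= c then ?I v w else 0) = real (if m = 0 then d else d - 1) * ?I v w"
    proof (cases w)
      case Nil then show ?thesis using w by (simp add: reduced_words_def)
    next
      case (Cons a w')
      then have m: "m ~= 0" and a: "a < d" using w by (auto simp: reduced_words_def)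
      have "{..<d} \<inter> {c. a ~= c} = {..<d} - {a}" by auto
      then have "card ({..<d} \<inter> {c. a ~= c}) = d - 1" using a by simp
      then show ?thesis using m Cons by (simp add: sum.If_cases)
    qed
  qed
  also have "... = real (if m = 0 then d else d - 1) * nbw d s m v u"
    by (simp add: nbw_def sum_distrib_left)
  finally show ?thesis .
qed

text \<open>The left side is the kernel of \<open>nb_poly p m\<close> applied to the adjacency
  operator, written in an orthonormal eigenbasis \<open>e\<close>; both sides obey the same
  recurrence in \<open>m\<close>.\<close>

lemma spectral_kernel:
  assumes ms: "matchings (Suc p) N s" and i: "i < N" "j < N"
    and e: "\<And>k i. k < N ==> i < N ==> (\<Sum>c<Suc p. e k (s c i)) = l k * (e k i :: real)"
    and compl: "\<And>i j. i < N ==> j < N ==> (\<Sum>k<N. e k i * e k j) = (if i = j then 1 else 0)"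
  shows "(\<Sum>k<N. poly (nb_poly p m) (l k) * (e k i * e k j)) = nbw (Suc p) s m i j"
proof -
  define K where "K m i = (\<Sum>k<N. poly (nb_poly p m) (l k) * (e k i * e k j))" for m i
  have shift: "(\<Sum>k<N. l k * poly (nb_poly p m) (l k) * (e k i * e k j)) = (\<Sum>c<Suc p. K m (s c i))" if "i < N" for m i
  proof -
    have "(\<Sum>c<Suc p. K m (s c i)) = (\<Sum>k<N. poly (nb_poly p m) (l k) * ((\<Sum>c<Suc p. e k (s c i)) * e k j))"
      unfolding K_def by (subst sum.swap) (simp only: sum_distrib_left sum_distrib_right mult.assoc)
    also have "... = (\<Sum>k<N. l k * poly (nb_poly p m) (l k) * (e k i * e k j))"
      by (intro sum.cong refl) (use e that in \<open>simp add: mult_ac\<close>)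
    finally show ?thesis by simp
  qed
  have K0: "K 0 i = nbw (Suc p) s 0 i j" if "i < N" for i
    using compl[OF that i(2)] by (simp add: K_def nbw_0)
  have sl: "s c i < N" if "i < N" "c < Suc p" for c i using ms_less[OF ms that(2)] that by simp
  have "i < N ==> K m i = nbw (Suc p) s m i j" for i
  proof (induction "real p" m arbitrary: i rule: nb_poly.induct)
    case 1 then show ?case by (rule K0)
  next
    case 2
    have "K (Suc 0) i = (\<Sum>c<Suc p. K 0 (s c i))" using shift[OF 2, of 0] by (simp add: K_def)
    then show ?case using K0 sl 2 by (simp add: nbw_1)
  next
    case 3
    have "K (Suc (Suc 0)) i = (\<Sum>k<N. l k * poly (nb_poly p (Suc 0)) (l k) * (e k i * e k j)) - (p + 1) * K 0 i"
      unfolding K_def sum_distrib_left sum_subtractf[symmetric]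
      by (intro sum.cong refl) (simp add: algebra_simps)
    also have "(\<Sum>k<N. l k * poly (nb_poly p (Suc 0)) (l k) * (e k i * e k j)) = (\<Sum>c<Suc p. K (Suc 0) (s c i))"
      by (rule shift[OF 3])
    also have "(\<Sum>c<Suc p. K (Suc 0) (s c i)) = (\<Sum>c<Suc p. nbw (Suc p) s (Suc 0) (s c i) j)"
    proof (intro sum.cong refl)
      fix c assume "c \<in> {..<Suc p}"
      then have c: "s c i < N" using sl 3 by simp
      have "K (Suc 0) (s c i) = (\<Sum>c'<Suc p. K 0 (s c' (s c i)))" using shift[OF c, of 0] by (simp add: K_def)
      then show "K (Suc 0) (s c i) = nbw (Suc p) s (Suc 0) (s c i) j" using K0 sl[OF c] by (simp add: nbw_1)
    qed
    finally show ?case using nbw_Suc[OF ms, of 0 i j] K0[OF 3] by (simp add: algebra_simps)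
  next
    case (4 m)
    have "K (Suc (Suc (Suc m))) i = (\<Sum>c<Suc p. K (Suc (Suc m)) (s c i)) - p * K (Suc m) i"
      unfolding shift[OF 4(3), symmetric]
      by (simp add: K_def sum_distrib_left sum_subtractf[symmetric] algebra_simps)
    also have "(\<Sum>c<Suc p. K (Suc (Suc m)) (s c i)) = (\<Sum>c<Suc p. nbw (Suc p) s (Suc (Suc m)) (s c i) j)"
      using 4(1) sl 4(3) by (intro sum.cong refl) auto
    finally show ?case using nbw_Suc[OF ms, of "Suc m" i j] 4(2)[OF 4(3)] by simp
  qed
  then show ?thesis using i unfolding K_def by blast
qed

text \<open>Trace formula for a list \<open>l\<close> of eigenvalues, taken in the basis
  \<open>nb_poly\<close>, in which the averages over random systems are known from
  \<open>avg_fixed_points\<close>.\<close>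

definition has_walk_counts :: "nat => nat => (nat => nat => nat) => (nat => real) => bool" where
  "has_walk_counts p N s l \<longleftrightarrow> (\<forall>m. (\<Sum>k<N. poly (nb_poly p m) (l k))
     = (\<Sum>w\<in>reduced_words (Suc p) m. real (card {v. v < N & walk s v w = v})))"

text \<open>The index 0 is reserved for the trivial eigenvalue.\<close>

theorem system_spectrum:
  assumes ms: "matchings (Suc p) N s" and N: "0 < N"
  shows "\<exists>l :: nat => real. l 0 = Suc p & (\<forall>k<N. \<bar>l k\<bar> \<le> Suc p)
    & char_poly (sys_mat (Suc p) N s) = (\<Prod>k<N. [:- l k, 1:])
    & has_walk_counts p N s l
    & (\<forall>L\<ge>0. (\<forall>k. 0 < k --> k < N --> \<bar>l k\<bar> \<le> L) --> spectral_bound (Suc p) N s L)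
    & (\<forall>L. spectral_bound (Suc p) N s L --> (\<forall>k. 0 < k --> k < N --> \<bar>l k\<bar> \<le> L))"
proof -
  let ?A = "sys_mat (Suc p) N s" and ?v = "\<lambda>i::nat. 1 / sqrt N"
  have "(\<Sum>i<N. (?v i)^2) = 1" using N by (simp add: power_divide)
  moreover have "(\<Sum>j<N. ?A $$ (i, j) * ?v j) = real (Suc p) * ?v i" if "i < N" for i
    using sys_mat_sum[OF ms that, of ?v] by simp
  ultimately obtain Q D where Q: "Q \<in> carrier_mat N N" and D: "D \<in> carrier_mat N N" and QQ: "transpose_mat Q * Q = 1\<^sub>m N"
    and AQ: "?A * Q = Q * D" and diag: "diagonal_mat D" and D0: "D $$ (0, 0) = real (Suc p)" "\<And>i. i < N ==> Q $$ (i, 0) = ?v i"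
    using spectral_theorem[OF sys_mat_carrier sys_mat_sym[OF ms], of ?v "real (Suc p)"] N by blast
  define l where "l k = D $$ (k, k)" for k
  define e where "e k i = Q $$ (i, k)" for k i
  have Qt: "transpose_mat Q \<in> carrier_mat N N" using Q by simp
  have QQ': "Q * transpose_mat Q = 1\<^sub>m N" by (rule mat_mult_left_right_inverse[OF Qt Q QQ])
  have compl: "(\<Sum>k<N. e k i * e k j) = (if i = j then 1 else 0)" if "i < N" "j < N" for i j
    using mat_prod_entry[OF Q Qt that] QQ' that Q by (simp add: e_def)
  have orth: "(\<Sum>i<N. e k i * e k' i) = (if k = k' then 1 else 0)" if "k < N" "k' < N" for k k'
    using mat_prod_entry[OF Qt Q that] QQ that Q by (simp add: e_def)
  have ev: "(\<Sum>c<Suc p. e k (s c i)) = l k * e k i" if "k < N" "i < N" for k i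
  proof -
    have "(\<Sum>c<Suc p. e k (s c i)) = (?A * Q) $$ (i, k)"
      using sys_mat_sum[OF ms that(2), of "e k"] mat_prod_entry[OF sys_mat_carrier Q that(2,1)] by (simp add: e_def)
    also have "... = (\<Sum>j<N. Q $$ (i, j) * D $$ (j, k))" unfolding AQ by (rule mat_prod_entry[OF Q D that(2,1)])
    also have "... = (\<Sum>j<N. if j = k then Q $$ (i, k) * D $$ (k, k) else 0)"
      using diag D that by (intro sum.cong) (auto simp: diagonal_mat_def)
    finally show ?thesis using that by (simp add: e_def l_def)
  qed
  have l0: "l 0 = Suc p" using D0 by (simp add: l_def)
  have form: "(\<Sum>i<N. \<Sum>c<Suc p. e k i * e k (s c i)) = l k" if "k < N" for k
  proof -
    have "(\<Sum>i<N. \<Sum>c<Suc p. e k i * e k (s c i)) = (\<Sum>i<N. e k i * (l k * e k i))"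
      unfolding sum_distrib_left[symmetric] using ev that by (intro sum.cong) auto
    also have "... = l k * (\<Sum>i<N. e k i * e k i)" by (simp add: sum_distrib_left mult_ac)
    finally show ?thesis using orth[OF that that] by simp
  qed
  have bound: "\<bar>l k\<bar> \<le> Suc p" if "k < N" for k
  proof -
    have "\<bar>l k\<bar> \<le> (\<Sum>i<N. \<Sum>c<Suc p. \<bar>e k i * e k (s c i)\<bar>)"
      unfolding form[OF that, symmetric] by (intro order.trans[OF sum_abs] sum_mono sum_abs)
    also have "... \<le> (\<Sum>i<N. \<Sum>c<Suc p. ((e k i)^2 + (e k (s c i))^2) / 2)"
    proof (intro sum_mono)
      fix i c
      show "\<bar>e k i * e k (s c i)\<bar> \<le> ((e k i)^2 + (e k (s c i))^2) / 2"
        using sum_squares_bound[of "\<bar>e k i\<bar>" "\<bar>e k (s c i)\<bar>"] by (simp add: abs_mult)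
    qed
    also have "... = (\<Sum>c<Suc p. ((\<Sum>i<N. (e k i)^2) + (\<Sum>i<N. (e k (s c i))^2)) / 2)"
      by (subst sum.swap) (simp add: sum_divide_distrib sum.distrib add_divide_distrib del: sum.lessThan_Suc)
    also have "... = (\<Sum>c<Suc p. 1)"
      using sum_match_reindex[OF ms, of _ "\<lambda>i. (e k i)^2"] orth[OF that that] by (intro sum.cong) (auto simp: power2_eq_square)
    finally show ?thesis by simp
  qed
  have "similar_mat ?A D"
  proof (rule similar_matI[of _ _ Q "transpose_mat Q" N])
    have "?A = ?A * (Q * transpose_mat Q)"
      unfolding QQ' by (rule right_mult_one_mat[OF sys_mat_carrier, symmetric])
    also have "... = Q * D * transpose_mat Q"
      unfolding AQ[symmetric] by (rule assoc_mult_mat[OF sys_mat_carrier Q Qt, symmetric])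
    finally show "?A = Q * D * transpose_mat Q" .
  qed (use Q D Qt QQ QQ' in auto)
  then have "char_poly ?A = char_poly D" by (rule char_poly_similar)
  also have "... = (\<Prod>a\<leftarrow>diag_mat D. [:- a, 1:])"
    by (rule char_poly_upper_triangular[OF D]) (use diag D in \<open>auto simp: diagonal_mat_def\<close>)
  also have "... = (\<Prod>k<N. [:- l k, 1:])"
    using D by (simp add: diag_mat_def l_def prod.list_conv_set_nth atLeast0LessThan)
  finally have cp: "char_poly ?A = (\<Prod>k<N. [:- l k, 1:])" .
  have tr: "(\<Sum>k<N. poly (nb_poly p m) (l k)) = (\<Sum>w\<in>reduced_words (Suc p) m. real (card {v. v < N & walk s v w = v}))" for m
  proof -
    have "(\<Sum>k<N. poly (nb_poly p m) (l k)) = (\<Sum>k<N. poly (nb_poly p m) (l k) * (\<Sum>i<N. e k i * e k i))"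
      using orth by (intro sum.cong) auto
    also have "... = (\<Sum>i<N. \<Sum>k<N. poly (nb_poly p m) (l k) * (e k i * e k i))"
      by (subst sum.swap) (simp add: sum_distrib_left)
    also have "... = (\<Sum>i<N. nbw (Suc p) s m i i)"
      by (intro sum.cong refl spectral_kernel[OF ms]) (use ev compl in auto)
    also have "... = (\<Sum>w\<in>reduced_words (Suc p) m. \<Sum>i<N. if walk s i w = i then 1 else 0)"
      unfolding nbw_def by (rule sum.swap)
    also have "... = (\<Sum>w\<in>reduced_words (Suc p) m. real (card {v. v < N & walk s v w = v}))"
      by (simp add: sum.If_cases Int_def)
    finally show ?thesis .
  qed
  have sb: "spectral_bound (Suc p) N s L" if L: "0 \<le> L" "\<forall>k. 0 < k --> k < N --> \<bar>l k\<bar> \<le> L" for L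
    unfolding spectral_bound_def
  proof (intro allI impI)
    fix f :: "nat => real" assume f: "(\<Sum>v<N. f v) = 0"
    define a where "a k = (\<Sum>i<N. f i * e k i)" for k
    have a0: "a 0 = 0" using f D0(2) by (simp add: a_def e_def sum_divide_distrib[symmetric])
    have exp: "f i = (\<Sum>k<N. a k * e k i)" if "i < N" for i
    proof -
      have "(\<Sum>k<N. a k * e k i) = (\<Sum>j<N. f j * (\<Sum>k<N. e k j * e k i))"
        unfolding a_def sum_distrib_right by (subst sum.swap) (simp add: sum_distrib_left mult_ac)
      also have "... = (\<Sum>j<N. if j = i then f i else 0)" using compl that by (intro sum.cong) auto
      finally show ?thesis using that by simp
    qed
    have nrm: "(\<Sum>i<N. (f i)^2) = (\<Sum>k<N. (a k)^2)"
    proof -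
      have "(\<Sum>i<N. (f i)^2) = (\<Sum>i<N. f i * (\<Sum>k<N. a k * e k i))"
        unfolding power2_eq_square by (intro sum.cong refl arg_cong2[where f = "(*)"] exp) auto
      also have "... = (\<Sum>k<N. a k * (\<Sum>i<N. f i * e k i))"
        unfolding sum_distrib_left by (subst sum.swap) (simp add: mult_ac)
      finally show ?thesis by (simp add: a_def power2_eq_square)
    qed
    have "(\<Sum>v<N. \<Sum>c<Suc p. f v * f (s c v)) = (\<Sum>v<N. f v * (\<Sum>k<N. a k * (l k * e k v)))"
    proof (rule sum.cong[OF refl])
      fix v assume "v \<in> {..<N}"
      then have v: "v < N" by simp
      have "(\<Sum>c<Suc p. f (s c v)) = (\<Sum>c<Suc p. \<Sum>k<N. a k * e k (s c v))"
        by (intro sum.cong refl exp) (use ms_less[OF ms] v in auto)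
      also have "... = (\<Sum>k<N. a k * (\<Sum>c<Suc p. e k (s c v)))"
        by (subst sum.swap) (simp only: sum_distrib_left)
      also have "... = (\<Sum>k<N. a k * (l k * e k v))" using ev v by (intro sum.cong) auto
      finally show "(\<Sum>c<Suc p. f v * f (s c v)) = f v * (\<Sum>k<N. a k * (l k * e k v))"
        by (simp only: sum_distrib_left[symmetric])
    qed
    also have "... = (\<Sum>k<N. l k * a k * (\<Sum>v<N. f v * e k v))"
      unfolding sum_distrib_left by (subst sum.swap) (simp add: mult_ac)
    also have "... = (\<Sum>k<N. l k * (a k)^2)" by (simp add: a_def power2_eq_square mult_ac)
    also have "\<bar>...\<bar> \<le> (\<Sum>k<N. L * (a k)^2)"
    proof (intro order.trans[OF sum_abs] sum_mono)
      fix k assume "k \<in> {..<N}"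
      then show "\<bar>l k * (a k)^2\<bar> \<le> L * (a k)^2"
        using L a0 by (cases "k = 0") (auto simp: abs_mult intro!: mult_right_mono)
    qed
    finally show "\<bar>\<Sum>v<N. \<Sum>c<Suc p. f v * f (s c v)\<bar> \<le> L * (\<Sum>v<N. (f v)^2)"
      unfolding nrm by (simp add: sum_distrib_left)
  qed
  have sb': "\<bar>l k\<bar> \<le> L" if L: "spectral_bound (Suc p) N s L" and k: "0 < k" "k < N" for L k
  proof -
    have "(\<Sum>i<N. e k i) = sqrt N * (\<Sum>i<N. e k i * e 0 i)"
      using D0(2) N by (simp add: e_def sum_divide_distrib[symmetric])
    then have "(\<Sum>i<N. e k i) = 0" using orth[OF k(2) N] k by simp
    then have "\<bar>\<Sum>v<N. \<Sum>c<Suc p. e k v * e k (s c v)\<bar> \<le> L * (\<Sum>v<N. (e k v)^2)"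
      using L unfolding spectral_bound_def by blast
    then show ?thesis using form[OF k(2)] orth[OF k(2) k(2)] by (simp add: power2_eq_square)
  qed
  show ?thesis
    unfolding has_walk_counts_def using l0 bound cp tr sb sb' by (intro exI[of _ l]) blast
qed

section \<open>Random systems are nearly Ramanujan\<close>

abbreviation ret_fun :: "real => nat list => real" where
  "ret_fun x w \<equiv> ret_prob x 1 (\<lambda>_. 0) (\<lambda>c i. i) 0 w"

lemma card_systems: "card (systems d N) = mcount N ^ d"
  by (simp add: systems_def card_PiE card_pmatch)

lemma card_systems_pos: "even N ==> 0 < card (systems d N)"
  by (simp add: card_systems mcount_pos)

lemma avg_fixed_points:
  assumes w: "set w \<subseteq> {..<d}" and N: "even N"
  shows "(\<Sum>s\<in>systems d N. real (card {v. v < N & walk s v w = v}))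
    = card (systems d N) * (N * ret_fun (1 / N) w)"
proof -
  have "(\<Sum>s\<in>systems d N. real (card {v. v < N & walk s v w = v}))
    = (\<Sum>s\<in>systems d N. \<Sum>v<N. if walk s v w = v then 1 else 0)"
    by (simp add: sum.If_cases Int_def)
  also have "... = (\<Sum>v<N. \<Sum>s\<in>systems d N. if walk s v w = v then 1 else 0)" by (rule sum.swap)
  also have "... = (\<Sum>v<N. real (card {s \<in> systems d N. walk s v w = v}))"
    by (simp add: sum.If_cases Int_def finite_systems)
  also have "... = (\<Sum>v<N. ret_fun (1 / N) w * card (systems d N))"
  proof (intro sum.cong refl)
    fix v assume "v \<in> {..<N}"
    then show "real (card {s \<in> systems d N. walk s v w = v}) = ret_fun (1 / N) w * card (systems d N)"
      using card_return[OF explored_start, of v N 0 w d] w N by (simp add: ext_sys_start)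
  qed
  finally show ?thesis by simp
qed

lemma ret_fun_0: "distinct_adj w ==> ret_fun 0 w = (if w = [] then 1 else 0)"
proof (cases w)
  case (Cons c r)
  assume "distinct_adj w"
  then have "ret_prob 0 (Suc (Suc 0)) (\<lambda>_. 0) (link (\<lambda>c i. i) c 0 (Suc 0)) (Suc 0) r = 0"
    by (intro ret_prob_0_fresh[where b = c]) (auto simp: link_def Cons)
  then show ?thesis
    using ret_prob_0_e[of "Suc (Suc 0)" "(\<lambda>_. 0)(c := Suc 0)" "link (\<lambda>c i. i) c 0 (Suc 0)" "Suc 0" r "\<lambda>_. 0"] Cons by simp
qed simp

lemma nb_poly_at_degree: "poly (nb_poly p m) (Suc p) = card (reduced_words (Suc p) m)" for p :: nat
proof -
  have "poly (nb_poly p m) (real p + 1) = (if m = 0 then 1 else (real p + 1) * real p ^ (m - 1))"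
  proof (induction "real p" m rule: nb_poly.induct)
    case 3 then show ?case by (simp add: algebra_simps)
  next
    case (4 m) then show ?case by (simp add: algebra_simps)
  qed auto
  then show ?thesis by (cases m) (simp_all add: reduced_words_0 card_reduced_words algebra_simps)
qed

lemma ret_fun_poly:
  assumes w: "set w \<subseteq> {..<d}" and q: "length w \<le> q"
  shows "\<exists>Q :: real poly. degree Q \<le> d * q + q & (\<forall>x. (\<forall>j<q. 1 - (2 * real j + 1) * x ~= 0) -->
      ret_fun x w * (\<Prod>c<d. \<Prod>j<q. 1 - (2 * real j + 1) * x) = poly Q x)"
proof -
  obtain Q :: "real poly" where "degree Q \<le> d * q + length w"
    "\<forall>x. (\<forall>j<q. 1 - (2 * real j + 1) * x ~= 0) -->
      ret_fun x w * (\<Prod>c<d. \<Prod>j=0..<q. 1 - (2 * real j + 1) * x) = poly Q x"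
    using ret_prob_poly[of d "\<lambda>_. 0" w q 1 "\<lambda>c i. i" 0] assms by auto
  then show ?thesis using q by (intro exI[of _ Q]) (auto simp: atLeast0LessThan)
qed

text \<open>The multiples of \<open>M\<close> come from the small coefficients, the term with
  \<open>K\<close> is the Taylor remainder, and \<open>G / N\<close> is the loss from clearing
  denominators; the outer factor 2 comes from dividing by a denominator that is at least
  1/2.\<close>

definition trace_error :: "nat => nat => nat => nat => nat => real => real => real" where
  "trace_error N n1 p q K G M = 2 * ((real N + 1 + G + real q * (2 * real p + 2 * (real q)^2)) * (2 * (real q + 1) * M)
     + 32 * real K ^ 6 * (real n1)^2 / N + G / N)"

text \<open>The mean trace of \<open>h\<close> is \<open>N * f (1 / N)\<close>. Times a common
  denominator, \<open>f\<close> is a polynomial bounded at reciprocals, so its Taylor expansion at 0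
  is effective. The constant coefficient is \<open>c 0\<close>, which is small with
  \<open>M\<close>; the linear one is \<open>poly h (p + 1) - c 0\<close> up to an error controlled
  by \<open>sum_ret_deriv\<close>. So what the nontrivial eigenvalues contribute is small on
  average.\<close>

theorem expected_trace:
  fixes h :: "real poly"
  assumes p: "1 \<le> p" and dh: "degree h \<le> q" and q: "1 \<le> q"
    and h01: "\<And>x. \<bar>x :: real\<bar> \<le> Suc p ==> 0 \<le> poly h x & poly h x \<le> 1"
    and hM: "\<And>x. \<bar>x\<bar> \<le> 2 * sqrt p ==> \<bar>poly h x\<bar> \<le> M"
  defines "K \<equiv> Suc p * q + q" and "G \<equiv> 8 * real (Suc p * q) ^ 3 * q"
  assumes n1: "16 * K ^ 3 \<le> n1" "2 * q \<le> n1" and N: "even N" "n1 \<le> N" "2 * G \<le> N"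
  shows "\<exists>T. (\<forall>s\<in>systems (Suc p) N. \<forall>l.
        has_walk_counts p N s l
        --> T s = (\<Sum>k<N. poly h (l k :: real)))
     & (\<Sum>s\<in>systems (Suc p) N. T s - poly h (Suc p)) \<le> card (systems (Suc p) N) *
        trace_error N n1 p q K G M"
proof -
  let ?d = "Suc p"
  have rp: "1 \<le> real p" using p by simp
  obtain c where hc: "h = (\<Sum>i\<le>q. psmult (c i) (nb_poly p i))"
    and cb: "\<And>i. i \<le> q ==> \<bar>c i\<bar> * sqrt p ^ i \<le> 2 * (real q + 1) * M"
    using nb_coeff_bound[OF rp dh hM] by blast
  define M' where "M' = 2 * (real q + 1) * M"
  have M0: "0 \<le> M'" using cb[of 0] by (simp add: M'_def)
  define T where "T N s = (\<Sum>m\<le>q. c m * (\<Sum>w\<in>reduced_words ?d m. real (card {v. v < N & walk s v w = v})))" for N s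
  define f where "f x = (\<Sum>m\<le>q. c m * (\<Sum>w\<in>reduced_words ?d m. ret_fun x w))" for x
  have Tl: "T N s = (\<Sum>k<N. poly h (l k))" if "has_walk_counts p N s l" for s l N
    unfolding T_def that[unfolded has_walk_counts_def, rule_format, symmetric] hc
    by (simp add: poly_sum sum_distrib_left sum.swap[of _ "{..<N}"])
  have avg: "(\<Sum>s\<in>systems ?d N. T N s) = card (systems ?d N) * (N * f (1 / N))" if "even N" for N
  proof -
    have "(\<Sum>s\<in>systems ?d N. T N s) = (\<Sum>m\<le>q. c m * (\<Sum>w\<in>reduced_words ?d m. \<Sum>s\<in>systems ?d N. real (card {v. v < N & walk s v w = v})))"
      unfolding T_def sum_distrib_left by (subst sum.swap, intro sum.cong refl, subst sum.swap, rule refl)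
    also have "... = (\<Sum>m\<le>q. c m * (\<Sum>w\<in>reduced_words ?d m. card (systems ?d N) * (N * ret_fun (1 / N) w)))"
      by (intro sum.cong refl arg_cong2[where f = "(*)"] avg_fixed_points that) (auto simp: reduced_words_def)
    finally show ?thesis unfolding f_def by (simp add: sum_distrib_left mult_ac)
  qed
  \<comment> \<open>The trace of \<open>h\<close> is a sum of \<open>N\<close> values in
    \<open>[0, 1]\<close>.\<close>
  have f1: "\<bar>f (1 / N)\<bar> \<le> 1" if N: "even N" "0 < N" for N :: nat
  proof -
    have "\<bar>T N s\<bar> \<le> N" if s: "s \<in> systems ?d N" for s
    proof -
      obtain l :: "nat => real" where l: "\<forall>k<N. \<bar>l k\<bar> \<le> ?d" "has_walk_counts p N s l"
      proof -
        have "\<exists>l :: nat => real. (\<forall>k<N. \<bar>l k\<bar> \<le> ?d) & has_walk_counts p N s l"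
          using system_spectrum[OF systems_ms[OF s] N(2)] by (elim exE conjE, intro exI conjI)
        then show thesis using that by (elim exE conjE) 
      qed
      have "\<bar>T N s\<bar> \<le> (\<Sum>k<N. \<bar>poly h (l k)\<bar>)" unfolding Tl[OF l(2)] by (rule sum_abs)
      also have "... \<le> (\<Sum>k<N. 1)" using h01 l(1) by (intro sum_mono) auto
      finally show ?thesis by simp
    qed
    then have "\<bar>\<Sum>s\<in>systems ?d N. T N s\<bar> \<le> (\<Sum>s\<in>systems ?d N. real N)"
      by (intro order.trans[OF sum_abs] sum_mono) auto
    then have "card (systems ?d N) * real N * \<bar>f (1 / N)\<bar> \<le> card (systems ?d N) * real N * 1"
      unfolding avg[OF N(1)] by (simp add: abs_mult mult_ac)
    then show ?thesis using card_systems_pos[OF N(1), of ?d] N(2) by (subst (asm) mult_le_cancel_left_pos) auto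
  qed
  define Dp :: "real poly" where "Dp = (\<Prod>c<?d. \<Prod>j<q. [:1, - (2 * real j + 1):])"
  have Dp: "poly Dp x = (\<Prod>c<?d. \<Prod>j<q. 1 - (2 * real j + 1) * x)" for x
    unfolding Dp_def poly_prod by (intro prod.cong refl) (simp add: algebra_simps)
  have degD: "degree Dp \<le> ?d * q"
  proof -
    have "degree Dp \<le> (\<Sum>c<?d. degree (\<Prod>j<q. [:1, - (2 * real j + 1):]))"
      unfolding Dp_def using degree_prod_sum_le[of "{..<?d}" "\<lambda>c. \<Prod>j<q. [:1, - (2 * real j + 1):]"] by (simp add: o_def)
    also have "degree (\<Prod>j<q. [:1, - (2 * real j + 1):]) \<le> (\<Sum>j<q. degree [:1, - (2 * real j + 1):])"
      using degree_prod_sum_le[of "{..<q}" "\<lambda>j. [:1, - (2 * real j + 1):]"] by (simp add: o_def)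
    then have "(\<Sum>c<?d. degree (\<Prod>j<q. [:1, - (2 * real j + 1):])) \<le> (\<Sum>c<?d. q)" by (intro sum_mono) auto
    finally show ?thesis by simp
  qed
  have small: "0 < 1 - (2 * real j + 1) * x" "1 - (2 * real j + 1) * x \<le> 1" if "j < q" "0 \<le> x" "x \<le> 1 / (2 * q)" for j x
  proof -
    have "(2 * real j + 1) * x \<le> (2 * real j + 1) * (1 / (2 * q))" using that by (intro mult_left_mono) auto
    also have "... < 1" using that by simp
    finally show "0 < 1 - (2 * real j + 1) * x" by simp
    show "1 - (2 * real j + 1) * x \<le> 1" using that by simp
  qed
  have D01: "0 < poly Dp x & poly Dp x \<le> 1" if "0 \<le> x" "x \<le> 1 / (2 * q)" for x
  proof -
    have "0 < poly Dp x" unfolding Dp by (intro prod_pos) (use small that in auto)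
    moreover have "poly Dp x \<le> 1" unfolding Dp
      by (intro prod_le_1 conjI prod_nonneg) (use small that in \<open>auto intro: less_imp_le\<close>)
    ultimately show ?thesis by simp
  qed
  \<comment> \<open>Markov inequality for \<open>Dp\<close>, which lies between 0 and 1 on
    \<open>[0, 1 / (2 * q)]\<close> and has degree at most \<open>Suc p * q\<close>; this is the
    origin of \<open>G\<close>.\<close>
  have D'G: "\<bar>poly (pderiv Dp) x\<bar> \<le> G" if "0 \<le> x" "x \<le> 1 / (2 * q)" for x
    using markov_weak_closed[OF degD, of "1 / (2 * q)" 1 x] D01 that q by (simp add: G_def abs_of_pos)
  have G0: "0 \<le> G" by (simp add: G_def)
  have DG: "1 - G / N \<le> poly Dp (1 / N)" if "2 * q \<le> N" for N
  proof -
    have le: "1 / real N \<le> 1 / (2 * q)" using that q by (intro divide_left_mono) auto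
    have "\<bar>poly Dp (1 / N) - poly Dp 0\<bar> \<le> (1 / N - 0) * G"
      by (rule poly_lipschitz) (use D'G le in auto)
    moreover have "poly Dp 0 = 1" by (simp add: Dp)
    ultimately show ?thesis by simp
  qed
  have "\<exists>Q :: real poly. degree Q \<le> K & (\<forall>x. (\<forall>j<q. 1 - (2 * real j + 1) * x ~= 0) --> ret_fun x w * poly Dp x = poly Q x)"
    if "w \<in> reduced_words ?d m" "m \<le> q" for w m
    unfolding Dp K_def using that by (intro ret_fun_poly) (auto simp: reduced_words_def)
  then have "\<exists>Q :: real poly. m \<le> q --> w \<in> reduced_words ?d m --> degree Q \<le> K & (\<forall>x. (\<forall>j<q. 1 - (2 * real j + 1) * x ~= 0) --> ret_fun x w * poly Dp x = poly Q x)" for m w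
    by blast
  then have "\<exists>Q :: nat => nat list => real poly. \<forall>m w. m \<le> q --> w \<in> reduced_words ?d m --> degree (Q m w) \<le> K & (\<forall>x. (\<forall>j<q. 1 - (2 * real j + 1) * x ~= 0) --> ret_fun x w * poly Dp x = poly (Q m w) x)"
    by (intro choice allI)
  then obtain Q where Q: "\<And>m w. m \<le> q ==> w \<in> reduced_words ?d m ==> degree (Q m w) \<le> K"
    "\<And>m w x. m \<le> q ==> w \<in> reduced_words ?d m ==> (\<forall>j<q. 1 - (2 * real j + 1) * x ~= 0) ==> ret_fun x w * poly Dp x = poly (Q m w) x"
    by blast
  define P where "P = (\<Sum>m\<le>q. psmult (c m) (\<Sum>w\<in>reduced_words ?d m. Q m w))"
  have degP: "degree P \<le> K"
    unfolding P_def using Q(1)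
    by (intro degree_sum_le order.trans[OF degree_smult_le]) (auto simp: finite_reduced_words)
  have fP: "f x * poly Dp x = poly P x" if "\<forall>j<q. 1 - (2 * real j + 1) * x ~= 0" for x
  proof -
    have "f x * poly Dp x = (\<Sum>m\<le>q. c m * (\<Sum>w\<in>reduced_words ?d m. ret_fun x w * poly Dp x))"
      unfolding f_def sum_distrib_right by (simp only: mult.assoc sum_distrib_right)
    also have "... = (\<Sum>m\<le>q. c m * (\<Sum>w\<in>reduced_words ?d m. poly (Q m w) x))"
      by (intro sum.cong refl arg_cong2[where f = "(*)"] Q(2)[OF _ _ that]) auto
    finally show ?thesis by (simp add: P_def poly_sum)
  qed
  have fN: "f (1 / N) * poly Dp (1 / N) = poly P (1 / N)" if "2 * q \<le> N" for N
  proof (rule fP, intro allI impI)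
    fix j assume "j < q"
    moreover have "1 / real N \<le> 1 / (2 * q)" using that q by (intro divide_left_mono) auto
    ultimately have "0 < 1 - (2 * real j + 1) * (1 / real N)" by (intro small(1)) auto
    then show "1 - (2 * real j + 1) * (1 / N) ~= 0" by linarith
  qed
  have P1: "\<bar>poly P (1 / N)\<bar> \<le> 1" if "even N" "n1 \<le> N" for N
  proof -
    have qN: "2 * q \<le> N" using that n1 by simp
    then have le: "1 / real N \<le> 1 / (2 * q)" using q by (intro divide_left_mono) auto
    have "\<bar>f (1 / N)\<bar> * poly Dp (1 / N) \<le> 1 * 1"
      using f1[OF that(1)] D01[OF _ le] qN q by (intro mult_mono) auto
    then show ?thesis using fN[OF qN] D01[OF _ le] by (metis abs_mult abs_of_pos mult_1 zero_le_divide_1_iff of_nat_0_le_iff)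
  qed
  define F1 where "F1 = (\<Sum>m\<le>q. c m * (\<Sum>w\<in>reduced_words ?d m. ret_deriv 1 (\<lambda>_. 0) (\<lambda>c i. i) 0 w))"
  have f0: "f 0 = c 0"
  proof -
    have "f 0 = (\<Sum>m\<le>q. if m = 0 then c 0 else 0)"
      unfolding f_def
    proof (intro sum.cong refl)
      fix m assume "m \<in> {..q}"
      have "(\<Sum>w\<in>reduced_words ?d m. ret_fun 0 w) = (\<Sum>w\<in>reduced_words ?d m. if m = 0 then 1 else 0)"
        by (intro sum.cong refl, subst ret_fun_0) (auto simp: reduced_words_def)
      then show "c m * (\<Sum>w\<in>reduced_words ?d m. ret_fun 0 w) = (if m = 0 then c 0 else 0)"
        by (auto simp: reduced_words_0)
    qed
    then show ?thesis by simp
  qed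
  have P0: "poly P 0 = c 0" using fP[of 0] f0 by (simp add: Dp)
  have f': "(f has_real_derivative F1) (at 0)"
    unfolding f_def F1_def by (auto intro!: derivative_eq_intros ret_prob_has_derivative simp: mult.commute)
  have P': "poly (pderiv P) 0 = F1 + c 0 * poly (pderiv Dp) 0"
  proof -
    have "((\<lambda>x. f x * poly Dp x) has_real_derivative F1 * poly Dp 0 + poly (pderiv Dp) 0 * f 0) (at 0)"
      by (rule DERIV_mult[OF f' poly_DERIV])
    moreover have "((\<lambda>x. f x * poly Dp x) has_real_derivative poly (pderiv P) 0) (at 0)"
    proof (rule has_field_derivative_transform_within_open[OF poly_DERIV])
      show "open {- (1 / (2 * real q)) <..< 1 / (2 * real q)}" "0 \<in> {- (1 / (2 * real q)) <..< 1 / (2 * real q)}" using q by auto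
      fix x assume x: "x \<in> {- (1 / (2 * real q)) <..< 1 / (2 * real q)}"
      show "poly P x = f x * poly Dp x"
      proof (rule fP[symmetric], intro allI impI)
        fix j assume j: "j < q"
        show "1 - (2 * real j + 1) * x ~= 0"
        proof (cases "0 \<le> x")
          case True then show ?thesis using small(1)[OF j, of x] x by simp
        next
          case False
          then have "(2 * real j + 1) * x \<le> 0" by (intro mult_nonneg_nonpos) auto
          then show ?thesis by simp
        qed
      qed
    qed
    ultimately show ?thesis using DERIV_unique f0 by (fastforce simp: Dp)
  qed
  have hd: "poly h ?d = (\<Sum>m\<le>q. c m * card (reduced_words ?d m))"
    unfolding hc using nb_poly_at_degree[of p] by (simp add: poly_sum)
  have F1b: "F1 \<le> poly h ?d - c 0 + q * (2 * p + 2 * (real q)^2) * M'"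
  proof -
    have "F1 - (poly h ?d - c 0) = (\<Sum>m\<in>{1..q}. c m * ((\<Sum>w\<in>reduced_words ?d m. ret_deriv 1 (\<lambda>_. 0) (\<lambda>c i. i) 0 w) - card (reduced_words ?d m)))"
    proof -
      have s: "(\<Sum>m\<le>q. g m) = g 0 + (\<Sum>m\<in>{1..q}. g m)" for g :: "nat => real"
        using sum.atLeast_Suc_atMost[of 0 q g] by (simp add: atMost_atLeast0)
      show ?thesis unfolding F1_def hd s by (simp add: reduced_words_0 sum_subtractf right_diff_distrib)
    qed
    also have "... \<le> (\<Sum>m\<in>{1..q}. (2 * p + 2 * (real q)^2) * M')"
    proof (intro sum_mono)
      fix m assume m: "m \<in> {1..q}"
      let ?X = "(\<Sum>w\<in>reduced_words ?d m. ret_deriv 1 (\<lambda>_. 0) (\<lambda>c i. i) 0 w) - card (reduced_words ?d m)"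
      have "c m * ?X \<le> \<bar>c m\<bar> * \<bar>?X\<bar>" by (metis abs_ge_self abs_mult)
      also have "... \<le> \<bar>c m\<bar> * ((2 * p + 2 * (real m)^2) * sqrt p ^ m)"
        using sum_ret_deriv[of p m] p m by (intro mult_left_mono) auto
      also have "... = (2 * p + 2 * (real m)^2) * (\<bar>c m\<bar> * sqrt p ^ m)" by simp
      also have "... \<le> (2 * p + 2 * (real q)^2) * M'"
        using cb[of m] m M0 by (intro mult_mono) (auto simp: M'_def power_mono)
      finally show "c m * ?X \<le> (2 * p + 2 * (real q)^2) * M'" .
    qed
    finally show ?thesis by (simp add: mult_ac)
  qed
  define B where "B = 32 * real K ^ 6 * (real n1)^2"
  define Y where "Y = (real N + 1 + G + real q * (2 * real p + 2 * (real q)^2)) * M' + B / N"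
  have qN: "2 * q \<le> N" using N n1 by simp
  have Npos: "0 < real N" using qN q by simp
  have n1pos: "0 < n1" using n1 q by simp
  have B0: "0 \<le> B / N" by (simp add: B_def)
  have Y0: "0 \<le> Y" unfolding Y_def using M0 G0 B0 by (intro add_nonneg_nonneg mult_nonneg_nonneg) auto
  have c0: "\<bar>c 0\<bar> \<le> M'" using cb[of 0] by (simp add: M'_def)
  have NP: "N * poly P (1 / N) \<le> poly h ?d + Y"
  proof -
    have "\<bar>poly P (1 / N) - poly P 0 - 1 / N * poly (pderiv P) 0\<bar> \<le> B * (1 / N)^2"
      unfolding B_def using N n1pos by (intro poly_taylor_from_reciprocals[OF degP P1 n1(1)]) (auto intro: divide_left_mono)
    then have "poly P (1 / N) \<le> c 0 + 1 / N * (F1 + c 0 * poly (pderiv Dp) 0) + B * (1 / N)^2"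
      unfolding P0 P' by linarith
    then have "N * poly P (1 / N) \<le> N * (c 0 + 1 / N * (F1 + c 0 * poly (pderiv Dp) 0) + B * (1 / N)^2)"
      using Npos by (intro mult_left_mono) auto
    also have "... = N * c 0 + (F1 + c 0 * poly (pderiv Dp) 0) + B / N"
      using Npos by (simp add: field_simps power2_eq_square)
    also have "... \<le> N * M' + (poly h ?d - c 0 + q * (2 * p + 2 * (real q)^2) * M' + M' * G) + B / N"
    proof -
      have "c 0 * poly (pderiv Dp) 0 \<le> \<bar>c 0\<bar> * \<bar>poly (pderiv Dp) 0\<bar>" by (metis abs_ge_self abs_mult)
      also have "... \<le> M' * G" using c0 D'G[of 0] M0 by (intro mult_mono) auto
      finally have "c 0 * poly (pderiv Dp) 0 \<le> M' * G" .
      moreover have "N * c 0 \<le> N * M'" using c0 by (intro mult_left_mono) auto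
      ultimately show ?thesis using F1b by linarith
    qed
    also have "... \<le> poly h ?d + Y" unfolding Y_def using c0 by (simp add: algebra_simps)
    finally show ?thesis .
  qed
  have "1 / real N \<le> 1 / (2 * q)" using qN q by (intro divide_left_mono) auto
  then have D: "0 < poly Dp (1 / N)" "poly Dp (1 / N) \<le> 1" "1 - G / N \<le> poly Dp (1 / N)" using D01 DG[OF qN] by auto
  have "G / N \<le> 1 / 2" using N(3) Npos by (simp add: field_simps)
  then have D2: "1 / 2 \<le> poly Dp (1 / N)" using D by linarith
  have hd01: "0 \<le> poly h ?d" "poly h ?d \<le> 1" using h01[of "real ?d"] by auto
  have "N * f (1 / N) - poly h ?d \<le> 2 * (Y + G / N)"
  proof -
    define D0 where "D0 = poly Dp (1 / N)"
    have "(N * f (1 / N)) * D0 \<le> poly h ?d + Y" using fN[OF qN] NP by (simp add: D0_def mult.assoc)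
    then have "(N * f (1 / N) - poly h ?d) * D0 \<le> Y + poly h ?d * (1 - D0)" by (simp add: algebra_simps)
    also have "... \<le> Y + 1 * (G / N)" using D hd01 by (intro add_left_mono mult_mono) (auto simp: D0_def)
    finally have "(N * f (1 / N) - poly h ?d) * D0 \<le> Y + G / N" by simp
    also have "... \<le> (Y + G / N) * (2 * D0)"
      using D2 Y0 G0 Npos mult_left_mono[of 1 "2 * D0" "Y + G / N"] by (simp add: D0_def)
    also have "... = 2 * (Y + G / N) * D0" by simp
    finally show ?thesis using D(1) by (subst (asm) mult_le_cancel_right_pos) (auto simp: D0_def)
  qed
  then have "card (systems ?d N) * (N * f (1 / N) - poly h ?d) \<le> card (systems ?d N) * (2 * (Y + G / N))"
    by (intro mult_left_mono) auto
  moreover have "(\<Sum>s\<in>systems ?d N. T N s - poly h ?d) = card (systems ?d N) * (N * f (1 / N) - poly h ?d)"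
    by (simp add: sum_subtractf avg[OF N(1)] right_diff_distrib)
  ultimately have "(\<Sum>s\<in>systems ?d N. T N s - poly h ?d) \<le> card (systems ?d N) * (2 * (Y + G / N))" by linarith
  then show ?thesis
    unfolding trace_error_def Y_def B_def M'_def using Tl by (intro exI[of _ "T N"] conjI) blast+
qed

section \<open>Step polynomials of polylogarithmic degree\<close>

fun smooth :: "real poly => nat => real poly" where
  "smooth f 0 = f"
| "smooth f (Suc k) = pcompose [:0, 0, 3, -2:] (smooth f k)"

lemma degree_smooth: "degree (smooth f k) \<le> 3 ^ k * degree f"
proof (induction k)
  case (Suc k)
  have "degree [:0, 0, 3, -2 :: real:] = 3" by simp
  then have "degree (smooth f (Suc k)) = 3 * degree (smooth f k)" by (simp only: smooth.simps degree_pcompose)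
  then show ?case using Suc by simp
qed simp

lemma poly_smooth_Suc: "poly (smooth f (Suc k)) x = 3 * (poly (smooth f k) x)^2 - 2 * (poly (smooth f k) x) ^ 3"
  by (simp add: poly_pcompose power2_eq_square power3_eq_cube algebra_simps)

lemma smooth_range:
  assumes "0 \<le> poly f x" "poly f x \<le> 1"
  shows "0 \<le> poly (smooth f k) x & poly (smooth f k) x \<le> 1"
proof (induction k)
  case (Suc k)
  let ?t = "poly (smooth f k) x"
  have "0 \<le> ?t^2 * (3 - 2 * ?t)" "0 \<le> (1 - ?t)^2 * (1 + 2 * ?t)" using Suc by (auto intro!: mult_nonneg_nonneg)
  then show ?case unfolding poly_smooth_Suc by (simp add: power2_eq_square power3_eq_cube algebra_simps)
qed (use assms in simp)

lemma smooth_ge_half: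
  assumes "1 / 2 \<le> poly f x" "poly f x \<le> 1"
  shows "1 / 2 \<le> poly (smooth f k) x"
proof (induction k)
  case (Suc k)
  let ?t = "poly (smooth f k) x"
  have t: "1/2 \<le> ?t" "?t \<le> 1" using Suc smooth_range[of f x k] assms by auto
  have "0 \<le> (?t - 1/2) * (1 + 2 * ?t * (1 - ?t))" using t by (intro mult_nonneg_nonneg add_nonneg_nonneg) auto
  then show ?case unfolding poly_smooth_Suc by (simp add: power2_eq_square power3_eq_cube algebra_simps)
qed (use assms in simp)

text \<open>The smoothstep map has the repelling fixed point 1/2 with slope 3/2, so a gap
  \<open>u <= 1/4\<close> below 1/2 grows at least by the factor 5/4.\<close>

lemma smoothstep_gap:
  fixes t u :: real
  assumes "0 \<le> t" "t \<le> 1/2 - u" "0 \<le> u" "u \<le> 1/4"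
  shows "3 * t^2 - 2 * t ^ 3 \<le> 1/2 - 5/4 * u"
proof -
  define v where "v = 1/2 - t"
  have v: "u \<le> v" "v \<le> 1/2" "0 \<le> v" using assms by (auto simp: v_def)
  have e: "3 * t^2 - 2 * t ^ 3 = 1/2 - v * (3/2 - 2 * v^2)"
    by (simp add: v_def power2_eq_square power3_eq_cube algebra_simps)
  have "5/4 * u \<le> v * (3/2 - 2 * v^2)"
  proof (cases "v \<le> 7/20")
    case True
    then have "v^2 \<le> (7/20)^2" using v by (intro power_mono) auto
    then have "5/4 \<le> 3/2 - 2 * v^2" by (simp add: power2_eq_square)
    then have "v * (5/4) \<le> v * (3/2 - 2 * v^2)" using v by (intro mult_left_mono) auto
    then show ?thesis using v by linarith
  next
    case False
    have "v^2 \<le> (1/2)^2" using v by (intro power_mono) auto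
    then have "1 \<le> 3/2 - 2 * v^2" by (simp add: power2_eq_square)
    then have "v * 1 \<le> v * (3/2 - 2 * v^2)" using v by (intro mult_left_mono) auto
    then show ?thesis using False assms by linarith
  qed
  then show ?thesis using e by linarith
qed

text \<open>Two phases: \<open>k\<close> iterations widen the gap from \<open>(4/5)^k / 4\<close> to
  \<open>1/4\<close>. From then on \<open>t\<close> is replaced by at most \<open>3 * t^2\<close>,
  so that \<open>3 * t\<close>, at most 3/4 at that time, is squared in every iteration.\<close>

lemma smooth_small:
  assumes f: "0 \<le> poly f x" "poly f x \<le> 1/2 - 1/4 * (4/5) ^ k"
  shows "poly (smooth f (k + j)) x \<le> 1/3 * (3/4) ^ (2 ^ j)"
proof -
  have f1: "poly f x \<le> 1" 
  proof -
    have "0 \<le> (4/5 :: real) ^ k" by simp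
    then show ?thesis using f(2) by linarith
  qed
  note rg = smooth_range[OF f(1) f1]
  have A: "i \<le> k ==> poly (smooth f i) x \<le> 1/2 - 1/4 * (4/5) ^ (k - i)" for i
  proof (induction i)
    case (Suc i)
    have "poly (smooth f i) x \<le> 1/2 - 1/4 * (4/5) ^ (k - i)" using Suc by simp
    moreover have "(4/5 :: real) ^ (k - i) \<le> 1" by (intro power_le_one) auto
    ultimately have "poly (smooth f (Suc i)) x \<le> 1/2 - 5/4 * (1/4 * (4/5) ^ (k - i))"
      unfolding poly_smooth_Suc using rg[of i] by (intro smoothstep_gap) auto
    moreover have "k - i = Suc (k - Suc i)" using Suc.prems by simp
    ultimately show ?case by simp
  qed (use f in simp)
  show ?thesis
  proof (induction j)
    case 0 then show ?case using A[of k] by simp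
  next
    case (Suc j)
    let ?t = "poly (smooth f (k + j)) x"
    have "poly (smooth f (k + Suc j)) x \<le> 3 * ?t^2" using rg[of "k + j"] by (simp only: add_Suc_right poly_smooth_Suc) simp
    also have "... \<le> 3 * (1/3 * (3/4) ^ (2 ^ j))^2" using Suc rg[of "k + j"] by (intro mult_left_mono power_mono) auto
    also have "... = 1/3 * (3/4) ^ (2 ^ Suc j)" by (simp add: power2_eq_square flip: power_add mult_2)
    finally show ?case .
  qed
qed

text \<open>Starts from an even quadratic polynomial that takes the value 1/2 at the threshold and
  spends \<open>k\<close> iterations on each of the two phases, hence degree
  \<open>2 * 3^(2 k)\<close>. Decay by repeated squaring makes the degree polylogarithmic in the
  inverse of the size on \<open>[-\<rho>, \<rho>]\<close>.\<close>

theorem step_polynomial: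
  fixes d \<rho> :: real
  assumes d: "0 < d" and \<tau>: "\<rho>^2 / d^2 + 1/2 * (4/5) ^ k \<le> 1"
  shows "\<exists>h :: real poly. degree h \<le> 2 * 9 ^ k & (\<forall>x. \<bar>x\<bar> \<le> d --> 0 \<le> poly h x & poly h x \<le> 1)
    & (\<forall>x. \<bar>x\<bar> \<le> \<rho> --> \<bar>poly h x\<bar> \<le> (3/4) ^ (2 ^ k))
    & (\<forall>x. \<bar>x\<bar> \<le> d --> \<rho>^2 + 1/2 * (4/5) ^ k * d^2 \<le> x^2 --> 1/2 \<le> poly h x)"
proof -
  define t where "t = \<rho>^2 / d^2 + 1/2 * (4/5) ^ k"
  have t: "0 \<le> t" "t \<le> 1" using \<tau> by (auto simp: t_def)
  define f where "f = [:1/2 - t/2, 0, 1/(2 * d^2):]"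
  define h where "h = smooth f (k + k)"
  have pf: "poly f x = 1/2 + (x^2 / d^2 - t) / 2" for x
    by (simp add: f_def power2_eq_square field_simps)
  have x2: "0 \<le> x^2 / d^2" "\<bar>x\<bar> \<le> d ==> x^2 / d^2 \<le> 1" for x
    using d power_mono[of "\<bar>x\<bar>" d 2] by auto
  have aux1: "0 \<le> X ==> u \<le> 1 ==> 0 \<le> 1/2 + (X - u) / 2" for X u :: real by (simp add: field_simps)
  have aux2: "X \<le> 1 ==> 0 \<le> u ==> 1/2 + (X - u) / 2 \<le> 1" for X u :: real by (simp add: field_simps)
  have aux3: "X \<le> Y ==> 1/2 + (X - (Y + 1/2 * Z)) / 2 \<le> 1/2 - 1/4 * Z" for X Y Z :: real by (simp add: field_simps)
  have f01: "0 \<le> poly f x" for x unfolding pf by (rule aux1[OF x2(1) t(2)])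
  have f1: "poly f x \<le> 1" if "\<bar>x\<bar> \<le> d" for x unfolding pf by (rule aux2[OF x2(2)[OF that] t(1)])
  have "degree f \<le> 2" by (simp add: f_def)
  then have "degree h \<le> 3 ^ (k + k) * 2" unfolding h_def by (intro order.trans[OF degree_smooth] mult_left_mono) auto
  also have "(3::nat) ^ (k + k) = 9 ^ k" by (simp add: power_add flip: power_mult_distrib)
  finally have "degree h \<le> 2 * 9 ^ k" by simp
  moreover have "0 \<le> poly h x & poly h x \<le> 1" if "\<bar>x\<bar> \<le> d" for x
    unfolding h_def by (rule smooth_range[OF f01 f1[OF that]])
  moreover have "\<bar>poly h x\<bar> \<le> (3/4) ^ (2 ^ k)" if x: "\<bar>x\<bar> \<le> \<rho>" for x
  proof -
    have "x^2 / d^2 \<le> \<rho>^2 / d^2" using x by (intro divide_right_mono) (auto simp: abs_le_square_iff[symmetric])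
    then have le: "poly f x \<le> 1/2 - 1/4 * (4/5) ^ k" unfolding pf t_def by (rule aux3)
    have "0 \<le> (4/5 :: real) ^ k" by simp
    then have "poly f x \<le> 1" using le by linarith
    then have "0 \<le> poly h x" unfolding h_def using smooth_range[OF f01] by blast
    moreover have "poly h x \<le> 1/3 * (3/4) ^ (2 ^ k)" unfolding h_def by (rule smooth_small[OF f01 le])
    moreover have "0 \<le> (3/4 :: real) ^ (2 ^ k)" by simp
    ultimately show ?thesis by linarith
  qed
  moreover have "1/2 \<le> poly h x" if x: "\<bar>x\<bar> \<le> d" "\<rho>^2 + 1/2 * (4/5) ^ k * d^2 \<le> x^2" for x
  proof -
    have "t * d^2 = \<rho>^2 + 1/2 * (4/5) ^ k * d^2" using d by (simp add: t_def distrib_right)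
    then have "t \<le> x^2 / d^2" using x(2) d by (simp add: pos_le_divide_eq)
    then have "1/2 \<le> poly f x" unfolding pf by simp
    then show ?thesis unfolding h_def by (rule smooth_ge_half[OF _ f1[OF x(1)]])
  qed
  ultimately show ?thesis by blast
qed

text \<open>All parameters below are polylogarithmic in \<open>N\<close>, whereas the error terms carry a factor
  \<open>1/N\<close>.\<close>

lemma parameters_eventually:
  "\<forall>\<^sub>F N :: nat in sequentially. \<forall>q. real q \<le> 2 * (5/4 * ln N) ^ 10 --> 
     (let K = Suc p * q + q; G = 8 * real (Suc p * q) ^ 3 * q; n1 = 16 * K ^ 3 + 2 * q in
      n1 \<le> N & 2 * G \<le> N &
      trace_error N n1 p q K G (1 / real N ^ 3) \<le> 1/64)"
proof -
  \<comment> \<open>Bounds the degree \<open>2 * 9^k\<close> when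
    \<open>(5/4)^k <= 5/4 * ln N\<close>, because \<open>9 <= (5/4)^10\<close>.\<close>
  define Q where "Q x = 2 * (5/4 * ln x) ^ 10" for x :: real
  have e1: "\<forall>\<^sub>F N :: nat in sequentially. 16 * (ln N * Q N) ^ 3 + 2 * Q N \<le> N"
    unfolding Q_def by real_asymp
  have e2: "\<forall>\<^sub>F N :: nat in sequentially. 2 * (8 * (ln N * Q N) ^ 3 * Q N) \<le> N"
    unfolding Q_def by real_asymp
  have e3: "\<forall>\<^sub>F N :: nat in sequentially. 2 * ((real N + 1 + 8 * (ln N * Q N) ^ 3 * Q N + Q N * (2 * ln N + 2 * (Q N)^2)) * (2 * (Q N + 1) * (1 / real N ^ 3))
     + 32 * (ln N * Q N) ^ 6 * (16 * (ln N * Q N) ^ 3 + 2 * Q N)^2 / N + 8 * (ln N * Q N) ^ 3 * Q N / N) \<le> 1/64"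
    unfolding Q_def by real_asymp
  have e4: "\<forall>\<^sub>F N :: nat in sequentially. real (p + 2) \<le> ln N" by real_asymp
  show ?thesis using e1 e2 e3 e4 eventually_gt_at_top[of 1]
  proof eventually_elim
    case (elim N)
    show ?case unfolding Let_def
    proof (intro allI impI)
      fix q assume q: "real q \<le> 2 * (5/4 * ln N) ^ 10"
      define K where "K = Suc p * q + q"
      define G where "G = 8 * real (Suc p * q) ^ 3 * q"
      define n1 where "n1 = 16 * K ^ 3 + 2 * q"
      have qQ: "real q \<le> Q N" using q by (simp add: Q_def)
      have Q0: "0 \<le> Q N" by (simp add: Q_def)
      have L0: "0 \<le> ln (real N)" using elim by simp
      have "real K = real (p + 2) * real q" by (simp add: K_def algebra_simps)
      then have K: "real K \<le> ln N * Q N" using elim(4) qQ Q0 by (auto intro!: mult_mono)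
      have dq: "real (Suc p * q) \<le> ln N * Q N" unfolding of_nat_mult using elim(4) qQ Q0 by (intro mult_mono) auto
      have G: "G \<le> 8 * (ln N * Q N) ^ 3 * Q N"
        unfolding G_def using dq qQ L0 Q0 by (intro mult_mono power_mono mult_nonneg_nonneg) auto
      have G0: "0 \<le> G" by (simp add: G_def)
      have n1: "real n1 \<le> 16 * (ln N * Q N) ^ 3 + 2 * Q N"
        using power_mono[OF K, of 3] qQ by (simp add: n1_def)
      have pL: "real p \<le> ln N" using elim(4) by simp
      have 1: "n1 \<le> N" using n1 elim(1) by linarith
      have 2: "2 * G \<le> N" using G elim(2) by linarith
      have "trace_error N n1 p q K G (1 / real N ^ 3)
        \<le> 2 * ((real N + 1 + 8 * (ln N * Q N) ^ 3 * Q N + Q N * (2 * ln N + 2 * (Q N)^2)) * (2 * (Q N + 1) * (1 / real N ^ 3))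
     + 32 * (ln N * Q N) ^ 6 * (16 * (ln N * Q N) ^ 3 + 2 * Q N)^2 / N + 8 * (ln N * Q N) ^ 3 * Q N / N)"
        unfolding trace_error_def using G G0 n1 K qQ Q0 L0 pL
        by (intro mult_left_mono add_mono mult_mono divide_right_mono power_mono mult_nonneg_nonneg add_nonneg_nonneg divide_nonneg_nonneg) auto
      then have 3: "trace_error N n1 p q K G (1 / real N ^ 3) \<le> 1/64"
        using elim(3) by linarith
      show "16 * (Suc p * q + q) ^ 3 + 2 * q \<le> N & 2 * (8 * real (Suc p * q) ^ 3 * q) \<le> N &
        trace_error N (16 * (Suc p * q + q) ^ 3 + 2 * q) p q (Suc p * q + q) (8 * real (Suc p * q) ^ 3 * q) (1 / real N ^ 3) \<le> 1/64"
        using 1 2 3 unfolding n1_def K_def G_def by blast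
    qed
  qed
qed

text \<open>Here \<open>g s\<close> is the trace of a step polynomial over the nontrivial
  eigenvalues. The summands are nonnegative, so \<open>g s < 1/2\<close> keeps every such eigenvalue
  out of the region where the polynomial is at least 1/2. The small mean leaves room for two more
  requirements on the same system in \<open>good_base\<close>.\<close>

theorem near_ramanujan_mean:
  assumes p: "2 \<le> p"
  shows "\<forall>\<^sub>F N :: nat in sequentially. even N --> (\<exists>g. (\<forall>s\<in>systems (Suc p) N. 0 \<le> g s &
       (g s < 1/2 --> spectral_bound (Suc p) N s (2 * sqrt p + (real p + 1)^2 / ln N)))
     & (\<Sum>s\<in>systems (Suc p) N. g s) \<le> card (systems (Suc p) N) / (64::real))"
  (is "\<forall>\<^sub>F N in _. even N --> ?P N")
proof -
  have c1: "4 * real p / (real p + 1)^2 < 1"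
  proof -
    have "0 < (real p - 1)^2" using p by simp
    then show ?thesis by (simp add: power2_eq_square field_simps)
  qed
  have e1: "\<forall>\<^sub>F N :: nat in sequentially. 4 * real p / (real p + 1)^2 + 1 / (2 * ln N) \<le> 1"
  proof -
    have "(\<lambda>N. 4 * real p / (real p + 1)^2 + 1 / (2 * ln (real N))) \<longlonglongrightarrow> 4 * real p / (real p + 1)^2 + 0"
      by (intro tendsto_intros) real_asymp
    then have "\<forall>\<^sub>F N :: nat in sequentially. 4 * real p / (real p + 1)^2 + 1 / (2 * ln N) < 1"
      using c1 by (intro order_tendstoD(2)[of _ "4 * real p / (real p + 1)^2"]) auto
    then show ?thesis by eventually_elim simp
  qed
  have e2: "\<forall>\<^sub>F N :: nat in sequentially. 4 \<le> ln N" by real_asymp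
  show ?thesis using e1 e2 parameters_eventually[of p] eventually_gt_at_top[of 2]
  proof eventually_elim
    case (elim N)
    let ?L = "ln (real N)" and ?d = "Suc p" and ?dr = "real p + 1"
    have "?P N" if ev: "even N"
    proof -
    have N: "2 < N" "even N" using elim ev by auto
    then have N0: "0 < N" by simp
    have L: "4 \<le> ?L" using elim by simp
    \<comment> \<open>The least \<open>k\<close> with \<open>(5/4)^k >= ln N\<close>: the transition
      window in \<open>x^2\<close> then has width of order \<open>1 / ln N\<close>.\<close>
    define k where "k = nat \<lceil>ln ?L / ln (5/4)\<rceil>"
    have l54: "0 < ln (5/4 :: real)" by simp
    have k: "ln ?L / ln (5/4) \<le> k" "real k < ln ?L / ln (5/4) + 1"
    proof -
      have "0 \<le> ln ?L / ln (5/4)" using L l54 by (intro divide_nonneg_nonneg) auto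
      then have "real k = of_int \<lceil>ln ?L / ln (5/4)\<rceil>" unfolding k_def by (intro of_nat_nat) auto
      then show "ln ?L / ln (5/4) \<le> k" "real k < ln ?L / ln (5/4) + 1"
        using ceiling_correct[of "ln ?L / ln (5/4)"] by linarith+
    qed
    have lk: "ln ((5/4 :: real) ^ k) = k * ln (5/4)" by (simp add: ln_realpow)
    have "ln ?L \<le> ln ((5/4) ^ k)" unfolding lk using k(1) l54 by (simp add: pos_divide_le_eq)
    then have kL: "?L \<le> (5/4) ^ k" using L by (subst (asm) ln_le_cancel_iff) auto
    have "ln ((5/4) ^ k) \<le> ln (5/4 * ?L)"
    proof -
      have "real k * ln (5/4) \<le> (ln ?L / ln (5/4) + 1) * ln (5/4)" using k(2) l54 by (intro mult_right_mono) auto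
      also have "... = ln (5/4) + ln ?L" using l54 by (simp add: distrib_right)
      also have "... = ln (5/4 * ?L)" using L by (subst ln_mult) auto
      finally show ?thesis unfolding lk .
    qed
    then have kU: "(5/4) ^ k \<le> 5/4 * ?L" using L by (subst (asm) ln_le_cancel_iff) auto
    have inv: "(4/5 :: real) ^ k = 1 / (5/4) ^ k" by (simp add: power_divide)
    have d45: "(4/5 :: real) ^ k \<le> 1 / ?L" unfolding inv using kL L by (intro divide_left_mono) auto
    define q where "q = 2 * (9::nat) ^ k"
    have "(9 :: real) ^ k \<le> ((5/4) ^ 10) ^ k" by (intro power_mono) (auto simp: power_divide)
    also have "... = ((5/4) ^ k) ^ 10" by (simp add: power_mult[symmetric] mult.commute)
    also have "... \<le> (5/4 * ?L) ^ 10" using kU by (intro power_mono) auto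
    finally have q: "real q \<le> 2 * (5/4 * ?L) ^ 10" by (simp add: q_def)
    define K where "K = Suc p * q + q"
    define G where "G = 8 * real (Suc p * q) ^ 3 * q"
    define n1 where "n1 = 16 * K ^ 3 + 2 * q"
    have par: "n1 \<le> N" "2 * G \<le> N"
      "trace_error N n1 p q K G (1 / real N ^ 3) \<le> 1/64"
      using elim(3)[rule_format, OF q] unfolding Let_def K_def G_def n1_def by blast+
    have \<rho>: "(2 * sqrt p)^2 = 4 * real p" by (simp add: power_mult_distrib)
    have "(2 * sqrt p)^2 / ?dr^2 + 1/2 * (4/5) ^ k \<le> 1"
    proof -
      have "1/2 * (4/5) ^ k \<le> 1 / (2 * ?L)" using d45 by simp
      then show ?thesis using elim(1) unfolding \<rho> by linarith
    qed
    then obtain h :: "real poly" where h: "degree h \<le> 2 * 9 ^ k" "\<And>x. \<bar>x\<bar> \<le> ?dr ==> 0 \<le> poly h x & poly h x \<le> 1"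
      "\<And>x. \<bar>x\<bar> \<le> 2 * sqrt p ==> \<bar>poly h x\<bar> \<le> (3/4) ^ (2 ^ k)"
      "\<And>x. \<bar>x\<bar> \<le> ?dr ==> (2 * sqrt p)^2 + 1/2 * (4/5) ^ k * ?dr^2 \<le> x^2 ==> 1/2 \<le> poly h x"
      using step_polynomial[of ?dr "2 * sqrt p" k] by auto
    \<comment> \<open>Since \<open>(5/4)^3 <= 2\<close>, the exponent \<open>2^k\<close> is at least
      \<open>(ln N)^3\<close>, which outweighs the \<open>3 * ln N\<close> needed.\<close>
    have M: "(3/4 :: real) ^ (2 ^ k) \<le> 1 / real N ^ 3"
    proof -
      have "?L ^ 3 \<le> ((5/4) ^ k) ^ 3" using kL L by (intro power_mono) auto
      also have "... = ((5/4) ^ 3) ^ k" by (simp add: power_mult[symmetric] mult.commute)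
      also have "... \<le> 2 ^ k" by (intro power_mono) (auto simp: power_divide)
      finally have 2: "?L ^ 3 \<le> 2 ^ k" .
      have "16 * ?L \<le> ?L ^ 3"
        using mult_mono[of 4 ?L 4 ?L] L mult_right_mono[of 16 "?L * ?L" ?L] by (simp add: power3_eq_cube)
      moreover have "1/4 \<le> ln (4/3 :: real)"
        using ln_le_minus_one[of "3/4 :: real"] ln_div[of 3 "4::real"] ln_div[of 4 "3::real"] by simp
      ultimately have "3 * ?L \<le> 2 ^ k * ln (4/3)"
        using 2 mult_mono[of "16 * ?L" "2 ^ k" "1/4" "ln (4/3)"] L by simp
      then have "ln (real N ^ 3) \<le> ln ((4/3) ^ (2 ^ k))" using N by (simp add: ln_realpow)
      then have "real N ^ 3 \<le> (4/3) ^ (2 ^ k)" using N by (subst (asm) ln_le_cancel_iff) auto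
      then have "1 / (4/3) ^ (2 ^ k) \<le> 1 / real N ^ 3" using N by (intro divide_left_mono) auto
      then show ?thesis by (simp add: power_divide)
    qed
    have hM: "\<And>x. \<bar>x\<bar> \<le> 2 * sqrt p ==> \<bar>poly h x\<bar> \<le> 1 / real N ^ 3" using h(3) M by (meson order_trans)
    have h01: "\<And>x. \<bar>x\<bar> \<le> real (Suc p) ==> 0 \<le> poly h x & poly h x \<le> 1" using h(2) by (simp add: add.commute)
    have "\<exists>T. (\<forall>s\<in>systems ?d N. \<forall>l.
        has_walk_counts p N s l
        --> T s = (\<Sum>k<N. poly h (l k :: real))) & (\<Sum>s\<in>systems ?d N. T s - poly h ?d) \<le> card (systems ?d N) *
        trace_error N n1 p q K G (1 / real N ^ 3)"
      unfolding K_def G_def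
      by (rule expected_trace) (use p h(1) h01 hM par N in \<open>simp_all only: q_def[symmetric] n1_def K_def G_def\<close>, simp_all add: q_def)
    then obtain T where T: "\<And>s l. s \<in> systems ?d N ==>
        has_walk_counts p N s l
        ==> T s = (\<Sum>k<N. poly h (l k :: real))"
      and Tsum: "(\<Sum>s\<in>systems ?d N. T s - poly h ?d) \<le> card (systems ?d N) *
        trace_error N n1 p q K G (1 / real N ^ 3)"
      by blast
    define g where "g s = T s - poly h ?d" for s
    have "0 \<le> g s & (g s < 1/2 --> spectral_bound ?d N s (2 * sqrt p + ?dr^2 / ?L))" if s: "s \<in> systems ?d N" for s
    proof -
      obtain l :: "nat => real" where l: "l 0 = real ?d" "\<forall>k<N. \<bar>l k\<bar> \<le> ?d"
        "has_walk_counts p N s l"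
        "\<forall>L\<ge>0. (\<forall>k. 0 < k --> k < N --> \<bar>l k\<bar> \<le> L) --> spectral_bound ?d N s L"
      proof -
        have "\<exists>l :: nat => real. l 0 = real ?d & (\<forall>k<N. \<bar>l k\<bar> \<le> ?d) &
          has_walk_counts p N s l &
          (\<forall>L\<ge>0. (\<forall>k. 0 < k --> k < N --> \<bar>l k\<bar> \<le> L) --> spectral_bound ?d N s L)"
          using system_spectrum[OF systems_ms[OF s] N0] by (elim exE conjE, intro exI conjI)
        then show thesis using that by (elim exE conjE)
      qed
      have "T s = (\<Sum>k<N. poly h (l k))" by (rule T[OF s l(3)])
      also have "... = poly h (l 0) + (\<Sum>k\<in>{..<N} - {0}. poly h (l k))" using N by (subst sum.remove[of _ 0]) auto
      finally have g: "g s = (\<Sum>k\<in>{..<N} - {0}. poly h (l k))" by (simp add: g_def l(1))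
      have h0: "0 \<le> poly h (l k)" if "k < N" for k using h01[of "l k"] l(2) that by simp
      have "0 \<le> g s" unfolding g using h0 by (intro sum_nonneg) auto
      moreover have "spectral_bound ?d N s (2 * sqrt p + ?dr^2 / ?L)" if g2: "g s < 1/2"
      proof (rule l(4)[rule_format])
        fix k assume k': "0 < k" "k < N"
        have "poly h (l k) \<le> g s" unfolding g using k' h0 by (intro member_le_sum) auto
        then have "poly h (l k) < 1/2" using g2 by simp
        have "(l k)^2 < (2 * sqrt p)^2 + 1/2 * (4/5) ^ (nat \<lceil>ln ?L / ln (5/4)\<rceil>) * ?dr^2"
          using h(4)[of "l k"] \<open>poly h (l k) < 1/2\<close> l(2) k' unfolding k_def by (force simp: add.commute)
        also have "... \<le> (2 * sqrt p)^2 + 1/2 * (1 / ?L) * ?dr^2"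
          using d45 unfolding k_def by (intro add_left_mono mult_right_mono mult_left_mono) auto
        \<comment> \<open>From squares to absolute values; the cross term of the square absorbs the
          window.\<close>
        also have "... \<le> (2 * sqrt p + ?dr^2 / ?L)^2"
        proof -
          have "1 \<le> 2 * (2 * sqrt p)" using p real_sqrt_ge_one[of "real p"] by linarith
          then have 1: "1/2 * (?dr^2 / ?L) \<le> 2 * (2 * sqrt p) * (?dr^2 / ?L)" using L by (intro mult_right_mono) auto
          have aux: "1/2 * X \<le> 2 * a * X ==> a^2 + 1/2 * X \<le> (a + X)^2" for a X :: real
            using zero_le_power2[of X] by (simp only: power2_sum)
          have "1/2 * (1 / ?L) * ?dr^2 = 1/2 * (?dr^2 / ?L)" by simp
          then show ?thesis using aux[OF 1] by (simp only:)
        qed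
        finally have "(l k)^2 \<le> (2 * sqrt p + ?dr^2 / ?L)^2" by simp
        moreover have "0 \<le> 2 * sqrt p + ?dr^2 / ?L" using L by (intro add_nonneg_nonneg divide_nonneg_nonneg) auto
        ultimately show "\<bar>l k\<bar> \<le> 2 * sqrt p + ?dr^2 / ?L" by (metis abs_le_square_iff abs_of_nonneg)
      qed (use L in \<open>auto intro!: add_nonneg_nonneg divide_nonneg_nonneg\<close>)
      ultimately show ?thesis by blast
    qed
    moreover have "(\<Sum>s\<in>systems ?d N. g s) \<le> card (systems ?d N) / (64::real)"
    proof -
      have "(\<Sum>s\<in>systems ?d N. g s) \<le> card (systems ?d N) * (1/64)"
        unfolding g_def using Tsum by (rule order.trans) (intro mult_left_mono par(3); simp)
      then show ?thesis by simp
    qed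
    ultimately show ?thesis by (intro exI[of _ g]) blast
    qed
    then show ?case by blast
  qed
qed

section \<open>Short cycles\<close>

text \<open>Reduced also across the base point, so that closed walks may be rotated
  (\<open>cyc_reduced_rotate\<close>).\<close>

definition cyc_reduced :: "nat list => bool" where
  "cyc_reduced w \<longleftrightarrow> w ~= [] & distinct_adj w & hd w ~= last w"

definition short_cycles :: "nat => nat => (nat => nat => nat) => nat => (nat \<times> nat list) set" where
  "short_cycles d N s g = {(v, w). v < N & set w \<subseteq> {..<d} & length w \<le> g & cyc_reduced w & walk s v w = v}"

lemma finite_short_cycles: "finite (short_cycles d N s g)"
proof -
  have "short_cycles d N s g \<subseteq> {..<N} \<times> {w. set w \<subseteq> {..<d} & length w \<le> g}"
    by (auto simp: short_cycles_def)
  then show ?thesis by (rule finite_subset) (simp add: finite_lists_length_le)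
qed

text \<open>As long as first and last letter agree they are stripped and become part of a common
  tail \<open>r\<close>; the core that remains is cyclically reduced.\<close>

lemma lollipop_decomp:
  assumes ms: "matchings d N s"
  shows "set w \<subseteq> {..<d} ==> distinct_adj w ==> w ~= [] ==> v < N ==> walk s v w = v ==>
    \<exists>r w0. w = r @ w0 @ rev r & cyc_reduced w0 & walk s (walk s v r) w0 = walk s v r"
proof (induction "length w" arbitrary: w v rule: less_induct)
  case less
  show ?case
  proof (cases "hd w = last w")
    case False
    then show ?thesis using less.prems by (intro exI[of _ "[]"] exI[of _ w]) (simp add: cyc_reduced_def)
  next
    case True
    obtain c w1 where w: "w = c # w1" using less.prems by (cases w) auto
    have c: "c < d" using less.prems w by simp
    have "w1 ~= []" using less.prems w ms_neq[OF ms c] by auto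
    then obtain w2 where w1: "w1 = w2 @ [c]" using True w by (metis append_butlast_last_id last_ConsR list.sel(1))
    have ne: "w2 ~= []" using less.prems(2) w w1 by auto
    have red: "distinct_adj w2" using less.prems(2) w w1 by (auto simp: distinct_adj_Cons distinct_adj_append_iff)
    have "walk s (s c v) w2 = s c v"
    proof -
      have "s c (walk s (s c v) w2) = v" using less.prems(5) by (simp add: w w1 walk_append)
      then show ?thesis using ms_invol[OF ms c] by metis
    qed
    then obtain r w0 where r: "w2 = r @ w0 @ rev r" "cyc_reduced w0" "walk s (walk s (s c v) r) w0 = walk s (s c v) r"
      using less.hyps[of w2 "s c v"] less.prems ne red w w1 ms_less[OF ms c] by auto
    then show ?thesis using w w1 by (intro exI[of _ "c # r"] exI[of _ w0]) simp
  qed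
qed

text \<open>Girth in terms of reduced walks; for \<open>g >= 2\<close> this also excludes parallel
  edges, whose closed walks are the words of two different colours.\<close>

definition girth_gt :: "nat => nat => (nat => nat => nat) => nat => bool" where
  "girth_gt d N s g \<longleftrightarrow> (\<forall>v w. v < N --> set w \<subseteq> {..<d} --> distinct_adj w --> w ~= [] --> length w \<le> g --> walk s v w ~= v)"

lemma girth_gtD:
  "girth_gt d N s g ==> v < N ==> set w \<subseteq> {..<d} ==> distinct_adj w ==> w ~= [] ==> length w \<le> g ==> walk s v w ~= v"
  by (simp add: girth_gt_def)

lemma girth_gt_mono: "girth_gt d N s g ==> g' \<le> g ==> girth_gt d N s g'"
  unfolding girth_gt_def using le_trans by blast

lemma girth_gt_iff:
  assumes ms: "matchings d N s"
  shows "girth_gt d N s g \<longleftrightarrow> short_cycles d N s g = {}"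
proof
  assume g: "girth_gt d N s g"
  have "x \<notin> short_cycles d N s g" for x
    using girth_gtD[OF g, of "fst x" "snd x"] by (auto simp: short_cycles_def cyc_reduced_def split: prod.splits)
  then show "short_cycles d N s g = {}" by blast
next
  assume e: "short_cycles d N s g = {}"
  show "girth_gt d N s g"
    unfolding girth_gt_def
  proof (intro allI impI notI)
    fix v w assume a: "v < N" "set w \<subseteq> {..<d}" "distinct_adj w" "w ~= []" "length w \<le> g" "walk s v w = v"
    from lollipop_decomp[OF ms a(2,3,4,1,6)] obtain r w0 where
      r: "w = r @ w0 @ rev r" "cyc_reduced w0" "walk s (walk s v r) w0 = walk s v r" by blast
    then have "(walk s v r, w0) \<in> short_cycles d N s g"
      using a walk_less[OF ms, of r v] by (auto simp: short_cycles_def)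
    then show False using e by simp
  qed
qed

text \<open>Otherwise \<open>w1\<close> followed by the reverse of \<open>w2\<close> would, after
  cancelling equal ends, be a short closed reduced walk.\<close>

lemma reduced_walk_unique:
  assumes ms: "matchings d N s" and g: "girth_gt d N s g"
  shows "v < N ==> set w1 \<subseteq> {..<d} ==> set w2 \<subseteq> {..<d} ==> distinct_adj w1 ==> distinct_adj w2 ==>
    length w1 + length w2 \<le> g ==> walk s v w1 = walk s v w2 ==> w1 = w2"
proof (induction w1 arbitrary: w2 rule: rev_induct)
  case Nil
  then show ?case using girth_gtD[OF g, of v w2] by auto
next
  case (snoc c w1)
  show ?case
  proof (cases w2 rule: rev_cases)
    case Nil
    then show ?thesis using girth_gtD[OF g, of v "w1 @ [c]"] snoc.prems by simp
  next
    case (snoc w3 c')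
    show ?thesis
    proof (cases "c = c'")
      case True
      have c: "c < d" using snoc.prems by simp
      have "walk s v w1 = walk s v w3"
        using snoc.prems(7) True \<open>w2 = w3 @ [c']\<close> ms_inj[OF ms c] by (simp add: walk_append)
      then have "w1 = w3" using snoc.prems snoc.IH[of w3] \<open>w2 = w3 @ [c']\<close> by (auto simp: distinct_adj_append_iff)
      then show ?thesis using True \<open>w2 = w3 @ [c']\<close> by simp
    next
      case False
      let ?w = "(w1 @ [c]) @ rev w2"
      have "walk s v ?w = v"
        using walk_rev[OF ms snoc.prems(3), of v] snoc.prems(7) by (simp only: walk_append)
      moreover have "distinct_adj ?w"
        using snoc.prems False \<open>w2 = w3 @ [c']\<close>
        using distinct_adj_rev[of w2] by (subst distinct_adj_append_iff) (auto simp: hd_rev)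
      ultimately show ?thesis
        using girth_gtD[OF g, of v ?w] snoc.prems by simp
    qed
  qed
qed

section \<open>Switching one edge against a far one\<close>

definition switch :: "(nat => nat => nat) => nat => nat => nat => nat => nat => nat" where
  "switch s c x u = s(c := (s c)(x := u, u := x, s c x := s c u, s c u := s c x))"

definition far :: "nat => (nat => nat => nat) => nat => nat => nat => bool" where
  "far d s g x u \<longleftrightarrow> (\<forall>w. set w \<subseteq> {..<d} --> length w \<le> g --> walk s x w ~= u)"

lemma farD: "far d s g x u ==> set w \<subseteq> {..<d} ==> length w \<le> g ==> walk s x w ~= u"
  by (simp add: far_def)

lemma far_neq: "far d s g x u ==> x ~= u"
  using farD[of d s g x u "[]"] by auto

lemma far_sym:
  assumes "matchings d N s" "far d s g x u"
  shows "far d s g u x"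
  unfolding far_def
proof (intro allI impI notI)
  fix w assume w: "set w \<subseteq> {..<d}" "length w \<le> g" "walk s u w = x"
  then have "walk s x (rev w) = u" using walk_rev[OF assms(1) w(1)] by blast
  then show False using farD[OF assms(2), of "rev w"] w by simp
qed

lemma far_mono: "far d s g x u ==> g' \<le> g ==> far d s g' x u"
  unfolding far_def using le_trans by blast

lemma far_step: "far d s (Suc g) x u ==> c < d ==> far d s g (s c x) u"
  unfolding far_def
proof (intro allI impI)
  fix w assume a: "\<forall>w. set w \<subseteq> {..<d} --> length w \<le> Suc g --> walk s x w ~= u" "c < d" "set w \<subseteq> {..<d}" "length w \<le> g"
  then show "walk s (s c x) w ~= u" using a(1)[rule_format, of "c # w"] by auto
qed

text \<open>The edge at \<open>x\<close> is to be destroyed, the edge at \<open>u\<close> is its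
  partner. The partner is far away and no short closed reduced walk starts at its ends, so that
  neither new edge will lie on a cycle of length at most \<open>g\<close>.\<close>

locale switching =
  fixes d N :: nat and s :: "nat => nat => nat" and c x u g :: nat
  assumes ms: "matchings d N s" and c: "c < d" and x: "x < N" and u: "u < N"
    and far: "\<And>a b. a \<in> {x, s c x} ==> b \<in> {u, s c u} ==> far d s g a b"
    and clean: "\<And>b w. b \<in> {u, s c u} ==> set w \<subseteq> {..<d} ==> distinct_adj w ==> w ~= [] ==> length w < g ==> walk s b w ~= b"
begin

abbreviation "t \<equiv> switch s c x u"
abbreviation "A \<equiv> {x, s c x}"
abbreviation "B \<equiv> {u, s c u}"

lemma AB: "A \<inter> B = {}"
  using far far_neq by fastforce

lemma t_other: "c' ~= c \<or> v \<notin> A \<union> B ==> t c' v = s c' v"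
  by (auto simp: switch_def)

lemma t_A: "v \<in> A ==> t c v \<in> B"
  and t_B: "v \<in> B ==> t c v \<in> A"
  using AB by (auto simp: switch_def)

lemma t_vals: "t c x = u" "t c (s c x) = s c u" "t c u = x" "t c (s c u) = s c x"
  using AB ms_neq[OF ms c x] ms_neq[OF ms c u] by (auto simp: switch_def)

lemma ms_t: "matchings d N t"
  unfolding matchings_def
proof (intro allI impI)
  fix c' assume c': "c' < d"
  show "t c' \<in> pmatch {..<N}"
  proof (cases "c' = c")
    case False
    then show ?thesis using ms c' by (simp add: switch_def matchings_def)
  next
    case True
    have sc: "s c \<in> pmatch {..<N}" using ms c by (simp add: matchings_def)
    have AN: "A \<subseteq> {..<N}" "B \<subseteq> {..<N}" using x u ms_less[OF ms c] by auto
    have out: "s c v \<notin> A \<union> B" if "v \<notin> A \<union> B" for v using that ms_invol[OF ms c] by (metis Un_iff insert_iff empty_iff)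
    show ?thesis unfolding True pmatch_def
    proof (intro CollectI conjI allI)
      fix v
      show "t c (t c v) = v"
      proof (cases "v \<in> A \<union> B")
        case True then show ?thesis using t_vals by auto
      next
        case False then show ?thesis using t_other[of c v] t_other[of c "s c v"] out[OF False] ms_invol[OF ms c] by simp
      qed
      show "t c v ~= v \<longleftrightarrow> v \<in> {..<N}"
      proof (cases "v \<in> A \<union> B")
        case True
        then have "t c v ~= v" using t_A t_B AB by blast
        then show ?thesis using True AN by blast
      next
        case False
        then show ?thesis using t_other[of c v] sc by (simp add: pmatch_def)
      qed
    qed
  qed
qed

text \<open>A walk follows the old system until it first crosses a switched edge.\<close>

lemma first_use:
  "(walk t a r = walk s a r) \<or> (\<exists>r1 r2. r = r1 @ c # r2 & walk t a r1 = walk s a r1 & walk s a r1 \<in> A \<union> B)"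
proof (induction r arbitrary: a)
  case (Cons c' r)
  show ?case
  proof (cases "c' = c & a \<in> A \<union> B")
    case True
    then show ?thesis by (intro disjI2 exI[of _ "[]"] exI[of _ r]) auto
  next
    case False
    then have e: "t c' a = s c' a" using t_other by blast
    from Cons.IH[of "s c' a"] show ?thesis
    proof
      assume "walk t (s c' a) r = walk s (s c' a) r"
      then show ?thesis using e by simp
    next
      assume "\<exists>r1 r2. r = r1 @ c # r2 & walk t (s c' a) r1 = walk s (s c' a) r1 & walk s (s c' a) r1 \<in> A \<union> B"
      then obtain r1 r2 where "r = r1 @ c # r2" "walk t (s c' a) r1 = walk s (s c' a) r1" "walk s (s c' a) r1 \<in> A \<union> B" by blast
      then show ?thesis using e by (intro disjI2 exI[of _ "c' # r1"] exI[of _ r2]) auto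
    qed
  qed
qed simp

text \<open>The new edge leads into \<open>B\<close>, and in the old system \<open>A\<close> is too
  far to get back. So a new edge has to be crossed again, starting from \<open>B\<close>; but
  reaching \<open>B\<close> before that gives a short closed reduced walk of \<open>s\<close> at an
  end of the partner edge.\<close>

lemma no_use_A:
  assumes v: "v \<in> A" and w: "set r \<subseteq> {..<d}" "cyc_reduced (c # r)" "length (c # r) \<le> g"
  shows "walk t v (c # r) ~= v"
proof
  assume cl: "walk t v (c # r) = v"
  define b where "b = t c v"
  have b: "b \<in> B" using t_A[OF v] by (simp add: b_def)
  have red: "distinct_adj (c # r)" using w by (simp add: cyc_reduced_def)
  have farb: "far d s g b a" if "a \<in> A" for a using far[OF that b] far_sym[OF ms] by blast
  from first_use[of b r] show False
  proof
    assume "walk t b r = walk s b r"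
    then have "walk s b r = v" using cl by (simp add: b_def)
    then show False using farD[OF farb[OF v], of r] w by simp
  next
    assume "\<exists>r1 r2. r = r1 @ c # r2 & walk t b r1 = walk s b r1 & walk s b r1 \<in> A \<union> B"
    then obtain r1 r2 where r: "r = r1 @ c # r2" "walk s b r1 \<in> A \<union> B" by blast
    have r1: "set r1 \<subseteq> {..<d}" "Suc (length r1) < g" using w r by auto
    have ne: "r1 ~= []" using red r by auto
    have red1: "distinct_adj r1" "last r1 ~= c" using red r ne by (auto simp: distinct_adj_Cons distinct_adj_append_iff)
    have "walk s b r1 \<notin> A" using farD[OF farb, of _ r1] r1 by auto
    then have e: "walk s b r1 \<in> B" using r by blast
    show False
    proof (cases "walk s b r1 = b")
      case True
      then show False using clean[OF b r1(1) red1(1) ne] r1 by simp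
    next
      case False
      \<comment> \<open>The other end of the partner edge is reached; one more step along that edge
        closes the walk at \<open>b\<close>.\<close>
      then have "walk s b r1 = s c b" using e b False ms_invol[OF ms c, of u] by auto
      then have "walk s b (r1 @ [c]) = b" using ms_invol[OF ms c, of b] by (simp add: walk_append)
      moreover have "distinct_adj (r1 @ [c])" using red1 by (simp add: distinct_adj_append_iff)
      ultimately show False using clean[OF b, of "r1 @ [c]"] r1 c by simp
    qed
  qed
qed

text \<open>From \<open>B\<close> a new edge leads to \<open>A\<close>, and the cycle has to leave
  \<open>A\<close> by a new edge again; rotated to start there it is excluded by
  \<open>no_use_A\<close>.\<close>

lemma no_use:
  assumes v: "v \<in> A \<union> B" and w: "set r \<subseteq> {..<d}" "cyc_reduced (c # r)" "length (c # r) \<le> g"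
  shows "walk t v (c # r) ~= v"
proof (cases "v \<in> A")
  case True then show ?thesis by (rule no_use_A[OF _ w])
next
  case False
  show ?thesis
  proof
    assume cl: "walk t v (c # r) = v"
    define a where "a = t c v"
    have vB: "v \<in> B" using v False by blast
    have a: "a \<in> A" unfolding a_def by (rule t_B[OF vB])
    from first_use[of a r] show False
    proof
      assume "walk t a r = walk s a r"
      then have "walk s a r = v" using cl by (simp add: a_def)
      then show False using farD[OF far[OF a vB], of r] w by simp
    next
      assume "\<exists>r1 r2. r = r1 @ c # r2 & walk t a r1 = walk s a r1 & walk s a r1 \<in> A \<union> B"
      then obtain r1 r2 where r: "r = r1 @ c # r2" "walk t a r1 = walk s a r1" "walk s a r1 \<in> A \<union> B" by blast
      define e where "e = walk s a r1"
      have "e \<notin> B" using farD[OF far[OF a], of _ r1] w r by (auto simp: e_def)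
      then have eA: "e \<in> A" using r by (simp add: e_def)
      have 1: "walk t e (c # r2) = v" using cl r by (simp add: a_def e_def walk_append)
      have "walk t v (c # r1) = e" using r by (simp add: a_def e_def)
      then have 2: "walk t e (c # (r2 @ c # r1)) = e" using 1 by (simp add: walk_append)
      have cyc: "cyc_reduced (c # (r2 @ c # r1))"
        using w(2) r(1) unfolding cyc_reduced_def
        by (cases "r1 = []"; cases "r2 = []") (auto simp: distinct_adj_Cons distinct_adj_append_iff)
      show False using no_use_A[OF eA, of "r2 @ c # r1"] 2 cyc w r by auto
    qed
  qed
qed

lemma cyc_reduced_rotate: "cyc_reduced (w1 @ w2) ==> cyc_reduced (w2 @ w1)"
  unfolding cyc_reduced_def by (cases "w1 = []"; cases "w2 = []") (auto simp: distinct_adj_append_iff)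

theorem cycle_avoids:
  assumes "(v, w) \<in> short_cycles d N t g" "w = w1 @ c' # w2"
  shows "\<not> (c' = c & walk t v w1 \<in> A \<union> B)"
proof
  assume u: "c' = c & walk t v w1 \<in> A \<union> B"
  have w: "set w \<subseteq> {..<d}" "length w \<le> g" "cyc_reduced w" "walk t v w = v" using assms(1) by (auto simp: short_cycles_def)
  have cyc: "cyc_reduced (c # (w2 @ w1))" using cyc_reduced_rotate[of w1 "c # w2"] w(3) assms(2) u by simp
  have "walk t (walk t v w1) (c # (w2 @ w1)) = walk t v w1"
    using w(4) assms(2) u by (simp add: walk_append)
  then show False using no_use[of "walk t v w1" "w2 @ w1"] cyc u w assms(2) by auto
qed

theorem cycle_same:
  assumes "(v, w) \<in> short_cycles d N t g" "w = w1 @ w2"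
  shows "walk t v w1 = walk s v w1"
  using assms(2)
proof (induction w1 arbitrary: w2 rule: rev_induct)
  case (snoc c' w1)
  then have "walk t v w1 = walk s v w1" by simp
  moreover have "t c' (walk t v w1) = s c' (walk t v w1)"
    using cycle_avoids[OF assms(1), of w1 c' w2] snoc.prems t_other by auto
  ultimately show ?case by (simp add: walk_append)
qed simp

theorem cycles_subset: "short_cycles d N t g \<subseteq> short_cycles d N s g"
proof
  fix y assume y: "y \<in> short_cycles d N t g"
  obtain v w where "y = (v, w)" by (cases y)
  then show "y \<in> short_cycles d N s g"
    using cycle_same[of v w w "[]"] y by (auto simp: short_cycles_def)
qed

end

section \<open>First moments of short cycles and of crowded spots\<close>

lemma reduced_words_le_card:
  assumes "2 \<le> p"
  shows "card {w. set w \<subseteq> {..<Suc p} & distinct_adj w & length w \<le> k} \<le> 4 * p ^ k"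
proof -
  have "{w. set w \<subseteq> {..<Suc p} & distinct_adj w & length w \<le> k} = (\<Union>m\<le>k. reduced_words (Suc p) m)"
    by (auto simp: reduced_words_def)
  then have "card {w. set w \<subseteq> {..<Suc p} & distinct_adj w & length w \<le> k} \<le> (\<Sum>m\<le>k. card (reduced_words (Suc p) m))"
    using card_UN_le[of "{..k}" "reduced_words (Suc p)"] by simp
  also have "... \<le> (\<Sum>m\<le>k. 2 * p ^ m)" using assms by (intro sum_mono card_reduced_words_le) auto
  also have "... \<le> 4 * p ^ k"
  proof (induction k)
    case (Suc k)
    have "(\<Sum>m\<le>Suc k. 2 * p ^ m) \<le> 4 * p ^ k + 2 * p ^ Suc k" using Suc by simp
    also have "4 * p ^ k \<le> 2 * p ^ Suc k" using assms by simp
    finally show ?case by simp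
  qed simp
  finally show ?thesis .
qed

text \<open>Bounds the number of starting points of closed reduced walks of length at most
  \<open>g\<close>: a cycle of length \<open>m\<close> leaves tails of length at most
  \<open>(g - m) div 2\<close>, and there are at most \<open>4 * p^k\<close> reduced words of length
  at most \<open>k\<close>.\<close>

definition cycle_weight :: "nat => nat => (nat => nat => nat) => nat => nat" where
  "cycle_weight p N s g = (\<Sum>(v, w)\<in>short_cycles (Suc p) N s g. 4 * p ^ ((g - length w) div 2))"

lemma lollipop_vertices_card:
  assumes ms: "matchings (Suc p) N s" and p: "2 \<le> p"
  shows "card {v. v < N & (\<exists>w. set w \<subseteq> {..<Suc p} & distinct_adj w & w ~= [] & length w \<le> g & walk s v w = v)}
    \<le> cycle_weight p N s g" (is "card ?L \<le> _")
proof -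
  let ?W = "\<lambda>k. {w. set w \<subseteq> {..<Suc p} & distinct_adj w & length w \<le> k}"
  have fin: "finite (?W k)" for k
    by (rule finite_subset[OF _ finite_lists_length_le[of "{..<Suc p}" k]]) auto
  have "?L \<subseteq> (\<Union>x\<in>short_cycles (Suc p) N s g. walk s (fst x) ` ?W ((g - length (snd x)) div 2))"
  proof
    fix v assume "v \<in> ?L"
    then obtain w where v: "v < N" and w: "set w \<subseteq> {..<Suc p}" "distinct_adj w" "w ~= []" "length w \<le> g" "walk s v w = v" by blast
    from lollipop_decomp[OF ms w(1,2,3) v w(5)] obtain r w0 where
      r: "w = r @ w0 @ rev r" "cyc_reduced w0" "walk s (walk s v r) w0 = walk s v r" by blast
    have rd: "set r \<subseteq> {..<Suc p}" using w r by auto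
    have "(walk s v r, w0) \<in> short_cycles (Suc p) N s g"
      using w r v walk_less[OF ms rd, of v] by (auto simp: short_cycles_def)
    moreover have "v = walk s (walk s v r) (rev r)" using walk_rev[OF ms rd, of v] by simp
    moreover have "rev r \<in> ?W ((g - length w0) div 2)" using w r by (auto simp: distinct_adj_append_iff)
    ultimately show "v \<in> (\<Union>x\<in>short_cycles (Suc p) N s g. walk s (fst x) ` ?W ((g - length (snd x)) div 2))"
      by (intro UN_I[of "(walk s v r, w0)"]) (auto intro!: image_eqI[of _ _ "rev r"])
  qed
  then have "card ?L \<le> card (\<Union>x\<in>short_cycles (Suc p) N s g. walk s (fst x) ` ?W ((g - length (snd x)) div 2))"
    by (intro card_mono) (auto simp: finite_short_cycles fin)
  also have "... \<le> (\<Sum>x\<in>short_cycles (Suc p) N s g. card (walk s (fst x) ` ?W ((g - length (snd x)) div 2)))"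
    by (rule card_UN_le) (rule finite_short_cycles)
  also have "... \<le> (\<Sum>x\<in>short_cycles (Suc p) N s g. 4 * p ^ ((g - length (snd x)) div 2))"
    by (intro sum_mono order.trans[OF card_image_le[OF fin] reduced_words_le_card[OF p]])
  finally show ?thesis by (simp add: cycle_weight_def split_def)
qed

lemma cycle_weight_mono: "short_cycles (Suc p) N t g \<subseteq> short_cycles (Suc p) N s g ==> cycle_weight p N t g \<le> cycle_weight p N s g"
  unfolding cycle_weight_def by (intro sum_mono2 finite_short_cycles) auto

lemma card_short_cycles_le:
  assumes "2 \<le> p"
  shows "card (short_cycles (Suc p) N s g) \<le> cycle_weight p N s g"
proof -
  have "(\<Sum>x\<in>short_cycles (Suc p) N s g. 1) \<le> cycle_weight p N s g"
    unfolding cycle_weight_def split_def using assms by (intro sum_mono) (simp add: Suc_le_eq)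
  then show ?thesis by simp
qed

text \<open>The factor of \<open>excess_weight\<close> for \<open>z^2 = N / L^2\<close> is at most
  \<open>(1 + 1/L) / (1 - 1/(2 L))\<close>, whose \<open>L\<close>-th power is at most
  \<open>3 / (1/2)\<close>.\<close>

lemma power_ratio_le_8:
  fixes N L n :: nat
  assumes L: "1 \<le> L" "4 * L^2 \<le> N" and n: "n \<le> L"
  shows "((real N + real L * (real N / (real L)^2)) / (real N - 2 * real L)) ^ n \<le> 8"
proof -
  define l where "l = real L"
  have l: "1 \<le> l" "4 * l^2 \<le> real N" using L by (auto simp: l_def simp flip: of_nat_power)
  have "0 < 4 * l^2" using l by auto
  then have N: "0 < real N" using l by linarith
  have half: "0 < 1 - 1/(2*l)" using l by (simp add: field_simps)
  have "2 * l = 4 * l^2 / (2 * l)" using l by (simp add: power2_eq_square)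
  also have "... \<le> real N / (2 * l)" using l by (intro divide_right_mono) auto
  finally have "real N * (1 - 1/(2*l)) \<le> real N - 2 * l" by (simp add: algebra_simps)
  moreover have "0 < real N * (1 - 1/(2*l))" using N half by simp
  ultimately have "(real N + l * (real N / l^2)) / (real N - 2 * l) \<le> (real N + l * (real N / l^2)) / (real N * (1 - 1/(2*l)))"
    using l by (intro divide_left_mono) auto
  also have "... = (1 + 1/l) / (1 - 1/(2*l))" using l N half by (simp add: divide_simps power2_eq_square) (simp add: algebra_simps)
  finally have b: "(real N + l * (real N / l^2)) / (real N - 2 * l) \<le> (1 + 1/l) / (1 - 1/(2*l))" .
  have b1: "1 \<le> (1 + 1/l) / (1 - 1/(2*l))" using l half by (subst le_divide_eq_1_pos) (auto simp: field_simps)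
  have b0: "0 \<le> (real N + l * (real N / l^2)) / (real N - 2 * l)"
    using \<open>real N * (1 - 1/(2*l)) \<le> real N - 2 * l\<close> \<open>0 < real N * (1 - 1/(2*l))\<close> l by (intro divide_nonneg_nonneg) auto
  have "((real N + l * (real N / l^2)) / (real N - 2 * l)) ^ n \<le> ((1 + 1/l) / (1 - 1/(2*l))) ^ n"
    by (rule power_mono[OF b b0])
  also have "... \<le> ((1 + 1/l) / (1 - 1/(2*l))) ^ L" by (rule power_increasing[OF n b1])
  also have "... = (1 + 1/l) ^ L / (1 - 1/(2*l)) ^ L" by (simp add: power_divide)
  also have "... \<le> 3 / (1/2)"
  proof (rule frac_le)
    have "(1 + 1/l) ^ L \<le> exp (1/l) ^ L" using l by (intro power_mono) auto
    also have "... = exp 1" using l by (simp add: l_def flip: exp_of_nat_mult)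
    also have "... \<le> 3" by (rule exp_le)
    finally show "(1 + 1/l) ^ L \<le> 3" .
    have "1 + real L * (- (1/(2*l))) \<le> (1 + (- (1/(2*l)))) ^ L"
      using l by (intro Bernoulli_inequality) (auto simp: field_simps)
    moreover have "1 + real L * (- (1/(2*l))) = 1/2" using l by (simp add: l_def)
    ultimately show "1/2 \<le> (1 - 1/(2*l)) ^ L" by simp
  qed auto
  finally show ?thesis by (simp add: l_def)
qed

text \<open>Exponential Markov inequality with \<open>z = sqrt N / L\<close>. As every edge is
  counted by two half-edges, the event says that the connected traced graph has cyclomatic number at
  least \<open>K\<close>; each independent cycle costs a factor \<open>L^2 / N\<close>.\<close>

theorem excess_card:
  assumes v: "v < N" and r: "\<And>c. Some c \<in> set r ==> c < d" and N: "even N"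
    and L: "Suc (length r) \<le> L" "4 * L^2 \<le> N"
  shows "real (card {s\<in>systems d N. 2 * (card (insert v (snd ` prog_edges s v v r)) + K) \<le> card (prog_edges s v v r) + 2})
    \<le> card (systems d N) * (8 * ((real L)^2 / real N) ^ K)"
proof -
  define z where "z = sqrt (real N) / real L"
  define V where "V s = card (insert v (snd ` prog_edges s v v r))" for s
  define E where "E s = card (prog_edges s v v r)" for s
  have L1: "1 \<le> L" using L by simp
  have z2: "z^2 = real N / (real L)^2" by (simp add: z_def power_divide)
  have LN: "2 * L < N"
  proof -
    have "2 * L \<le> 2 * L^2" using L1 by (simp add: power2_eq_square)
    also have "... < 4 * L^2" using L1 by simp
    finally show ?thesis using L(2) by simp
  qed
  have "(real L)^2 \<le> real N" using L(2) by (simp flip: of_nat_power)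
  then have "1 \<le> z^2" using L1 by (simp add: z2)
  then have z: "1 \<le> z" using power2_le_imp_le[of 1 z] by (simp add: z_def)
  have "real (card {s\<in>systems d N. 2 * (V s + K) \<le> E s + 2}) = (\<Sum>s\<in>systems d N. if 2 * (V s + K) \<le> E s + 2 then 1 else 0)"
    by (simp add: sum.If_cases finite_systems Int_def)
  also have "... \<le> (\<Sum>s\<in>systems d N. z ^ E s / z ^ (2 * V s) * (z^2 / (z^2) ^ K))"
  proof (intro sum_mono)
    fix s
    have "z ^ (2 * (V s + K)) \<le> z ^ (E s + 2)" if "2 * (V s + K) \<le> E s + 2" using that z by (intro power_increasing)
    moreover have "z ^ E s / z ^ (2 * V s) * (z^2 / (z^2) ^ K) = z ^ (E s + 2) / z ^ (2 * (V s + K))"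
      unfolding power_mult[symmetric] by (simp add: power_add distrib_left power2_eq_square)
    ultimately show "(if 2 * (V s + K) \<le> E s + 2 then 1 else 0) \<le> z ^ E s / z ^ (2 * V s) * (z^2 / (z^2) ^ K)"
      using z by (simp add: le_divide_eq_1)
  qed
  also have "... = (\<Sum>s\<in>systems d N. z ^ E s / z ^ (2 * V s)) * (z^2 / (z^2) ^ K)" by (rule sum_distrib_right[symmetric])
  also have "... \<le> (real (card (systems d N)) * ((real N + real L * z^2) / (real N - 2 * real L)) ^ length r / z^2) * (z^2 / (z^2) ^ K)"
    unfolding E_def V_def using z LN excess_weight_start[OF v r N z L(1) LN] by (intro mult_right_mono) (auto simp: of_nat_diff)
  also have "... = real (card (systems d N)) * (((real N + real L * z^2) / (real N - 2 * real L)) ^ length r / (z^2) ^ K)" using z by simp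
  also have "... \<le> real (card (systems d N)) * (8 / (z^2) ^ K)"
    using power_ratio_le_8[OF L1 L(2), of "length r"] L(1) z unfolding z2
    by (intro mult_left_mono divide_right_mono) (auto simp: z2)
  also have "8 / (z^2) ^ K = 8 * ((real L)^2 / real N) ^ K" by (simp add: z2 power_divide)
  finally show ?thesis by (simp add: V_def E_def)
qed

fun traced :: "(nat => nat => nat) => nat => nat list => (nat \<times> nat) set" where
  "traced s v [] = {}"
| "traced s v (c # w) = {(c, v), (c, s c v)} \<union> traced s (s c v) w"

lemma traced_append: "traced s v (w @ w') = traced s v w \<union> traced s (walk s v w) w'"
  by (induction w arbitrary: v) auto

lemma finite_traced [simp]: "finite (traced s v w)"
  by (induction w arbitrary: v) auto

lemma prog_edges_Some: "prog_edges s v0 v (map Some w @ r) = traced s v w \<union> prog_edges s v0 (walk s v w) r"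
  by (induction w arbitrary: v) auto

lemma prog_edges_map_Some [simp]: "prog_edges s v0 v (map Some w) = traced s v w"
  using prog_edges_Some[of s v0 v w "[]"] by simp

lemma traced_in: "(c, y) \<in> traced s v w ==> \<exists>w1 w2. w = w1 @ c # w2 & (y = walk s v w1 \<or> y = walk s v (w1 @ [c]))"
proof (induction w arbitrary: v)
  case (Cons c' w)
  show ?case
  proof (cases "(c, y) \<in> traced s (s c' v) w")
    case True
    from Cons.IH[OF this] obtain w1 w2 where
      "w = w1 @ c # w2" "y = walk s (s c' v) w1 \<or> y = walk s (s c' v) (w1 @ [c])" by blast
    then show ?thesis by (intro exI[of _ "c' # w1"] exI[of _ w2]) auto
  next
    case False
    then show ?thesis using Cons.prems by (intro exI[of _ "[]"] exI[of _ w]) auto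
  qed
qed simp

lemma traced_mid: "(c, walk s v w1) \<in> traced s v (w1 @ c # w2)" "(c, s c (walk s v w1)) \<in> traced s v (w1 @ c # w2)"
  by (simp_all add: traced_append)

lemma traced_sub: "traced s v (w1 @ w2 @ w3) \<supseteq> traced s (walk s v w1) w2"
  by (auto simp: traced_append)

lemma card_two_per_point:
  assumes "finite E" "finite V" and c: "\<And>y. y \<in> V ==> c1 y ~= c2 y & (c1 y, y) \<in> E & (c2 y, y) \<in> E"
  shows "2 * card V \<le> card E"
proof -
  have "card ((\<lambda>y. (c1 y, y)) ` V \<union> (\<lambda>y. (c2 y, y)) ` V) = card ((\<lambda>y. (c1 y, y)) ` V) + card ((\<lambda>y. (c2 y, y)) ` V)"
    using assms by (intro card_Un_disjoint) auto
  also have "... = 2 * card V" by (subst (1 2) card_image) (auto simp: inj_on_def)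
  finally have "2 * card V = card ((\<lambda>y. (c1 y, y)) ` V \<union> (\<lambda>y. (c2 y, y)) ` V)" by simp
  also have "... \<le> card E" using c assms by (intro card_mono) auto
  finally show ?thesis .
qed

text \<open>Every vertex is left by another colour than it was entered by, also \<open>v\<close>
  since the word is cyclically reduced, so it carries two half-edges. This is excess
  \<open>K = 1\<close> in \<open>excess_card\<close>.\<close>

lemma cyc_walk_excess:
  assumes cyc: "cyc_reduced w" and cl: "walk s v w = v"
  shows "2 * card (insert v (snd ` traced s v w)) \<le> card (traced s v w)"
proof -
  let ?V = "insert v (snd ` traced s v w)" and ?E = "traced s v w"
  have w: "w ~= []" "distinct_adj w" "hd w ~= last w" using cyc by (auto simp: cyc_reduced_def)
  have two: "\<exists>c1 c2. c1 ~= c2 & (c1, y) \<in> ?E & (c2, y) \<in> ?E" if "w = w1 @ w2" "y = walk s v w1" for y w1 w2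
  proof (cases "w1 = [] \<or> w2 = []")
    case True
    then have y: "y = v" using that cl by auto
    obtain c a where a: "w = c # a" using w by (cases w) auto
    obtain c' b where b: "w = b @ [c']" using w by (cases w rule: rev_cases) auto
    have "(c, v) \<in> ?E" using a by simp
    moreover have "(c', v) \<in> ?E" using b cl traced_mid(2)[of c' s v b "[]"] by (simp add: walk_append)
    moreover have "c ~= c'" using w(3) a b by (metis last_snoc list.sel(1))
    ultimately show ?thesis using y by blast
  next
    case False
    obtain c a where a: "w2 = c # a" using False by (cases w2) auto
    obtain c' b where b: "w1 = b @ [c']" using False by (cases w1 rule: rev_cases) auto
    have "(c, y) \<in> ?E" unfolding that a by (rule traced_mid)
    moreover have "(c', y) \<in> ?E" using traced_mid(2)[of c' s v b w2] that b by (simp add: walk_append)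
    moreover have "c ~= c'" using w(2) that a b by (auto simp: distinct_adj_append_iff)
    ultimately show ?thesis by blast
  qed
  have all: "\<exists>c1 c2. c1 ~= c2 & (c1, y) \<in> ?E & (c2, y) \<in> ?E" if y: "y \<in> ?V" for y
  proof (cases "y = v")
    case True then show ?thesis using two[of "[]" w y] by simp
  next
    case False
    then obtain c where "(c, y) \<in> ?E" using y by force
    from traced_in[OF this] obtain w1 w2 where w12: "w = w1 @ c # w2" "y = walk s v w1 \<or> y = walk s v (w1 @ [c])" by blast
    from w12(2) show ?thesis
    proof
      assume "y = walk s v w1" then show ?thesis using two[of w1 "c # w2" y] w12(1) by simp
    next
      assume "y = walk s v (w1 @ [c])" then show ?thesis using two[of "w1 @ [c]" w2 y] w12(1) by simp
    qed
  qed
  then obtain c1 c2 where c: "\<And>y. y \<in> ?V ==> c1 y ~= c2 y & (c1 y, y) \<in> ?E & (c2 y, y) \<in> ?E" by metis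
  show ?thesis by (rule card_two_per_point[of _ _ c1 c2]) (simp, simp, rule c)
qed

text \<open>The \<open>N\<close> starting points cancel the factor \<open>1 / N\<close> from
  \<open>excess_card\<close>, and \<open>p^m\<close> words times the weight
  \<open>p^((g - m) div 2)\<close> stay below \<open>p^g\<close>.\<close>

theorem sum_cycle_weight:
  assumes p: "0 < p" and N: "even N" and L: "Suc g \<le> L" "4 * L^2 \<le> N"
  shows "(\<Sum>s\<in>systems (Suc p) N. real (cycle_weight p N s g)) \<le> card (systems (Suc p) N) * (64 * (real L)^2 * real (Suc g) * real p ^ g)"
proof -
  let ?S = "systems (Suc p) N"
  define I where "I = (SIGMA v:{..<N}. SIGMA m:{..g}. reduced_words (Suc p) m)"
  have finI: "finite I" by (simp add: I_def finite_reduced_words)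
  have N0: "0 < N" using L by (cases N) auto
  have Isum: "(\<Sum>(v, m, w)\<in>I. f v m w) = (\<Sum>v<N. \<Sum>m\<le>g. \<Sum>w\<in>reduced_words (Suc p) m. f v m w)"
    for f :: "nat => nat => nat list => real"
    by (simp add: I_def sum.Sigma finite_reduced_words)
  have "(\<Sum>s\<in>?S. real (cycle_weight p N s g))
     \<le> (\<Sum>s\<in>?S. \<Sum>(v, m, w)\<in>I. if (v, w) \<in> short_cycles (Suc p) N s g then 4 * real p ^ ((g - m) div 2) else 0)"
  proof (intro sum_mono)
    fix s
    have "real (cycle_weight p N s g) = (\<Sum>(v, w)\<in>short_cycles (Suc p) N s g. 4 * real p ^ ((g - length w) div 2))"
      by (simp add: cycle_weight_def split_def)
    also have "... = (\<Sum>(v, m, w)\<in>{(v, m, w)\<in>I. (v, w) \<in> short_cycles (Suc p) N s g}. 4 * real p ^ ((g - m) div 2))"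
      by (rule sum.reindex_bij_witness[of _ "\<lambda>(v, m, w). (v, w)" "\<lambda>(v, w). (v, length w, w)"])
        (auto simp: I_def short_cycles_def reduced_words_def cyc_reduced_def)
    also have "... = (\<Sum>(v, m, w)\<in>I. if (v, w) \<in> short_cycles (Suc p) N s g then 4 * real p ^ ((g - m) div 2) else 0)"
      using finI by (intro sum.mono_neutral_cong_left) (auto split: if_splits)
    finally show "real (cycle_weight p N s g) \<le> ..." by simp
  qed
  also have "... = (\<Sum>(v, m, w)\<in>I. \<Sum>s\<in>?S. if (v, w) \<in> short_cycles (Suc p) N s g then 4 * real p ^ ((g - m) div 2) else 0)"
    by (subst sum.swap) (simp add: split_def)
  also have "... \<le> (\<Sum>(v, m, w)\<in>I. 4 * real p ^ ((g - m) div 2) * (card ?S * (8 * ((real L)^2 / real N) ^ 1)))"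
  proof (intro sum_mono, clarify)
    fix v m w assume i: "(v, m, w) \<in> I"
    have "real (card {s\<in>?S. (v, w) \<in> short_cycles (Suc p) N s g})
      \<le> real (card {s\<in>?S. 2 * (card (insert v (snd ` prog_edges s v v (map Some w))) + 1) \<le> card (prog_edges s v v (map Some w)) + 2})"
      using cyc_walk_excess[of w _ v] by (intro of_nat_mono card_mono) (auto simp: finite_systems short_cycles_def)
    also have "... \<le> card ?S * (8 * ((real L)^2 / real N) ^ 1)"
      using i L by (intro excess_card N) (auto simp: I_def reduced_words_def)
    finally have c: "real (card {s\<in>?S. (v, w) \<in> short_cycles (Suc p) N s g}) \<le> card ?S * (8 * ((real L)^2 / real N) ^ 1)" .
    have "(\<Sum>s\<in>?S. if (v, w) \<in> short_cycles (Suc p) N s g then 4 * real p ^ ((g - m) div 2) else 0)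
       = 4 * real p ^ ((g - m) div 2) * real (card {s\<in>?S. (v, w) \<in> short_cycles (Suc p) N s g})"
      by (simp add: sum.If_cases finite_systems Int_def mult.commute)
    also have "... \<le> 4 * real p ^ ((g - m) div 2) * (card ?S * (8 * ((real L)^2 / real N) ^ 1))"
      by (rule mult_left_mono[OF c]) simp
    finally show "(\<Sum>s\<in>?S. if (v, w) \<in> short_cycles (Suc p) N s g then 4 * real p ^ ((g - m) div 2) else 0) \<le> ..." .
  qed
  also have "... = (\<Sum>v<N. \<Sum>m\<le>g. \<Sum>w\<in>reduced_words (Suc p) m. 4 * real p ^ ((g - m) div 2) * (card ?S * (8 * ((real L)^2 / real N) ^ 1)))"
    by (rule Isum)
  also have "... \<le> (\<Sum>v<N. \<Sum>m\<le>g. 8 * real p ^ g * (card ?S * (8 * ((real L)^2 / real N) ^ 1)))"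
  proof (intro sum_mono)
    fix m assume m: "m \<in> {..g}"
    have "real (card (reduced_words (Suc p) m)) \<le> real (2 * p ^ m)"
      using card_reduced_words_le[OF p] by (intro of_nat_mono)
    then have "real (card (reduced_words (Suc p) m)) * (4 * real p ^ ((g - m) div 2)) \<le> 2 * real p ^ m * (4 * real p ^ ((g - m) div 2))"
      by (intro mult_right_mono) auto
    also have "... = 8 * real p ^ (m + (g - m) div 2)" by (simp add: power_add)
    also have "... \<le> 8 * real p ^ g" using p m by (intro mult_left_mono power_increasing) auto
    finally have "real (card (reduced_words (Suc p) m)) * (4 * real p ^ ((g - m) div 2)) * (card ?S * (8 * ((real L)^2 / real N) ^ 1))
      \<le> 8 * real p ^ g * (card ?S * (8 * ((real L)^2 / real N) ^ 1))" by (rule mult_right_mono) auto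
    then show "(\<Sum>w\<in>reduced_words (Suc p) m. 4 * real p ^ ((g - m) div 2) * (card ?S * (8 * ((real L)^2 / real N) ^ 1)))
      \<le> 8 * real p ^ g * (card ?S * (8 * ((real L)^2 / real N) ^ 1))" by (simp add: mult.assoc)
  qed
  also have "... = card ?S * (64 * (real L)^2 * real (Suc g) * real p ^ g)" using N0 by (simp add: field_simps)
  finally show ?thesis .
qed

definition lollipops :: "(nat list \<times> nat list) list => nat option list" where
  "lollipops ls = concat (map (\<lambda>(u, w). map Some (u @ w) @ [None]) ls)"

definition lollipop_lists :: "nat => nat => nat => (nat list \<times> nat list) list set" where
  "lollipop_lists d D g = {ls. length ls = 4 & set ls \<subseteq>
     {u. set u \<subseteq> {..<d} & length u \<le> D} \<times> {w. set w \<subseteq> {..<d} & distinct_adj w & length w \<le> g}}"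

text \<open>Four short walks within reach of one vertex whose union has cyclomatic number at least
  4. Four is the least number for which the first moment, about \<open>N * (p^g / N)^4\<close>,
  decays when \<open>p^g\<close> is about \<open>N^(2/3)\<close>.\<close>

definition crowded :: "nat => nat => (nat => nat => nat) => nat => nat => bool" where
  "crowded d N s D g \<longleftrightarrow> (\<exists>v ls. v < N & ls \<in> lollipop_lists d D g &
     2 * (card (insert v (snd ` prog_edges s v v (lollipops ls))) + 4) \<le> card (prog_edges s v v (lollipops ls)) + 2)"

lemma length_lollipops: "ls \<in> lollipop_lists d D g ==> length (lollipops ls) \<le> 4 * (D + g + 1)"
proof -
  have "length (lollipops ls) \<le> length ls * (D + g + 1)" if "set ls \<subseteq>
     {u. set u \<subseteq> {..<d} & length u \<le> D} \<times> {w. set w \<subseteq> {..<d} & distinct_adj w & length w \<le> g}"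
    using that by (induction ls) (auto simp: lollipops_def)
  then show "ls \<in> lollipop_lists d D g ==> length (lollipops ls) \<le> 4 * (D + g + 1)" by (auto simp: lollipop_lists_def)
qed

lemma lollipops_colours: "ls \<in> lollipop_lists d D g ==> Some c \<in> set (lollipops ls) ==> c < d"
  by (fastforce simp: lollipops_def lollipop_lists_def)

lemma card_lollipop_lists:
  assumes p: "2 \<le> p"
  shows "finite (lollipop_lists (Suc p) D g)" "card (lollipop_lists (Suc p) D g) \<le> ((D + 1) * Suc p ^ D * (4 * p ^ g)) ^ 4"
proof -
  let ?A = "{u. set u \<subseteq> {..<Suc p} & length u \<le> D}" and ?B = "{w. set w \<subseteq> {..<Suc p} & distinct_adj w & length w \<le> g}"
  have fA: "finite ?A" by (rule finite_lists_length_le) simp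
  have fB: "finite ?B" by (rule finite_subset[OF _ finite_lists_length_le[of "{..<Suc p}" g]]) auto
  have "card ?A = (\<Sum>i\<le>D. Suc p ^ i)" by (simp add: card_lists_length_le)
  also have "... \<le> (\<Sum>i\<le>D. Suc p ^ D)" by (intro sum_mono power_increasing) auto
  finally have A: "card ?A \<le> (D + 1) * Suc p ^ D" by simp
  have e: "lollipop_lists (Suc p) D g = {ls. set ls \<subseteq> ?A \<times> ?B & length ls = 4}" by (auto simp: lollipop_lists_def)
  show "finite (lollipop_lists (Suc p) D g)" unfolding e by (rule finite_lists_length_eq) (simp add: fA fB)
  have "card (lollipop_lists (Suc p) D g) = card (?A \<times> ?B) ^ 4" unfolding e by (rule card_lists_length_eq) (simp add: fA fB)
  also have "... \<le> ((D + 1) * Suc p ^ D * (4 * p ^ g)) ^ 4"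
    unfolding card_cartesian_product by (intro power_mono mult_mono A reduced_words_le_card p) auto
  finally show "card (lollipop_lists (Suc p) D g) \<le> ((D + 1) * Suc p ^ D * (4 * p ^ g)) ^ 4" .
qed

theorem card_crowded:
  assumes p: "2 \<le> p" and N: "even N" and L: "4 * (D + g + 1) < L" "4 * L^2 \<le> N"
  shows "real (card {s\<in>systems (Suc p) N. crowded (Suc p) N s D g})
    \<le> card (systems (Suc p) N) * (real (N * ((D + 1) * Suc p ^ D * (4 * p ^ g)) ^ 4) * (8 * ((real L)^2 / real N) ^ 4))"
proof -
  let ?S = "systems (Suc p) N" and ?LL = "lollipop_lists (Suc p) D g"
  let ?X = "\<lambda>v ls. {s\<in>?S. 2 * (card (insert v (snd ` prog_edges s v v (lollipops ls))) + 4) \<le> card (prog_edges s v v (lollipops ls)) + 2}"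
  have "{s\<in>?S. crowded (Suc p) N s D g} \<subseteq> (\<Union>(v, ls)\<in>{..<N} \<times> ?LL. ?X v ls)"
    by (auto simp: crowded_def)
  then have "card {s\<in>?S. crowded (Suc p) N s D g} \<le> card (\<Union>(v, ls)\<in>{..<N} \<times> ?LL. ?X v ls)"
    using card_lollipop_lists(1)[OF p] by (intro card_mono) (auto simp: finite_systems)
  also have "... \<le> (\<Sum>(v, ls)\<in>{..<N} \<times> ?LL. card (?X v ls))"
    using card_UN_le[of "{..<N} \<times> ?LL" "\<lambda>(v, ls). ?X v ls"] card_lollipop_lists(1)[OF p] by (simp add: split_def)
  finally have "real (card {s\<in>?S. crowded (Suc p) N s D g}) \<le> real (\<Sum>(v, ls)\<in>{..<N} \<times> ?LL. card (?X v ls))" by (rule of_nat_mono)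
  also have "... = (\<Sum>x\<in>{..<N} \<times> ?LL. real (card (?X (fst x) (snd x))))" by (simp add: split_def)
  also have "... \<le> (\<Sum>x\<in>{..<N} \<times> ?LL. real (card ?S) * (8 * ((real L)^2 / real N) ^ 4))"
  proof (intro sum_mono)
    fix x assume "x \<in> {..<N} \<times> ?LL"
    then have a: "fst x < N" "snd x \<in> ?LL" by auto
    show "real (card (?X (fst x) (snd x))) \<le> real (card ?S) * (8 * ((real L)^2 / real N) ^ 4)"
      by (rule excess_card[OF a(1) lollipops_colours[OF a(2)] N _ L(2)]) (use L(1) length_lollipops[OF a(2)] in auto)
  qed
  also have "... = real (N * card ?LL) * (real (card ?S) * (8 * ((real L)^2 / real N) ^ 4))" by (simp add: card_cartesian_product)
  also have "... \<le> real (N * ((D + 1) * Suc p ^ D * (4 * p ^ g)) ^ 4) * (real (card ?S) * (8 * ((real L)^2 / real N) ^ 4))"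
    by (intro mult_right_mono of_nat_mono mult_left_mono card_lollipop_lists p) auto
  finally show ?thesis by (simp only: mult_ac)
qed

text \<open>Grows a connected set from \<open>v\<close>; each new vertex is attached by a new edge,
  that is, by two new half-edges.\<close>

lemma connected_half_edges:
  assumes E: "finite E" "\<And>c y. (c, y) \<in> E ==> (c, s c y) \<in> E & s c (s c y) = y & s c y ~= y" and V: "finite V" "v \<in> V"
    and reach: "\<And>y. y \<in> V ==> (v, y) \<in> {(a, b). \<exists>c. (c, a) \<in> E & b = s c a}\<^sup>*" and EV: "snd ` E \<subseteq> V"
  shows "2 * card V \<le> card E + 2"
proof -
  have grow: "n < card V ==> \<exists>A. v \<in> A & A \<subseteq> V & card A = Suc n & 2 * n \<le> card {(c, y)\<in>E. y \<in> A & s c y \<in> A}" for n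
  proof (induction n)
    case 0
    show ?case using V by (intro exI[of _ "{v}"]) auto
  next
    case (Suc n)
    then obtain A where A: "v \<in> A" "A \<subseteq> V" "card A = Suc n" "2 * n \<le> card {(c, y)\<in>E. y \<in> A & s c y \<in> A}" by auto
    have finA: "finite A" using A(2) V(1) finite_subset by blast
    have "A ~= V" using A(3) Suc.prems by auto
    then obtain y where y: "y \<in> V" "y \<notin> A" using A(2) by blast
    have "\<exists>c a. (c, a) \<in> E & a \<in> A & s c a \<notin> A"
    proof (rule ccontr)
      assume n: "\<not> ?thesis"
      have "z \<in> A" if "(v, z) \<in> {(a, b). \<exists>c. (c, a) \<in> E & b = s c a}\<^sup>*" for z
        using that by (induction rule: rtrancl_induct) (use A(1) n in auto)
      then show False using reach[OF y(1)] y(2) by blast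
    qed
    then obtain c a where ca: "(c, a) \<in> E" "a \<in> A" "s c a \<notin> A" by blast
    let ?F = "\<lambda>A. {(c, y)\<in>E. y \<in> A & s c y \<in> A}" and ?b = "s c a"
    have b: "(c, ?b) \<in> E" "s c ?b = a" "?b ~= a" using E(2)[OF ca(1)] by auto
    have fin: "finite (?F A)" for A by (rule finite_subset[OF _ E(1)]) auto
    have "card (?F A) + 2 = card (insert (c, a) (insert (c, ?b) (?F A)))"
      using ca b fin by (subst card_insert_disjoint; auto)+
    also have "... \<le> card (?F (insert ?b A))" using ca b by (intro card_mono[OF fin]) auto
    finally have "card (?F A) + 2 \<le> card (?F (insert ?b A))" .
    moreover have "?b \<in> V" using b EV by force
    ultimately show ?case using A ca finA by (intro exI[of _ "insert ?b A"]) auto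
  qed
  have "card V - 1 < card V" using V card_gt_0_iff[of V] by auto
  from grow[OF this] obtain A where "2 * (card V - 1) \<le> card {(c, y)\<in>E. y \<in> A & s c y \<in> A}" by blast
  also have "... \<le> card E" by (intro card_mono E) auto
  finally show ?thesis by simp
qed

lemma traced_closed:
  assumes "matchings d N s"
  shows "set w \<subseteq> {..<d} ==> (c, y) \<in> traced s v w ==> c < d & (c, s c y) \<in> traced s v w"
  by (induction w arbitrary: v) (auto simp: ms_invol[OF assms])

lemma traced_less:
  assumes "matchings d N s"
  shows "set w \<subseteq> {..<d} ==> v < N ==> (c, y) \<in> traced s v w ==> y < N"
proof (induction w arbitrary: v)
  case (Cons a w)
  then show ?case using ms_less[OF assms, of a v] Cons.IH[of "s a v"] by auto
qed simp

lemma traced_reach: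
  assumes "traced s v w \<subseteq> E"
  shows "(v, walk s v w) \<in> {(a, b). \<exists>c. (c, a) \<in> E & b = s c a}\<^sup>*"
    and "(c, y) \<in> traced s v w ==> (v, y) \<in> {(a, b). \<exists>c. (c, a) \<in> E & b = s c a}\<^sup>*"
proof -
  have 1: "(v, walk s v w) \<in> {(a, b). \<exists>c. (c, a) \<in> E & b = s c a}\<^sup>*" if "traced s v w \<subseteq> E" for v w
    using that by (induction w arbitrary: v) (auto intro: converse_rtrancl_into_rtrancl)
  show "(v, walk s v w) \<in> {(a, b). \<exists>c. (c, a) \<in> E & b = s c a}\<^sup>*" by (rule 1[OF assms])
  assume "(c, y) \<in> traced s v w"
  from traced_in[OF this] obtain w1 w2 where w: "w = w1 @ c # w2" "y = walk s v w1 \<or> y = walk s v (w1 @ [c])" by blast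
  have "traced s v w1 \<subseteq> E" "traced s v (w1 @ [c]) \<subseteq> E" using assms w(1) by (auto simp: traced_append)
  then show "(v, y) \<in> {(a, b). \<exists>c. (c, a) \<in> E & b = s c a}\<^sup>*" using w(2) 1 by blast
qed

lemma prog_edges_lollipops:
  "prog_edges s v v (lollipops ls) = (\<Union>(u, w)\<in>set ls. traced s v (u @ w))"
proof (induction ls)
  case (Cons a ls)
  then show ?case using prog_edges_Some[of s v v "fst a @ snd a" "None # lollipops ls"]
    by (cases a) (auto simp: lollipops_def traced_append)
qed (simp add: lollipops_def)

section \<open>Private cycles through a minimal hitting set of edges\<close>

definition edge :: "(nat => nat => nat) => nat => nat => (nat \<times> nat) set" where
  "edge s c x = {(c, x), (c, s c x)}"

text \<open>Deleting the four private edges leaves everything connected to \<^term>\<open>v\<close>, because each deleted edge is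
  bypassed by the rest of its own cycle.\<close>

theorem four_private_cycles_crowded:
  fixes c x :: "nat => nat" and u w :: "nat => nat list"
  assumes ms: "matchings d N s" and v: "v < N"
    and u: "\<And>i. i < 4 ==> set (u i) \<subseteq> {..<d} & length (u i) \<le> D & walk s v (u i) = x i"
    and w: "\<And>i. i < 4 ==> set (c i # w i) \<subseteq> {..<d} & distinct_adj (c i # w i) & length (c i # w i) \<le> g & walk s (x i) (c i # w i) = x i"
    and priv: "\<And>i j. i < 4 ==> j < 4 ==> traced s (s (c i) (x i)) (w i) \<inter> edge s (c j) (x j) = {}"
    and disj: "\<And>i j. i < 4 ==> j < 4 ==> i ~= j ==> edge s (c i) (x i) \<inter> edge s (c j) (x j) = {}"
  shows "crowded d N s D g"
proof -
  define ls where "ls = map (\<lambda>i. (u i, c i # w i)) [0..<4]"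
  have "(u i, c i # w i) \<in> {u. set u \<subseteq> {..<d} & length u \<le> D} \<times> {w. set w \<subseteq> {..<d} & distinct_adj w & length w \<le> g}"
    if "i < 4" for i using u[OF that] w[OF that] by simp
  then have "(\<lambda>i. (u i, c i # w i)) ` {..<4} \<subseteq> {u. set u \<subseteq> {..<d} & length u \<le> D} \<times> {w. set w \<subseteq> {..<d} & distinct_adj w & length w \<le> g}"
    by blast
  then have ls: "ls \<in> lollipop_lists d D g" unfolding ls_def lollipop_lists_def by (simp add: lessThan_atLeast0)
  define E where "E = prog_edges s v v (lollipops ls)"
  have E: "E = (\<Union>i<4. traced s v (u i @ c i # w i))" by (auto simp: E_def prog_edges_lollipops ls_def)
  define V where "V = insert v (snd ` E)"
  note priv = priv[unfolded edge_def] and disj = disj[unfolded edge_def]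
  let ?e = "\<lambda>i. {(c i, x i), (c i, s (c i) (x i))}"
  define E' where "E' = E - (\<Union>i<4. ?e i)"
  have cd: "c i < d" if "i < 4" for i using w[OF that] by auto
  have xN: "x i < N" if "i < 4" for i using u[OF that] walk_less[OF ms, of "u i" v] v by auto
  have pe: "s (c i) (s (c i) (x i)) = x i" "s (c i) (x i) ~= x i" if "i < 4" for i
    using ms_invol[OF ms cd[OF that]] ms_neq[OF ms cd[OF that] xN[OF that]] by auto
  have colE: "set (u i @ c i # w i) \<subseteq> {..<d}" if "i < 4" for i using u[OF that] w[OF that] by simp
  have finE: "finite E" by (simp add: E)
  have Ecl: "cc < d & (cc, s cc y) \<in> E & y < N" if "(cc, y) \<in> E" for cc y
    using that traced_closed[OF ms colE] traced_less[OF ms colE v] unfolding E by blast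
  have eE: "?e i \<subseteq> E" if "i < 4" for i
    using u[OF that] that unfolding E by (auto simp: traced_append intro!: bexI[of _ i])
  have wE: "traced s (s (c i) (x i)) (w i) \<subseteq> E'" if "i < 4" for i
  proof -
    have "traced s (s (c i) (x i)) (w i) \<subseteq> traced s v (u i @ c i # w i)" using u[OF that] by (auto simp: traced_append)
    then show ?thesis using priv[OF that] that unfolding E'_def E by blast
  qed
  let ?R = "\<lambda>E. {(a, b). \<exists>c. (c, a) \<in> E & b = s c a}"
  have E'cl: "(cc, s cc y) \<in> E' & s cc (s cc y) = y & s cc y ~= y" if a: "(cc, y) \<in> E'" for cc y
  proof -
    have c1: "cc < d" "(cc, s cc y) \<in> E" "y < N" using Ecl[of cc y] a by (auto simp: E'_def)
    have inv: "s cc (s cc y) = y" "s cc y ~= y" using ms_invol[OF ms c1(1)] ms_neq[OF ms c1(1,3)] by auto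
    have "(cc, s cc y) \<notin> ?e i" if i: "i < 4" for i
    proof
      assume "(cc, s cc y) \<in> ?e i"
      then have "cc = c i" "s cc y = x i \<or> s cc y = s (c i) (x i)" by auto
      then have "y = s (c i) (x i) \<or> y = x i" using inv ms_inj[OF ms c1(1)] by metis
      then show False using a i \<open>cc = c i\<close> by (auto simp: E'_def)
    qed
    then show ?thesis using c1 inv by (auto simp: E'_def)
  qed
  have "sym (?R E')"
  proof (rule symI)
    fix a b assume "(a, b) \<in> ?R E'"
    then show "(b, a) \<in> ?R E'" using E'cl by force
  qed
  then have sy: "sym ((?R E')\<^sup>*)" by (rule sym_rtrancl)
  have byp: "(s (c i) (x i), x i) \<in> (?R E')\<^sup>*" if "i < 4" for i
    using traced_reach(1)[OF wE[OF that]] w[OF that] by simp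
  have RE: "?R E \<subseteq> (?R E')\<^sup>*"
  proof (clarify)
    fix a cc assume a: "(cc, a) \<in> E"
    show "(a, s cc a) \<in> (?R E')\<^sup>*"
    proof (cases "(cc, a) \<in> E'")
      case False
      then obtain i where i: "i < 4" "(cc, a) \<in> ?e i" using a by (auto simp: E'_def)
      from i(2) consider "cc = c i" "a = x i" | "cc = c i" "a = s (c i) (x i)" by blast
      then show ?thesis
      proof cases
        case 1 then show ?thesis using symD[OF sy byp[OF i(1)]] by simp
      next
        case 2 then show ?thesis using byp[OF i(1)] pe(1)[OF i(1)] by simp
      qed
    next
      case True
      then show ?thesis by (intro r_into_rtrancl) blast
    qed
  qed
  then have RE': "(?R E)\<^sup>* \<subseteq> (?R E')\<^sup>*" by (rule rtrancl_subset_rtrancl)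
  have "2 * card V \<le> card E' + 2"
  proof (rule connected_half_edges[where s = s and v = v])
    show "finite E'" "finite V" "v \<in> V" "snd ` E' \<subseteq> V" using finE by (auto simp: E'_def V_def)
    show "(cc, s cc y) \<in> E' & s cc (s cc y) = y & s cc y ~= y" if "(cc, y) \<in> E'" for cc y by (rule E'cl[OF that])
    fix y assume "y \<in> V"
    then show "(v, y) \<in> (?R E')\<^sup>*"
    proof (cases "y = v")
      case False
      then obtain cc where "(cc, y) \<in> E" using \<open>y \<in> V\<close> by (force simp: V_def)
      then obtain i where i: "i < 4" "(cc, y) \<in> traced s v (u i @ c i # w i)" unfolding E by blast
      have "traced s v (u i @ c i # w i) \<subseteq> E" using i(1) unfolding E by blast
      from traced_reach(2)[OF this i(2)] show ?thesis using RE' by blast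
    qed simp
  qed
  \<comment> \<open>Eight half-edges disappear without disconnecting anything, so the tree bound for
    \<open>E'\<close> becomes excess 4 for \<open>E\<close>.\<close>
  moreover have "card E' + 8 = card E"
  proof -
    have "card (\<Union>i<4. ?e i) = (\<Sum>i<4. card (?e i))"
      by (rule card_UN_disjoint) (use disj in auto)
    also have "... = (\<Sum>i<(4::nat). 2)" using not_sym[OF pe(2)] by (intro sum.cong[OF refl]) simp
    finally have c8: "card (\<Union>i<4. ?e i) = 8" by simp
    have "card E' = card E - 8" unfolding E'_def c8[symmetric] using eE by (intro card_Diff_subset) auto
    moreover have "8 \<le> card E" unfolding c8[symmetric] using eE finE by (intro card_mono) auto
    ultimately show ?thesis by simp
  qed
  ultimately have "2 * (card V + 4) \<le> card E + 2" by simp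
  then show ?thesis unfolding crowded_def using v ls unfolding V_def E_def by blast
qed

lemma edge_eq:
  assumes ms: "matchings d N s" and c: "c < d" and i: "edge s c x \<inter> edge s c' x' ~= {}"
  shows "edge s c x = edge s c' x'"
proof -
  have "c' = c" "x = x' \<or> x = s c x' \<or> s c x = x' \<or> s c x = s c x'" using i by (auto simp: edge_def)
  then show ?thesis using ms_invol[OF ms c, of x] ms_invol[OF ms c, of x'] ms_inj[OF ms c, of x x'] by (auto simp: edge_def)
qed

text \<open>A shortest cycle through exactly one edge of a minimal hitting set crosses that edge only once:
  otherwise it could be cut at the two crossings.\<close>

lemma private_cycle:
  assumes ms: "matchings d N s"
    and vw: "(v, w) \<in> short_cycles d N s g" and av: "traced s v w \<inter> F = {}" and hit: "traced s v w \<inter> edge s c0 x0 ~= {}"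
    and hitall: "\<And>v' w'. (v', w') \<in> short_cycles d N s g ==> traced s v' w' \<inter> (F \<union> edge s c0 x0) ~= {}"
    and least: "\<And>v' w'. (v', w') \<in> short_cycles d N s g ==> traced s v' w' \<inter> F = {} ==> length w \<le> length w'"
    and c0: "c0 < d"
  shows "\<exists>x w'. edge s c0 x = edge s c0 x0 & (x, c0 # w') \<in> short_cycles d N s g
    & traced s (s c0 x) w' \<inter> (F \<union> edge s c0 x0) = {}"
proof -
  have w: "v < N" "set w \<subseteq> {..<d}" "length w \<le> g" "cyc_reduced w" "walk s v w = v"
    using vw by (auto simp: short_cycles_def)
  obtain c y where "(c, y) \<in> traced s v w" "(c, y) \<in> edge s c0 x0" using hit by (metis disjoint_iff surj_pair)
  then have c: "c = c0" and y: "y \<in> {x0, s c0 x0}" and "(c0, y) \<in> traced s v w" by (auto simp: edge_def)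
  from traced_in[OF this(3)] obtain w1 w2 where w12: "w = w1 @ c0 # w2"
    and y2: "y = walk s v w1 \<or> y = walk s v (w1 @ [c0])" by blast
  define x where "x = walk s v w1"
  have yx: "y = x \<or> y = s c0 x" using y2 by (auto simp: x_def walk_append)
  have ex: "edge s c0 x = edge s c0 x0"
    by (rule edge_eq[OF ms c0]) (use y yx in \<open>auto simp: edge_def\<close>)
  define w' where "w' = w2 @ w1"
  have cyc: "cyc_reduced (c0 # w')"
    using w(4) unfolding w12 w'_def cyc_reduced_def by (cases "w1 = []"; cases "w2 = []") (auto simp: distinct_adj_append_iff distinct_adj_Cons)
  have v2: "walk s (s c0 x) w2 = v" using w(5) by (simp add: w12 walk_append x_def)
  then have cl: "walk s x (c0 # w') = x" by (simp add: w'_def walk_append x_def)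
  have he: "traced s x (c0 # w') = traced s v w"
    using v2 by (auto simp: w12 w'_def traced_append x_def)
  have xN: "x < N" using walk_less[OF ms, of w1 v] w w12 by (simp add: x_def)
  have col: "set w' \<subseteq> {..<d}" and len: "length (c0 # w') = length w" using w w12 by (auto simp: w'_def)
  have sc: "(x, c0 # w') \<in> short_cycles d N s g" using cyc cl xN col len w c0 by (simp add: short_cycles_def)
  have "traced s (s c0 x) w' \<inter> edge s c0 x = {}"
  proof (rule ccontr)
    assume "\<not> ?thesis"
    then obtain z where "(c0, z) \<in> traced s (s c0 x) w'" "z \<in> {x, s c0 x}" by (auto simp: edge_def)
    from traced_in[OF this(1)] obtain a b where ab: "w' = a @ c0 # b"
      and z2: "z = walk s (s c0 x) a \<or> z = walk s (s c0 x) (a @ [c0])" by blast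
    define q where "q = walk s (s c0 x) a"
    have q: "q = x \<or> q = s c0 x"
      using z2 \<open>z \<in> {x, s c0 x}\<close> ms_invol[OF ms c0, of x] ms_invol[OF ms c0, of q] ms_inj[OF ms c0, of q x]
      by (auto simp: q_def[symmetric] walk_append)
    have red: "distinct_adj (c0 # a @ c0 # b)" using cyc ab by (simp add: cyc_reduced_def)
    have ne: "a ~= []" using red by auto
    have la: "last a ~= c0" "distinct_adj (c0 # a)" using red ne by (auto simp: distinct_adj_Cons distinct_adj_append_iff)
    have sub: "traced s (s c0 x) a \<subseteq> traced s v w" using he by (auto simp: ab traced_append)
    have la': "length a < length w'" by (simp add: ab)
    \<comment> \<open>A second crossing in the same direction cuts off a shorter cycle through the
      edge. A crossing in the opposite direction makes \<open>a\<close> a closed walk at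
      \<open>s c0 x\<close>, whose cyclically reduced core is shorter. Either contradicts the
      minimality of \<open>w\<close>.\<close>
    from q show False
    proof
      assume qx: "q = x"
      have "(x, c0 # a) \<in> short_cycles d N s g"
        using qx xN col len w c0 la ne la' by (auto simp: short_cycles_def cyc_reduced_def q_def ab)
      moreover have "traced s x (c0 # a) \<inter> F = {}" using sub av he by auto
      ultimately show False using least[of x "c0 # a"] la' len by simp
    next
      assume qx: "q = s c0 x"
      have da: "distinct_adj a" "set a \<subseteq> {..<d}" "s c0 x < N"
        using la col ab ms_less[OF ms c0] xN by (auto simp: distinct_adj_Cons)
      obtain r w0 where r: "a = r @ w0 @ rev r" "cyc_reduced w0" "walk s (walk s (s c0 x) r) w0 = walk s (s c0 x) r"
        using lollipop_decomp[OF ms da(2,1) ne da(3)] qx by (auto simp: q_def)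
      have "(walk s (s c0 x) r, w0) \<in> short_cycles d N s g"
        using r da w len la' walk_less[OF ms, of r "s c0 x"] by (auto simp: short_cycles_def)
      moreover have "traced s (walk s (s c0 x) r) w0 \<inter> F = {}" using sub av traced_sub[of s "s c0 x" r w0 "rev r"] r(1) by blast
      ultimately show False using least[of _ w0] r(1) la' len by fastforce
    qed
  qed
  moreover have "traced s (s c0 x) w' \<inter> F = {}" using he av by auto
  ultimately show ?thesis using sc ex by (intro exI[of _ x] exI[of _ w']) auto
qed

text \<open>Take a hitting set of least cardinality. Dropping an edge leaves some short cycle unhit,
  and a shortest one of these is private to the edge by \<open>private_cycle\<close>. Private cycles
  are distinct, which bounds the size of the hitting set by the number of short cycles.\<close>

theorem private_hitting_edges:
  assumes ms: "matchings d N s"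
  shows "\<exists>(n::nat) c x w. n \<le> card (short_cycles d N s g)
    & (\<forall>i<n. c i < d & x i < N & (x i, c i # w i) \<in> short_cycles d N s g)
    & (\<forall>i<n. \<forall>j<n. traced s (s (c i) (x i)) (w i) \<inter> edge s (c j) (x j) = {})
    & (\<forall>i<n. \<forall>j<n. i ~= j --> edge s (c i) (x i) \<inter> edge s (c j) (x j) = {})
    & (\<forall>v w. (v, w) \<in> short_cycles d N s g --> (\<exists>i<n. traced s v w \<inter> edge s (c i) (x i) ~= {}))"
proof -
  let ?S = "short_cycles d N s g"
  define EE where "EE = (\<lambda>(c, x). edge s c x) ` ({..<d} \<times> {..<N})"
  define hits where "hits H \<longleftrightarrow> (\<forall>v w. (v, w) \<in> ?S --> traced s v w \<inter> \<Union>H ~= {})" for H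
  have "hits EE"
    unfolding hits_def
  proof (intro allI impI)
    fix v w assume a: "(v, w) \<in> ?S"
    then obtain c w' where w: "w = c # w'" by (cases w) (auto simp: short_cycles_def cyc_reduced_def)
    have "(c, v) \<in> traced s v w" "(c, v) \<in> edge s c v" "edge s c v \<in> EE" using a w by (auto simp: EE_def edge_def short_cycles_def)
    then show "traced s v w \<inter> \<Union>EE ~= {}" by blast
  qed
  then obtain H where H: "H \<subseteq> EE" "hits H" and Hmin: "\<And>H'. H' \<subseteq> EE ==> hits H' ==> card H \<le> card H'"
    using ex_has_least_nat[of "\<lambda>H. H \<subseteq> EE & hits H" EE card] by auto
  have finH: "finite H" by (rule finite_subset[OF H(1)]) (simp add: EE_def)
  have one: "\<exists>c x w. e = edge s c x & c < d & x < N & (x, c # w) \<in> ?S & traced s (s c x) w \<inter> \<Union>H = {}" if e: "e \<in> H" for e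
  proof -
    obtain c0 x0 where e0: "e = edge s c0 x0" "c0 < d" "x0 < N" using e H(1) by (auto simp: EE_def)
    have "card (H - {e}) < card H" using e finH by (intro psubset_card_mono) auto
    then have "\<not> hits (H - {e})" using Hmin[of "H - {e}"] H(1) by auto
    then obtain v1 w1 where "(v1, w1) \<in> ?S" "traced s v1 w1 \<inter> \<Union>(H - {e}) = {}" unfolding hits_def by blast
    then obtain vw where vw: "vw \<in> ?S" "traced s (fst vw) (snd vw) \<inter> \<Union>(H - {e}) = {}"
      and least: "\<And>y. y \<in> ?S ==> traced s (fst y) (snd y) \<inter> \<Union>(H - {e}) = {} ==> length (snd vw) \<le> length (snd y)"
      using ex_has_least_nat[of "\<lambda>y. y \<in> ?S & traced s (fst y) (snd y) \<inter> \<Union>(H - {e}) = {}" "(v1, w1)" "\<lambda>y. length (snd y)"] by auto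
    have UH: "\<Union>H = \<Union>(H - {e}) \<union> edge s c0 x0" using e e0 by blast
    have hitall: "traced s v' w' \<inter> (\<Union>(H - {e}) \<union> edge s c0 x0) ~= {}" if "(v', w') \<in> ?S" for v' w'
      using that H(2) unfolding hits_def UH by blast
    have vw': "(fst vw, snd vw) \<in> ?S" using vw(1) by simp
    have hit: "traced s (fst vw) (snd vw) \<inter> edge s c0 x0 ~= {}" using hitall[OF vw'] vw(2) by blast
    from private_cycle[OF ms vw' vw(2) hit hitall _ e0(2)] least obtain x w' where
      xw: "edge s c0 x = edge s c0 x0" "(x, c0 # w') \<in> ?S" "traced s (s c0 x) w' \<inter> (\<Union>(H - {e}) \<union> edge s c0 x0) = {}"
      by (metis fst_conv snd_conv)
    have "x < N" using xw(2) by (simp add: short_cycles_def)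
    then show ?thesis using xw e0 UH by metis
  qed
  then obtain C X W where CXW: "\<And>e. e \<in> H ==> e = edge s (C e) (X e) & C e < d & X e < N & (X e, C e # W e) \<in> ?S
      & traced s (s (C e) (X e)) (W e) \<inter> \<Union>H = {}" by metis
  obtain f :: "nat => (nat \<times> nat) set" where f: "bij_betw f {0..<card H} H" using ex_bij_betw_nat_finite[OF finH] by blast
  define n where "n = card H"
  have fH: "f i \<in> H" if "i < n" for i using f that by (auto simp: bij_betw_def n_def)
  have finj: "f i ~= f j" if "i < n" "j < n" "i ~= j" for i j using f that by (auto simp: bij_betw_def n_def inj_on_def)
  have fe: "edge s (C (f i)) (X (f i)) = f i" if "i < n" for i using CXW[OF fH[OF that]] by simp
  define c x w where "c i = C (f i)" and "x i = X (f i)" and "w i = W (f i)" for i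
  note cxw = c_def x_def w_def
  have disj: "edge s (c i) (x i) \<inter> edge s (c j) (x j) = {}" if "i < n" "j < n" "i ~= j" for i j
  proof (rule ccontr)
    assume "edge s (c i) (x i) \<inter> edge s (c j) (x j) ~= {}"
    then have "edge s (c i) (x i) = edge s (c j) (x j)" using CXW[OF fH[OF that(1)]] by (intro edge_eq[OF ms]) (auto simp: cxw)
    then show False using finj[OF that] fe that by (simp add: cxw)
  qed
  have "inj_on (\<lambda>i. (x i, c i # w i)) {..<n}"
  proof (intro inj_onI, rule ccontr)
    fix i j assume a: "i \<in> {..<n}" "j \<in> {..<n}" "(x i, c i # w i) = (x j, c j # w j)" "i ~= j"
    then show False using disj[of i j] by (auto simp: edge_def)
  qed
  then have "card ((\<lambda>i. (x i, c i # w i)) ` {..<n}) = n" by (simp add: card_image)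
  moreover have "card ((\<lambda>i. (x i, c i # w i)) ` {..<n}) \<le> card ?S"
    using CXW fH by (intro card_mono finite_short_cycles) (auto simp: cxw)
  ultimately have "n \<le> card ?S" by simp
  moreover have "\<forall>i<n. c i < d & x i < N & (x i, c i # w i) \<in> ?S" using CXW fH by (auto simp: cxw)
  moreover have "\<forall>i<n. \<forall>j<n. traced s (s (c i) (x i)) (w i) \<inter> edge s (c j) (x j) = {}"
  proof (intro allI impI)
    fix i j assume ij: "i < n" "j < n"
    have "edge s (c j) (x j) \<subseteq> \<Union>H" using fe[OF ij(2)] fH[OF ij(2)] by (auto simp: cxw)
    then show "traced s (s (c i) (x i)) (w i) \<inter> edge s (c j) (x j) = {}" using CXW[OF fH[OF ij(1)]] by (auto simp: cxw)
  qed
  moreover have "\<forall>v w. (v, w) \<in> ?S --> (\<exists>i<n. traced s v w \<inter> edge s (c i) (x i) ~= {})"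
  proof (intro allI impI)
    fix v w assume "(v, w) \<in> ?S"
    then have "traced s v w \<inter> \<Union>H ~= {}" using H(2) unfolding hits_def by blast
    then obtain e where e: "e \<in> H" "traced s v w \<inter> e ~= {}" by blast
    then have "e \<in> f ` {0..<n}" using f by (simp add: bij_betw_imp_surj_on n_def)
    then obtain i where "i < n" "f i = e" by auto
    then show "\<exists>i<n. traced s v w \<inter> edge s (c i) (x i) ~= {}" using fe e by (auto simp: cxw)
  qed
  ultimately show ?thesis using disj by (intro exI[of _ n] exI[of _ c] exI[of _ x] exI[of _ w]) auto
qed

section \<open>Switching away all short cycles\<close>

lemma reduce_walk:
  assumes ms: "matchings d N s"
  shows "set w \<subseteq> {..<d} ==> \<exists>w'. set w' \<subseteq> {..<d} & distinct_adj w' & length w' \<le> length w & walk s v w' = walk s v w"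
proof (induction w arbitrary: v)
  case (Cons c w)
  then obtain w' where w': "set w' \<subseteq> {..<d}" "distinct_adj w'" "length w' \<le> length w" "walk s (s c v) w' = walk s (s c v) w" by force
  show ?case
  proof (cases "w' ~= [] & hd w' = c")
    case True
    then obtain w'' where w'': "w' = c # w''" by (cases w') auto
    then show ?thesis using w' Cons.prems ms_invol[OF ms, of c v] by (intro exI[of _ w'']) (auto simp: distinct_adj_Cons)
  next
    case False
    then show ?thesis using w' Cons.prems by (intro exI[of _ "c # w'"]) (auto simp: distinct_adj_Cons)
  qed
qed auto

lemma card_not_far:
  assumes ms: "matchings (Suc p) N s" and p: "2 \<le> p"
  shows "finite {u. \<not> far (Suc p) s R x u}" "card {u. \<not> far (Suc p) s R x u} \<le> 4 * p ^ R"
proof -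
  let ?W = "{w. set w \<subseteq> {..<Suc p} & distinct_adj w & length w \<le> R}"
  have fin: "finite ?W" by (rule finite_subset[OF _ finite_lists_length_le[of "{..<Suc p}" R]]) auto
  have sub: "{u. \<not> far (Suc p) s R x u} \<subseteq> walk s x ` ?W"
  proof
    fix u assume "u \<in> {u. \<not> far (Suc p) s R x u}"
    then obtain w where w: "set w \<subseteq> {..<Suc p}" "length w \<le> R" "walk s x w = u" by (auto simp: far_def)
    obtain w' where "set w' \<subseteq> {..<Suc p}" "distinct_adj w'" "length w' \<le> length w" "walk s x w' = walk s x w"
      using reduce_walk[OF ms w(1), of x] by blast
    then show "u \<in> walk s x ` ?W" using w by (intro image_eqI[of _ _ w']) auto
  qed
  show "finite {u. \<not> far (Suc p) s R x u}" by (rule finite_subset[OF sub]) (simp add: fin)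
  have "card {u. \<not> far (Suc p) s R x u} \<le> card (walk s x ` ?W)" by (rule card_mono[OF _ sub]) (simp add: fin)
  also have "... \<le> card ?W" by (rule card_image_le[OF fin])
  also have "... \<le> 4 * p ^ R" by (rule reduced_words_le_card[OF p])
  finally show "card {u. \<not> far (Suc p) s R x u} \<le> 4 * p ^ R" .
qed

lemma far_edges:
  assumes ms: "matchings d N s" and f: "far d s (R + 2) x u" and c: "c < d" "c' < d"
    and a: "a \<in> {x, s c x}" and b: "b \<in> {u, s c' u}"
  shows "far d s R a b"
proof -
  have 1: "far d s (Suc R) a u" using a far_step[of d s "Suc R" x u c] f c far_mono[OF f, of "Suc R"] by auto
  then have 2: "far d s (Suc R) u a" by (rule far_sym[OF ms])
  have "far d s R b a" using b far_step[OF 2 c(2)] far_mono[OF 2, of R] by auto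
  then show ?thesis by (rule far_sym[OF ms])
qed

definition switch_points :: "(nat => nat => nat) => (nat => nat) => (nat => nat) => (nat => nat) => nat => nat set" where
  "switch_points X c x u j = {x j, X (c j) (x j), u j, X (c j) (u j)}"

text \<open>The state after the first \<open>k\<close> edges have been switched away, edge \<open>j\<close> against the edge of the same colour at \<open>u j\<close>.\<close>

definition switched where
  "switched d N X g r n c x k t u \<longleftrightarrow> matchings d N t
    & (\<forall>v w. (v, w) \<in> short_cycles d N t g --> (v, w) \<in> short_cycles d N X g
         & (\<forall>w1 w2. w = w1 @ w2 --> walk t v w1 = walk X v w1)
         & (\<forall>j<k. traced X v w \<inter> edge X (c j) (x j) = {}))
    & (\<forall>j<k. u j < N & (\<forall>i<n. far d X r (x i) (u j)))
    & (\<forall>j<k. \<forall>i<k. i ~= j --> far d X r (u i) (u j))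
    & (\<forall>c' v. t c' v ~= X c' v -->
         (\<exists>j<k. c' = c j & v \<in> switch_points X c x u j & t c' v \<in> switch_points X c x u j))"

text \<open>Greedy choice of partners. Forbidden are a ball around \<open>x k\<close>, the starting
  points of short closed walks together with their neighbours in colour \<open>c k\<close>, and
  balls around all chosen points; \<open>room\<close> says that these do not exhaust
  \<open>{..<N}\<close>. Switching creates no short cycles, so the weight of \<open>X\<close> bounds
  that of all later states.\<close>

theorem switch_all:
  fixes c x :: "nat => nat" and n :: nat
  assumes ms: "matchings (Suc p) N X" and p: "2 \<le> p"
    and cx: "\<And>i. i < n ==> c i < Suc p & x i < N"
    and disj: "\<And>i j. i < n ==> j < n ==> i ~= j ==> edge X (c i) (x i) \<inter> edge X (c j) (x j) = {}"
    and room: "4 * p ^ (g + 2) + 2 * cycle_weight p N X g + 8 * n * p ^ (R + 2) < N"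
  shows "k \<le> n ==> \<exists>t u. switched (Suc p) N X g (R + 2) n c x k t u"
proof (induction k)
  case 0
  show ?case using ms by (intro exI[of _ X]) (auto simp: switched_def)
next
  case (Suc k)
  let ?d = "Suc p"
  let ?T = "switch_points X c x"
  obtain t u where "switched ?d N X g (R + 2) n c x k t u" using Suc.IH Suc.prems by auto
  note IH = this[unfolded switched_def]
  note mst = IH[THEN conjunct1]
    and uu = IH[THEN conjunct2, THEN conjunct2, THEN conjunct2, THEN conjunct1, rule_format]
    and dif = IH[THEN conjunct2, THEN conjunct2, THEN conjunct2, THEN conjunct2, rule_format]
  have cyc: "(v, w) \<in> short_cycles ?d N X g & (\<forall>w1 w2. w = w1 @ w2 --> walk t v w1 = walk X v w1)
      & (\<forall>j<k. traced X v w \<inter> edge X (c j) (x j) = {})" if "(v, w) \<in> short_cycles ?d N t g" for v w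
    by (rule IH[THEN conjunct2, THEN conjunct1, THEN spec, THEN spec, THEN mp, OF that])
  have uj: "u j < N & (\<forall>i<n. far ?d X (R + 2) (x i) (u j))" if "j < k" for j
    by (rule IH[THEN conjunct2, THEN conjunct2, THEN conjunct1, THEN spec, THEN mp, OF that])
  have kn: "k < n" using Suc.prems by simp
  have ck: "c k < ?d" "x k < N" using cx[OF kn] by auto
  have farS: "y \<notin> ?T u j" if j: "j < k" and y: "far ?d X (R + 2) (x j) y" "far ?d X (R + 2) (u j) y" for y j
  proof -
    have "far ?d X 0 (x j) y" "far ?d X 0 (u j) y" "far ?d X 1 (x j) y" "far ?d X 1 (u j) y"
      using far_mono[OF y(1)] far_mono[OF y(2)] by auto
    then have "y ~= x j" "y ~= u j" "y ~= X (c j) (x j)" "y ~= X (c j) (u j)"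
      using farD[of ?d X 0 _ y "[]"] farD[of ?d X 1 _ y "[c j]"] cx[of j] j kn by auto
    then show ?thesis by (simp add: switch_points_def)
  qed
  \<comment> \<open>Earlier switches have not touched this edge, because it is disjoint from the
    other edges to be removed and far from their partners.\<close>
  have tx: "t (c k) (x k) = X (c k) (x k)"
  proof (rule ccontr)
    assume "\<not> ?thesis"
    then obtain j where j: "j < k" "c k = c j" "x k \<in> ?T u j" using dif by metis
    have "x k ~= x j" "x k ~= X (c j) (x j)" using disj[of k j] j kn by (auto simp: edge_def)
    moreover have "x k ~= u j" using uj[OF j(1)] kn far_neq by blast
    moreover have "x k ~= X (c j) (u j)"
    proof
      assume a: "x k = X (c j) (u j)"
      have "far ?d X 1 (x k) (u j)" using uj[OF j(1)] kn far_mono[of ?d X "R + 2" "x k" "u j" 1] by auto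
      then have "walk X (x k) [c j] ~= u j" using cx[of j] j kn by (intro farD) auto
      then show False using a ms_invol[OF ms, of "c j" "u j"] cx[of j] j kn by simp
    qed
    ultimately show False using j(3) by (simp add: switch_points_def)
  qed
  define L where "L = {v. v < N & (\<exists>w. set w \<subseteq> {..<?d} & distinct_adj w & w ~= [] & length w \<le> g & walk t v w = v)}"
  have finL: "finite L" by (simp add: L_def)
  have cL: "card L \<le> cycle_weight p N X g"
    unfolding L_def using lollipop_vertices_card[OF mst p] cycle_weight_mono[of p N t g X] cyc by (meson order.trans subrelI)
  define P where "P = x ` {..<n} \<union> u ` {..<k}"
  have "card P \<le> card (x ` {..<n}) + card (u ` {..<k})" unfolding P_def by (rule card_Un_le)
  also have "... \<le> n + k" by (rule order.trans[OF add_mono[OF card_image_le card_image_le]]) auto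
  finally have cP: "card P \<le> 2 * n" using kn by simp
  have finP: "finite P" by (simp add: P_def)
  define Bad where "Bad = {y. \<not> far ?d t (g + 2) (x k) y} \<union> (L \<union> t (c k) ` L) \<union> (\<Union>z\<in>P. {y. \<not> far ?d X (R + 2) z y})"
  have "card Bad \<le> card {y. \<not> far ?d t (g + 2) (x k) y} + (card L + card (t (c k) ` L)) + card (\<Union>z\<in>P. {y. \<not> far ?d X (R + 2) z y})"
    unfolding Bad_def by (intro order.trans[OF card_Un_le] add_mono card_Un_le order_refl)
  also have "... \<le> 4 * p ^ (g + 2) + (cycle_weight p N X g + cycle_weight p N X g) + 2 * n * (4 * p ^ (R + 2))"
  proof (intro add_mono card_not_far(2)[OF mst p] cL)
    show "card (t (c k) ` L) \<le> cycle_weight p N X g" using card_image_le[OF finL] cL order.trans by blast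
    have "card (\<Union>z\<in>P. {y. \<not> far ?d X (R + 2) z y}) \<le> (\<Sum>z\<in>P. card {y. \<not> far ?d X (R + 2) z y})" by (rule card_UN_le[OF finP])
    also have "... \<le> (\<Sum>z\<in>P. 4 * p ^ (R + 2))" by (intro sum_mono card_not_far(2)[OF ms p])
    also have "... \<le> 2 * n * (4 * p ^ (R + 2))" using cP by simp
    finally show "card (\<Union>z\<in>P. {y. \<not> far ?d X (R + 2) z y}) \<le> 2 * n * (4 * p ^ (R + 2))" .
  qed
  also have "... < card {..<N}" using room by simp
  finally have "card Bad < card {..<N}" .
  then have "\<not> {..<N} \<subseteq> Bad"
    using finL finP card_not_far(1)[OF mst p] card_not_far(1)[OF ms p] by (auto simp: Bad_def dest!: card_mono[rotated])
  then obtain y where y: "y < N" "y \<notin> Bad" by blast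
  have yt: "far ?d t (g + 2) (x k) y" and yL: "y \<notin> L" "y \<notin> t (c k) ` L" and yP: "\<And>z. z \<in> P ==> far ?d X (R + 2) z y"
    using y(2) by (auto simp: Bad_def)
  have ty: "t (c k) y = X (c k) y"
  proof (rule ccontr)
    assume "\<not> ?thesis"
    then obtain j where j: "j < k" "y \<in> ?T u j" using dif by metis
    then show False using farS[OF j(1), of y] yP kn by (auto simp: P_def)
  qed
  interpret sw: switching ?d N t "c k" "x k" y g
  proof
    show "matchings ?d N t" "c k < ?d" "x k < N" "y < N" by (fact mst ck y)+
    show "far ?d t g a b" if "a \<in> {x k, t (c k) (x k)}" "b \<in> {y, t (c k) y}" for a b
      by (rule far_edges[OF mst yt ck(1) ck(1) that])
    fix b w assume b: "b \<in> {y, t (c k) y}" and w: "set w \<subseteq> {..<?d}" "distinct_adj w" "w ~= []" "length w < g"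
    show "walk t b w ~= b"
    proof
      assume cl: "walk t b w = b"
      have "b < N" using b y ms_less[OF mst ck(1)] by auto
      then have bL: "b \<in> L" using w cl by (auto simp: L_def intro!: exI[of _ w])
      then have "b ~= y" using yL by blast
      then have "b = t (c k) y" using b by blast
      then have "y = t (c k) b" using ms_invol[OF mst ck(1)] by simp
      then show False using yL bL by blast
    qed
  qed
  let ?t = "switch t (c k) (x k) y" and ?u = "u(k := y)"
  have Told: "?T ?u j = ?T u j" if "j < k" for j using that by (simp add: switch_points_def)
  have Tnew: "?T ?u k = sw.A \<union> sw.B" using tx ty by (auto simp: switch_points_def)
  show ?case
  proof (intro exI[of _ ?t] exI[of _ ?u], unfold switched_def, intro conjI allI impI)
    show "matchings ?d N ?t" by (rule sw.ms_t)
  next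
    fix v w assume vw: "(v, w) \<in> short_cycles ?d N ?t g"
    then have vwt: "(v, w) \<in> short_cycles ?d N t g" using sw.cycles_subset by blast
    show "(v, w) \<in> short_cycles ?d N X g" using cyc[OF vwt] by blast
    have same: "walk ?t v w1 = walk X v w1" if "w = w1 @ w2" for w1 w2
      using sw.cycle_same[OF vw that] cyc[OF vwt] that by simp
    show "walk ?t v w1 = walk X v w1" if "w = w1 @ w2" for w1 w2 by (rule same[OF that])
    fix j assume j: "j < Suc k"
    show "traced X v w \<inter> edge X (c j) (x j) = {}"
    proof (cases "j = k")
      case False then show ?thesis using cyc[OF vwt] j by simp
    next
      case True
      show ?thesis
      proof (rule ccontr)
        assume "\<not> ?thesis"
        then obtain z where z: "(c k, z) \<in> traced X v w" "z \<in> sw.A" using True tx by (auto simp: edge_def)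
        from traced_in[OF z(1)] obtain w1 w2 where w: "w = w1 @ c k # w2"
          and zz: "z = walk X v w1 \<or> z = walk X v (w1 @ [c k])" by blast
        from zz have "walk ?t v w1 \<in> sw.A \<union> sw.B"
        proof
          assume "z = walk X v w1" then show ?thesis using same[OF w] z by simp
        next
          assume "z = walk X v (w1 @ [c k])"
          then have "z = walk ?t v (w1 @ [c k])" using same[of "w1 @ [c k]" w2] w by simp
          then have "walk ?t v w1 = ?t (c k) z" using ms_invol[OF sw.ms_t ck(1)] by (simp add: walk_append)
          then show ?thesis using sw.t_A[OF z(2)] by auto
        qed
        then show False using sw.cycle_avoids[OF vw w] by simp
      qed
    qed
  next
    fix j assume j: "j < Suc k"
    show "?u j < N" using uj[of j] y j by (auto simp: less_Suc_eq)
    show "far ?d X (R + 2) (x i) (?u j)" if "i < n" for i using uj[of j] yP[of "x i"] that j by (auto simp: P_def less_Suc_eq)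
    show "far ?d X (R + 2) (?u i) (?u j)" if "i < Suc k" "i ~= j" for i
      using uu[of j i] yP[of "u i"] far_sym[OF ms yP[of "u j"]] that j by (auto simp: P_def less_Suc_eq)
  next
    fix c' v assume ne: "?t c' v ~= X c' v"
    show "\<exists>j<Suc k. c' = c j & v \<in> ?T ?u j & ?t c' v \<in> ?T ?u j"
    proof (cases "c' = c k & v \<in> sw.A \<union> sw.B")
      case True
      then have "?t c' v \<in> sw.A \<union> sw.B" using sw.t_A[of v] sw.t_B[of v] by blast
      then show ?thesis using True Tnew by (intro exI[of _ k]) auto
    next
      case False
      then have e: "?t c' v = t c' v" using sw.t_other[of c' v] by blast
      then obtain j where "j < k" "c' = c j & v \<in> ?T u j & t c' v \<in> ?T u j" using dif[of c' v] ne by auto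
      then show ?thesis using Told e by (intro exI[of _ j]) auto
    qed
  qed
qed

section \<open>Patching a system near a sparse set\<close>

text \<open>Distance to \<open>S\<close> capped at \<open>R\<close>; the cap inside
  \<open>LEAST\<close> gives a value also when \<open>S\<close> cannot be reached.\<close>

definition sdist :: "nat => (nat => nat => nat) => nat set => nat => nat => nat" where
  "sdist d s S R v = (LEAST k. k = R \<or> (\<exists>w. set w \<subseteq> {..<d} & length w \<le> k & walk s v w \<in> S))"

lemma sdist_le: "sdist d s S R v \<le> R"
  unfolding sdist_def by (rule Least_le) simp

lemma sdist_upper: "set w \<subseteq> {..<d} ==> walk s v w \<in> S ==> sdist d s S R v \<le> length w"
  unfolding sdist_def by (rule Least_le) auto

lemma sdist_witness:
  assumes "sdist d s S R v < R"
  shows "\<exists>w. set w \<subseteq> {..<d} & length w \<le> sdist d s S R v & walk s v w \<in> S"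
  using LeastI[of "\<lambda>k. k = R \<or> (\<exists>w. set w \<subseteq> {..<d} & length w \<le> k & walk s v w \<in> S)" R] assms
  unfolding sdist_def by auto

lemma sdist_step: "c < d ==> sdist d s S R v \<le> Suc (sdist d s S R (s c v))"
proof (cases "sdist d s S R (s c v) < R")
  case True
  assume c: "c < d"
  from sdist_witness[OF True] obtain w where "set w \<subseteq> {..<d}" "length w \<le> sdist d s S R (s c v)" "walk s (s c v) w \<in> S" by blast
  then show ?thesis using sdist_upper[of "c # w" d s v S R] c by simp
next
  case False
  then show ?thesis using sdist_le[of d s S R v] by simp
qed

lemma sdist_0: "v \<in> S ==> sdist d s S R v = 0"
  using sdist_upper[of "[]" d s v S R] by simp

text \<open>Cut the walk at its first visit to \<open>S\<close>; up to there both systems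
  agree.\<close>

lemma walk_to_set:
  assumes eq: "\<And>c v. c < d ==> v \<notin> S ==> t c v = s c v"
  shows "set w \<subseteq> {..<d} ==> walk s v w \<in> S ==>
    \<exists>w'. set w' \<subseteq> {..<d} & length w' \<le> length w & walk s v w' \<in> S & walk t v w' = walk s v w'"
proof (induction w arbitrary: v)
  case Nil
  then show ?case by (intro exI[of _ "[]"]) auto
next
  case (Cons c w)
  show ?case
  proof (cases "v \<in> S")
    case True
    then show ?thesis by (intro exI[of _ "[]"]) auto
  next
    case False
    have c: "c < d" using Cons.prems by simp
    obtain w' where "set w' \<subseteq> {..<d}" "length w' \<le> length w" "walk s (s c v) w' \<in> S" "walk t (s c v) w' = walk s (s c v) w'"
      using Cons.IH[of "s c v"] Cons.prems by auto
    then show ?thesis using eq[OF c False] c by (intro exI[of _ "c # w'"]) auto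
  qed
qed

text \<open>\<open>localization\<close> with \<open>\<theta>\<close> growing linearly in the
  distance to \<open>S\<close>, from 0 up to \<open>pi / 2\<close> at distance \<open>R\<close>. The
  slope bound also holds across modified edges because both their ends lie in \<open>S\<close>,
  where \<open>\<theta> = 0\<close>.\<close>

theorem local_patch:
  fixes h :: "nat => real"
  assumes s: "matchings d N s" and t: "matchings d N t"
    and L: "spectral_bound d N s L" "0 \<le> L" and N: "0 < N" and R: "0 < R"
    and S: "\<And>c v. c < d ==> t c v ~= s c v ==> v \<in> S & t c v \<in> S"
    and h0: "\<And>v. v < N ==> 0 \<le> h v"
    and h: "\<And>v. v < N ==> sdist d s S R v < R ==> 0 < h v & (\<Sum>c<d. h (t c v)) \<le> r * h v"
    and W: "card {v. v < N & sdist d s S R v < R} \<le> w"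
  shows "spectral_bound d N t (max r L + real d * (pi / (2 * R))^2 / 2 + real d * real w / real N)"
proof -
  define \<theta> where "\<theta> v = pi / 2 * (real (sdist d s S R v) / real R)" for v
  have lt: "\<theta> v < pi / 2 \<longleftrightarrow> sdist d s S R v < R" for v
    using R by (simp add: \<theta>_def field_simps)
  show ?thesis
  proof (rule localization[OF s t L N, where \<theta> = \<theta> and h = h])
    show "0 \<le> \<theta> v" for v by (simp add: \<theta>_def)
    show "\<theta> v \<le> pi / 2" for v using R sdist_le[of d s S R v] by (simp add: \<theta>_def field_simps)
    show "\<theta> v = 0" if "c < d" "s c v ~= t c v" for v c
      using S[of c v] that sdist_0[of v S d s R] by (auto simp: \<theta>_def)
    show "\<bar>\<theta> v - \<theta> (t c v)\<bar> \<le> pi / (2 * R)" if c: "c < d" for v c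
    proof -
      have "sdist d s S R v \<le> Suc (sdist d s S R (t c v)) & sdist d s S R (t c v) \<le> Suc (sdist d s S R v)"
      proof (cases "t c v = s c v")
        case True
        then show ?thesis using sdist_step[OF c, of s S R v] sdist_step[OF c, of s S R "s c v"] ms_invol[OF s c, of v] by simp
      next
        case False
        then show ?thesis using S[OF c False] sdist_0[of _ S d s R] by simp
      qed
      then have "\<bar>real (sdist d s S R v) - real (sdist d s S R (t c v))\<bar> \<le> 1" by linarith
      then have "pi / (2 * R) * \<bar>real (sdist d s S R v) - real (sdist d s S R (t c v))\<bar> \<le> pi / (2 * R) * 1"
        by (intro mult_left_mono) auto
      moreover have "\<theta> v - \<theta> (t c v) = pi / (2 * R) * (real (sdist d s S R v) - real (sdist d s S R (t c v)))"
        by (simp add: \<theta>_def right_diff_distrib diff_divide_distrib)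
      ultimately show ?thesis by (simp add: abs_mult)
    qed
    show "0 < h v & (\<Sum>c<d. h (t c v)) \<le> r * h v" if "v < N" "\<theta> v < pi / 2" for v using h that lt by simp
    show "card {v. v < N & \<theta> v < pi / 2} \<le> w" using W lt by simp
  qed (use h0 in auto)
qed

lemma card_sdist_less:
  assumes ms: "matchings (Suc p) N s" and p: "2 \<le> p" and S: "finite S"
  shows "card {v. v < N & sdist (Suc p) s S R v < R} \<le> card S * (4 * p ^ R)"
proof -
  have "{v. v < N & sdist (Suc p) s S R v < R} \<subseteq> (\<Union>a\<in>S. {u. \<not> far (Suc p) s R a u})"
  proof
    fix v assume "v \<in> {v. v < N & sdist (Suc p) s S R v < R}"
    then obtain w where w: "set w \<subseteq> {..<Suc p}" "length w \<le> R" "walk s v w \<in> S"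
      using sdist_witness[of "Suc p" s S R v] by force
    then have "\<not> far (Suc p) s R (walk s v w) v"
      using walk_rev[OF ms w(1), of v] farD[of "Suc p" s R "walk s v w" v "rev w"] by auto
    then show "v \<in> (\<Union>a\<in>S. {u. \<not> far (Suc p) s R a u})" using w(3) by blast
  qed
  then have "card {v. v < N & sdist (Suc p) s S R v < R} \<le> card (\<Union>a\<in>S. {u. \<not> far (Suc p) s R a u})"
    by (intro card_mono finite_UN_I S card_not_far(1)[OF ms p])
  also have "... \<le> (\<Sum>a\<in>S. card {u. \<not> far (Suc p) s R a u})" by (rule card_UN_le[OF S])
  also have "... \<le> (\<Sum>a\<in>S. 4 * p ^ R)" by (intro sum_mono card_not_far(2)[OF ms p])
  finally show ?thesis by simp
qed

section \<open>Radial supersolutions on trees\<close>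

definition wdist :: "nat => (nat => nat => nat) => nat => nat => nat" where
  "wdist d t a b = (LEAST k. \<exists>w. set w \<subseteq> {..<d} & length w \<le> k & walk t a w = b)"

lemma wdist_le: "set w \<subseteq> {..<d} ==> walk t a w = b ==> wdist d t a b \<le> length w"
  unfolding wdist_def by (rule Least_le) auto

lemma wdist_witness:
  assumes ms: "matchings d N t" and w: "set w \<subseteq> {..<d}" "walk t a w = b"
  shows "\<exists>w. set w \<subseteq> {..<d} & distinct_adj w & length w = wdist d t a b & walk t a w = b"
proof -
  have "\<exists>w. set w \<subseteq> {..<d} & length w \<le> wdist d t a b & walk t a w = b"
    unfolding wdist_def using w by (intro LeastI[of "\<lambda>k. \<exists>w. set w \<subseteq> {..<d} & length w \<le> k & walk t a w = b" "length w"]) blast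
  then obtain w1 where w1: "set w1 \<subseteq> {..<d}" "length w1 \<le> wdist d t a b" "walk t a w1 = b" by blast
  from reduce_walk[OF ms w1(1), of a] obtain w' where
    w': "set w' \<subseteq> {..<d}" "distinct_adj w'" "length w' \<le> length w1" "walk t a w' = walk t a w1" by blast
  then show ?thesis using wdist_le[OF w'(1), of t a b] w1 by (intro exI[of _ w']) auto
qed

text \<open>At distance \<open>m > 0\<close> from \<open>a\<close> all neighbours but one are at
  distance \<open>m + 1\<close> by the girth condition, the last one at no less than
  \<open>m - 1\<close>, and \<open>q^(m-1) + p * q^(m+1) = 2 * sqrt p * q^m\<close>. At
  \<open>a\<close> itself \<open>(p + 1) * q <= 2 * p * q\<close> suffices.\<close>

theorem tree_supersolution:
  fixes q :: real
  assumes ms: "matchings (Suc p) N t" and p: "2 \<le> p" and g: "girth_gt (Suc p) N t (2 * \<rho> + 2)"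
    and a: "a < N" and w: "set w \<subseteq> {..<Suc p}" "length w \<le> \<rho>" "walk t a w = v"
  defines "q \<equiv> 1 / sqrt p"
  shows "(\<Sum>c<Suc p. q ^ wdist (Suc p) t a (t c v)) \<le> 2 * sqrt p * q ^ wdist (Suc p) t a v"
proof -
  let ?D = "wdist (Suc p) t a"
  define m where "m = ?D v"
  obtain w0 where w0: "set w0 \<subseteq> {..<Suc p}" "distinct_adj w0" "length w0 = m" "walk t a w0 = v"
    using wdist_witness[OF ms w(1,3)] unfolding m_def by blast
  have m: "m \<le> \<rho>" using wdist_le[OF w(1,3)] w(2) by (simp add: m_def)
  have q: "0 < q" "q \<le> 1" using p by (auto simp: q_def)
  have sp: "sqrt p * q = 1" "real p * (q * q) = 1" "0 < sqrt p" using p by (auto simp: q_def)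
  have low: "m \<le> Suc (?D (t c v))" if c: "c < Suc p" for c
  proof -
    obtain w' where w': "set w' \<subseteq> {..<Suc p}" "length w' = ?D (t c v)" "walk t a w' = t c v"
      using wdist_witness[OF ms, of "w0 @ [c]" a "t c v"] w0 c by (auto simp: walk_append)
    then show ?thesis unfolding m_def using wdist_le[of "w' @ [c]" "Suc p" t a v] c ms_invol[OF ms c, of v] by (simp add: walk_append)
  qed
  have up: "Suc m \<le> ?D (t c v)" if c: "c < Suc p" "w0 = [] \<or> last w0 ~= c" for c
  proof (rule ccontr)
    assume n: "\<not> ?thesis"
    obtain w' where w': "set w' \<subseteq> {..<Suc p}" "distinct_adj w'" "length w' = ?D (t c v)" "walk t a w' = t c v"
      using wdist_witness[OF ms, of "w0 @ [c]" a "t c v"] w0 c by (auto simp: walk_append)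
    have "w0 @ [c] = w'"
      using w0 w' c n m by (intro reduced_walk_unique[OF ms g a]) (auto simp: walk_append distinct_adj_append_iff)
    then show False using w0(3) w'(3) n by auto
  qed
  have mono: "q ^ j \<le> q ^ i" if "i \<le> j" for i j using that q by (intro power_decreasing) auto
  show ?thesis
  proof (cases "m = 0")
    case True
    have "(\<Sum>c<Suc p. q ^ ?D (t c v)) \<le> (\<Sum>c<Suc p. q ^ 1)"
      using up w0(3) True by (intro sum_mono mono) auto
    also have "... = (real p + 1) * q" by (simp add: algebra_simps)
    also have "... \<le> (2 * (sqrt p * sqrt p)) * q" using p q by (intro mult_right_mono) auto
    also have "... = 2 * sqrt p * (sqrt p * q)" by (simp only: mult_ac)
    also have "... = 2 * sqrt p" using sp by simp
    finally show ?thesis using True by (simp add: m_def)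
  next
    case False
    define c0 where "c0 = last w0"
    have ne: "w0 ~= []" using False w0(3) by auto
    then have c0: "c0 < Suc p" using subsetD[OF w0(1) last_in_set[OF ne]] by (simp add: c0_def)
    have "(\<Sum>c<Suc p. q ^ ?D (t c v)) = q ^ ?D (t c0 v) + (\<Sum>c\<in>{..<Suc p} - {c0}. q ^ ?D (t c v))"
      using c0 by (subst sum.remove[of _ c0]) auto
    also have "... \<le> q ^ (m - 1) + (\<Sum>c\<in>{..<Suc p} - {c0}. q ^ Suc m)"
      using low[OF c0] up by (intro add_mono mono sum_mono) (auto simp: c0_def)
    also have "... = q ^ (m - 1) + real p * (q * q) * q ^ (m - 1)" using c0 False by (cases m) auto
    also have "... = 2 * (sqrt p * q) * q ^ (m - 1)" using sp by simp
    also have "... = 2 * sqrt p * q ^ m" using False by (cases m) auto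
    finally show ?thesis by (simp add: m_def)
  qed
qed

text \<open>The sets reached in at most \<open>k\<close> steps grow strictly until they are
  constant; starting with one element and ending with at most \<open>m\<close>, they stop before
  step \<open>m\<close>.\<close>

lemma rtrancl_stabilises:
  assumes fin: "finite {j. \<exists>k\<le>m. (a, j) \<in> M ^^ k}" and c: "card {j. \<exists>k\<le>m. (a, j) \<in> M ^^ k} \<le> m" and j: "(a, j) \<in> M\<^sup>*"
  shows "\<exists>k\<le>m. (a, j) \<in> M ^^ k"
proof -
  define f where "f m = {j. \<exists>k\<le>m. (a, j) \<in> M ^^ k}" for m
  have mono: "f i \<subseteq> f j" if "i \<le> j" for i j using that by (auto simp: f_def intro: le_trans)
  have finf: "finite (f i)" if "i \<le> m" for i using finite_subset[OF mono[OF that]] fin by (simp only: f_def)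
  have "\<exists>k<m. f k = f (Suc k)"
  proof (rule ccontr)
    assume n: "\<not> ?thesis"
    have "Suc k \<le> card (f k)" if "k \<le> m" for k using that
    proof (induction k)
      case 0
      have "f 0 = {a}" by (auto simp: f_def)
      then show ?case by simp
    next
      case (Suc k)
      have "f k \<subset> f (Suc k)" using n Suc.prems mono[of k "Suc k"] by auto
      then have "card (f k) < card (f (Suc k))" using finf[OF Suc.prems] by (intro psubset_card_mono)
      then show ?case using Suc by simp
    qed
    from this[of m] show False using c by (simp add: f_def)
  qed
  then obtain k where k: "k < m" "f k = f (Suc k)" by blast
  have "j \<in> f k" using j
  proof (induction rule: rtrancl_induct)
    case base
    show ?case by (auto simp: f_def intro!: exI[of _ 0])
  next
    case (step y z)
    then obtain i where "i \<le> k" "(a, y) \<in> M ^^ i" by (auto simp: f_def)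
    then have "z \<in> f (Suc k)" using step.hyps(2) by (auto simp: f_def intro!: exI[of _ "Suc i"])
    then show ?case using k by simp
  qed
  then have "j \<in> f m" using mono[of k m] k(1) by auto
  then show ?thesis by (simp add: f_def)
qed

section \<open>Clusters of switched edges\<close>

lemma relpow_walk:
  assumes step: "\<And>a b. (a, b) \<in> M ==> \<exists>w. set w \<subseteq> {..<d} & length w \<le> l & walk s (f a) w = f b"
  shows "(a, b) \<in> M ^^ k ==> \<exists>w. set w \<subseteq> {..<d} & length w \<le> k * l & walk s (f a) w = f b"
proof (induction k arbitrary: b)
  case 0
  then show ?case by (intro exI[of _ "[]"]) auto
next
  case (Suc k)
  then obtain y where y: "(a, y) \<in> M ^^ k" "(y, b) \<in> M" by auto
  obtain w where "set w \<subseteq> {..<d}" "length w \<le> k * l" "walk s (f a) w = f y" using Suc.IH[OF y(1)] by blast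
  moreover obtain w' where "set w' \<subseteq> {..<d}" "length w' \<le> l" "walk s (f y) w' = f b" using step[OF y(2)] by blast
  ultimately show ?case by (intro exI[of _ "w @ w'"]) (auto simp: walk_append)
qed

text \<open>The girth \<open>580 * R + 2\<close> is twice the radius \<open>290 * R\<close> of
  \<open>component_radius\<close> plus 2, as \<open>tree_supersolution\<close> requires; the reach
  \<open>3 * (2 * R + 3)\<close> in \<open>sparse\<close> is three hops of
  \<open>step_X\<close>.\<close>

locale clusters =
  fixes p N n g R :: nat and X t :: "nat => nat => nat" and c x u :: "nat => nat" and w :: "nat => nat list"
  assumes msX: "matchings (Suc p) N X" and mst: "matchings (Suc p) N t" and p: "2 \<le> p" and R: "0 < R"
    and cx: "\<And>i. i < n ==> c i < Suc p & x i < N & (x i, c i # w i) \<in> short_cycles (Suc p) N X g"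
    and priv: "\<And>i j. i < n ==> j < n ==> traced X (X (c i) (x i)) (w i) \<inter> edge X (c j) (x j) = {}"
    and disj: "\<And>i j. i < n ==> j < n ==> i ~= j ==> edge X (c i) (x i) \<inter> edge X (c j) (x j) = {}"
    and sparse: "\<not> crowded (Suc p) N X (3 * (2 * R + 3)) g"
    and uN: "\<And>j. j < n ==> u j < N"
    and xu: "\<And>i j. i < n ==> j < n ==> far (Suc p) X (2 * R + 2) (x i) (u j)"
    and uu: "\<And>i j. i < n ==> j < n ==> i ~= j ==> far (Suc p) X (2 * R + 2) (u i) (u j)"
    and dif: "\<And>c' v. t c' v ~= X c' v ==> \<exists>j<n. c' = c j & v \<in> switch_points X c x u j
       & t c' v \<in> switch_points X c x u j"
    and girth: "girth_gt (Suc p) N t (580 * R + 2)"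
begin

abbreviation "d \<equiv> Suc p"

abbreviation "T \<equiv> switch_points X c x u"
definition "S = (\<Union>j<n. T j)"
definition "W = {v. v < N & sdist d X S R v < R}"
definition "EW = {(a, b). a \<in> W & b \<in> W & (\<exists>c'<d. b = t c' a)}"

lemma dif': "t c' v ~= X c' v ==> \<exists>j<n. v \<in> T j & t c' v \<in> T j"
  using dif by blast

lemma far_T:
  assumes i: "i < n" and j: "j < n" and ij: "i ~= j" and a: "a \<in> T i" and b: "b \<in> {u j, X (c j) (u j)}"
  shows "far d X (2 * R) a b"
proof -
  have ci: "c i < d" "c j < d" using cx i j by auto
  have "far d X (2 * R) a b" if "a \<in> {x i, X (c i) (x i)}" by (rule far_edges[OF msX xu[OF i j] ci that b])
  moreover have "far d X (2 * R) a b" if "a \<in> {u i, X (c i) (u i)}" by (rule far_edges[OF msX uu[OF i j ij] ci that b])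
  ultimately show ?thesis using a by (auto simp: switch_points_def)
qed

lemma to_x:
  assumes "i < n" "a \<in> {x i, X (c i) (x i)}"
  shows "\<exists>r. set r \<subseteq> {..<d} & length r \<le> 1 & walk X a r = x i & walk X (x i) r = a"
proof (cases "a = x i")
  case True
  then show ?thesis by (intro exI[of _ "[]"]) auto
next
  case False
  then show ?thesis using assms cx[OF assms(1)] ms_invol[OF msX, of "c i" "x i"] by (intro exI[of _ "[c i]"]) auto
qed

text \<open>Partner edges are far from everything of another index, so nearby switch points of
  different indices lie on removed edges, at most one step from \<open>x i\<close> and
  \<open>x j\<close>.\<close>

lemma near_T:
  assumes i: "i < n" and j: "j < n" and ij: "i ~= j" and a: "a \<in> T i" and b: "b \<in> T j"
    and r: "set r \<subseteq> {..<d}" "length r \<le> 2 * R" "walk X a r = b"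
  shows "\<exists>r'. set r' \<subseteq> {..<d} & length r' \<le> length r + 2 & walk X (x i) r' = x j"
proof -
  have "b \<notin> {u j, X (c j) (u j)}" using farD[OF far_T[OF i j ij a] r(1,2)] r(3) by blast
  then have bx: "b \<in> {x j, X (c j) (x j)}" using b by (auto simp: switch_points_def)
  have "a \<notin> {u i, X (c i) (u i)}"
    using far_sym[OF msX far_T[OF j i not_sym[OF ij] b]] farD[of d X "2 * R" a b r] r by blast
  then have ax: "a \<in> {x i, X (c i) (x i)}" using a by (auto simp: switch_points_def)
  obtain r1 where r1: "set r1 \<subseteq> {..<d}" "length r1 \<le> 1" "walk X (x i) r1 = a" using to_x[OF i ax] by blast
  obtain r2 where r2: "set r2 \<subseteq> {..<d}" "length r2 \<le> 1" "walk X b r2 = x j" using to_x[OF j bx] by blast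
  show ?thesis using r r1 r2 by (intro exI[of _ "r1 @ r @ r2"]) (auto simp: walk_append)
qed

text \<open>A switch point near \<open>v\<close>, joined to it by a walk that is the same in both
  systems. It translates connections in \<open>t\<close> into connections in \<open>X\<close>, where
  crowding is excluded.\<close>

definition "nr v = (if v \<in> S then v else SOME y. y \<in> S & (\<exists>r. set r \<subseteq> {..<d} & length r < R & walk X v r = y & walk t v r = y))"
definition "md a = (SOME j. j < n & a \<in> T j)"

lemma nr:
  assumes "v \<in> W"
  shows "nr v \<in> S" "\<exists>r. set r \<subseteq> {..<d} & length r < R & walk X v r = nr v & walk t v r = nr v"
proof -
  have "nr v \<in> S & (\<exists>r. set r \<subseteq> {..<d} & length r < R & walk X v r = nr v & walk t v r = nr v)"
  proof (cases "v \<in> S")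
    case True
    then show ?thesis using R by (auto simp: nr_def intro!: exI[of _ "[]"])
  next
    case False
    have lt: "sdist d X S R v < R" using assms by (simp add: W_def)
    obtain r where r: "set r \<subseteq> {..<d}" "length r \<le> sdist d X S R v" "walk X v r \<in> S" using sdist_witness[OF lt] by blast
    have "t c' v' = X c' v'" if "v' \<notin> S" for c' v' using that dif'[of c' v'] by (auto simp: S_def)
    from walk_to_set[OF this r(1,3)] obtain r' where
      "set r' \<subseteq> {..<d}" "length r' \<le> length r" "walk X v r' \<in> S" "walk t v r' = walk X v r'" by blast
    then have "\<exists>y. y \<in> S & (\<exists>r. set r \<subseteq> {..<d} & length r < R & walk X v r = y & walk t v r = y)"
      using r(2) lt by (intro exI[of _ "walk X v r'"] conjI exI[of _ r']) auto
    from someI_ex[OF this] show ?thesis using False by (simp add: nr_def)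
  qed
  then show "nr v \<in> S" "\<exists>r. set r \<subseteq> {..<d} & length r < R & walk X v r = nr v & walk t v r = nr v" by auto
qed

lemma md:
  assumes "a \<in> S" shows "md a < n" "a \<in> T (md a)"
proof -
  have "\<exists>j. j < n & a \<in> T j" using assms by (auto simp: S_def)
  from someI_ex[OF this] show "md a < n" "a \<in> T (md a)" by (auto simp: md_def)
qed

lemma EW_sym: "(a, b) \<in> EW ==> (b, a) \<in> EW"
  unfolding EW_def using ms_invol[OF mst] by auto

lemma step_t:
  assumes e: "(v, v') \<in> EW"
  shows "\<exists>r. set r \<subseteq> {..<d} & length r \<le> 2 * R & walk t (nr v) r = nr v'"
proof -
  obtain c' where c': "v \<in> W" "v' \<in> W" "c' < d" "v' = t c' v" using e by (auto simp: EW_def)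
  obtain r where r: "set r \<subseteq> {..<d}" "length r < R" "walk t v r = nr v" using nr(2)[OF c'(1)] by blast
  obtain r' where r': "set r' \<subseteq> {..<d}" "length r' < R" "walk t v' r' = nr v'" using nr(2)[OF c'(2)] by blast
  show ?thesis using r r' c' walk_rev[OF mst r(1), of v]
    by (intro exI[of _ "rev r @ c' # r'"]) (auto simp: walk_append)
qed

text \<open>Across an unchanged edge the representatives are joined by a short walk of
  \<open>X\<close>, and \<open>near_T\<close> applies. The ends of a changed edge are switch points
  of one index \<open>k\<close>, and two hops through \<open>x k\<close> suffice.\<close>

lemma step_X:
  assumes e: "(v, v') \<in> EW"
  shows "\<exists>r. set r \<subseteq> {..<d} & length r \<le> 2 * R + 3 & walk X (x (md (nr v))) r = x (md (nr v'))"
proof (cases "md (nr v) = md (nr v')")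
  case True
  then show ?thesis by (intro exI[of _ "[]"]) auto
next
  case ij: False
  obtain c' where c': "v \<in> W" "v' \<in> W" "c' < d" "v' = t c' v" using e by (auto simp: EW_def)
  note i = md[OF nr(1)[OF c'(1)]] and j = md[OF nr(1)[OF c'(2)]]
  show ?thesis
  proof (cases "t c' v = X c' v")
    case True
    obtain r where r: "set r \<subseteq> {..<d}" "length r < R" "walk X v r = nr v" using nr(2)[OF c'(1)] by blast
    obtain r' where r': "set r' \<subseteq> {..<d}" "length r' < R" "walk X v' r' = nr v'" using nr(2)[OF c'(2)] by blast
    have "walk X (nr v) (rev r @ c' # r') = nr v'"
      using r r' c' walk_rev[OF msX r(1), of v] True by (simp add: walk_append)
    moreover have "set (rev r @ c' # r') \<subseteq> {..<d}" "length (rev r @ c' # r') \<le> 2 * R" using r r' c' by auto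
    ultimately obtain r2 where r2: "set r2 \<subseteq> {..<d}" "length r2 \<le> length (rev r @ c' # r') + 2" "walk X (x (md (nr v))) r2 = x (md (nr v'))"
      using near_T[OF i(1) j(1) ij i(2) j(2)] by blast
    have "length r2 \<le> 2 * R + 3" using r2(2) r r' by simp
    then show ?thesis using r2 by blast
  next
    case False
    then obtain k where k: "k < n" "v \<in> T k" "v' \<in> T k" using dif'[of c' v] c' by blast
    then have vS: "nr v = v" "nr v' = v'" by (auto simp: nr_def S_def)
    have hop: "\<exists>r. set r \<subseteq> {..<d} & length r \<le> 2 & walk X (x i) r = x j"
      if "i < n" "j < n" "a \<in> T i" "a \<in> T j" for i j a
    proof (cases "i = j")
      case True
      then show ?thesis by (intro exI[of _ "[]"]) auto
    next
      case False
      then show ?thesis using near_T[OF that(1,2) False that(3,4), of "[]"] by auto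
    qed
    obtain r1 where r1: "set r1 \<subseteq> {..<d}" "length r1 \<le> 2" "walk X (x (md (nr v))) r1 = x k"
      using hop[OF i(1) k(1) i(2)] k vS by auto
    obtain r2 where r2: "set r2 \<subseteq> {..<d}" "length r2 \<le> 2" "walk X (x k) r2 = x (md (nr v'))"
      using hop[OF k(1) j(1) _ j(2)] k vS by auto
    show ?thesis using r1 r2 R by (intro exI[of _ "r1 @ r2"]) (auto simp: walk_append)
  qed
qed

text \<open>Four such indices would bring four private cycles within reach of \<open>x i\<close>,
  against \<open>sparse\<close>.\<close>

lemma cluster_size:
  assumes i: "i < n" and J: "J \<subseteq> {..<n}" and near: "\<And>j. j \<in> J ==> \<exists>r. set r \<subseteq> {..<d} & length r \<le> 3 * (2 * R + 3) & walk X (x i) r = x j"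
  shows "card J \<le> 3"
proof (rule ccontr)
  assume "\<not> ?thesis"
  then have "4 \<le> card J" by simp
  then obtain J4 where J4: "J4 \<subseteq> J" "card J4 = 4" by (rule obtain_subset_with_card_n)
  have "finite J4" using finite_subset[OF J4(1) finite_subset[OF J]] by simp
  then obtain f :: "nat => nat" where f: "bij_betw f {0..<4} J4" using ex_bij_betw_nat_finite[OF \<open>finite J4\<close>] unfolding J4(2) by blast
  have fJ: "f k \<in> J" if "k < 4" for k using bij_betwE[OF f] J4(1) that by auto
  then have fn: "f k < n" if "k < 4" for k using J that by blast
  have finj: "f k ~= f l" if "k < 4" "l < 4" "k ~= l" for k l using f that by (auto simp: bij_betw_def inj_on_def)
  have "\<forall>k<4. \<exists>r. set r \<subseteq> {..<d} & length r \<le> 3 * (2 * R + 3) & walk X (x i) r = x (f k)" using near fJ by blast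
  then obtain r where r: "\<And>k. k < 4 ==> set (r k) \<subseteq> {..<d} & length (r k) \<le> 3 * (2 * R + 3) & walk X (x i) (r k) = x (f k)"
    by metis
  have "crowded d N X (3 * (2 * R + 3)) g"
  proof (rule four_private_cycles_crowded[OF msX, where u = r and c = "\<lambda>k. c (f k)" and x = "\<lambda>k. x (f k)" and w = "\<lambda>k. w (f k)"])
    show "x i < N" using cx[OF i] by simp
    show "set (c (f k) # w (f k)) \<subseteq> {..<d} & distinct_adj (c (f k) # w (f k)) & length (c (f k) # w (f k)) \<le> g
        & walk X (x (f k)) (c (f k) # w (f k)) = x (f k)" if "k < 4" for k
      using cx[OF fn[OF that]] by (simp add: short_cycles_def cyc_reduced_def)
    show "set (r k) \<subseteq> {..<d} & length (r k) \<le> 3 * (2 * R + 3) & walk X (x i) (r k) = x (f k)" if "k < 4" for k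
      by (rule r[OF that])
    show "traced X (X (c (f k)) (x (f k))) (w (f k)) \<inter> edge X (c (f l)) (x (f l)) = {}"
      if "k < 4" "l < 4" for k l by (rule priv[OF fn[OF that(1)] fn[OF that(2)]])
    show "edge X (c (f k)) (x (f k)) \<inter> edge X (c (f l)) (x (f l)) = {}"
      if "k < 4" "l < 4" "k ~= l" for k l by (rule disj[OF fn[OF that(1)] fn[OF that(2)] finj[OF that]])
  qed
  then show False using sparse by simp
qed

text \<open>At most 3 indices occur, since a fourth would show up within three hops; so there are at
  most 12 representatives and 144 ordered pairs of them. A shortest connection takes at most 144
  steps of length \<open>2 * R\<close>, and the two walks from the ends to their representatives add
  \<open>2 * R\<close>.\<close>

lemma component_radius:
  assumes r: "r \<in> W" and rv: "(r, v) \<in> EW\<^sup>*"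
  shows "\<exists>q. set q \<subseteq> {..<d} & length q \<le> 290 * R & walk t r q = v"
proof -
  define K where "K = {y. (r, y) \<in> EW\<^sup>*}"
  have KW: "y \<in> W" if "y \<in> K" for y
  proof -
    have "(r, y) \<in> EW\<^sup>*" using that by (simp add: K_def)
    then show ?thesis by (induction rule: rtrancl_induct) (use r in \<open>auto simp: EW_def\<close>)
  qed
  define Q where "Q = {(nr y, nr y') | y y'. y \<in> K & (y, y') \<in> EW}"
  define M where "M = {(md a, md b) | a b. (a, b) \<in> Q}"
  define P where "P = nr ` K"
  have Kstep: "y' \<in> K" if "y \<in> K" "(y, y') \<in> EW" for y y' using that by (auto simp: K_def)
  have rQ: "(nr r, nr y) \<in> Q\<^sup>* & (md (nr r), md (nr y)) \<in> M\<^sup>*" if "y \<in> K" for y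
  proof -
    have "(r, y) \<in> EW\<^sup>*" using that by (simp add: K_def)
    then show ?thesis
    proof (induction rule: rtrancl_induct)
      case (step y z)
      then have "(nr y, nr z) \<in> Q" by (auto simp: Q_def K_def)
      moreover then have "(md (nr y), md (nr z)) \<in> M" by (auto simp: M_def)
      ultimately show ?case using step.IH by (auto intro: rtrancl_into_rtrancl)
    qed simp
  qed
  have Mstep: "\<exists>q. set q \<subseteq> {..<d} & length q \<le> 2 * R + 3 & walk X (x a) q = x b" if "(a, b) \<in> M" for a b
    using that step_X by (auto simp: M_def Q_def)
  define i where "i = md (nr r)"
  have i: "i < n" using md(1)[OF nr(1)[OF r]] by (simp add: i_def)
  define J where "J = {j. \<exists>k\<le>3. (i, j) \<in> M ^^ k}"
  have Mn: "b < n" if "(a, b) \<in> M" for a b using that Kstep KW nr(1) md(1) by (auto simp: M_def Q_def)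
  have Jn: "J \<subseteq> {..<n}"
  proof
    fix j assume "j \<in> J"
    then obtain k where "(i, j) \<in> M ^^ k" by (auto simp: J_def)
    then show "j \<in> {..<n}" using i Mn by (cases k) auto
  qed
  have cJ: "card J \<le> 3"
  proof (rule cluster_size[OF i Jn])
    fix j assume "j \<in> J"
    then obtain k where k: "k \<le> 3" "(i, j) \<in> M ^^ k" by (auto simp: J_def)
    from relpow_walk[where f = x and s = X, OF Mstep k(2)] obtain q where
      "set q \<subseteq> {..<d}" "length q \<le> k * (2 * R + 3)" "walk X (x i) q = x j" by blast
    moreover have "k * (2 * R + 3) \<le> 3 * (2 * R + 3)" using k(1) by (rule mult_le_mono1)
    ultimately show "\<exists>r. set r \<subseteq> {..<d} & length r \<le> 3 * (2 * R + 3) & walk X (x i) r = x j" by (meson le_trans)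
  qed
  have finJ: "finite J" using Jn finite_subset by blast
  have mdJ: "md (nr y) \<in> J" if "y \<in> K" for y
    using rtrancl_stabilises[of 3 i M "md (nr y)"] finJ cJ rQ[OF that] by (simp add: J_def i_def)
  have "P \<subseteq> (\<Union>j\<in>J. T j)" using mdJ md(2)[OF nr(1)[OF KW]] by (auto simp: P_def)
  then have "card P \<le> card (\<Union>j\<in>J. T j)" using finJ by (intro card_mono) (auto simp: switch_points_def)
  also have "... \<le> (\<Sum>j\<in>J. card (T j))" by (rule card_UN_le[OF finJ])
  also have "... \<le> (\<Sum>j\<in>J. 4)" unfolding switch_points_def by (intro sum_mono) (auto simp: card_insert_if)
  also have "... \<le> 12" using cJ by simp
  finally have cP: "card P \<le> 12" .
  have finP: "finite P" by (rule finite_subset[OF \<open>P \<subseteq> (\<Union>j\<in>J. T j)\<close>]) (use finJ in \<open>auto simp: switch_points_def\<close>)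
  have QP: "Q \<subseteq> P \<times> P" using Kstep by (auto simp: Q_def P_def)
  have finQ: "finite Q" by (rule finite_subset[OF QP]) (simp add: finP)
  have "card Q \<le> card P * card P" using card_mono[OF _ QP] finP by (simp add: card_cartesian_product)
  also have "... \<le> 12 * 12" by (rule mult_mono[OF cP cP]) auto
  finally have cQ: "card Q \<le> 144" by simp
  have vK: "v \<in> K" and rK: "r \<in> K" using rv by (auto simp: K_def)
  have "(nr r, nr v) \<in> Q\<^sup>*" using rQ[OF vK] by simp
  then obtain k where k: "k \<le> card Q" "(nr r, nr v) \<in> Q ^^ k" unfolding rtrancl_finite_eq_relpow[OF finQ] by auto
  have Qstep: "\<exists>q. set q \<subseteq> {..<d} & length q \<le> 2 * R & walk t (id a) q = id b" if "(a, b) \<in> Q" for a b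
    using that step_t by (auto simp: Q_def)
  from relpow_walk[where f = id and s = t, OF Qstep k(2)] obtain q where
    q: "set q \<subseteq> {..<d}" "length q \<le> k * (2 * R)" "walk t (nr r) q = nr v" by auto
  have "k * (2 * R) \<le> 144 * (2 * R)" using k(1) cQ by (intro mult_le_mono1) simp
  from order.trans[OF q(2) this] have lq: "length q \<le> 288 * R" by simp
  obtain q1 where q1: "set q1 \<subseteq> {..<d}" "length q1 < R" "walk t r q1 = nr r" using nr(2)[OF r] by blast
  obtain q2 where q2: "set q2 \<subseteq> {..<d}" "length q2 < R" "walk t v q2 = nr v" using nr(2)[OF KW[OF vK]] by blast
  have "walk t r (q1 @ q @ rev q2) = v" using q1 q q2 walk_rev[OF mst q2(1), of v] by (simp add: walk_append)
  then show ?thesis using q1 q q2 lq by (intro exI[of _ "q1 @ q @ rev q2"]) auto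
qed

text \<open>Each component of the \<open>t\<close>-edges inside \<open>W\<close> gets a root, and
  \<open>h\<close> decays with the distance from it. Neighbours inside \<open>W\<close> share the
  root; those outside carry the value 0, which only lowers the sum to be bounded.\<close>

theorem cluster_spectral_bound:
  assumes L: "spectral_bound d N X L" "0 \<le> L" and N: "0 < N"
  shows "spectral_bound d N t (max (2 * sqrt p) L + real d * (pi / (2 * R))^2 / 2 + real d * real (4 * n * (4 * p ^ R)) / real N)"
proof -
  define root where "root v = (LEAST y. (v, y) \<in> EW\<^sup>*)" for v
  have symE: "sym (EW\<^sup>*)" by (rule sym_rtrancl, rule symI, rule EW_sym)
  have rt: "(v, root v) \<in> EW\<^sup>*" for v unfolding root_def by (rule LeastI[of _ v]) simp
  have root_eq: "root v = root v'" if "(v, v') \<in> EW" for v v'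
  proof -
    have "(v, y) \<in> EW\<^sup>* \<longleftrightarrow> (v', y) \<in> EW\<^sup>*" for y
      using converse_rtrancl_into_rtrancl[OF that, of y] converse_rtrancl_into_rtrancl[OF EW_sym[OF that], of y] by blast
    then show ?thesis by (simp add: root_def)
  qed
  have "y \<in> W" if "(v, y) \<in> EW\<^sup>*" "v \<in> W" for v y
    using that by (induction rule: rtrancl_induct) (auto simp: EW_def)
  then have rW: "root v \<in> W" if "v \<in> W" for v using that rt[of v] by blast
  define q where "q = 1 / sqrt (real p)"
  have q0: "0 < q" using p by (simp add: q_def)
  define h where "h v = (if v \<in> W then q ^ wdist d t (root v) v else 0)" for v
  have finS: "finite S" by (auto simp: S_def switch_points_def)
  have cS: "card S \<le> 4 * n"
  proof -
    have "card S \<le> (\<Sum>j<n. card (T j))" unfolding S_def by (rule card_UN_le) simp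
    also have "... \<le> (\<Sum>j<n. 4)" unfolding switch_points_def by (intro sum_mono) (auto simp: card_insert_if)
    finally show ?thesis by simp
  qed
  show ?thesis
  proof (rule local_patch[OF msX mst L N R, where S = S and h = h])
    show "v \<in> S & t c v \<in> S" if "t c v ~= X c v" for c v using dif'[OF that] by (auto simp: S_def)
    show "0 \<le> h v" for v using q0 by (simp add: h_def)
    show "card {v. v < N & sdist d X S R v < R} \<le> 4 * n * (4 * p ^ R)"
      by (rule order.trans[OF card_sdist_less[OF msX p finS] mult_le_mono1[OF cS]])
    fix v assume v: "v < N" "sdist d X S R v < R"
    then have vW: "v \<in> W" by (simp add: W_def)
    obtain r where r: "set r \<subseteq> {..<d}" "length r \<le> 290 * R" "walk t (root v) r = v"
      using component_radius[OF rW[OF vW] symD[OF symE rt[of v]]] by blast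
    have "(\<Sum>c<d. h (t c v)) \<le> (\<Sum>c<d. q ^ wdist d t (root v) (t c v))"
    proof (intro sum_mono)
      fix c assume c: "c \<in> {..<d}"
      show "h (t c v) \<le> q ^ wdist d t (root v) (t c v)"
      proof (cases "t c v \<in> W")
        case True
        then have "(v, t c v) \<in> EW" using vW c by (auto simp: EW_def)
        then show ?thesis using True root_eq by (simp add: h_def)
      next
        case False
        then show ?thesis using q0 by (simp add: h_def)
      qed
    qed
    also have "... \<le> 2 * sqrt p * q ^ wdist d t (root v) v"
      unfolding q_def
    proof (rule tree_supersolution[OF mst p _ _ r])
      show "girth_gt d N t (2 * (290 * R) + 2)" using girth by simp
      show "root v < N" using rW[OF vW] by (simp add: W_def)
    qed
    finally show "0 < h v & (\<Sum>c<d. h (t c v)) \<le> 2 * sqrt p * h v" using vW q0 by (simp add: h_def)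
  qed
qed

end

section \<open>Vertex sets with small neighbourhood\<close>

text \<open>Among systems of girth above \<open>g\<close> take one with the fewest cycles of length
  \<open>g + 1\<close>. If one remained, a far partner edge would exist because \<open>m\<close>
  exceeds the size of a ball, and switching would destroy the cycle and create none of length at
  most \<open>g + 1\<close>.\<close>

theorem exists_girth_gt:
  assumes p: "2 \<le> p" and m: "even m"
  shows "4 * p ^ (g + 2) < m ==> \<exists>H. matchings (Suc p) m H & girth_gt (Suc p) m H g"
proof (induction g)
  case 0
  obtain H where "H \<in> systems (Suc p) m" using card_systems_pos[OF m, of "Suc p"] by (metis card.empty ex_in_conv less_numeral_extra(3))
  then show ?case using systems_ms by (intro exI[of _ H]) (auto simp: girth_gt_def)
next
  case (Suc g)
  let ?d = "Suc p"
  have "4 * p ^ (g + 2) \<le> 4 * p ^ (Suc g + 2)" using p by (intro mult_left_mono power_increasing) auto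
  then have "4 * p ^ (g + 2) < m" using Suc.prems by linarith
  from Suc.IH[OF this] obtain H0 where "matchings ?d m H0 & girth_gt ?d m H0 g" by blast
  then obtain H where H: "matchings ?d m H" "girth_gt ?d m H g"
    and least: "\<And>H'. matchings ?d m H' ==> girth_gt ?d m H' g ==> card (short_cycles ?d m H (Suc g)) \<le> card (short_cycles ?d m H' (Suc g))"
    using ex_has_least_nat[of "\<lambda>H. matchings ?d m H & girth_gt ?d m H g" H0 "\<lambda>H. card (short_cycles ?d m H (Suc g))"] by auto
  have "short_cycles ?d m H (Suc g) = {}"
  proof (rule ccontr)
    assume "short_cycles ?d m H (Suc g) ~= {}"
    then obtain v w where vw: "(v, w) \<in> short_cycles ?d m H (Suc g)" by auto
    then have "w ~= []" by (simp add: short_cycles_def cyc_reduced_def)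
    then obtain c w' where w: "w = c # w'" by (cases w) auto
    have c: "c < ?d" "v < m" using vw w by (auto simp: short_cycles_def)
    have "card {u. \<not> far ?d H (Suc g + 2) v u} < card {..<m}"
      using card_not_far(2)[OF H(1) p, of "Suc g + 2" v] Suc.prems by (simp only: card_lessThan)
    then have "\<not> {..<m} \<subseteq> {u. \<not> far ?d H (Suc g + 2) v u}"
      using card_mono[OF card_not_far(1)[OF H(1) p, of "Suc g + 2" v], of "{..<m}"] by linarith
    then obtain u where u: "u < m" "far ?d H (Suc g + 2) v u" by blast
    interpret switching ?d m H c v u "Suc g"
    proof
      show "far ?d H (Suc g) a b" if "a \<in> {v, H c v}" "b \<in> {u, H c u}" for a b
        by (rule far_edges[OF H(1) u(2) c(1) c(1) that])
      fix b r assume "b \<in> {u, H c u}" "set r \<subseteq> {..<?d}" "distinct_adj r" "r ~= []" "length r < Suc g"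
      then show "walk H b r ~= b" using u(1) ms_less[OF H(1) c(1)] by (intro girth_gtD[OF H(2)]) auto
    qed (use H c u in auto)
    have "(v, w) \<notin> short_cycles ?d m (switch H c v u) (Suc g)"
      using cycle_avoids[of v w "[]" c w'] w by auto
    then have "short_cycles ?d m (switch H c v u) (Suc g) \<subset> short_cycles ?d m H (Suc g)" using vw cycles_subset by blast
    then have less: "card (short_cycles ?d m (switch H c v u) (Suc g)) < card (short_cycles ?d m H (Suc g))"
      by (intro psubset_card_mono finite_short_cycles)
    have "short_cycles ?d m (switch H c v u) g = {}"
    proof (rule ccontr)
      assume "\<not> ?thesis"
      then obtain v' r where r: "(v', r) \<in> short_cycles ?d m (switch H c v u) g" by auto
      then have "(v', r) \<in> short_cycles ?d m (switch H c v u) (Suc g)" by (auto simp: short_cycles_def)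
      then have "(v', r) \<in> short_cycles ?d m H (Suc g)" using cycles_subset by blast
      then have "(v', r) \<in> short_cycles ?d m H g" using r by (auto simp: short_cycles_def)
      then show False using girth_gt_iff[OF H(1)] H(2) by blast
    qed
    then show False using less least[OF ms_t] girth_gt_iff[OF ms_t] by auto
  qed
  then show ?case using H(1) girth_gt_iff[OF H(1)] by blast
qed

lemma exists_far_points:
  assumes ms: "matchings (Suc p) N s" and p: "2 \<le> p"
  shows "K * (4 * p ^ r) < N ==> \<exists>U. (\<forall>i<K. U i < N) & (\<forall>i<K. \<forall>j<K. i ~= j --> far (Suc p) s r (U i) (U j))"
proof (induction K)
  case (Suc K)
  then obtain U where U: "\<And>i. i < K ==> U i < N" "\<And>i j. i < K ==> j < K ==> i ~= j ==> far (Suc p) s r (U i) (U j)" by auto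
  let ?B = "\<Union>i<K. {u. \<not> far (Suc p) s r (U i) u}"
  have "card ?B \<le> (\<Sum>i<K. card {u. \<not> far (Suc p) s r (U i) u})" by (rule card_UN_le) simp
  also have "... \<le> (\<Sum>i<K. 4 * p ^ r)" by (intro sum_mono card_not_far(2)[OF ms p])
  also have "... < card {..<N}" using Suc.prems by simp
  finally have lt: "card ?B < card {..<N}" .
  have "finite ?B" using card_not_far(1)[OF ms p] by blast
  then have "\<not> {..<N} \<subseteq> ?B" using lt card_mono[of ?B "{..<N}"] by linarith
  then obtain y where y: "y < N" "\<And>i. i < K ==> far (Suc p) s r (U i) y" by blast
  show ?case
  proof (intro exI[of _ "U(K := y)"] conjI allI impI)
    show "(U(K := y)) i < N" if "i < Suc K" for i using that U(1) y(1) by (auto simp: less_Suc_eq)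
    show "far (Suc p) s r ((U(K := y)) i) ((U(K := y)) j)" if "i < Suc K" "j < Suc K" "i ~= j" for i j
      using that U(2)[of i j] y(2)[of i] far_sym[OF ms y(2)[of j]] by (auto simp: less_Suc_eq)
  qed
qed simp

text \<open>The centres are \<open>U a\<close> and \<open>U (m + a)\<close> for \<open>a < m\<close>. The graph \<open>H\<close> prescribes which of them get a common neighbour:
  the neighbour of \<open>U a\<close> along colour \<open>i\<close> is rewired, in colour \<open>i + 1\<close>, to \<open>U (m + H i a)\<close>.\<close>

locale gadget =
  fixes p N m l :: nat and s H :: "nat => nat => nat" and U :: "nat => nat"
  assumes mss: "matchings (Suc p) N s" and msH: "matchings (Suc p) m H" and p: "2 \<le> p"
    and girth: "girth_gt (Suc p) N s (2 * l + 4)"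
    and UN: "\<And>k. k < 2 * m ==> U k < N"
    and farU: "\<And>k k'. k < 2 * m ==> k' < 2 * m ==> k ~= k' ==> far (Suc p) s (2 * l + 4) (U k) (U k')"
begin

abbreviation "d \<equiv> Suc p"

text \<open>Cyclic shift of the colours. The vertex \<open>V a i\<close> already spends colour
  \<open>i\<close> on its edge to \<open>U a\<close>, so its edge to a second centre takes the
  different colour \<open>nxt i\<close>.\<close>

definition "nxt i = (if p \<le> i then 0 else Suc i)"
definition "prv j = (if j = 0 then p else j - 1)"

lemma nxt_prv: "j < d ==> nxt (prv j) = j" "i < d ==> prv (nxt i) = i" "nxt i < d" "j < d ==> prv j < d"
  and prv_neq: "j < d ==> prv j ~= j" "i < d ==> nxt i ~= i"
  using p by (auto simp: nxt_def prv_def split: if_splits)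

text \<open>Tree coordinates around the centres. By the girth and the mutual distance of the centres
  they are unique as long as two lengths add up to at most \<open>2 * l + 4\<close>
  (\<open>addr_unique\<close>).\<close>

definition "addr k q y \<longleftrightarrow> k < 2 * m & set q \<subseteq> {..<d} & distinct_adj q & walk s (U k) q = y"

lemma addr_unique:
  assumes "addr k q y" "addr k' q' y" "length q + length q' \<le> 2 * l + 4"
  shows "k = k'" "q = q'"
proof -
  show k: "k = k'"
  proof (rule ccontr)
    assume "k ~= k'"
    then have "far d s (2 * l + 4) (U k) (U k')" using farU assms by (simp add: addr_def)
    moreover have "walk s (U k) (q @ rev q') = U k'"
      using assms walk_rev[OF mss, of q' "U k'"] by (simp add: addr_def walk_append)
    ultimately show False using farD[of d s "2 * l + 4" "U k" "U k'" "q @ rev q'"] assms by (simp add: addr_def)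
  qed
  show "q = q'" using assms UN[of k'] k by (intro reduced_walk_unique[OF mss girth]) (auto simp: addr_def)
qed

definition "V a i = s i (U a)"
definition "B b j = s j (U (m + b))"

lemma addr_U: "k < 2 * m ==> addr k [] (U k)"
  by (auto simp: addr_def)

lemma addr_V: "a < m ==> i < d ==> addr a [i] (V a i)"
  and addr_B: "b < m ==> j < d ==> addr (m + b) [j] (B b j)"
  and addr_W: "a < m ==> j < d ==> addr a [prv j, j] (s j (V a (prv j)))"
  and addr_u1: "b < m ==> addr (m + b) [] (U (m + b))"
  using nxt_prv prv_neq by (auto simp: addr_def V_def B_def)

lemma addr_snoc: "addr k q y ==> c < d ==> q = [] \<or> last q ~= c ==> addr k (q @ [c]) (s c y)"
  by (auto simp: addr_def walk_append distinct_adj_append_iff)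

text \<open>Involution swapping each \<open>V a (prv j)\<close> with the \<open>j\<close>-neighbour
  of the second centre that \<open>H\<close> assigns to it.\<close>

definition "mate j y = (if \<exists>b<m. y = B b j then V (H (prv j) (THE b. b < m & y = B b j)) (prv j)
   else if \<exists>a<m. y = V a (prv j) then B (H (prv j) (THE a. a < m & y = V a (prv j))) j else y)"

lemma addr_eq: "addr k q y ==> addr k' q' y' ==> y = y' ==> length q + length q' \<le> 2 * l + 4 ==> k = k' & q = q'"
  using addr_unique by blast

lemma B_inj: "b < m ==> b' < m ==> j < d ==> B b j = B b' j \<longleftrightarrow> b = b'"
  using addr_eq[OF addr_B[of b j] addr_B[of b' j]] by auto

lemma V_inj: "a < m ==> a' < m ==> i < d ==> i' < d ==> V a i = V a' i' \<longleftrightarrow> a = a' & i = i'"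
  using addr_eq[OF addr_V[of a i] addr_V[of a' i']] by auto

lemma V_neq_B: "a < m ==> b < m ==> i < d ==> j < d ==> V a i ~= B b j"
  using addr_eq[OF addr_V[of a i] addr_B[of b j]] by auto

lemma mate_B: "b < m ==> j < d ==> mate j (B b j) = V (H (prv j) b) (prv j)"
proof -
  assume b: "b < m" "j < d"
  then have "(THE b'. b' < m & B b j = B b' j) = b" using B_inj by (intro the_equality) auto
  then show ?thesis using b by (auto simp: mate_def)
qed

lemma mate_V: "a < m ==> j < d ==> mate j (V a (prv j)) = B (H (prv j) a) j"
proof -
  assume a: "a < m" "j < d"
  have pj: "prv j < d" using nxt_prv(4) a by blast
  have "(THE a'. a' < m & V a (prv j) = V a' (prv j)) = a" using V_inj[OF _ _ pj pj] a by (intro the_equality) auto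
  moreover have "(\<exists>b<m. V a (prv j) = B b j) = False" using V_neq_B[OF a(1) _ pj a(2)] by blast
  moreover have "(\<exists>a'<m. V a (prv j) = V a' (prv j)) = True" using a by blast
  ultimately show ?thesis unfolding mate_def by (simp only: if_False if_True)
qed

lemma mate_other: "(\<And>b. b < m ==> y ~= B b j) ==> (\<And>a. a < m ==> y ~= V a (prv j)) ==> mate j y = y"
  by (auto simp: mate_def)

lemma H_less: "i < d ==> H i a < m \<longleftrightarrow> a < m"
  by (rule ms_less[OF msH])

lemma mate_mate: "j < d ==> mate j (mate j y) = y"
proof -
  assume j: "j < d"
  have pj: "prv j < d" using nxt_prv j by blast
  consider b where "b < m" "y = B b j" | a where "a < m" "y = V a (prv j)" | "\<And>b. b < m ==> y ~= B b j" "\<And>a. a < m ==> y ~= V a (prv j)"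
    by blast
  then show ?thesis
    by cases (use j pj mate_B mate_V mate_other H_less ms_invol[OF msH pj] in auto)
qed

lemma mate_less: "j < d ==> mate j y < N \<longleftrightarrow> y < N"
proof -
  assume j: "j < d"
  have pj: "prv j < d" using nxt_prv j by blast
  have VN: "V a i < N" if "a < m" "i < d" for a i using UN[of a] ms_less[OF mss that(2)] that by (simp add: V_def)
  have BN: "B b i < N" if "b < m" "i < d" for b i using UN[of "m + b"] ms_less[OF mss that(2)] that by (simp add: B_def)
  consider b where "b < m" "y = B b j" | a where "a < m" "y = V a (prv j)" | "\<And>b. b < m ==> y ~= B b j" "\<And>a. a < m ==> y ~= V a (prv j)"
    by blast
  then show ?thesis
    by cases (use j pj mate_B mate_V mate_other H_less VN BN in auto)
qed

text \<open>Conjugation by an involution keeps a perfect matching for free. It exchanges the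
  \<open>j\<close>-edges at swapped vertices: the second centre gets \<open>V\<close> as neighbour,
  and the two vertices thereby detached, \<open>B\<close> and the former \<open>j\<close>-partner of
  \<open>V\<close>, are joined to each other.\<close>

definition "t j y = mate j (s j (mate j y))"

lemma ms_t: "matchings d N t"
  unfolding matchings_def pmatch_def
proof (intro allI impI CollectI conjI)
  fix j y assume j: "j < d"
  show "t j (t j y) = y" using mate_mate[OF j] ms_invol[OF mss j] by (simp add: t_def)
  have "t j y ~= y \<longleftrightarrow> s j (mate j y) ~= mate j y" using mate_mate[OF j] unfolding t_def by metis
  also have "... \<longleftrightarrow> mate j y < N" using mss j by (simp add: matchings_def pmatch_def)
  finally show "t j y ~= y \<longleftrightarrow> y \<in> {..<N}" using mate_less[OF j] by simp
qed

lemma t_changed: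
  assumes j: "j < d" and ne: "t j y ~= s j y"
  shows "(\<exists>b<m. y = U (m + b)) \<or> (\<exists>a<m. y = V a (prv j)) \<or> (\<exists>b<m. y = B b j) \<or> (\<exists>a<m. y = s j (V a (prv j)))"
proof (rule ccontr)
  assume n: "\<not> ?thesis"
  then have "mate j y = y" by (intro mate_other) auto
  moreover have "mate j (s j y) = s j y"
  proof (rule mate_other)
    show "s j y ~= B b j" if "b < m" for b using n that ms_inj[OF mss j, of y "U (m + b)"] by (auto simp: B_def)
    show "s j y ~= V a (prv j)" if "a < m" for a using n that ms_invol[OF mss j, of y] by metis
  qed
  ultimately show False using ne by (simp add: t_def)
qed

lemma t_addr:
  assumes a: "addr k q y" "length q \<le> 2 * l + 2" and j: "j < d"
    and q: "\<not> (k < m & (q = [prv j] \<or> q = [prv j, j]))" "\<not> (m \<le> k & (q = [] \<or> q = [j]))"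
  shows "t j y = s j y"
proof (rule ccontr)
  assume "t j y ~= s j y"
  have pj: "prv j < d" using nxt_prv j by blast
  from t_changed[OF j \<open>t j y ~= s j y\<close>] consider b where "b < m" "y = U (m + b)" | a where "a < m" "y = V a (prv j)"
    | b where "b < m" "y = B b j" | a where "a < m" "y = s j (V a (prv j))" by blast
  then show False
  proof cases
    case 1
    then show ?thesis using addr_unique[OF a(1), of "m + b" "[]"] addr_u1[of b] a(2) q by auto
  next
    case 2
    then show ?thesis using addr_unique[OF a(1), of _ "[prv j]"] addr_V[OF 2(1) pj] a(2) q by auto
  next
    case 3
    then show ?thesis using addr_unique[OF a(1), of _ "[j]"] addr_B[OF 3(1) j] a(2) q by auto
  next
    case 4
    then show ?thesis using addr_unique[OF a(1), of _ "[prv j, j]"] addr_W[OF 4(1) j] a(2) q by auto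
  qed
qed

lemma mate_fix:
  assumes a: "addr k q y" "length q \<le> 2 * l + 2" and j: "j < d"
    and q: "\<not> (k < m & q = [prv j])" "\<not> (m \<le> k & q = [j])"
  shows "mate j y = y"
proof (rule mate_other)
  have pj: "prv j < d" using nxt_prv j by blast
  show "y ~= B b j" if "b < m" for b using addr_unique[OF a(1), of _ "[j]"] addr_B[OF that j] a(2) q by auto
  show "y ~= V c (prv j)" if "c < m" for c using addr_eq[OF a(1) addr_V[OF that pj]] a(2) q that by auto
qed

lemma t_u1: "b < m ==> j < d ==> t j (U (m + b)) = V (H (prv j) b) (prv j)"
  and t_V: "b < m ==> j < d ==> t j (V b (prv j)) = U (m + H (prv j) b)"
  and t_B: "b < m ==> j < d ==> t j (B b j) = s j (V (H (prv j) b) (prv j))"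
  and t_W: "b < m ==> j < d ==> t j (s j (V b (prv j))) = B (H (prv j) b) j"
proof -
  assume b: "b < m" and j: "j < d"
  have pj: "prv j < d" using nxt_prv j by blast
  have fu: "mate j (U (m + b)) = U (m + b)" if "b < m" for b using mate_fix[OF addr_u1[OF that] _ j] by simp
  have fW: "mate j (s j (V a (prv j))) = s j (V a (prv j))" if "a < m" for a using mate_fix[OF addr_W[OF that j] _ j] by simp
  have Hb: "H (prv j) b < m" using H_less[OF pj] b by simp
  show "t j (U (m + b)) = V (H (prv j) b) (prv j)" using fu[OF b] mate_B[OF b j] by (simp add: t_def B_def)
  show "t j (V b (prv j)) = U (m + H (prv j) b)"
    using mate_V[OF b j] fu[OF Hb] ms_invol[OF mss j] by (simp add: t_def B_def)
  show "t j (B b j) = s j (V (H (prv j) b) (prv j))" using mate_B[OF b j] fW[OF Hb] by (simp add: t_def)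
  show "t j (s j (V b (prv j))) = B (H (prv j) b) j"
    using fW[OF b] mate_V[OF b j] ms_invol[OF mss j] by (simp add: t_def)
qed

text \<open>Addresses past the modified edges: at least two steps from the centre, and not the
  detached neighbour \<open>[i, nxt i]\<close> of \<open>V k i\<close>.\<close>

definition "free k q \<longleftrightarrow> 2 \<le> length q & (k < m --> \<not> (\<exists>i. q = [i, nxt i]))"

lemma t_free: "free k q ==> addr k q y ==> length q \<le> 2 * l + 2 ==> j < d ==> t j y = s j y"
  by (rule t_addr) (auto simp: free_def nxt_prv)

text \<open>A reduced walk that has left the neighbourhood of a centre along an unmodified branch stays on the tree of
  addresses and does not meet a modified edge again.\<close>

lemma escape:
  "free k q ==> addr k q y ==> set r \<subseteq> {..<d} ==> distinct_adj (q @ r) ==> length (q @ r) \<le> 2 * l + 3 ==>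
    addr k (q @ r) (walk t y r)"
proof (induction r arbitrary: q y)
  case (Cons c r)
  have ty: "t c y = s c y" using Cons.prems by (intro t_free[OF Cons.prems(1,2)]) auto
  have qne: "q ~= []" using Cons.prems(1) by (auto simp: free_def)
  have a: "addr k (q @ [c]) (t c y)"
    unfolding ty using Cons.prems qne by (intro addr_snoc) (auto simp: distinct_adj_append_iff)
  have f: "free k (q @ [c])" using Cons.prems(1) by (auto simp: free_def)
  show ?case using Cons.IH[OF f a] Cons.prems by simp
qed simp

text \<open>Short walks between centres follow \<open>H\<close>, each edge of \<open>H\<close> taking two steps.\<close>

lemma u1_path:
  "b < m ==> b' < m ==> set w \<subseteq> {..<d} ==> distinct_adj w ==> length w \<le> 2 * l ==> walk t (U (m + b)) w = U (m + b') ==>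
    \<exists>h. set h \<subseteq> {..<d} & distinct_adj h & walk H b h = b' & 2 * length h = length w & (w ~= [] --> h ~= [] & nxt (hd h) = hd w)"
proof (induction "length w" arbitrary: w b rule: less_induct)
  case less
  note b = less.prems(1) and b' = less.prems(2) and w = less.prems(3-6)
  have not_end: False if "k < m" "addr k q (U (m + b'))" "length q \<le> 2 * l + 3" for k q
    using addr_unique(1)[OF that(2) addr_u1[OF b']] that by simp
  show ?case
  proof (cases w)
    case Nil
    then have "addr (m + b) [] (U (m + b'))" using w addr_u1[OF b] by simp
    from addr_unique(1)[OF this addr_u1[OF b']] have "b = b'" by simp
    then show ?thesis using Nil by (intro exI[of _ "[]"]) auto
  next
    case (Cons j w1)
    define i where "i = prv j"
    have j: "j < d" using w Cons by simp
    have i: "i < d" "nxt i = j" "i ~= j" using nxt_prv prv_neq j by (auto simp: i_def)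
    define a where "a = H i b"
    have a: "a < m" using H_less[OF i(1)] b by (simp add: a_def)
    have tj: "t j (U (m + b)) = V a i" using t_u1[OF b j] by (simp add: a_def i_def)
    have e1: "walk t (V a i) w1 = U (m + b')" using w Cons tj by simp
    have "w1 ~= []" using not_end[OF a, of "[i]"] addr_V[OF a i(1)] e1 by auto
    then obtain c w2 where w1: "w1 = c # w2" by (cases w1) auto
    have c: "c < d" "c ~= j" using w Cons w1 by auto
    \<comment> \<open>Any other colour enters an unmodified branch, from which \<open>escape\<close>
      forbids reaching a second centre within the allowed length.\<close>
    have ci: "c = i"
    proof (rule ccontr)
      assume "c ~= i"
      have "prv c ~= i" using c i nxt_prv by metis
      then have tc: "t c (V a i) = s c (V a i)" using t_addr[OF addr_V[OF a i(1)] _ c(1)] a by auto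
      have "addr a [i, c] (s c (V a i))" using addr_snoc[OF addr_V[OF a i(1)] c(1)] \<open>c ~= i\<close> by simp
      moreover have "free a [i, c]" using c i by (auto simp: free_def)
      ultimately have "addr a ([i, c] @ w2) (walk t (s c (V a i)) w2)"
        using w Cons w1 \<open>c ~= i\<close> by (intro escape) (auto simp: distinct_adj_Cons)
      then show False using not_end[OF a, of "[i, c] @ w2"] e1 w1 tc w Cons by auto
    qed
    have "prv i ~= i" using prv_neq i by blast
    then have ti: "t i (V a i) = U a" using t_addr[OF addr_V[OF a i(1)] _ i(1)] a ms_invol[OF mss i(1)] by (auto simp: V_def)
    have e2: "walk t (U a) w2 = U (m + b')" using e1 w1 ci ti by simp
    have "w2 ~= []" using not_end[OF a, of "[]"] addr_U[of a] a e2 by auto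
    then obtain k w3 where w2: "w2 = k # w3" by (cases w2) auto
    have k: "k < d" "k ~= i" using w Cons w1 w2 ci by auto
    have tk: "t k (U a) = V a k" using t_addr[OF addr_U _ k(1), of a] a by (auto simp: V_def)
    have e3: "walk t (V a k) w3 = U (m + b')" using e2 w2 tk by simp
    have "w3 ~= []" using not_end[OF a, of "[k]"] addr_V[OF a k(1)] e3 by auto
    then obtain f w4 where w3: "w3 = f # w4" by (cases w3) auto
    have f: "f < d" "f ~= k" using w Cons w1 w2 w3 by auto
    have fk: "f = nxt k"
    proof (rule ccontr)
      assume nk: "f ~= nxt k"
      have "prv f ~= k" using f nk nxt_prv by metis
      then have tf: "t f (V a k) = s f (V a k)" using t_addr[OF addr_V[OF a k(1)] _ f(1)] a by auto
      have "addr a [k, f] (s f (V a k))" using addr_snoc[OF addr_V[OF a k(1)] f(1)] f(2) by simp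
      moreover have "free a [k, f]" using nk by (auto simp: free_def)
      ultimately have "addr a ([k, f] @ w4) (walk t (s f (V a k)) w4)"
        using w Cons w1 w2 w3 f by (intro escape) (auto simp: distinct_adj_Cons)
      then show False using not_end[OF a, of "[k, f] @ w4"] e3 w3 tf w Cons w1 w2 by auto
    qed
    have pk: "prv f = k" using fk nxt_prv k by simp
    have Hk: "H k a < m" using H_less[OF k(1)] a by simp
    have e4: "walk t (U (m + H k a)) w4 = U (m + b')" using t_V[OF a f(1)] pk e3 w3 by simp
    have r4: "set w4 \<subseteq> {..<d}" "distinct_adj w4" "length w4 \<le> 2 * l" "length w4 < length w"
      using w Cons w1 w2 w3 by (auto simp: distinct_adj_Cons)
    obtain h where h: "set h \<subseteq> {..<d}" "distinct_adj h" "walk H (H k a) h = b'" "2 * length h = length w4"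
      "w4 ~= [] --> h ~= [] & nxt (hd h) = hd w4"
      using less.hyps[OF r4(4) Hk b' r4(1,2,3) e4] by blast
    have "h = [] \<or> hd h ~= k"
    proof (cases "w4 = []")
      case False
      then have "hd w4 ~= f" using w Cons w1 w2 w3 by (auto simp: distinct_adj_Cons)
      then show ?thesis using h(5) False fk by auto
    qed (use h(4) in auto)
    then have "distinct_adj (i # k # h)" using h(2) k by (auto simp: distinct_adj_Cons)
    then show ?thesis
      using h i k Cons w1 w2 w3 by (intro exI[of _ "i # k # h"]) (auto simp: a_def)
  qed
qed

text \<open>A short cycle through a second centre projects to a closed reduced walk of half its
  length in \<open>H\<close> (\<open>no_u1\<close>). One that crosses an edge between two detached
  vertices is trapped in a free branch (\<open>no_float\<close>). Any other one is a cycle of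
  \<open>s\<close>.\<close>

theorem girth_t:
  assumes gH: "girth_gt d m H l"
  shows "girth_gt d N t (2 * l)"
proof -
  have "(v, w) \<notin> short_cycles d N t (2 * l)" for v w
  proof
    assume "(v, w) \<in> short_cycles d N t (2 * l)"
    then have w: "v < N" "set w \<subseteq> {..<d}" "length w \<le> 2 * l" "cyc_reduced w" "walk t v w = v" by (auto simp: short_cycles_def)
    have rot: "walk t (walk t v w1) (w2 @ w1) = walk t v w1 & cyc_reduced (w2 @ w1)" if "w = w1 @ w2" for w1 w2
      using w(4,5) that unfolding cyc_reduced_def
      by (cases "w1 = []"; cases "w2 = []") (auto simp: walk_append distinct_adj_append_iff)
    have no_u1: "walk t v w1 ~= U (m + b)" if w12: "w = w1 @ w2" and b: "b < m" for w1 w2 b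
    proof
      assume y: "walk t v w1 = U (m + b)"
      have r: "distinct_adj (w2 @ w1)" "w2 @ w1 ~= []" "walk t (U (m + b)) (w2 @ w1) = U (m + b)"
        using rot[OF w12] y by (auto simp: cyc_reduced_def)
      have "set (w2 @ w1) \<subseteq> {..<d}" "length (w2 @ w1) \<le> 2 * l" using w w12 by auto
      from u1_path[OF b b this(1) r(1) this(2) r(3)] obtain h where
        h: "set h \<subseteq> {..<d}" "distinct_adj h" "walk H b h = b" "2 * length h = length (w2 @ w1)" "h ~= []" using r(2) by blast
      then show False using girth_gtD[OF gH b h(1,2,5)] w w12 by simp
    qed
    have no_float: False if w12: "w = w1 @ j # w2" and y: "(\<exists>b<m. walk t v w1 = B b j) \<or> (\<exists>a<m. walk t v w1 = s j (V a (prv j)))" for w1 j w2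
    proof -
      define y0 r where "y0 = walk t v w1" and "r = w2 @ w1"
      have j: "j < d" using w w12 by simp
      have pj: "prv j < d" using nxt_prv j by blast
      have cl: "walk t (t j y0) r = y0" and cyc: "cyc_reduced (j # r)" using rot[OF w12] by (auto simp: y0_def r_def)
      have red: "distinct_adj (j # r)" and col: "set r \<subseteq> {..<d}" and len: "length r < 2 * l" using cyc w w12 by (auto simp: cyc_reduced_def r_def)
      \<comment> \<open>The ends of such an edge have addresses at different centres, and every
        continuation beyond it is free.\<close>
      have "\<exists>k q k' q'. addr k q (t j y0) & addr k' q' y0 & k ~= k' & q ~= [] & last q = j & length q \<le> 2 & length q' \<le> 2
         & (\<forall>c<d. c ~= j --> free k (q @ [c]) & t c (t j y0) = s c (t j y0))"
        using y
      proof (elim disjE exE conjE)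
        fix b assume b: "b < m" "walk t v w1 = B b j"
        have Hb: "H (prv j) b < m" using H_less[OF pj] b by simp
        have y0e: "y0 = B b j" using b by (simp add: y0_def)
        have ty: "t j y0 = s j (V (H (prv j) b) (prv j))" using t_B[OF b(1) j] y0e by simp
        have *: "free (H (prv j) b) ([prv j, j] @ [c]) & t c (t j y0) = s c (t j y0)" if "c < d" "c ~= j" for c
          unfolding ty using Hb that by (intro conjI t_addr[OF addr_W[OF Hb j]]) (auto simp: free_def)
        show ?thesis
          using addr_W[OF Hb j] addr_B[OF b(1) j] b Hb *
          by (intro exI[of _ "H (prv j) b"] exI[of _ "[prv j, j]"] exI[of _ "m + b"] exI[of _ "[j]"]) (auto simp: ty, simp add: y0e)
      next
        fix a assume a: "a < m" "walk t v w1 = s j (V a (prv j))"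
        have Ha: "H (prv j) a < m" using H_less[OF pj] a by simp
        have y0e: "y0 = s j (V a (prv j))" using a by (simp add: y0_def)
        have ty: "t j y0 = B (H (prv j) a) j" using t_W[OF a(1) j] y0e by simp
        have *: "free (m + H (prv j) a) ([j] @ [c]) & t c (t j y0) = s c (t j y0)" if "c < d" "c ~= j" for c
          unfolding ty using Ha that by (intro conjI t_addr[OF addr_B[OF Ha j]]) (auto simp: free_def)
        show ?thesis
          using addr_B[OF Ha j] addr_W[OF a(1) j] a Ha *
          by (intro exI[of _ "m + H (prv j) a"] exI[of _ "[j]"] exI[of _ "a"] exI[of _ "[prv j, j]"]) (auto simp: ty, simp add: y0e)
      qed
      then obtain k q k' q' where kq: "addr k q (t j y0)" "addr k' q' y0" "k ~= k'" "q ~= []" "last q = j" "length q \<le> 2" "length q' \<le> 2"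
         "\<And>c. c < d ==> c ~= j ==> free k (q @ [c]) & t c (t j y0) = s c (t j y0)" by blast
      show False
      proof (cases r)
        case Nil
        then show ?thesis using addr_unique(1)[OF kq(1), of k' q'] kq cl by simp
      next
        case (Cons c r')
        have c: "c < d" "c ~= j" using col red Cons by auto
        have a1: "addr k (q @ [c]) (t c (t j y0))" using addr_snoc[OF kq(1) c(1)] kq c by auto
        have "addr k ((q @ [c]) @ r') (walk t (t c (t j y0)) r')"
          using kq(8)[OF c] a1 col len Cons red kq(6) c a1 by (intro escape) (auto simp: addr_def distinct_adj_append_iff distinct_adj_Cons)
        moreover have "walk t (t c (t j y0)) r' = y0" using cl Cons by simp
        ultimately show ?thesis using addr_unique(1)[of k "(q @ [c]) @ r'" y0 k' q'] kq len Cons by simp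
      qed
    qed
    have same: "walk t v w1 = walk s v w1" if "w = w1 @ w2" for w1 w2 using that
    proof (induction w1 arbitrary: w2 rule: rev_induct)
      case (snoc c w1)
      then have IH: "walk t v w1 = walk s v w1" by simp
      have c: "c < d" using snoc.prems w by simp
      have "t c (walk t v w1) = s c (walk t v w1)"
      proof (rule ccontr)
        assume ne: "\<not> ?thesis"
        have w12: "w = w1 @ c # w2" using snoc.prems by simp
        from t_changed[OF c ne] show False
        proof (elim disjE exE conjE)
          fix b assume "b < m" "walk t v w1 = U (m + b)" then show False using no_u1[OF w12] by blast
        next
          fix a assume a: "a < m" "walk t v w1 = V a (prv c)"
          then have "walk t v (w1 @ [c]) = U (m + H (prv c) a)" using t_V[OF a(1) c] by (simp add: walk_append)
          then show False using no_u1[of "w1 @ [c]" w2 "H (prv c) a"] w12 H_less[of "prv c" a] nxt_prv(4)[OF c] a by simp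
        qed (use no_float[OF w12] in blast)+
      qed
      then show ?case using IH by (simp add: walk_append)
    qed simp
    have "walk s v w = v" using same[of w "[]"] w by simp
    then show False using girth_gtD[OF girth w(1,2)] w by (auto simp: cyc_reduced_def)
  qed
  then have "short_cycles d N t (2 * l) = {}" by auto
  then show ?thesis using girth_gt_iff[OF ms_t] by blast
qed

lemma U_inj: "inj_on U {..<2 * m}"
proof (intro inj_onI, rule ccontr)
  fix k k' assume "k \<in> {..<2 * m}" "k' \<in> {..<2 * m}" "U k = U k'" "k ~= k'"
  then show False using farU[of k k'] far_neq[of d s "2 * l + 4" "U k" "U k'"] by auto
qed

text \<open>This makes the neighbourhood small: \<open>2 * m\<close> centres share the
  \<open>m * d\<close> vertices \<open>V a i\<close>.\<close>

lemma t_U_neighbours: "k < 2 * m ==> c < d ==> t c (U k) \<in> (\<lambda>(a, i). V a i) ` ({..<m} \<times> {..<d})"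
proof (cases "k < m")
  case True
  assume "c < d"
  then have "t c (U k) = V k c" using t_addr[OF addr_U, of k c] True by (simp add: V_def)
  then show ?thesis using True \<open>c < d\<close> by auto
next
  case False
  assume k: "k < 2 * m" and c: "c < d"
  then have km: "k - m < m" "m + (k - m) = k" using False by auto
  have "t c (U k) = V (H (prv c) (k - m)) (prv c)" using t_u1[OF km(1) c] km(2) by simp
  then show ?thesis using H_less[of "prv c" "k - m"] nxt_prv(4)[OF c] km by force
qed

end

lemma sum_one_special:
  fixes f :: "nat => real"
  assumes "c0 < Suc p" "f c0 = x" "\<And>c. c < Suc p ==> c ~= c0 ==> f c = y"
  shows "(\<Sum>c<Suc p. f c) = x + real p * y"
proof -
  have "(\<Sum>c<Suc p. f c) = f c0 + (\<Sum>c\<in>{..<Suc p} - {c0}. f c)" using assms(1) by (subst sum.remove[of _ c0]) auto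
  also have "(\<Sum>c\<in>{..<Suc p} - {c0}. f c) = (\<Sum>c\<in>{..<Suc p} - {c0}. y)" using assms(3) by (intro sum.cong) auto
  also have "... = real p * y" using assms(1) by simp
  finally show ?thesis using assms(2) by simp
qed

section \<open>Supersolution near the rewired centres\<close>

context gadget
begin

definition "q0 = 1 / sqrt (real p)"
definition "\<beta> = 2 * sqrt (real p) / (real p + 1)"

text \<open>Value 1 at all centres and \<open>\<beta>\<close> at their common neighbours
  \<open>V a i\<close>, where \<open>\<beta>\<close> satisfies both balance equations:
  \<open>(p + 1) * \<beta> = 2 * sqrt p\<close> at a centre and
  \<open>2 + (p - 1) * q0 * \<beta> = 2 * sqrt p * \<beta>\<close> at \<open>V a i\<close>. The
  detached vertices, now joined in pairs, restart with value 1; along free branches the decay is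
  \<open>q0\<close> per step.\<close>

definition haddr :: "nat => nat list => real" where
  "haddr k q = (if k < m then (case q of [] => 1 | i # r => (case r of [] => \<beta>
       | c # r' => if c = nxt i then q0 ^ length r' else \<beta> * q0 ^ Suc (length r')))
     else (case q of [] => 1 | i # r => q0 ^ length r))"

lemma q0_beta: "0 < q0" "0 < \<beta>" "sqrt (real p) * q0 = 1" "real p * q0 = sqrt (real p)" "real (Suc p) * \<beta> = 2 * sqrt (real p)"
    "2 + (real p - 1) * (q0 * \<beta>) = 2 * sqrt (real p) * \<beta>" "1 + sqrt (real p) \<le> 2 * sqrt (real p)"
proof -
  have sp: "0 < sqrt (real p)" "sqrt (real p) * sqrt (real p) = real p" "1 \<le> sqrt (real p)" using p by auto
  show "0 < q0" "0 < \<beta>" using p by (auto simp: q0_def \<beta>_def)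
  show 1: "sqrt (real p) * q0 = 1" using sp by (simp add: q0_def)
  show "real p * q0 = sqrt (real p)" using 1 sp by (metis mult.assoc mult.right_neutral)
  show "real (Suc p) * \<beta> = 2 * sqrt (real p)" using p by (simp add: \<beta>_def field_simps)
  have "q0 * \<beta> = 2 / (real p + 1)" using 1 by (simp add: \<beta>_def mult.commute)
  moreover have "2 * sqrt (real p) * \<beta> = 4 * real p / (real p + 1)" using sp by (simp add: \<beta>_def)
  moreover have "2 + (real p - 1) * (2 / (real p + 1)) = 4 * real p / (real p + 1)" by (simp add: field_simps)
  ultimately show "2 + (real p - 1) * (q0 * \<beta>) = 2 * sqrt (real p) * \<beta>" by simp
  show "1 + sqrt (real p) \<le> 2 * sqrt (real p)" using sp by simp
qed

lemma haddr_pos: "0 < haddr k q"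
  using q0_beta by (auto simp: haddr_def split: list.split)

lemma haddr_snoc: "q ~= [] ==> free k (q @ [c]) ==> haddr k (q @ [c]) = q0 * haddr k q"
  by (auto simp: haddr_def free_def split: list.split)

definition "modified = U ` {m..<2 * m} \<union> (\<lambda>(a, i). V a i) ` ({..<m} \<times> {..<d})
  \<union> (\<lambda>(b, j). B b j) ` ({..<m} \<times> {..<d}) \<union> (\<lambda>(a, j). s j (V a (prv j))) ` ({..<m} \<times> {..<d})"

lemma modifiedI: "b < m ==> U (m + b) \<in> modified" "a < m ==> i < d ==> V a i \<in> modified" "a < m ==> i < d ==> B a i \<in> modified"
    "a < m ==> i < d ==> s i (V a (prv i)) \<in> modified"
  unfolding modified_def by auto

lemma modified_addr: "y \<in> modified ==> \<exists>k q. addr k q y & length q \<le> 2"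
  unfolding modified_def
proof (elim UnE imageE, goal_cases)
  case (1 k)
  then show ?case using addr_U[of k] by (intro exI[of _ k] exI[of _ "[]"]) auto
next
  case (2 x)
  then show ?case using addr_V[of "fst x" "snd x"] by (intro exI[of _ "fst x"] exI[of _ "[snd x]"]) (auto split: prod.splits)
next
  case (3 x)
  then show ?case using addr_B[of "fst x" "snd x"] by (intro exI[of _ "m + fst x"] exI[of _ "[snd x]"]) (auto split: prod.splits)
next
  case (4 x)
  then show ?case using addr_W[of "fst x" "snd x"] by (intro exI[of _ "fst x"] exI[of _ "[prv (snd x), snd x]"]) (auto split: prod.splits)
qed

lemma card_modified: "finite modified" "card modified \<le> 4 * m * d"
proof -
  have c: "card (f ` ({..<m} \<times> {..<d})) \<le> m * d" for f :: "nat \<times> nat => nat"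
    using card_image_le[of "{..<m} \<times> {..<d}" f] by (simp add: card_cartesian_product)
  have "card (U ` {m..<2 * m}) \<le> m * d" using card_image_le[of "{m..<2 * m}" U] by simp
  then show "card modified \<le> 4 * m * d"
    unfolding modified_def using c[of "\<lambda>(a, i). V a i"] c[of "\<lambda>(b, j). B b j"] c[of "\<lambda>(a, j). s j (V a (prv j))"]
    by (intro order.trans[OF card_Un_le]) (use card_Un_le[of "U ` {m..<2 * m} \<union> (\<lambda>(a, i). V a i) ` ({..<m} \<times> {..<d})" "(\<lambda>(b, j). B b j) ` ({..<m} \<times> {..<d})"]
        card_Un_le[of "U ` {m..<2 * m}" "(\<lambda>(a, i). V a i) ` ({..<m} \<times> {..<d})"] in linarith)
qed (simp add: modified_def)

lemma changed_modified:
  assumes j: "j < d" and ne: "t j y ~= s j y"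
  shows "y \<in> modified & t j y \<in> modified"
proof -
  have pj: "prv j < d" using nxt_prv(4)[OF j] .
  have H: "H (prv j) b < m" if "b < m" for b using H_less[OF pj] that by blast
  from t_changed[OF j ne] show ?thesis
  proof (elim disjE exE conjE)
    fix b assume "b < m" "y = U (m + b)" then show ?thesis using t_u1[of b j] j pj H modifiedI by auto
  next
    fix b assume "b < m" "y = V b (prv j)" then show ?thesis using t_V[of b j] j pj H modifiedI by auto
  next
    fix b assume "b < m" "y = B b j" then show ?thesis using t_B[of b j] j pj H modifiedI by auto
  next
    fix b assume "b < m" "y = s j (V b (prv j))" then show ?thesis using t_W[of b j] j pj H modifiedI by auto
  qed
qed

lemma near_modified_addr:
  assumes "sdist d s modified R v < R"
  shows "\<exists>k q. addr k q v & length q \<le> R + 2"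
proof -
  obtain w where w: "set w \<subseteq> {..<d}" "length w \<le> sdist d s modified R v" "walk s v w \<in> modified"
    using sdist_witness[OF assms] by blast
  obtain k q where kq: "addr k q (walk s v w)" "length q \<le> 2" using modified_addr[OF w(3)] by blast
  have e: "walk s (U k) (q @ rev w) = v" using kq walk_rev[OF mss w(1), of v] by (simp add: addr_def walk_append)
  have "set (q @ rev w) \<subseteq> {..<d}" using kq w by (simp add: addr_def)
  from reduce_walk[OF mss this, of "U k"] obtain q' where
    "set q' \<subseteq> {..<d}" "distinct_adj q'" "length q' \<le> length (q @ rev w)" "walk s (U k) q' = walk s (U k) (q @ rev w)" by blast
  then show ?thesis using kq w e assms by (intro exI[of _ k] exI[of _ q']) (auto simp: addr_def)
qed

text \<open>For \<open>R + 1 <= l\<close> addresses of length at most \<open>R + 3\<close> are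
  unique, so the choice is immaterial (\<open>hval_addr\<close>); the range includes the neighbours
  of all vertices met in \<open>near_modified_addr\<close>.\<close>

definition hval :: "nat => nat => real" where
  "hval R v = (if \<exists>x. addr (fst x) (snd x) v & length (snd x) \<le> R + 3
     then (let x = (SOME x. addr (fst x) (snd x) v & length (snd x) \<le> R + 3) in haddr (fst x) (snd x)) else 0)"

lemma hval_addr:
  assumes R: "R + 1 \<le> l" and a: "addr k q v" "length q \<le> R + 3"
  shows "hval R v = haddr k q"
proof -
  let ?P = "\<lambda>x. addr (fst x) (snd x) v & length (snd x) \<le> R + 3"
  have P: "?P (k, q)" using a by simp
  then have "?P (SOME x. ?P x)" by (rule someI)
  then have "fst (SOME x. ?P x) = k & snd (SOME x. ?P x) = q" using a R addr_eq[of "fst (SOME x. ?P x)" "snd (SOME x. ?P x)" v k q v] by linarith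
  moreover have "\<exists>x. ?P x" using P by blast
  ultimately show ?thesis by (simp add: hval_def Let_def)
qed

lemma hval_nonneg: "0 \<le> hval R v"
  using haddr_pos less_imp_le by (auto simp: hval_def Let_def)

text \<open>Six kinds of addresses. The balance is exact at free addresses, at centres and at
  \<open>V k i\<close>; at detached vertices the sum is \<open>1 + p * q0 = 1 + sqrt p\<close>,
  below \<open>2 * sqrt p\<close>.\<close>

lemma hval_sum:
  assumes R: "R + 1 \<le> l" and a: "addr k q v" "length q \<le> R + 2"
  shows "(\<Sum>c<d. hval R (t c v)) \<le> 2 * sqrt p * haddr k q"
proof -
  have lq: "length q \<le> 2 * l + 2" using a R by simp
  have k2: "k < 2 * m" using a by (simp add: addr_def)
  have child: "hval R (t c v) = haddr k (q @ [c])" if "c < d" "t c v = s c v" "q = [] \<or> last q ~= c" for c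
    using addr_snoc[OF a(1) that(1,3)] that(2) a(2) by (intro hval_addr[OF R]) auto
  have parent: "hval R (t c v) = haddr k q'" if "q = q' @ [c]" "t c v = s c v" for c q'
  proof -
    have c: "c < d" using a that by (simp add: addr_def)
    have "addr k q' (s c v)" using a that ms_invol[OF mss c] by (auto simp: addr_def walk_append distinct_adj_append_iff)
    then show ?thesis using that a(2) by (intro hval_addr[OF R]) auto
  qed
  have at: "t c v = s c v" if "c < d" "\<not> (k < m & (q = [prv c] \<or> q = [prv c, c]))" "\<not> (m \<le> k & (q = [] \<or> q = [c]))" for c
    by (rule t_addr[OF a(1) lq that])
  consider "free k q" | "k < m" "q = []" | i where "k < m" "q = [i]" | i where "k < m" "q = [i, nxt i]"
    | "m \<le> k" "q = []" | j where "m \<le> k" "q = [j]"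
    unfolding free_def by (cases q rule: list.exhaust[case_product list.exhaust]) (auto simp: Suc_le_eq neq_Nil_conv, (metis length_Cons not_less length_greater_0_conv not_less_eq_eq numeral_2_eq_2 list.exhaust list.size(3))+)
  then show ?thesis
  proof cases
    case 1
    then obtain q' c0 where q: "q = q' @ [c0]" by (cases q rule: rev_cases) (auto simp: free_def)
    have ne: "q' ~= []" using 1 q by (auto simp: free_def)
    have c0: "c0 < d" using a q by (simp add: addr_def)
    have ts: "t c v = s c v" if "c < d" for c by (rule t_free[OF 1 a(1) lq that])
    have h: "haddr k q = q0 * haddr k q'" using haddr_snoc[OF ne] 1 q by simp
    have "(\<Sum>c<d. hval R (t c v)) = haddr k q' + real p * (q0 * haddr k q)"
    proof (rule sum_one_special[OF c0])
      show "hval R (t c0 v) = haddr k q'" by (rule parent[OF q ts[OF c0]])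
      fix c assume c: "c < d" "c ~= c0"
      have "free k (q @ [c])" using 1 by (auto simp: free_def)
      then show "hval R (t c v) = q0 * haddr k q" using child[OF c(1) ts[OF c(1)]] haddr_snoc[of q k c] c(2) q by auto
    qed
    also have "haddr k q' = sqrt p * q0 * haddr k q'" using q0_beta(3) by simp
    also have "... = sqrt p * haddr k q" using h by simp
    also have "sqrt p * haddr k q + real p * (q0 * haddr k q) = 2 * sqrt p * haddr k q"
      using q0_beta(4) by (simp add: mult.assoc[symmetric])
    finally show ?thesis by simp
  next
    case 2
    have "(\<Sum>c<d. hval R (t c v)) = (\<Sum>c<d. \<beta>)"
    proof (intro sum.cong[OF refl])
      fix c assume "c \<in> {..<d}"
      then show "hval R (t c v) = \<beta>" using child[of c] at[of c] 2 by (auto simp: haddr_def)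
    qed
    also have "... = 2 * sqrt p" using q0_beta(5) by simp
    finally show ?thesis using 2 by (simp add: haddr_def)
  next
    case (3 i)
    have i: "i < d" using a 3 by (simp add: addr_def)
    have v: "v = V k i" using a 3 by (simp add: addr_def V_def)
    have ni: "nxt i < d" "prv (nxt i) = i" "nxt i ~= i" using nxt_prv prv_neq i by auto
    have "t (nxt i) v = U (m + H i k)" using t_V[OF 3(1) ni(1)] ni v by simp
    then have hn: "hval R (t (nxt i) v) = 1"
      using hval_addr[OF R addr_u1[of "H i k"]] H_less[OF i] 3 by (simp add: haddr_def)
    have hi: "hval R (t i v) = 1"
      using parent[of "[]" i] at[OF i] 3 i prv_neq(1)[OF i] by (auto simp: haddr_def)
    have ho: "hval R (t c v) = q0 * \<beta>" if c: "c < d" "c ~= i" "c ~= nxt i" for c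
    proof -
      have "prv c ~= i" using nxt_prv(1)[OF c(1)] c(3) by auto
      then have "q ~= [prv c] & q ~= [prv c, c]" using 3 by auto
      then have "t c v = s c v" using 3 by (intro at[OF c(1)]) auto
      then show ?thesis using child[OF c(1)] c 3 by (auto simp: haddr_def)
    qed
    have "(\<Sum>c<d. hval R (t c v)) = hval R (t i v) + (hval R (t (nxt i) v) + (\<Sum>c\<in>{..<d} - {i} - {nxt i}. hval R (t c v)))"
    proof -
      have "(\<Sum>c<d. hval R (t c v)) = hval R (t i v) + (\<Sum>c\<in>{..<d} - {i}. hval R (t c v))"
        by (rule sum.remove) (use i in auto)
      moreover have "(\<Sum>c\<in>{..<d} - {i}. hval R (t c v)) = hval R (t (nxt i) v) + (\<Sum>c\<in>{..<d} - {i} - {nxt i}. hval R (t c v))"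
        by (rule sum.remove) (use ni in auto)
      ultimately show ?thesis by (simp only:)
    qed
    also have "(\<Sum>c\<in>{..<d} - {i} - {nxt i}. hval R (t c v)) = (\<Sum>c\<in>{..<d} - {i} - {nxt i}. q0 * \<beta>)"
      using ho by (intro sum.cong) auto
    also have "... = (real p - 1) * (q0 * \<beta>)" using i ni p by (simp add: of_nat_diff)
    finally show ?thesis using q0_beta(6) hi hn 3 by (simp add: haddr_def)
  next
    case (4 i)
    define j where "j = nxt i"
    have i: "i < d" using a 4 by (simp add: addr_def)
    have j: "j < d" "prv j = i" using nxt_prv i by (auto simp: j_def)
    have v: "v = s j (V k (prv j))" using a 4 j by (simp add: addr_def V_def j_def)
    have Hk: "H (prv j) k < m" using H_less[of "prv j"] j i 4 by simp
    have "hval R (t j v) = 1"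
      using hval_addr[OF R addr_B[OF Hk j(1)]] t_W[OF 4(1) j(1)] v by (simp add: haddr_def)
    then have "(\<Sum>c<d. hval R (t c v)) = 1 + real p * q0"
    proof (rule sum_one_special[OF j(1)])
      fix c assume c: "c < d" "c ~= j"
      have "q ~= [prv c] & q ~= [prv c, c]" using 4 c by (auto simp: j_def)
      then have "t c v = s c v" using 4 by (intro at[OF c(1)]) auto
      then show "hval R (t c v) = q0" using child[OF c(1)] c 4 by (simp add: haddr_def j_def)
    qed
    then show ?thesis using q0_beta(4,7) 4 by (simp add: haddr_def)
  next
    case 5
    then obtain b where b: "k = m + b" "b < m" using k2 le_Suc_ex by (metis add_less_cancel_left mult_2)
    have "(\<Sum>c<d. hval R (t c v)) = (\<Sum>c<d. \<beta>)"
    proof (intro sum.cong[OF refl])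
      fix c assume "c \<in> {..<d}"
      then have c: "c < d" by simp
      have "t c v = V (H (prv c) b) (prv c)" using t_u1[OF b(2) c] a 5 b by (simp add: addr_def)
      then show "hval R (t c v) = \<beta>"
        using hval_addr[OF R addr_V] H_less[OF nxt_prv(4)[OF c]] nxt_prv(4)[OF c] b by (simp add: haddr_def)
    qed
    also have "... = 2 * sqrt p" using q0_beta(5) by simp
    finally show ?thesis using 5 by (simp add: haddr_def)
  next
    case (6 j)
    then obtain b where b: "k = m + b" "b < m" using k2 le_Suc_ex by (metis add_less_cancel_left mult_2)
    have j: "j < d" using a 6 by (simp add: addr_def)
    have v: "v = B b j" using a 6 b by (simp add: addr_def B_def)
    have Hb: "H (prv j) b < m" using H_less[OF nxt_prv(4)[OF j]] b by simp
    have "hval R (t j v) = 1"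
      using hval_addr[OF R addr_W[OF Hb j]] t_B[OF b(2) j] v Hb nxt_prv(1)[OF j] by (simp add: haddr_def)
    then have "(\<Sum>c<d. hval R (t c v)) = 1 + real p * q0"
    proof (rule sum_one_special[OF j])
      fix c assume c: "c < d" "c ~= j"
      have "t c v = s c v" using at[OF c(1)] 6 c by auto
      then show "hval R (t c v) = q0" using child[OF c(1)] c 6 by (simp add: haddr_def)
    qed
    then show ?thesis using q0_beta(4,7) 6 by (simp add: haddr_def)
  qed
qed

theorem gadget_spectral_bound:
  assumes L: "spectral_bound d N s L" "0 \<le> L" and N: "0 < N" and R: "0 < R" "R + 1 \<le> l"
  shows "spectral_bound d N t (max (2 * sqrt p) L + real d * (pi / (2 * R))^2 / 2 + real d * real (4 * m * d * (4 * p ^ R)) / real N)"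
proof (rule local_patch[OF mss ms_t L N R(1), where S = modified and h = "hval R"])
  show "v \<in> modified & t c v \<in> modified" if "c < d" "t c v ~= s c v" for c v by (rule changed_modified[OF that])
  show "0 \<le> hval R v" for v by (rule hval_nonneg)
  show "card {v. v < N & sdist d s modified R v < R} \<le> 4 * m * d * (4 * p ^ R)"
    by (rule order.trans[OF card_sdist_less[OF mss p card_modified(1)] mult_le_mono1[OF card_modified(2)]])
  fix v assume "v < N" "sdist d s modified R v < R"
  then obtain k q where kq: "addr k q v" "length q \<le> R + 2" using near_modified_addr by blast
  then have "hval R v = haddr k q" using hval_addr[OF R(2)] by simp
  then show "0 < hval R v & (\<Sum>c<d. hval R (t c v)) \<le> 2 * sqrt p * hval R v"
    using hval_sum[OF R(2) kq] haddr_pos by simp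
qed

end

section \<open>Choice of parameters\<close>

text \<open>The deterministic part. The private edges hit all short cycles, and switching creates no
  new ones, so the girth exceeds \<open>g\<close>; their number is at most
  \<open>cycle_weight\<close>, whence the last error term.\<close>

theorem girth_surgery:
  assumes msX: "matchings (Suc p) N X" and p: "2 \<le> p" and R: "0 < R" "580 * R + 2 \<le> g"
    and L: "spectral_bound (Suc p) N X L" "0 \<le> L" and sparse: "\<not> crowded (Suc p) N X (3 * (2 * R + 3)) g"
    and room: "4 * p ^ (g + 2) + 2 * cycle_weight p N X g + 8 * cycle_weight p N X g * p ^ (2 * R + 2) < N"
  shows "\<exists>t. matchings (Suc p) N t & girth_gt (Suc p) N t g &
    spectral_bound (Suc p) N t (max (2 * sqrt p) L + real (Suc p) * (pi / (2 * R))^2 / 2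
      + real (Suc p) * real (4 * cycle_weight p N X g * (4 * p ^ R)) / real N)"
proof -
  let ?d = "Suc p"
  from private_hitting_edges[OF msX, of g] obtain n :: nat and c x :: "nat => nat" and w where
    n: "n \<le> card (short_cycles ?d N X g)"
    and cx: "\<forall>i<n. c i < ?d & x i < N & (x i, c i # w i) \<in> short_cycles ?d N X g"
    and priv: "\<forall>i<n. \<forall>j<n. traced X (X (c i) (x i)) (w i) \<inter> edge X (c j) (x j) = {}"
    and disj: "\<forall>i<n. \<forall>j<n. i ~= j --> edge X (c i) (x i) \<inter> edge X (c j) (x j) = {}"
    and hit: "\<forall>v w. (v, w) \<in> short_cycles ?d N X g --> (\<exists>i<n. traced X v w \<inter> edge X (c i) (x i) ~= {})"
    by (elim exE conjE)
  have ncw: "n \<le> cycle_weight p N X g" using n card_short_cycles_le[OF p] order.trans by blast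
  have "8 * n * p ^ (2 * R + 2) \<le> 8 * cycle_weight p N X g * p ^ (2 * R + 2)" using ncw by (intro mult_le_mono1 mult_le_mono2)
  then have room': "4 * p ^ (g + 2) + 2 * cycle_weight p N X g + 8 * n * p ^ (2 * R + 2) < N" using room by linarith
  have cx1: "c i < ?d & x i < N" if "i < n" for i using cx that by blast
  have disj1: "edge X (c i) (x i) \<inter> edge X (c j) (x j) = {}" if "i < n" "j < n" "i ~= j" for i j using disj that by blast
  have "\<exists>t u. switched ?d N X g (2 * R + 2) n c x n t u"
    by (rule switch_all[OF msX p cx1 disj1 room' order_refl])
  then obtain t u where sw: "switched ?d N X g (2 * R + 2) n c x n t u" by blast
  note sw = sw[unfolded switched_def]
  note mst = sw[THEN conjunct1]
    and cyc = sw[THEN conjunct2, THEN conjunct1]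
    and u1 = sw[THEN conjunct2, THEN conjunct2, THEN conjunct1]
    and u2 = sw[THEN conjunct2, THEN conjunct2, THEN conjunct2, THEN conjunct1]
    and dif = sw[THEN conjunct2, THEN conjunct2, THEN conjunct2, THEN conjunct2]
  have "short_cycles ?d N t g = {}"
  proof (rule ccontr)
    assume "short_cycles ?d N t g ~= {}"
    then obtain v w' where vw: "(v, w') \<in> short_cycles ?d N t g" by auto
    note a = cyc[THEN spec, THEN spec, THEN mp, OF vw]
    from a have "(v, w') \<in> short_cycles ?d N X g" by (rule conjunct1)
    then obtain i where "i < n" "traced X v w' \<inter> edge X (c i) (x i) ~= {}" using hit by blast
    then show False using a[THEN conjunct2, THEN conjunct2] by blast
  qed
  then have gt: "girth_gt ?d N t g" using girth_gt_iff[OF mst] by blast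
  interpret clusters p N n g R X t c x u w
  proof
    show "matchings ?d N X" "matchings ?d N t" "2 \<le> p" "0 < R" by (fact msX mst p R)+
    show "c i < ?d & x i < N & (x i, c i # w i) \<in> short_cycles ?d N X g" if "i < n" for i using cx that by blast
    show "traced X (X (c i) (x i)) (w i) \<inter> edge X (c j) (x j) = {}" if "i < n" "j < n" for i j using priv that by blast
    show "edge X (c i) (x i) \<inter> edge X (c j) (x j) = {}" if "i < n" "j < n" "i ~= j" for i j by (rule disj1[OF that])
    show "\<not> crowded ?d N X (3 * (2 * R + 3)) g" by (rule sparse)
    show "u j < N" if "j < n" for j using u1 that by blast
    show "far ?d X (2 * R + 2) (x i) (u j)" if "i < n" "j < n" for i j using u1 that by blast
    show "far ?d X (2 * R + 2) (u i) (u j)" if "i < n" "j < n" "i ~= j" for i j using u2 that by blast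
    show "\<exists>j<n. c' = c j & v \<in> switch_points X c x u j & t c' v \<in> switch_points X c x u j" if "t c' v ~= X c' v" for c' v
      by (rule dif[THEN spec, THEN spec, THEN mp, OF that])
    show "girth_gt ?d N t (580 * R + 2)" by (rule girth_gt_mono[OF gt R(2)])
  qed
  have N: "0 < N" using room by simp
  have "real (4 * n * (4 * p ^ R)) \<le> real (4 * cycle_weight p N X g * (4 * p ^ R))"
    using ncw by (intro of_nat_mono mult_le_mono1 mult_le_mono2)
  then have "real ?d * real (4 * n * (4 * p ^ R)) / real N \<le> real ?d * real (4 * cycle_weight p N X g * (4 * p ^ R)) / real N"
    by (intro divide_right_mono mult_left_mono) auto
  then have "spectral_bound ?d N t (max (2 * sqrt p) L + real (Suc p) * (pi / (2 * R))^2 / 2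
      + real (Suc p) * real (4 * cycle_weight p N X g * (4 * p ^ R)) / real N)"
    using spectral_bound_mono[OF cluster_spectral_bound[OF L N]] by simp
  then show ?thesis using mst gt by blast
qed

section \<open>Radii and exponent budgets\<close>

lemma eventually_ln_ge: "\<forall>\<^sub>F N :: nat in sequentially. C \<le> ln (real N)"
proof -
  have "filterlim (\<lambda>N :: nat. ln (real N)) at_top sequentially"
    by (rule filterlim_compose[OF ln_at_top filterlim_real_sequentially])
  then show ?thesis by (simp add: filterlim_at_top)
qed

lemma power_le_powr:
  assumes p: "2 \<le> p" and N: "1 \<le> N" and k: "real k \<le> a * log (real p) (real N)"
  shows "real p ^ k \<le> real N powr a"
proof -
  have "real p ^ k = real p powr (real k)" using p by (simp add: powr_realpow)
  also have "... \<le> real p powr (log (real p) (real N) * a)" using p k by (intro powr_mono) (auto simp: mult.commute)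
  also have "... = real N powr a" using p N by (simp add: powr_powr[symmetric])
  finally show ?thesis .
qed

text \<open>The divisor 2000 achieves \<open>580 * R + 2 <= log_p N / 3\<close> and makes the
  factors \<open>p^R\<close> tiny powers of \<open>N\<close>, while \<open>R\<close> is still of
  order \<open>log N\<close>, so that the squared slope is below \<open>1 / ln N\<close>.\<close>

definition patch_radius :: "nat => nat => nat" where
  "patch_radius p N = nat \<lfloor>log (real p) (real N) / 2000\<rfloor>"

lemma patch_radius:
  assumes p: "2 \<le> p"
  defines "R \<equiv> patch_radius p"
  shows "\<forall>\<^sub>F N in sequentially. 0 < R N & real p ^ R N \<le> real N powr (1/2000) & real (580 * R N + 2) \<le> log p N / 3
    & real (R N) \<le> ln N / 1000 & real (Suc p) * (pi / (2 * R N))^2 / 2 \<le> 1 / ln N"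
proof -
  define b where "b = ln (real p)"
  have "ln 2 \<le> b" using p by (simp add: b_def)
  then have b: "2/3 \<le> b" using ln2_ge_two_thirds by linarith
  define C where "C = max 1 (max (4000 * b) (2 * real (Suc p) * (4000 * b)^2))"
  show ?thesis
    using eventually_ln_ge[of C] eventually_ge_at_top[of 1]
  proof eventually_elim
    case (elim N)
    define x where "x = ln (real N)"
    have x: "1 \<le> x" "4000 * b \<le> x" "2 * real (Suc p) * (4000 * b)^2 \<le> x" using elim by (auto simp: C_def x_def)
    have lg: "log p N = x / b" by (simp add: log_def b_def x_def)
    have f0: "0 \<le> x / b / 2000" using x b by simp
    have R1: "real (R N) \<le> x / b / 2000"
      unfolding R_def patch_radius_def lg using f0 of_int_floor_le[of "x / b / 2000"] by simp
    have R2: "x / b / 2000 - 1 \<le> real (R N)"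
      unfolding R_def patch_radius_def lg using f0 by simp
    have "1 \<le> x / b / 4000" using x b by (simp add: field_simps)
    then have R3: "x / b / 4000 \<le> real (R N)" using R2 by linarith
    then have R0: "1 \<le> real (R N)" using \<open>1 \<le> x / b / 4000\<close> by linarith
    have "real p ^ R N \<le> real N powr (1/2000)"
      using R1 elim(2) by (intro power_le_powr[OF p]) (auto simp: lg)
    moreover have "real (580 * R N + 2) \<le> log p N / 3"
    proof -
      have aux: "r \<le> y / 2000 ==> 1 \<le> y / 4000 ==> 580 * r + 2 \<le> y / 3" for r y :: real by linarith
      show ?thesis using aux[OF R1 \<open>1 \<le> x / b / 4000\<close>] unfolding lg by simp
    qed
    moreover have "real (R N) \<le> x / 1000"
    proof -
      have "x / b / 2000 \<le> x / (2/3) / 2000" using x b by (intro divide_right_mono divide_left_mono) auto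
      then show ?thesis using R1 x by simp
    qed
    moreover have "real (Suc p) * (pi / (2 * R N))^2 / 2 \<le> 1 / x"
    proof -
      have "2 * real (Suc p) * x * (4000 * b)^2 \<le> x * x" using mult_right_mono[OF x(3), of x] x by (simp add: mult_ac)
      then have "2 * real (Suc p) * x \<le> (x / b / 4000)^2"
        using b by (simp add: power_divide power_mult_distrib field_simps power2_eq_square)
      also have "... \<le> (real (R N))^2" using R3 x b by (intro power_mono) auto
      finally have 1: "2 * real (Suc p) * x \<le> (real (R N))^2" .
      have aux: "a * (4 / b) / 2 = 2 * a / b" for a b :: real by simp
      have "pi^2 \<le> 4^2" using pi_less_4 by (intro power_mono) auto
      then have "pi^2 / (4 * (real (R N))^2) \<le> 4^2 / (4 * (real (R N))^2)" by (intro divide_right_mono) auto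
      then have "(pi / (2 * R N))^2 \<le> 4 / (real (R N))^2" by (simp add: power_divide power_mult_distrib)
      then have "real (Suc p) * (pi / (2 * R N))^2 / 2 \<le> real (Suc p) * (4 / (real (R N))^2) / 2"
        by (intro divide_right_mono mult_left_mono) auto
      also have "... = 2 * real (Suc p) / (real (R N))^2" by (rule aux)
      also have "... \<le> 1 / x" using 1 x R0 by (simp add: field_simps)
      finally show ?thesis .
    qed
    ultimately show ?case using R0 by (simp add: x_def)
  qed
qed

lemma exists_below_average:
  fixes F :: "'a => real"
  assumes "finite A" "(\<Sum>s\<in>A. F s) < card A"
  shows "\<exists>s\<in>A. F s < 1"
proof (rule ccontr)
  assume "\<not> ?thesis"
  then have "(\<Sum>s\<in>A. 1) \<le> (\<Sum>s\<in>A. F s)" by (intro sum_mono) auto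
  then show False using assms by simp
qed

text \<open>One averaging for three requirements: \<open>2 * f\<close>, the cycle weight divided by
  four times the bound \<open>?M\<close> on its mean, and the indicator of crowding have total mean
  at most \<open>2/64 + 1/4 + 1/64 < 1\<close>, so some system has all three below 1 at
  once.\<close>

lemma good_base:
  assumes p: "2 \<le> p" and N: "even N" and L: "4 * (D + g + 1) < L" "4 * L^2 \<le> N"
    and mean: "\<exists>f. (\<forall>s\<in>systems (Suc p) N. 0 \<le> f s & (f s < 1/2 --> spectral_bound (Suc p) N s \<Lambda>))
      & (\<Sum>s\<in>systems (Suc p) N. f s) \<le> card (systems (Suc p) N) / (64::real)"
    and cr: "real (N * ((D + 1) * Suc p ^ D * (4 * p ^ g)) ^ 4) * (8 * ((real L)^2 / real N) ^ 4) \<le> 1/64"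
  shows "\<exists>X\<in>systems (Suc p) N. spectral_bound (Suc p) N X \<Lambda> & \<not> crowded (Suc p) N X D g
    & real (cycle_weight p N X g) \<le> 256 * (real L)^2 * real (Suc g) * real p ^ g"
proof -
  let ?S = "systems (Suc p) N" and ?M = "64 * (real L)^2 * real (Suc g) * real p ^ g"
  from mean obtain f where f: "\<And>s. s \<in> ?S ==> 0 \<le> f s & (f s < 1/2 --> spectral_bound (Suc p) N s \<Lambda>)"
    "(\<Sum>s\<in>?S. f s) \<le> card ?S / 64" by auto
  have M: "0 < ?M" using L p by simp
  have cS: "0 < card ?S" by (rule card_systems_pos[OF N])
  define I where "I s = (if crowded (Suc p) N s D g then 1 else 0 :: real)" for s
  have "(\<Sum>s\<in>?S. I s) = real (card {s\<in>?S. crowded (Suc p) N s D g})"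
    by (simp add: I_def sum.If_cases finite_systems Int_def)
  also have "... \<le> card ?S * (1/64)"
    using card_crowded[OF p N L] mult_left_mono[OF cr, of "real (card ?S)"] by simp
  finally have I: "(\<Sum>s\<in>?S. I s) \<le> card ?S / 64" by simp
  have "(\<Sum>s\<in>?S. real (cycle_weight p N s g)) \<le> card ?S * ?M"
    using L p by (intro sum_cycle_weight N) auto
  then have W: "(\<Sum>s\<in>?S. real (cycle_weight p N s g)) / (4 * ?M) \<le> card ?S / 4" using M by (simp add: field_simps)
  have "(\<Sum>s\<in>?S. 2 * f s + real (cycle_weight p N s g) / (4 * ?M) + I s)
      = 2 * (\<Sum>s\<in>?S. f s) + (\<Sum>s\<in>?S. real (cycle_weight p N s g)) / (4 * ?M) + (\<Sum>s\<in>?S. I s)"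
    by (simp only: sum.distrib sum_distrib_left sum_divide_distrib)
  also have "... < card ?S" using f(2) W I cS by linarith
  finally obtain X where X: "X \<in> ?S" "2 * f X + real (cycle_weight p N X g) / (4 * ?M) + I X < 1"
    using exists_below_average[OF finite_systems] by blast
  have nn: "0 \<le> f X" "0 \<le> real (cycle_weight p N X g) / (4 * ?M)" "0 \<le> I X"
    using f(1)[OF X(1)] by (auto simp: I_def)
  have "f X < 1/2" "I X < 1" "real (cycle_weight p N X g) / (4 * ?M) < 1" using X(2) nn by linarith+
  then have "spectral_bound (Suc p) N X \<Lambda>" "\<not> crowded (Suc p) N X D g" "real (cycle_weight p N X g) < 4 * ?M"
    using f(1)[OF X(1)] M by (auto simp: I_def divide_simps split: if_splits)
  then show ?thesis using X(1) by (intro bexI[of _ X]) auto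
qed

text \<open>With \<open>p^g <= N^(2/3)\<close> about \<open>N^(2/3)\<close> edges, up to logarithms,
  have to be switched; with a ball of size of order \<open>N^(1/2000)\<close> around each of them
  the patched region is still negligible against \<open>N\<close>.\<close>

theorem near_ramanujan_large_girth:
  assumes p: "2 \<le> p"
  shows "\<forall>\<^sub>F N :: nat in sequentially. even N --> (\<forall>g. log p N / 3 \<le> real g --> real p ^ g \<le> real N powr (2/3) -->
    (\<exists>t. matchings (Suc p) N t & girth_gt (Suc p) N t g & spectral_bound (Suc p) N t (2 * sqrt p + ((real p + 1)^2 + 2) / ln N)))"
  (is "\<forall>\<^sub>F N in _. even N --> (\<forall>g. _ --> _ --> ?P N g)")
proof -
  define R where "R = patch_radius p"
  have e1: "\<forall>\<^sub>F N :: nat in sequentially. ln (real N) + 1 \<le> 2 * ln (real N) & 8 * (ln (real N)) + 8 < (ln (real N))^2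
     & (ln (real N))^2 + 1 \<le> 2 * (ln (real N))^2 & 16 * ln (real N) ^ 4 \<le> real N & 9 + 6 * (ln (real N) / 1000) \<le> ln (real N)"
    by (intro eventually_conj; real_asymp)
  have e2: "\<forall>\<^sub>F N :: nat in sequentially. real N * (2 * ln (real N) * (ln (real N) * (real N powr (1/2000)) ^ 12) * (4 * real N powr (2/3))) ^ 4
      * (8 * ((2 * (ln (real N))^2)^2 / real N) ^ 4) \<le> 1/64" by real_asymp
  have e3: "\<forall>\<^sub>F N :: nat in sequentially. 4 * (real N powr (2/3) * ln (real N)) + 2 * (256 * (2 * (ln (real N))^2)^2 * (2 * ln (real N)) * real N powr (2/3))
     + 8 * (256 * (2 * (ln (real N))^2)^2 * (2 * ln (real N)) * real N powr (2/3)) * ((real N powr (1/2000))^2 * ln (real N)) < real N" by real_asymp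
  have e4: "\<forall>\<^sub>F N :: nat in sequentially. ln (real N) * (4 * (256 * (2 * (ln (real N))^2)^2 * (2 * ln (real N)) * real N powr (2/3)) * (4 * real N powr (1/2000))) / real N
      \<le> 1 / ln (real N)" by real_asymp
  show ?thesis
    using near_ramanujan_mean[OF p] patch_radius[OF p] eventually_ln_ge[of "max 2 (real p ^ 18)"] eventually_ge_at_top[of 2] e1 e2 e3 e4
  proof eventually_elim
    case (elim N)
    show ?case
    proof (intro impI allI)
      fix g :: nat assume N: "even N" and g1: "log p N / 3 \<le> real g" and g2: "real p ^ g \<le> real N powr (2/3)"
      define x where "x = ln (real N)"
      define r where "r = R N"
      \<comment> \<open>Three hops of length \<open>2 * r + 3\<close>, the reach used in the locale
        \<open>clusters\<close>.\<close>
      define D where "D = 3 * (2 * r + 3)"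
      \<comment> \<open>Only has to exceed the program length \<open>4 * (D + g + 1)\<close>, which
        is of order \<open>ln N\<close>, with a square negligible against \<open>N\<close>.\<close>
      define L where "L = nat \<lceil>x^2\<rceil>"
      have x: "2 \<le> x" "real p ^ 18 \<le> x" using elim by (auto simp: x_def)
      have N1: "1 \<le> N" using elim by simp
      note R = elim(2)[folded R_def, folded r_def x_def]
      note e = elim(5-8)[folded x_def]
      have p1: "1 \<le> real p" using p by simp
      have px: "real p \<le> x" "(real p)^2 \<le> x" "real (Suc p) \<le> x"
      proof -
        have "real p ^ 1 \<le> real p ^ 18" "(real p)^2 \<le> real p ^ 18" using p1 by (intro power_increasing; simp)+
        from order.trans[OF this(1) x(2)] order.trans[OF this(2) x(2)] show "real p \<le> x" "(real p)^2 \<le> x" by simp_all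
        have "real p + 1 \<le> 2 * real p" using p1 by simp
        also have "... \<le> real p * real p" using p by (intro mult_right_mono) auto
        finally show "real (Suc p) \<le> x" using \<open>(real p)^2 \<le> x\<close> by (simp add: power2_eq_square)
      qed
      have gx: "real g \<le> x"
      proof -
        have "real g * ln 2 \<le> real g * ln (real p)" using p by (intro mult_left_mono) auto
        also have "... = ln (real p ^ g)" using p by (simp add: ln_realpow)
        also have "... \<le> ln (real N powr (2/3))" using p g2 N1 by (subst ln_le_cancel_iff) auto
        also have "... = 2/3 * x" using N1 by (simp add: ln_powr x_def)
        finally have "real g * ln 2 \<le> 2/3 * x" .
        moreover have "real g * (2/3) \<le> real g * ln 2" using ln2_ge_two_thirds by (intro mult_left_mono) auto
        ultimately show ?thesis by linarith
      qed
      have Dx: "real D \<le> x" using R e(1) by (simp add: D_def)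
      have L1: "x^2 \<le> real L" "real L \<le> 2 * x^2" unfolding L_def using e(1) by (auto, linarith+)
      have Lg: "4 * (D + g + 1) < L"
      proof -
        have "real (4 * (D + g + 1)) \<le> 8 * x + 8" using Dx gx by simp
        also have "... < x^2" using e(1) by simp
        also have "... \<le> real L" by (rule L1)
        finally show ?thesis by linarith
      qed
      have L2: "(real L)^2 \<le> (2 * x^2)^2" using L1 by (intro power_mono) auto
      have LN: "4 * L^2 \<le> N"
      proof -
        have "real (4 * L^2) = 4 * (real L)^2" by simp
        also have "... \<le> 4 * (2 * x^2)^2" using L2 by (rule mult_left_mono) simp
        also have "... = 16 * x ^ 4" by (simp add: power_mult_distrib)
        also have "... \<le> real N" using e(1) by simp
        finally show ?thesis by linarith
      qed
      have dD: "real (Suc p) ^ D \<le> x * (real N powr (1/2000)) ^ 12"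
      proof -
        have "real (Suc p) \<le> (real p)^2"
        proof -
          have "real p + 1 \<le> 2 * real p" using p1 by simp
          also have "... \<le> real p * real p" using p by (intro mult_right_mono) auto
          finally show ?thesis by (simp add: power2_eq_square)
        qed
        then have "real (Suc p) ^ D \<le> ((real p)^2) ^ D" by (intro power_mono) auto
        also have "... = real p ^ 18 * (real p ^ r) ^ 12" by (simp add: D_def power_add[symmetric] power_mult[symmetric] algebra_simps)
        also have "... \<le> x * (real N powr (1/2000)) ^ 12" using x R by (intro mult_mono power_mono) auto
        finally show ?thesis .
      qed
      have cr: "real (N * ((D + 1) * Suc p ^ D * (4 * p ^ g)) ^ 4) * (8 * ((real L)^2 / real N) ^ 4) \<le> 1/64"
      proof -
        have "real (N * ((D + 1) * Suc p ^ D * (4 * p ^ g)) ^ 4) * (8 * ((real L)^2 / real N) ^ 4)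
          = real N * ((real D + 1) * real (Suc p) ^ D * (4 * real p ^ g)) ^ 4 * (8 * ((real L)^2 / real N) ^ 4)"
          by (simp only: of_nat_mult of_nat_power of_nat_add of_nat_1 of_nat_numeral)
        also have "... \<le> real N * (2 * x * (x * (real N powr (1/2000)) ^ 12) * (4 * real N powr (2/3))) ^ 4 * (8 * ((2 * x^2)^2 / real N) ^ 4)"
          using dD g2 L1 Dx e(1) x by (intro mult_mono power_mono divide_right_mono order_refl) auto
        also have "... \<le> 1/64" by (rule e(2))
        finally show ?thesis .
      qed
      have mean: "\<exists>f. (\<forall>s\<in>systems (Suc p) N. 0 \<le> f s & (f s < 1/2 --> spectral_bound (Suc p) N s (2 * sqrt p + (real p + 1)^2 / x)))
         & (\<Sum>s\<in>systems (Suc p) N. f s) \<le> card (systems (Suc p) N) / (64::real)"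
        using elim(1) N unfolding x_def by blast
      from good_base[OF p N Lg LN mean cr] obtain X where X: "X \<in> systems (Suc p) N"
        and \<Lambda>: "spectral_bound (Suc p) N X (2 * sqrt p + (real p + 1)^2 / x)" and sp: "\<not> crowded (Suc p) N X D g"
        and cw: "real (cycle_weight p N X g) \<le> 256 * (real L)^2 * real (Suc g) * real p ^ g" by blast
      define Z where "Z = 256 * (2 * x^2)^2 * (2 * x) * real N powr (2/3)"
      have Z: "real (cycle_weight p N X g) \<le> Z"
        unfolding Z_def using L2 gx e(1) g2 x by (intro order.trans[OF cw] mult_mono) auto
      have Z0: "0 \<le> Z" unfolding Z_def using x by (intro mult_nonneg_nonneg) auto
      have room: "4 * p ^ (g + 2) + 2 * cycle_weight p N X g + 8 * cycle_weight p N X g * p ^ (2 * r + 2) < N"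
      proof -
        have pr: "real p ^ (2 * r + 2) \<le> (real N powr (1/2000))^2 * x"
        proof -
          have "real p ^ (2 * r + 2) = (real p ^ r)^2 * (real p)^2" by (simp add: power_add mult_2 power2_eq_square)
          also have "... \<le> (real N powr (1/2000))^2 * x" using R px by (intro mult_mono power_mono) auto
          finally show ?thesis .
        qed
        have "real p ^ (g + 2) \<le> real N powr (2/3) * x" unfolding power_add using g2 px by (intro mult_mono) auto
        moreover have "real (cycle_weight p N X g) * real p ^ (2 * r + 2) \<le> Z * ((real N powr (1/2000))^2 * x)"
          using Z pr Z0 by (intro mult_mono) auto
        moreover have "4 * (real N powr (2/3) * x) + 2 * Z + 8 * Z * ((real N powr (1/2000))^2 * x) < real N"
          using e(3) by (simp add: Z_def)
        ultimately have "4 * real p ^ (g + 2) + 2 * real (cycle_weight p N X g) + 8 * (real (cycle_weight p N X g) * real p ^ (2 * r + 2)) < real N"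
          using Z by linarith
        then have "real (4 * p ^ (g + 2) + 2 * cycle_weight p N X g + 8 * cycle_weight p N X g * p ^ (2 * r + 2)) < real N" by simp
        then show ?thesis by linarith
      qed
      have err: "real (Suc p) * real (4 * cycle_weight p N X g * (4 * p ^ r)) / real N \<le> 1 / x"
      proof -
        have "real (Suc p) * real (4 * cycle_weight p N X g * (4 * p ^ r)) / real N
          = real (Suc p) * (4 * real (cycle_weight p N X g) * (4 * real p ^ r)) / real N" by simp
        also have "... \<le> x * (4 * Z * (4 * real N powr (1/2000))) / real N"
          using px Z R x by (intro divide_right_mono mult_mono) (auto simp: Z_def)
        also have "... \<le> 1 / x" using e(4) by (simp add: Z_def)
        finally show ?thesis .
      qed
      have r: "0 < r" "580 * r + 2 \<le> g" using R g1 by linarith+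
      have nn: "0 \<le> 2 * sqrt (real p) + (real p + 1)^2 / x" using x by auto
      from girth_surgery[OF systems_ms[OF X] p r \<Lambda> nn sp[unfolded D_def] room] obtain t where
        t: "matchings (Suc p) N t" "girth_gt (Suc p) N t g"
        and sb: "spectral_bound (Suc p) N t (max (2 * sqrt p) (2 * sqrt p + (real p + 1)^2 / x) + real (Suc p) * (pi / (2 * r))^2 / 2
          + real (Suc p) * real (4 * cycle_weight p N X g * (4 * p ^ r)) / real N)" by blast
      have "max (2 * sqrt p) (2 * sqrt p + (real p + 1)^2 / x) + real (Suc p) * (pi / (2 * r))^2 / 2
          + real (Suc p) * real (4 * cycle_weight p N X g * (4 * p ^ r)) / real N \<le> (2 * sqrt p + (real p + 1)^2 / x) + 1 / x + 1 / x"
        using R err x by (intro add_mono) auto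
      also have "... = 2 * sqrt p + ((real p + 1)^2 + 2) / x" by (simp add: add_divide_distrib)
      finally show "?P N g"
        using t spectral_bound_mono[OF sb] unfolding x_def by blast
    qed
  qed
qed

text \<open>With \<open>z = N^(1/3)\<close>: the \<open>2 * m <= z\<close> centres fit at mutual
  distance about \<open>(2/3) log_p N\<close> because \<open>z * z^2 = N\<close>, and a system
  \<open>H\<close> on \<open>m\<close> vertices can have girth above \<open>l\<close>, about
  \<open>log_p z\<close>, which doubles in the rewired graph.\<close>

theorem gadget_graphs:
  assumes p: "2 \<le> p"
  shows "\<forall>\<^sub>F N :: nat in sequentially. even N --> (\<exists>t g U. matchings (Suc p) N t & 2 \<le> g & 2/3 * log p N - 22 \<le> real g
    & girth_gt (Suc p) N t g & spectral_bound (Suc p) N t (2 * sqrt p + ((real p + 1)^2 + 4) / ln N)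
    & U \<subseteq> {..<N} & U ~= {} & real (card U) \<le> real N powr (1/3)
    & 2 * card {v. \<exists>u\<in>U. \<exists>c<Suc p. v = t c u} \<le> (Suc p + 1) * card U)"
  (is "\<forall>\<^sub>F N in _. even N --> ?P N")
proof -
  define R where "R = patch_radius p"
  have e1: "\<forall>\<^sub>F N :: nat in sequentially. ln (real N) * (4 * (real N powr (1/3)) * ln (real N) * (4 * real N powr (1/2000))) / real N
      \<le> 1 / ln (real N)" by real_asymp
  show ?thesis
    using near_ramanujan_large_girth[OF p] patch_radius[OF p] eventually_ln_ge[of "max 1 (real (Suc p))"] eventually_ge_at_top[of 2] e1
  proof eventually_elim
    case (elim N)
    show ?case
    proof
      assume N: "even N"
      define x y z r where "x = ln (real N)" and "y = log p N" and "z = real N powr (1/3)" and "r = R N"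
      note Rr = elim(2)[folded R_def, folded r_def x_def y_def]
      have x: "1 \<le> x" "real (Suc p) \<le> x" using elim(3) by (auto simp: x_def)
      have N1: "1 \<le> N" using elim by simp
      have y: "582 \<le> y / 3" using Rr by simp
      \<comment> \<open>The slack 10 absorbs constants: from \<open>p^(l + 10) <= z\<close> follows
        \<open>256 * p^(l + 2) <= z\<close>, which yields both \<open>4 * p^(l + 2) < m\<close> and
        room for the far centres. With rounding it is also the origin of the loss
        \<open>22 = 2 * 11\<close> in the girth.\<close>
      define l where "l = nat \<lfloor>y / 3\<rfloor> - 10"
      have "real (nat \<lfloor>y / 3\<rfloor>) = real_of_int \<lfloor>y / 3\<rfloor>" using y by simp
      then have fl: "real (nat \<lfloor>y / 3\<rfloor>) \<le> y / 3" "y / 3 - 1 \<le> real (nat \<lfloor>y / 3\<rfloor>)"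
        using of_int_floor_le[of "y / 3"] real_of_int_floor_gt_diff_one[of "y / 3"] by linarith+
      then have ge: "10 \<le> nat \<lfloor>y / 3\<rfloor>" using y by linarith
      have "real l = real (nat \<lfloor>y / 3\<rfloor>) - 10" using ge by (simp add: l_def of_nat_diff)
      then have l: "real l \<le> y / 3 - 10" "y / 3 - 11 \<le> real l" using fl by linarith+
      have z0: "0 < z" using N1 by (simp add: z_def)
      have z3: "z * z * z = real N" "z * z = real N powr (2/3)" using N1 by (simp_all add: z_def flip: powr_add)
      have "real p ^ (l + 10) \<le> z"
        unfolding z_def using l(1) by (intro power_le_powr[OF p N1]) (simp add: y_def)
      moreover have "256 * real p ^ (l + 2) \<le> real p ^ (l + 10)"
      proof -
        have "(2::real) ^ 8 \<le> real p ^ 8" using p by (intro power_mono) auto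
        then have "real p ^ (l + 2) * 256 \<le> real p ^ (l + 2) * real p ^ 8" by (intro mult_left_mono) auto
        also have "... = real p ^ ((l + 2) + 8)" by (rule power_add[symmetric])
        also have "(l + 2) + 8 = l + 10" by simp
        finally show ?thesis by simp
      qed
      ultimately have pl: "256 * real p ^ (l + 2) \<le> z" by linarith
      have p1: "1 \<le> real p ^ (l + 2)" using p by (intro one_le_power) simp
      define m where "m = 2 * nat \<lfloor>z / 4\<rfloor>"
      have m: "real m \<le> z / 2" "z / 2 - 2 \<le> real m" using z0 by (simp_all add: m_def, linarith+)
      have m4: "4 * p ^ (l + 2) < m"
      proof -
        have "real (4 * p ^ (l + 2)) = 4 * real p ^ (l + 2)" by (simp only: of_nat_mult of_nat_power of_nat_numeral)
        then have "real (4 * p ^ (l + 2)) < real m" using pl p1 m(2) by linarith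
        then show ?thesis by linarith
      qed
      have "even m" by (simp add: m_def)
      from exists_girth_gt[OF p this m4] obtain H where H: "matchings (Suc p) m H" "girth_gt (Suc p) m H l" by blast
      have p2: "real p ^ (2 * l + 4) = real p ^ (l + 2) * real p ^ (l + 2)"
      proof -
        have e: "2 * l + 4 = (l + 2) + (l + 2)" by simp
        show ?thesis unfolding e by (rule power_add)
      qed
      have p3: "65536 * real p ^ (2 * l + 4) \<le> z * z"
      proof -
        have "(256 * real p ^ (l + 2)) * (256 * real p ^ (l + 2)) \<le> z * z" using pl z0 by (intro mult_mono) auto
        then show ?thesis unfolding p2 by simp
      qed
      have "y / 3 \<le> real (2 * l + 4)" using l(2) y by simp
      moreover have "real p ^ (2 * l + 4) \<le> real N powr (2/3)"
        using p3 unfolding z3(2)[symmetric] by (rule order.trans[rotated]) simp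
      ultimately have "\<exists>s. matchings (Suc p) N s & girth_gt (Suc p) N s (2 * l + 4)
        & spectral_bound (Suc p) N s (2 * sqrt p + ((real p + 1)^2 + 2) / x)"
        unfolding x_def y_def by (rule elim(1)[THEN mp, OF N, THEN spec, THEN mp, THEN mp])
      then obtain s where s: "matchings (Suc p) N s" "girth_gt (Suc p) N s (2 * l + 4)"
        "spectral_bound (Suc p) N s (2 * sqrt p + ((real p + 1)^2 + 2) / x)" by (elim exE conjE)
      have "2 * m * (4 * p ^ (2 * l + 4)) < N"
      proof -
        have "real (2 * m * (4 * p ^ (2 * l + 4))) = (2 * real m) * (4 * real p ^ (2 * l + 4))" by simp
        also have "... \<le> z * (4 * (z * z / 65536))" using m(1) p3 z0 by (intro mult_mono) auto
        also have "... < z * z * z" using z0 by simp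
        finally show ?thesis unfolding z3(1) by linarith
      qed
      from exists_far_points[OF s(1) p this] obtain U where
        U: "\<forall>i<2 * m. U i < N" "\<forall>i<2 * m. \<forall>j<2 * m. i ~= j --> far (Suc p) s (2 * l + 4) (U i) (U j)" by (elim exE conjE)
      interpret gadget p N m l s H U
      proof
        show "matchings (Suc p) N s" by (rule s(1))
        show "matchings (Suc p) m H" by (rule H(1))
        show "2 \<le> p" by (rule p)
        show "girth_gt (Suc p) N s (2 * l + 4)" by (rule s(2))
        show "U k < N" if "k < 2 * m" for k using U(1) that by blast
        show "far (Suc p) s (2 * l + 4) (U k) (U k')" if "k < 2 * m" "k' < 2 * m" "k ~= k'" for k k' using U(2) that by blast
      qed
      have r: "0 < r" "r + 1 \<le> l"
      proof -
        show "0 < r" using Rr by simp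
        have "real (r + 1) \<le> real l" using Rr l(2) \<open>0 < r\<close> by simp
        then show "r + 1 \<le> l" by simp
      qed
      have nn: "0 \<le> 2 * sqrt (real p) + ((real p + 1)^2 + 2) / x" using x by auto
      have N0: "0 < N" using N1 by simp
      note sb = gadget_spectral_bound[OF s(3) nn N0 r]
      have err: "real (Suc p) * real (4 * m * Suc p * (4 * p ^ r)) / real N \<le> 1 / x"
      proof -
        have "real (Suc p) * real (4 * m * Suc p * (4 * p ^ r)) / real N = real (Suc p) * (4 * real m * real (Suc p) * (4 * real p ^ r)) / real N"
          by (simp only: of_nat_mult of_nat_power of_nat_numeral)
        also have "... \<le> x * (4 * z * x * (4 * real N powr (1/2000))) / real N"
          using x Rr m(1) z0 by (intro divide_right_mono mult_mono) auto
        also have "... \<le> 1 / x" using elim(5) by (simp only: x_def z_def)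
        finally show ?thesis .
      qed
      have "max (2 * sqrt p) (2 * sqrt p + ((real p + 1)^2 + 2) / x) + real (Suc p) * (pi / (2 * r))^2 / 2
          + real (Suc p) * real (4 * m * Suc p * (4 * p ^ r)) / real N \<le> (2 * sqrt p + ((real p + 1)^2 + 2) / x) + 1 / x + 1 / x"
        using Rr err x by (intro add_mono) auto
      also have "... = 2 * sqrt p + ((real p + 1)^2 + 4) / x" by (simp add: add_divide_distrib)
      finally have sb': "spectral_bound (Suc p) N t (2 * sqrt p + ((real p + 1)^2 + 4) / x)" by (rule spectral_bound_mono[OF sb])
      let ?U = "U ` {..<2 * m}"
      have cU: "card ?U = 2 * m" using card_image[OF U_inj] by simp
      have "{v. \<exists>u\<in>?U. \<exists>c<Suc p. v = t c u} \<subseteq> (\<lambda>(a, i). V a i) ` ({..<m} \<times> {..<Suc p})"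
        using t_U_neighbours by auto
      then have "card {v. \<exists>u\<in>?U. \<exists>c<Suc p. v = t c u} \<le> card ({..<m} \<times> {..<Suc p})"
        by (rule surj_card_le[rotated]) simp
      then have "2 * card {v. \<exists>u\<in>?U. \<exists>c<Suc p. v = t c u} \<le> (Suc p + 1) * card ?U"
        unfolding cU by (simp add: card_cartesian_product algebra_simps)
      moreover have "?U \<subseteq> {..<N}" "real (card ?U) \<le> z" using U(1) m(1) unfolding cU by auto
      moreover have "U 0 \<in> ?U" using m4 by (intro imageI) auto
      then have "?U ~= {}" by blast
      moreover have "2 \<le> 2 * l" "2/3 * y - 22 \<le> real (2 * l)" using r l(2) by auto
      ultimately show "?P N"
        using ms_t girth_t[OF H(2)] sb' unfolding x_def y_def z_def
        by (intro exI[of _ t] exI[of _ "2 * l"] exI[of _ ?U] conjI)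
    qed
  qed
qed

section \<open>From systems to graphs\<close>

definition sys_graph :: "nat => nat => (nat => nat => nat) => nat pair_pre_digraph" where
  "sys_graph d N s = \<lparr>pverts = {..<N}, parcs = {(x, s c x) | x c. x < N & c < d}\<rparr>"

lemma sys_graph_simps [simp]: "pverts (sys_graph d N s) = {..<N}" "parcs (sys_graph d N s) = {(x, s c x) | x c. x < N & c < d}"
  by (simp_all add: sys_graph_def)

lemma colour_inj:
  assumes ms: "matchings d N s" and g: "girth_gt d N s g" "2 \<le> g" and x: "x < N" and c: "c < d" "c' < d" "s c x = s c' x"
  shows "c = c'"
proof (rule ccontr)
  assume "c ~= c'"
  then have "walk s x [c, c'] ~= x" using c g(2) by (intro girth_gtD[OF g(1) x]) auto
  then show False using c ms_invol[OF ms c(2), of x] by simp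
qed

lemma regular_sys_graph:
  assumes ms: "matchings d N s" and g: "girth_gt d N s g" "2 \<le> g"
  shows "regular_graph d (sys_graph d N s)"
  unfolding regular_graph_def
proof (intro conjI ballI)
  have e: "parcs (sys_graph d N s) = (\<lambda>(x, c). (x, s c x)) ` ({..<N} \<times> {..<d})" by auto
  show "pair_graph (sys_graph d N s)"
  proof
    show "finite (parcs (sys_graph d N s))" unfolding e by simp
    show "symmetric (with_proj (sys_graph d N s))"
      unfolding symmetric_conv
    proof
      fix e assume "e \<in> arcs (with_proj (sys_graph d N s))"
      then obtain x c where xc: "e = (x, s c x)" "x < N" "c < d" by (auto simp: with_proj_def)
      then have "(s c x, x) \<in> parcs (sys_graph d N s)" using ms_invol[OF ms xc(3), of x] ms_less[OF ms xc(3), of x] by force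
      then show "\<exists>e2\<in>arcs (with_proj (sys_graph d N s)). tail (with_proj (sys_graph d N s)) e = head (with_proj (sys_graph d N s)) e2
          & head (with_proj (sys_graph d N s)) e = tail (with_proj (sys_graph d N s)) e2"
        using xc by (intro bexI[of _ "(s c x, x)"]) (auto simp: with_proj_def)
    qed
  qed (use ms_less[OF ms] ms_neq[OF ms, THEN not_sym] in auto)
  fix v assume v: "v \<in> pverts (sys_graph d N s)"
  have "out_arcs (with_proj (sys_graph d N s)) v = (\<lambda>c. (v, s c v)) ` {..<d}"
    using v by (auto simp: out_arcs_def with_proj_def)
  moreover have "inj_on (\<lambda>c. (v, s c v)) {..<d}" using colour_inj[OF ms g] v by (auto simp: inj_on_def)
  ultimately show "out_degree (with_proj (sys_graph d N s)) v = d" by (simp add: out_degree_def card_image)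
qed

lemma cas_pair:
  "pre_digraph.cas (with_proj G) u c v ==>
    pre_digraph.awalk_verts (with_proj G) u c = u # map snd c & (c ~= [] --> fst (hd c) = u & snd (last c) = v)
    & (\<forall>i. Suc i < length c --> snd (c ! i) = fst (c ! Suc i))
    & (\<forall>s col. (\<forall>e\<in>set c. snd e = s (col e) (fst e)) --> walk s u (map col c) = v)"
proof (induction c arbitrary: u)
  case Nil
  then show ?case by (simp add: pre_digraph.cas.simps pre_digraph.awalk_verts.simps)
next
  case (Cons e c)
  have e: "fst e = u" "pre_digraph.cas (with_proj G) (snd e) c v"
    using Cons.prems by (auto simp: pre_digraph.cas.simps with_proj_def)
  note IH = Cons.IH[OF e(2)]
  have "snd ((e # c) ! i) = fst ((e # c) ! Suc i)" if "Suc i < length (e # c)" for i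
    using IH that by (cases i) (auto simp: hd_conv_nth)
  then show ?case using IH e
    by (auto simp: pre_digraph.awalk_verts.simps with_proj_def pre_digraph.cas.simps)
qed

lemma girth_sys_graph:
  assumes ms: "matchings d N s" and g: "girth_gt d N s g"
  shows "enat (Suc g) \<le> girth (sys_graph d N s)"
  unfolding girth_def
proof (rule INF_greatest)
  let ?G = "with_proj (sys_graph d N s)"
  fix c assume "c \<in> {c. pre_digraph.cycle ?G c & 3 \<le> length c}"
  then obtain u where u: "pre_digraph.awalk ?G u c u" "distinct (tl (pre_digraph.awalk_verts ?G u c))" and len: "3 \<le> length c"
    by (auto simp: pre_digraph.cycle_def)
  have arcs: "set c \<subseteq> parcs (sys_graph d N s)" and uN: "u < N" and cas: "pre_digraph.cas ?G u c u"
    using u(1) by (auto simp: pre_digraph.awalk_def with_proj_def)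
  note cp = cas_pair[OF cas]
  have ne: "c ~= []" using len by auto
  have dist: "distinct (map snd c)" using u(2) cp by simp
  define col where "col e = (SOME k. k < d & snd e = s k (fst e))" for e :: "nat \<times> nat"
  have col: "col e < d & snd e = s (col e) (fst e)" if "e \<in> set c" for e
  proof -
    have "e \<in> parcs (sys_graph d N s)" using arcs that by blast
    then have "\<exists>k. k < d & snd e = s k (fst e)" by auto
    then show ?thesis unfolding col_def by (rule someI_ex)
  qed
  define w where "w = map col c"
  have cl: "walk s u w = u" using cp col by (simp add: w_def)
  \<comment> \<open>Equal colours on consecutive arcs mean that the second runs back along the
    first. Then its head is also the head of the cyclic predecessor \<open>j\<close> of arc
    \<open>i\<close>, impossible for distinct vertices and length at least 3.\<close>
  have "col (c ! i) ~= col (c ! Suc i)" if i: "Suc i < length c" for i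
  proof
    assume eq: "col (c ! i) = col (c ! Suc i)"
    have m: "c ! i \<in> set c" "c ! Suc i \<in> set c" using i by auto
    have "snd (c ! Suc i) = s (col (c ! i)) (s (col (c ! i)) (fst (c ! i)))"
      using col[OF m(1)] col[OF m(2)] eq cp i by metis
    then have bk: "snd (c ! Suc i) = fst (c ! i)" using ms_invol[OF ms] col[OF m(1)] by simp
    define j where "j = (if i = 0 then length c - 1 else i - 1)"
    have "snd (c ! j) = fst (c ! i)"
    proof (cases "i = 0")
      case True
      then show ?thesis using cp ne by (simp add: j_def hd_conv_nth last_conv_nth)
    next
      case False
      then show ?thesis using cp i by (cases i) (auto simp: j_def)
    qed
    moreover have jl: "j < length c" using i len by (auto simp: j_def)
    ultimately have "map snd c ! j = map snd c ! Suc i" using bk i by simp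
    then have "j = Suc i" using dist i jl by (subst (asm) nth_eq_iff_index_eq) auto
    then show False using len by (auto simp: j_def split: if_splits)
  qed
  then have "distinct_adj w" by (auto simp: distinct_adj_conv_nth w_def)
  moreover have "set w \<subseteq> {..<d}" using col by (auto simp: w_def)
  ultimately have "\<not> length w \<le> g" using girth_gtD[OF g uN] cl ne by (auto simp: w_def)
  then show "enat (Suc g) \<le> enat (length c)" by (simp add: w_def)
qed

lemma adj_matrix_sys_graph:
  assumes ms: "matchings d N s" and g: "girth_gt d N s g" "2 \<le> g"
  shows "adj_matrix (sys_graph d N s) = sys_mat d N s"
proof -
  have "sorted_list_of_set {..<N} = [0..<N]" by (simp add: lessThan_atLeast0)
  moreover have "(if (i, j) \<in> parcs (sys_graph d N s) then 1 else 0) = real (card {c. c < d & s c i = j})"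
    if "i < N" for i j
  proof (cases "\<exists>c<d. s c i = j")
    case True
    then obtain c where c: "c < d" "s c i = j" by blast
    then have "{c. c < d & s c i = j} = {c}" using colour_inj[OF ms g that] by auto
    then show ?thesis using c that by auto
  next
    case False
    then have "{c. c < d & s c i = j} = {}" by blast
    then show ?thesis using False by (auto simp del: Collect_empty_eq)
  qed
  ultimately show ?thesis
    by (intro eq_matI) (simp_all add: adj_matrix_def sys_mat_def Let_def del: sys_graph_simps(2))
qed

text \<open>Only the entry \<open>l 0\<close> may exceed \<open>L\<close>; if the second largest
  did, two entries of the multiset would. The smallest is at least \<open>-L\<close> because
  \<open>l 0\<close> is positive.\<close>

lemma eigenvalues_sys_graph:
  assumes ms: "matchings (Suc p) N s" and N: "2 \<le> N" and g: "girth_gt (Suc p) N s g" "2 \<le> g"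
    and L: "spectral_bound (Suc p) N s L" "0 \<le> L"
  shows "graph_eigenvalue (sys_graph (Suc p) N s) 2 \<le> L" "- graph_eigenvalue (sys_graph (Suc p) N s) N \<le> L"
proof -
  from system_spectrum[OF ms] N obtain l where l0: "l 0 = real (Suc p)"
    and cp: "char_poly (sys_mat (Suc p) N s) = (\<Prod>k<N. [:- l k, 1:])"
    and lL: "\<And>k. 0 < k ==> k < N ==> \<bar>l k\<bar> \<le> L" using L(1) by fastforce
  define M where "M = proots (char_poly (adj_matrix (sys_graph (Suc p) N s)))"
  have "M = (\<Sum>k<N. {#l k#})"
    unfolding M_def adj_matrix_sys_graph[OF ms g] cp by (subst proots_prod) auto
  also have "... = {#l 0#} + (\<Sum>k\<in>{..<N} - {0}. {#l k#})" using N by (intro sum.remove) auto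
  finally have M: "M = {#l 0#} + (\<Sum>k\<in>{..<N} - {0}. {#l k#})" .
  define M' where "M' = (\<Sum>k\<in>{..<N} - {0}. {#l k#})"
  have M'L: "\<bar>y\<bar> \<le> L" if "y \<in># M'" for y
    using that lL by (auto simp: M'_def set_mset_sum)
  have sM: "size M = N" using N by (simp add: M size_multiset_sum)
  define xs where "xs = sorted_list_of_multiset M"
  have mx: "mset xs = M" and so: "sorted xs" by (simp_all add: xs_def)
  have lx: "length xs = N" using sM mx by (metis size_mset)
  have ev: "graph_eigenvalue (sys_graph (Suc p) N s) k = rev xs ! (k - 1)" for k
    by (simp add: graph_eigenvalue_def eigenvalue_list_def xs_def M_def)
  have e2: "graph_eigenvalue (sys_graph (Suc p) N s) 2 = xs ! (N - 2)"
    using N lx by (simp add: ev rev_nth numeral_2_eq_2)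
  have eN: "graph_eigenvalue (sys_graph (Suc p) N s) N = xs ! 0" using N lx by (simp add: ev rev_nth)
  show "graph_eigenvalue (sys_graph (Suc p) N s) 2 \<le> L"
  proof (rule ccontr)
    assume "\<not> ?thesis"
    then have a: "L < xs ! (N - 2)" by (simp add: e2)
    also have "... \<le> xs ! (N - 1)" using so lx N by (intro sorted_nth_mono) auto
    finally have b: "L < xs ! (N - 1)" .
    have "card {N - 2, N - 1} \<le> card {i. i < length xs & L < xs ! i}" using a b lx N by (intro card_mono) auto
    also have "... = length (filter (\<lambda>y. L < y) xs)" by (simp add: length_filter_conv_card)
    also have "... = size (filter_mset (\<lambda>y. L < y) M)" by (metis mset_filter mx size_mset)
    also have "filter_mset (\<lambda>y. L < y) M = filter_mset (\<lambda>y. L < y) {#l 0#} + filter_mset (\<lambda>y. L < y) M'"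
      by (simp add: M M'_def)
    also have "filter_mset (\<lambda>y. L < y) M' = {#}" 
    proof (rule multiset_eqI)
      fix y
      show "count (filter_mset (\<lambda>y. L < y) M') y = count {#} y"
        using M'L[of y] by (cases "y \<in># M'") (auto simp: not_in_iff)
    qed
    also have "size (filter_mset (\<lambda>y. L < y) {#l 0#} + {#}) \<le> 1" by simp
    finally show False using N by simp
  qed
  have "xs ! 0 \<in># M" using lx N by (metis mx nth_mem_mset zero_less_numeral order_less_le_trans)
  then show "- graph_eigenvalue (sys_graph (Suc p) N s) N \<le> L"
    using M'L[of "xs ! 0"] l0 L(2) by (auto simp: eN M M'_def[symmetric])
qed

theorem theorem1p1:
  fixes p d :: nat
  assumes "prime p" and "d = p + 1"
  shows "\<exists>(G :: nat \<Rightarrow> nat pair_pre_digraph) (\<epsilon> :: nat \<Rightarrow> real) (\<delta> :: nat \<Rightarrow> real).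
    \<epsilon> \<in> o(\<lambda>n. 1) \<and>
    \<delta> \<in> O(\<lambda>n. 1 / log (real d - 1) (real n)) \<and>
    filterlim (\<lambda>k. card (pverts (G k))) at_top sequentially \<and>
    (\<forall>k n. n = card (pverts (G k)) \<longrightarrow>
       regular_graph d (G k) \<and>
       ereal ((2/3 - \<epsilon> n) * log (real d - 1) (real n)) \<le> ereal_of_enat (girth (G k)) \<and>
       (\<exists>U. U \<subseteq> pverts (G k) \<and> U \<noteq> {} \<and>
            real (card U) \<le> real n powr (1/3) \<and>
            real (card (nbhd (G k) U)) \<le> (real d + 1) * real (card U) / 2) \<and>
       max (graph_eigenvalue (G k) 2) (- graph_eigenvalue (G k) n) \<le> 2 * sqrt (real d - 1) + \<delta> n)"
proof -
  have p: "2 \<le> p" using assms(1) by (rule prime_ge_2_nat)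
  have d: "d = Suc p" "real d - 1 = real p" using assms(2) by auto
  define C where "C = ((real p + 1)^2 + 4) / ln (real p)"
  \<comment> \<open>\<open>\<epsilon> n\<close> is \<open>22 / log_p n\<close>, the additive girth
    loss of \<open>gadget_graphs\<close>; \<open>C\<close> carries the change from natural
    logarithms to base \<open>p\<close>.\<close>
  define \<epsilon> \<delta> where "\<epsilon> n = 22 * ln (real p) / ln (real n)" and "\<delta> n = C * (1 / log (real p) (real n))" for n :: nat
  let ?good = "\<lambda>n G. card (pverts G) = n & regular_graph d G &
       ereal ((2/3 - \<epsilon> n) * log (real p) (real n)) \<le> ereal_of_enat (girth G) &
       (\<exists>U. U \<subseteq> pverts G & U ~= {} & real (card U) \<le> real n powr (1/3) &
            real (card (nbhd G U)) \<le> (real d + 1) * real (card U) / 2) &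
       max (graph_eigenvalue G 2) (- graph_eigenvalue G n) \<le> 2 * sqrt (real p) + \<delta> n"
  have "\<forall>\<^sub>F N in sequentially. even N --> (\<exists>G :: nat pair_pre_digraph. ?good N G)"
    using gadget_graphs[OF p] eventually_ge_at_top[of 3]
  proof eventually_elim
    case (elim N)
    show ?case
    proof
      assume "even N"
      then obtain t g U where t: "matchings (Suc p) N t" "2 \<le> g" "2/3 * log p N - 22 \<le> real g" "girth_gt (Suc p) N t g"
        and sb: "spectral_bound (Suc p) N t (2 * sqrt p + ((real p + 1)^2 + 4) / ln N)"
        and U: "U \<subseteq> {..<N}" "U ~= {}" "real (card U) \<le> real N powr (1/3)"
          "2 * card {v. \<exists>u\<in>U. \<exists>c<Suc p. v = t c u} \<le> (Suc p + 1) * card U" using elim(1) by blast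
      let ?G = "sys_graph (Suc p) N t"
      have lnN: "0 < ln (real N)" and lnp: "0 < ln (real p)" using elim(2) p by auto
      have lg: "log p N = ln (real N) / ln (real p)" by (simp add: log_def)
      have "(2/3 - \<epsilon> N) * log p N = 2/3 * log p N - 22"
        unfolding lg \<epsilon>_def using lnN lnp by (simp add: field_simps)
      also have "... \<le> real (Suc g)" using t(3) by simp
      finally have "ereal ((2/3 - \<epsilon> N) * log p N) \<le> ereal_of_enat (enat (Suc g))" by simp
      also have "... \<le> ereal_of_enat (girth ?G)" 
        unfolding ereal_of_enat_le_iff by (rule girth_sys_graph[OF t(1,4)])
      finally have gi: "ereal ((2/3 - \<epsilon> N) * log p N) \<le> ereal_of_enat (girth ?G)" .
      have \<delta>: "((real p + 1)^2 + 4) / ln N = \<delta> N" unfolding \<delta>_def C_def lg using lnN lnp by simp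
      have nn: "0 \<le> 2 * sqrt p + ((real p + 1)^2 + 4) / ln N" using lnN by auto
      have "2 \<le> N" using elim(2) by simp
      from eigenvalues_sys_graph[OF t(1) this t(4,2) sb nn]
      have ev: "max (graph_eigenvalue ?G 2) (- graph_eigenvalue ?G N) \<le> 2 * sqrt p + \<delta> N" unfolding \<delta> by simp
      have finU: "finite U" using U(1) finite_subset by blast
      have "{v. \<exists>u\<in>U. \<exists>c<Suc p. v = t c u} = (\<Union>u\<in>U. (\<lambda>c. t c u) ` {..<Suc p})" by auto
      then have "finite {v. \<exists>u\<in>U. \<exists>c<Suc p. v = t c u}" using finU by simp
      then have "card (nbhd ?G U) \<le> card {v. \<exists>u\<in>U. \<exists>c<Suc p. v = t c u}"
        by (rule card_mono) (auto simp: nbhd_def)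
      then have "2 * card (nbhd ?G U) \<le> (Suc p + 1) * card U" using U(4) by linarith
      then have "real (2 * card (nbhd ?G U)) \<le> real ((Suc p + 1) * card U)" by (rule of_nat_mono)
      then have "real (card (nbhd ?G U)) \<le> (real d + 1) * real (card U) / 2" unfolding d(1) by (simp add: algebra_simps)
      then have "\<exists>U. U \<subseteq> pverts ?G & U ~= {} & real (card U) \<le> real N powr (1/3) &
            real (card (nbhd ?G U)) \<le> (real d + 1) * real (card U) / 2" using U by (intro exI[of _ U]) auto
      moreover have "regular_graph d ?G" unfolding d(1) by (rule regular_sys_graph[OF t(1,4,2)])
      moreover have "card (pverts ?G) = N" by simp
      ultimately show "\<exists>G :: nat pair_pre_digraph. ?good N G" using gi ev by (intro exI[of _ ?G] conjI)
    qed
  qed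
  then obtain K where K: "\<And>N. K \<le> N ==> even N ==> \<exists>G :: nat pair_pre_digraph. ?good N G"
    unfolding eventually_sequentially by blast
  \<comment> \<open>The family runs through all large even orders, as perfect matchings require an
    even number of vertices.\<close>
  have "\<forall>k. \<exists>G :: nat pair_pre_digraph. ?good (2 * (k + K)) G" by (intro allI K) auto
  from choice[OF this] obtain G :: "nat => nat pair_pre_digraph" where G: "\<And>k. ?good (2 * (k + K)) (G k)" by blast
  have "\<epsilon> \<in> o(\<lambda>n. 1)" unfolding \<epsilon>_def by real_asymp
  moreover have "\<delta> \<in> O(\<lambda>n. 1 / log (real d - 1) (real n))" 
    unfolding \<delta>_def d(2) by (rule bigoI[of _ "\<bar>C\<bar>"]) (simp add: abs_mult)
  moreover have "filterlim (\<lambda>k. card (pverts (G k))) at_top sequentially"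
  proof -
    have "filterlim (\<lambda>k. 2 * (k + K)) at_top sequentially" by (rule filterlim_subseq) (simp add: strict_mono_def)
    then show ?thesis using G by simp
  qed
  ultimately show ?thesis
    using G by (intro exI[of _ G] exI[of _ \<epsilon>] exI[of _ \<delta>] conjI allI impI) (simp_all add: d(2))
qed

end
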